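(* Let $G$ be a locally compact second countable group, let $(X,\mu)$ be a Lebesgue $G$-space and let $\mathcal{G}=G\ltimes X$ be the associated measured semidirect groupoid. If $(E,L)$ is a measurable coefficient $\mathcal{G}$-module, then in every degree $k\ge 0$ there is a canonical isometric isomorphism $$\mathrm{H}^{k}_{mb}(\mathcal{G},E)\cong \mathrm{H}^{k}_{cb}(G,L^\infty_{w^*}(X,E)),$$ where the right-hand side is the continuous bounded cohomology of $G$ with coefficients in $L^\infty_{w^*}(X,E)$ endowed with the $G$-action $(g\cdot\lambda)(x)=L(g,g^{-1}x)\lambda(g^{-1}x)$.
   Context: **Measured groupoids.** A groupoid $\mathcal{G}$ is a small category with all morphisms invertible, identified with its set of arrows; $s(g)=g^{-1}g$, $t(g)=gg^{-1}$, the unit space is $\mathcal{G}^{(0)}=s(\mathcal{G})=t(\mathcal{G})$, $gh$ is defined iff $s(g)=t(h)$, $\mathcal{G}^{[2]}$ is the set of composable pairs, and $\mathcal{G}^x=t^{-1}(x)$. A Borel groupoid carries a standard Borel structure making composition and inverse Borel. A measured groupoid is a Borel groupoid with a measure class that is symmetric (preserved by $g\mapsto g^{-1}$) and invariant: it contains a probability measure $\nu$ whose disintegration $\nu=\int\nu^x\,d\mu(x)$ along $t$ ($\mu=t_*\nu$, $\nu^x$ supported on $\mathcal{G}^x$) satisfies $g\nu^{s(g)}\sim\nu^{t(g)}$ for $\nu$-a.e. $g$. Such a symmetric $\nu$ is fixed. **Semidirect groupoid.** A Lebesgue $G$-space is a standard Borel measure space $(X,\mu)$ with a Borel $G$-action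 preserving the class of $\mu$. $G\ltimes X$ is the set $G\times X$ with unit space $X$, $s(g,x)=x$, $t(g,x)=gx$, $(h,gx)(g,x)=(hg,x)$, $(g,x)^{-1}=(g^{-1},gx)$, and measure class of (Haar)$\times\mu$. **Coefficients.** A measurable coefficient $\mathcal{G}$-module $(E,L)$: $E=(E^\flat)^*$ with $E^\flat$ a separable Banach space, together with $L^\flat:\mathcal{G}\to \mathrm{Isom}(E^\flat)$ such that $L^\flat(gh)=L^\flat(g)L^\flat(h)$ for almost every $(g,h)\in\mathcal{G}^{[2]}$ and $g\mapsto L^\flat(g)v$ is measurable for every $v\in E^\flat$; $L$ is the contragredient: $\langle L(g)\lambda,v\rangle=\langle\lambda,L^\flat(g^{-1})v\rangle$. **Measurable bounded cohomology.** $\mathcal{G}^{(n)}$ is the set of $n$-tuples in $\mathcal{G}$ with common target, with measure $\nu^{(n)}=\int(\nu^x)^{\otimes n}d\mu(x)$. $L^\infty_{w^*}(\mathcal{G}^{(n)},E)$ is the Banach space of weak$^*$ measurable essentially bounded functions $\mathcal{G}^{(n)}\to E$ modulo a.e. equality, with the essential supremum norm. Such $\lambda$ is $\mathcal{G}$-invariant if $L(g)\lambda(g^{-1}g_1,\dots,g^{-1}g_n)=\lambda(g_1,\dots,g_n)$ for $\nu^{(n+1)}$-a.e. $(g,g_1,\dots,g_n)\in\mathcal{G}^{(n+1)}$. $\mathrm{H}^k_{mb}(\mathcal{G},E)$ is the $k$-th cohomology of the complex $\big(L^\infty_{w^*}(\mathcal{G}^{(k+1)},E)^{\mathcal{G}}\big)_{k\ge0}$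 with the homogeneous coboundary $\delta\lambda(g_1,\dots,g_{k+2})=\sum_{i=1}^{k+2}(-1)^{i-1}\lambda(g_1,\dots,\widehat{g_i},\dots,g_{k+2})$, with the quotient seminorm. **Continuous bounded cohomology.** A coefficient $G$-module (in the sense of Monod) is the dual $V$ of a separable Banach space with the contragredient of a continuous isometric $G$-representation on the predual; $\mathrm{H}^\bullet_{cb}(G,V)$ is the cohomology of the complex of $G$-invariant bounded continuous functions $G^{\bullet+1}\to V$ with the homogeneous coboundary, with the seminorm induced by the sup norm. $L^\infty_{w^*}(X,E)$ (weak$^*$ measurable essentially bounded functions modulo null sets) is the dual of $L^1(X,E^\flat)$ and with the stated action is a coefficient $G$-module.
   Formalization: As L is multiplicative only almost everywhere, the formula for the G-action need not define an action for every g; it is required for almost every g, and existence and uniqueness of such a coefficient-module action are proved. If the literal formula is an action, it is covered. *)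

theory Defs
  imports "HOL-Probability.Probability"
begin

section \<open>Seminormed spaces with explicit carrier\<close>

text \<open>
  \<open>L\<^sup>\<infinity>\<close>-spaces and cohomology spaces are quotients that depend on a measure or on a group
  action, so they cannot be types; real seminormed spaces are therefore given by a carrier together
  with their operations.
\<close>

record 'v seminormed_space =
  vcarrier :: "'v set"
  vzero :: 'v
  vadd :: "'v \<Rightarrow> 'v \<Rightarrow> 'v"
  vscale :: "real \<Rightarrow> 'v \<Rightarrow> 'v"
  vnorm :: "'v \<Rightarrow> real"

definition vdist :: "'v seminormed_space \<Rightarrow> 'v \<Rightarrow> 'v \<Rightarrow> real" where
  "vdist V v w =
    (if v \<in> vcarrier V \<and> w \<in> vcarrier V then vnorm V (vadd V v (vscale V (-1) w)) else 0)"

definition norm_topology :: "'v seminormed_space \<Rightarrow> 'v topology" where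
  "norm_topology V = Metric_space.mtopology (vcarrier V) (vdist V)"

locale normed_vspace =
  fixes V :: "'v seminormed_space"
  assumes zero_closed: "vzero V \<in> vcarrier V"
    and add_closed: "\<lbrakk>u \<in> vcarrier V; v \<in> vcarrier V\<rbrakk> \<Longrightarrow> vadd V u v \<in> vcarrier V"
    and scale_closed: "v \<in> vcarrier V \<Longrightarrow> vscale V r v \<in> vcarrier V"
    and add_assoc: "\<lbrakk>u \<in> vcarrier V; v \<in> vcarrier V; w \<in> vcarrier V\<rbrakk> \<Longrightarrow>
      vadd V (vadd V u v) w = vadd V u (vadd V v w)"
    and add_commute: "\<lbrakk>u \<in> vcarrier V; v \<in> vcarrier V\<rbrakk> \<Longrightarrow> vadd V u v = vadd V v u"
    and add_zero: "v \<in> vcarrier V \<Longrightarrow> vadd V (vzero V) v = v"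
    and add_uminus: "v \<in> vcarrier V \<Longrightarrow> vadd V v (vscale V (-1) v) = vzero V"
    and scale_add_right: "\<lbrakk>u \<in> vcarrier V; v \<in> vcarrier V\<rbrakk> \<Longrightarrow>
      vscale V r (vadd V u v) = vadd V (vscale V r u) (vscale V r v)"
    and scale_add_left: "v \<in> vcarrier V \<Longrightarrow>
      vscale V (r + s) v = vadd V (vscale V r v) (vscale V s v)"
    and scale_scale: "v \<in> vcarrier V \<Longrightarrow> vscale V r (vscale V s v) = vscale V (r * s) v"
    and scale_one: "v \<in> vcarrier V \<Longrightarrow> vscale V 1 v = v"
    and norm_eq_zero_iff: "v \<in> vcarrier V \<Longrightarrow> vnorm V v = 0 \<longleftrightarrow> v = vzero V"
    and norm_scale: "v \<in> vcarrier V \<Longrightarrow> vnorm V (vscale V r v) = \<bar>r\<bar> * vnorm V v"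
    and norm_triangle: "\<lbrakk>u \<in> vcarrier V; v \<in> vcarrier V\<rbrakk> \<Longrightarrow>
      vnorm V (vadd V u v) \<le> vnorm V u + vnorm V v"

definition separable_banach_vspace :: "'v seminormed_space \<Rightarrow> bool" where
  "separable_banach_vspace V \<longleftrightarrow> normed_vspace V \<and>
    Metric_space.mcomplete (vcarrier V) (vdist V) \<and> separable_space (norm_topology V)"

definition isometric_iso ::
  "'v seminormed_space \<Rightarrow> 'w seminormed_space \<Rightarrow> ('v \<Rightarrow> 'w) \<Rightarrow> bool" where
  "isometric_iso V W \<phi> \<longleftrightarrow>
    bij_betw \<phi> (vcarrier V) (vcarrier W) \<and>
    (\<forall>u\<in>vcarrier V. \<forall>v\<in>vcarrier V. \<phi> (vadd V u v) = vadd W (\<phi> u) (\<phi> v)) \<and>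
    (\<forall>r. \<forall>v\<in>vcarrier V. \<phi> (vscale V r v) = vscale W r (\<phi> v)) \<and>
    (\<forall>v\<in>vcarrier V. vnorm W (\<phi> v) = vnorm V v)"

definition dual_vspace :: "'v seminormed_space \<Rightarrow> ('v \<Rightarrow> real) seminormed_space" where
  "dual_vspace V =
    \<lparr>vcarrier = {\<phi> \<in> extensional (vcarrier V).
       (\<forall>u\<in>vcarrier V. \<forall>v\<in>vcarrier V. \<phi> (vadd V u v) = \<phi> u + \<phi> v) \<and>
       (\<forall>r. \<forall>v\<in>vcarrier V. \<phi> (vscale V r v) = r * \<phi> v) \<and>
       (\<exists>C. \<forall>v\<in>vcarrier V. \<bar>\<phi> v\<bar> \<le> C * vnorm V v)},
     vzero = (\<lambda>v\<in>vcarrier V. 0),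
     vadd = (\<lambda>\<phi> \<psi>. \<lambda>v\<in>vcarrier V. \<phi> v + \<psi> v),
     vscale = (\<lambda>r \<phi>. \<lambda>v\<in>vcarrier V. r * \<phi> v),
     vnorm = (\<lambda>\<phi>. Inf {C. 0 \<le> C \<and> (\<forall>v\<in>vcarrier V. \<bar>\<phi> v\<bar> \<le> C * vnorm V v)})\<rparr>"

definition vcoset :: "'v seminormed_space \<Rightarrow> 'v set \<Rightarrow> 'v \<Rightarrow> 'v set" where
  "vcoset V N v = vadd V v ` N"

definition quotient_vspace :: "'v seminormed_space \<Rightarrow> 'v set \<Rightarrow> 'v set seminormed_space" where
  "quotient_vspace V N =
    \<lparr>vcarrier = vcoset V N ` vcarrier V,
     vzero = N,
     vadd = (\<lambda>A B. {vadd V a b | a b. a \<in> A \<and> b \<in> B}),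
     vscale = (\<lambda>r A. {vadd V (vscale V r a) n | a n. a \<in> A \<and> n \<in> N}),
     vnorm = (\<lambda>A. Inf (vnorm V ` A))\<rparr>"

definition function_vspace ::
  "('a \<Rightarrow> 'b::real_vector) set \<Rightarrow> (('a \<Rightarrow> 'b) \<Rightarrow> real) \<Rightarrow> ('a \<Rightarrow> 'b) seminormed_space" where
  "function_vspace S p =
    \<lparr>vcarrier = S, vzero = (\<lambda>x. 0), vadd = (\<lambda>f g x. f x + g x),
     vscale = (\<lambda>r f x. r *\<^sub>R f x), vnorm = p\<rparr>"

primrec vsum :: "'v seminormed_space \<Rightarrow> (nat \<Rightarrow> 'v) \<Rightarrow> nat \<Rightarrow> 'v" where
  "vsum V f 0 = vzero V"
| "vsum V f (Suc n) = vadd V (vsum V f n) (f n)"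


section \<open>Cohomology of a complex of seminormed spaces\<close>

definition cocycles :: "(nat \<Rightarrow> 'v seminormed_space) \<Rightarrow> (nat \<Rightarrow> 'v \<Rightarrow> 'v) \<Rightarrow> nat \<Rightarrow> 'v set" where
  "cocycles C d k = {z \<in> vcarrier (C k). d k z = vzero (C (Suc k))}"

definition coboundaries :: "(nat \<Rightarrow> 'v seminormed_space) \<Rightarrow> (nat \<Rightarrow> 'v \<Rightarrow> 'v) \<Rightarrow> nat \<Rightarrow> 'v set" where
  "coboundaries C d k =
    (case k of 0 \<Rightarrow> {vzero (C 0)} | Suc j \<Rightarrow> d j ` vcarrier (C j))"

definition cohomology_class ::
  "(nat \<Rightarrow> 'v seminormed_space) \<Rightarrow> (nat \<Rightarrow> 'v \<Rightarrow> 'v) \<Rightarrow> nat \<Rightarrow> 'v \<Rightarrow> 'v set" where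
  "cohomology_class C d k z = vcoset (C k) (coboundaries C d k) z"

definition cohomology ::
  "(nat \<Rightarrow> 'v seminormed_space) \<Rightarrow> (nat \<Rightarrow> 'v \<Rightarrow> 'v) \<Rightarrow> nat \<Rightarrow> 'v set seminormed_space" where
  "cohomology C d k =
    quotient_vspace ((C k)\<lparr>vcarrier := cocycles C d k\<rparr>) (coboundaries C d k)"

text \<open>Tuples of length \<open>n\<close> are extensional functions on \<open>{..<n}\<close>.\<close>

definition omit :: "nat \<Rightarrow> nat \<Rightarrow> (nat \<Rightarrow> 'a) \<Rightarrow> nat \<Rightarrow> 'a" where
  "omit n i \<gamma> = (\<lambda>j\<in>{..<n}. if j < i then \<gamma> j else \<gamma> (Suc j))"


section \<open>Weak-star measurable functions with values in a dual\<close>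

definition standard_borel :: "'a measure \<Rightarrow> bool" where
  "standard_borel M \<longleftrightarrow>
    (\<exists>T. completely_metrizable_space T \<and> second_countable T \<and> topspace T = space M \<and>
         sets M = sigma_sets (topspace T) {U. openin T U})"

definition equiv_measures :: "'a measure \<Rightarrow> 'a measure \<Rightarrow> bool" where
  "equiv_measures M N \<longleftrightarrow> sets M = sets N \<and> absolutely_continuous M N \<and> absolutely_continuous N M"

definition Linf_functions ::
  "'a measure \<Rightarrow> ('a \<Rightarrow> 'e::real_normed_vector \<Rightarrow>\<^sub>L real) set" where
  "Linf_functions M =
    {f. (\<forall>v. (\<lambda>x. blinfun_apply (f x) v) \<in> borel_measurable M) \<and>
        (\<exists>C. AE x in M. norm (f x) \<le> C)}"

definition Linf_norm :: "'a measure \<Rightarrow> ('a \<Rightarrow> 'e::real_normed_vector \<Rightarrow>\<^sub>L real) \<Rightarrow> real" where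
  "Linf_norm M f = Inf {C. 0 \<le> C \<and> (AE x in M. norm (f x) \<le> C)}"

definition Linf ::
  "'a measure \<Rightarrow> ('a \<Rightarrow> 'e::real_normed_vector \<Rightarrow>\<^sub>L real) set seminormed_space" where
  "Linf M = quotient_vspace (function_vspace (Linf_functions M) (Linf_norm M))
     {f \<in> Linf_functions M. AE x in M. f x = 0}"

definition L1 ::
  "'a measure \<Rightarrow> ('a \<Rightarrow> 'e::{banach, second_countable_topology}) set seminormed_space" where
  "L1 M = quotient_vspace
     (function_vspace {f. integrable M f} (\<lambda>f. integral\<^sup>L M (\<lambda>x. norm (f x))))
     {f. integrable M f \<and> (AE x in M. f x = 0)}"

definition Linf_L1_pairing ::
  "'a measure \<Rightarrow> ('a \<Rightarrow> 'e::{banach, second_countable_topology} \<Rightarrow>\<^sub>L real) set \<Rightarrow>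
    ('a \<Rightarrow> 'e) set \<Rightarrow> real" where
  "Linf_L1_pairing M A B =
    (THE r. \<forall>l\<in>A. \<forall>f\<in>B. r = integral\<^sup>L M (\<lambda>x. blinfun_apply (l x) (f x)))"


section \<open>Measured groupoids\<close>

text \<open>
  The unit space is kept as a separate type, embedded in the arrows by \<open>unit_arrow\<close>.  Of the
  measures \<open>arrows\<close> and \<open>units\<close> only the underlying measurable space is relevant.
\<close>

record ('a, 'u) groupoid =
  arrows :: "'a measure"
  units :: "'u measure"
  src :: "'a \<Rightarrow> 'u"
  tgt :: "'a \<Rightarrow> 'u"
  unit_arrow :: "'u \<Rightarrow> 'a"
  gcomp :: "'a \<Rightarrow> 'a \<Rightarrow> 'a"
  ginv :: "'a \<Rightarrow> 'a"

definition composable :: "('a, 'u) groupoid \<Rightarrow> ('a \<times> 'a) set" where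
  "composable \<G> = {(g, h) \<in> space (arrows \<G>) \<times> space (arrows \<G>). src \<G> g = tgt \<G> h}"

definition target_fibre :: "('a, 'u) groupoid \<Rightarrow> 'u \<Rightarrow> 'a set" where
  "target_fibre \<G> x = {g \<in> space (arrows \<G>). tgt \<G> g = x}"

locale borel_groupoid =
  fixes \<G> :: "('a, 'u) groupoid"
  assumes standard_borel_arrows: "standard_borel (arrows \<G>)"
    and standard_borel_units: "standard_borel (units \<G>)"
    and src_measurable: "src \<G> \<in> arrows \<G> \<rightarrow>\<^sub>M units \<G>"
    and tgt_measurable: "tgt \<G> \<in> arrows \<G> \<rightarrow>\<^sub>M units \<G>"
    and unit_arrow_measurable: "unit_arrow \<G> \<in> units \<G> \<rightarrow>\<^sub>M arrows \<G>"
    and ginv_measurable: "ginv \<G> \<in> arrows \<G> \<rightarrow>\<^sub>M arrows \<G>"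
    and gcomp_measurable: "(\<lambda>(g, h). gcomp \<G> g h) \<in>
      restrict_space (arrows \<G> \<Otimes>\<^sub>M arrows \<G>) (composable \<G>) \<rightarrow>\<^sub>M arrows \<G>"
    and src_unit: "x \<in> space (units \<G>) \<Longrightarrow> src \<G> (unit_arrow \<G> x) = x"
    and tgt_unit: "x \<in> space (units \<G>) \<Longrightarrow> tgt \<G> (unit_arrow \<G> x) = x"
    and src_gcomp: "(g, h) \<in> composable \<G> \<Longrightarrow> src \<G> (gcomp \<G> g h) = src \<G> h"
    and tgt_gcomp: "(g, h) \<in> composable \<G> \<Longrightarrow> tgt \<G> (gcomp \<G> g h) = tgt \<G> g"
    and gcomp_assoc: "\<lbrakk>(f, g) \<in> composable \<G>; (g, h) \<in> composable \<G>\<rbrakk> \<Longrightarrow>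
      gcomp \<G> (gcomp \<G> f g) h = gcomp \<G> f (gcomp \<G> g h)"
    and unit_left: "g \<in> space (arrows \<G>) \<Longrightarrow> gcomp \<G> (unit_arrow \<G> (tgt \<G> g)) g = g"
    and unit_right: "g \<in> space (arrows \<G>) \<Longrightarrow> gcomp \<G> g (unit_arrow \<G> (src \<G> g)) = g"
    and src_ginv: "g \<in> space (arrows \<G>) \<Longrightarrow> src \<G> (ginv \<G> g) = tgt \<G> g"
    and tgt_ginv: "g \<in> space (arrows \<G>) \<Longrightarrow> tgt \<G> (ginv \<G> g) = src \<G> g"
    and ginv_left: "g \<in> space (arrows \<G>) \<Longrightarrow> gcomp \<G> (ginv \<G> g) g = unit_arrow \<G> (src \<G> g)"
    and ginv_right: "g \<in> space (arrows \<G>) \<Longrightarrow> gcomp \<G> g (ginv \<G> g) = unit_arrow \<G> (tgt \<G> g)"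

definition unit_measure :: "('a, 'u) groupoid \<Rightarrow> 'a measure \<Rightarrow> 'u measure" where
  "unit_measure \<G> \<nu> = distr \<nu> (units \<G>) (tgt \<G>)"

text \<open>
  \<open>\<kappa> x\<close> is the fibre measure \<open>\<nu>\<^sup>x\<close> of the disintegration of \<open>\<nu>\<close> along the target map.  Symmetry is
  required of the measure class of \<open>\<nu>\<close> only.  In the last assumption \<open>gcomp \<G> g\<close> is only meaningful
  on the fibre over \<open>src \<G> g\<close>, whence the restriction.
\<close>

locale measured_groupoid = borel_groupoid \<G>
  for \<G> :: "('a, 'u) groupoid" +
  fixes \<nu> :: "'a measure" and \<kappa> :: "'u \<Rightarrow> 'a measure"
  assumes prob_nu: "prob_space \<nu>"
    and sets_nu: "sets \<nu> = sets (arrows \<G>)"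
    and symmetric: "equiv_measures (distr \<nu> (arrows \<G>) (ginv \<G>)) \<nu>"
    and kernel: "\<kappa> \<in> units \<G> \<rightarrow>\<^sub>M prob_algebra (arrows \<G>)"
    and fibre_supported: "AE x in unit_measure \<G> \<nu>. AE g in \<kappa> x. tgt \<G> g = x"
    and disintegration: "\<nu> = unit_measure \<G> \<nu> \<bind> \<kappa>"
    and invariant: "AE g in \<nu>. equiv_measures
      (distr (restrict_space (\<kappa> (src \<G> g)) (target_fibre \<G> (src \<G> g))) (arrows \<G>) (gcomp \<G> g))
      (\<kappa> (tgt \<G> g))"

definition fibre_power :: "('a, 'u) groupoid \<Rightarrow> nat \<Rightarrow> (nat \<Rightarrow> 'a) set" where
  "fibre_power \<G> n =
    {\<gamma> \<in> {..<n} \<rightarrow>\<^sub>E space (arrows \<G>). \<forall>i<n. \<forall>j<n. tgt \<G> (\<gamma> i) = tgt \<G> (\<gamma> j)}"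

definition fibre_power_measure ::
  "('a, 'u) groupoid \<Rightarrow> 'a measure \<Rightarrow> ('u \<Rightarrow> 'a measure) \<Rightarrow> nat \<Rightarrow> (nat \<Rightarrow> 'a) measure" where
  "fibre_power_measure \<G> \<nu> \<kappa> n =
    restrict_space (unit_measure \<G> \<nu> \<bind> (\<lambda>x. PiM {..<n} (\<lambda>_. \<kappa> x))) (fibre_power \<G> n)"

text \<open>
  The composable pairs carry the measure transported from the pairs with common target along
  \<open>(g, h) \<mapsto> (g\<^sup>-\<^sup>1, h)\<close>.
\<close>

definition composable_measure ::
  "('a, 'u) groupoid \<Rightarrow> 'a measure \<Rightarrow> ('u \<Rightarrow> 'a measure) \<Rightarrow> ('a \<times> 'a) measure" where
  "composable_measure \<G> \<nu> \<kappa> =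
    distr (fibre_power_measure \<G> \<nu> \<kappa> 2)
      (restrict_space (arrows \<G> \<Otimes>\<^sub>M arrows \<G>) (composable \<G>))
      (\<lambda>\<gamma>. (ginv \<G> (\<gamma> 0), \<gamma> 1))"


section \<open>Measurable coefficient modules and measurable bounded cohomology\<close>

text \<open>
  The separable Banach space \<open>E\<^sup>\<flat>\<close> is the type \<open>'e\<close>, and \<open>E\<close> is the type \<open>'e \<Rightarrow>\<^sub>L real\<close> of bounded
  linear functionals with the operator norm.
\<close>

definition measurable_coefficient_module ::
  "('a, 'u) groupoid \<Rightarrow> 'a measure \<Rightarrow> ('u \<Rightarrow> 'a measure) \<Rightarrow>
    ('a \<Rightarrow> 'e::{banach, second_countable_topology} \<Rightarrow>\<^sub>L 'e) \<Rightarrow> bool" where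
  "measurable_coefficient_module \<G> \<nu> \<kappa> Lb \<longleftrightarrow>
    (\<forall>g\<in>space (arrows \<G>). surj (blinfun_apply (Lb g)) \<and> (\<forall>v. norm (blinfun_apply (Lb g) v) = norm v)) \<and>
    (AE (g, h) in composable_measure \<G> \<nu> \<kappa>. Lb (gcomp \<G> g h) = Lb g o\<^sub>L Lb h) \<and>
    (\<forall>v. (\<lambda>g. blinfun_apply (Lb g) v) \<in> borel_measurable (arrows \<G>))"

definition contragredient ::
  "('a, 'u) groupoid \<Rightarrow> ('a \<Rightarrow> 'e::real_normed_vector \<Rightarrow>\<^sub>L 'e) \<Rightarrow> 'a \<Rightarrow>
    ('e \<Rightarrow>\<^sub>L real) \<Rightarrow> ('e \<Rightarrow>\<^sub>L real)" where
  "contragredient \<G> Lb g l = l o\<^sub>L Lb (ginv \<G> g)"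

definition groupoid_invariant ::
  "('a, 'u) groupoid \<Rightarrow> 'a measure \<Rightarrow> ('u \<Rightarrow> 'a measure) \<Rightarrow>
    ('a \<Rightarrow> 'e::real_normed_vector \<Rightarrow>\<^sub>L 'e) \<Rightarrow> nat \<Rightarrow> ((nat \<Rightarrow> 'a) \<Rightarrow> 'e \<Rightarrow>\<^sub>L real) \<Rightarrow> bool" where
  "groupoid_invariant \<G> \<nu> \<kappa> Lb n f \<longleftrightarrow>
    (AE \<gamma> in fibre_power_measure \<G> \<nu> \<kappa> (Suc n).
      contragredient \<G> Lb (\<gamma> 0) (f (\<lambda>i\<in>{..<n}. gcomp \<G> (ginv \<G> (\<gamma> 0)) (\<gamma> (Suc i))))
        = f (\<lambda>i\<in>{..<n}. \<gamma> (Suc i)))"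

definition mb_cochains ::
  "('a, 'u) groupoid \<Rightarrow> 'a measure \<Rightarrow> ('u \<Rightarrow> 'a measure) \<Rightarrow>
    ('a \<Rightarrow> 'e::real_normed_vector \<Rightarrow>\<^sub>L 'e) \<Rightarrow> nat \<Rightarrow>
    ((nat \<Rightarrow> 'a) \<Rightarrow> 'e \<Rightarrow>\<^sub>L real) set seminormed_space" where
  "mb_cochains \<G> \<nu> \<kappa> Lb k =
    (let V = Linf (fibre_power_measure \<G> \<nu> \<kappa> (Suc k))
     in V\<lparr>vcarrier := {A \<in> vcarrier V. \<forall>f\<in>A. groupoid_invariant \<G> \<nu> \<kappa> Lb (Suc k) f}\<rparr>)"

definition mb_coboundary ::
  "('a, 'u) groupoid \<Rightarrow> 'a measure \<Rightarrow> ('u \<Rightarrow> 'a measure) \<Rightarrow> nat \<Rightarrow>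
    ((nat \<Rightarrow> 'a) \<Rightarrow> 'e::real_normed_vector \<Rightarrow>\<^sub>L real) set \<Rightarrow>
    ((nat \<Rightarrow> 'a) \<Rightarrow> 'e \<Rightarrow>\<^sub>L real) set" where
  "mb_coboundary \<G> \<nu> \<kappa> k A =
    {h \<in> Linf_functions (fibre_power_measure \<G> \<nu> \<kappa> (k + 2)).
      \<exists>f\<in>A. AE \<gamma> in fibre_power_measure \<G> \<nu> \<kappa> (k + 2).
        h \<gamma> = (\<Sum>i<k + 2. (-1) ^ i *\<^sub>R f (omit (k + 1) i \<gamma>))}"

definition H_mb ::
  "('a, 'u) groupoid \<Rightarrow> 'a measure \<Rightarrow> ('u \<Rightarrow> 'a measure) \<Rightarrow>
    ('a \<Rightarrow> 'e::real_normed_vector \<Rightarrow>\<^sub>L 'e) \<Rightarrow> nat \<Rightarrow>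
    ((nat \<Rightarrow> 'a) \<Rightarrow> 'e \<Rightarrow>\<^sub>L real) set set seminormed_space" where
  "H_mb \<G> \<nu> \<kappa> Lb k = cohomology (mb_cochains \<G> \<nu> \<kappa> Lb) (mb_coboundary \<G> \<nu> \<kappa>) k"


section \<open>Coefficient modules and continuous bounded cohomology of groups\<close>

text \<open>
  Groups are written additively, following the library class of (not necessarily commutative)
  topological groups.
\<close>

definition isometric_rep ::
  "'v seminormed_space \<Rightarrow> ('g::group_add \<Rightarrow> 'v \<Rightarrow> 'v) \<Rightarrow> bool" where
  "isometric_rep V \<rho> \<longleftrightarrow>
    (\<forall>g. \<rho> g \<in> extensional (vcarrier V) \<and> isometric_iso V V (\<rho> g)) \<and>
    (\<forall>v\<in>vcarrier V. \<rho> 0 v = v) \<and>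
    (\<forall>g h. \<forall>v\<in>vcarrier V. \<rho> (g + h) v = \<rho> g (\<rho> h v))"

definition coefficient_module ::
  "'v seminormed_space \<Rightarrow> ('g::topological_group_add \<Rightarrow> 'v \<Rightarrow> 'v) \<Rightarrow>
    'w seminormed_space \<Rightarrow> ('v \<Rightarrow> 'w \<Rightarrow> real) \<Rightarrow> bool" where
  "coefficient_module V \<rho> W b \<longleftrightarrow>
    separable_banach_vspace W \<and>
    isometric_iso V (dual_vspace W) (\<lambda>v. \<lambda>w\<in>vcarrier W. b v w) \<and>
    isometric_rep V \<rho> \<and>
    (\<exists>\<rho>b. isometric_rep W \<rho>b \<and>
       (\<forall>w\<in>vcarrier W. continuous_map euclidean (norm_topology W) (\<lambda>g. \<rho>b g w)) \<and>
       (\<forall>g. \<forall>v\<in>vcarrier V. \<forall>w\<in>vcarrier W. b (\<rho> g v) w = b v (\<rho>b (- g) w)))"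

definition tuple_topology :: "nat \<Rightarrow> (nat \<Rightarrow> 'g::topological_space) topology" where
  "tuple_topology n = product_topology (\<lambda>_. euclidean) {..<n}"

definition cb_cochains ::
  "'v seminormed_space \<Rightarrow> ('g::topological_group_add \<Rightarrow> 'v \<Rightarrow> 'v) \<Rightarrow> nat \<Rightarrow>
    ((nat \<Rightarrow> 'g) \<Rightarrow> 'v) seminormed_space" where
  "cb_cochains V \<rho> k =
    (let T = tuple_topology (Suc k); D = topspace T in
     \<lparr>vcarrier = {f \<in> extensional D.
        continuous_map T (norm_topology V) f \<and>
        (\<exists>C. \<forall>\<gamma>\<in>D. vnorm V (f \<gamma>) \<le> C) \<and>
        (\<forall>g. \<forall>\<gamma>\<in>D. \<rho> g (f (\<lambda>i\<in>{..<Suc k}. - g + \<gamma> i)) = f \<gamma>)},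
      vzero = (\<lambda>\<gamma>\<in>D. vzero V),
      vadd = (\<lambda>f f'. \<lambda>\<gamma>\<in>D. vadd V (f \<gamma>) (f' \<gamma>)),
      vscale = (\<lambda>r f. \<lambda>\<gamma>\<in>D. vscale V r (f \<gamma>)),
      vnorm = (\<lambda>f. SUP \<gamma>\<in>D. vnorm V (f \<gamma>))\<rparr>)"

definition cb_coboundary ::
  "'v seminormed_space \<Rightarrow> nat \<Rightarrow>
    ((nat \<Rightarrow> 'g::topological_group_add) \<Rightarrow> 'v) \<Rightarrow> ((nat \<Rightarrow> 'g) \<Rightarrow> 'v)" where
  "cb_coboundary V k f =
    (\<lambda>\<gamma>\<in>topspace (tuple_topology (k + 2)).
      vsum V (\<lambda>i. vscale V ((-1) ^ i) (f (omit (k + 1) i \<gamma>))) (k + 2))"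

definition H_cb ::
  "'v seminormed_space \<Rightarrow> ('g::topological_group_add \<Rightarrow> 'v \<Rightarrow> 'v) \<Rightarrow> nat \<Rightarrow>
    ((nat \<Rightarrow> 'g) \<Rightarrow> 'v) set seminormed_space" where
  "H_cb V \<rho> k = cohomology (cb_cochains V \<rho>) (cb_coboundary V) k"


section \<open>Semidirect groupoids\<close>

definition left_haar_measure :: "'g::topological_group_add measure \<Rightarrow> bool" where
  "left_haar_measure \<eta> \<longleftrightarrow>
    sets \<eta> = sets borel \<and> emeasure \<eta> UNIV \<noteq> 0 \<and>
    (\<forall>K. compact K \<longrightarrow> emeasure \<eta> K < \<infinity>) \<and>
    (\<forall>g. distr \<eta> borel (\<lambda>h. g + h) = \<eta>)"

definition lebesgue_G_space :: "('g::topological_group_add \<Rightarrow> 'x \<Rightarrow> 'x) \<Rightarrow> 'x measure \<Rightarrow> bool" where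
  "lebesgue_G_space act \<mu> \<longleftrightarrow>
    standard_borel \<mu> \<and> sigma_finite_measure \<mu> \<and>
    (\<lambda>(g, x). act g x) \<in> borel \<Otimes>\<^sub>M \<mu> \<rightarrow>\<^sub>M \<mu> \<and>
    (\<forall>x\<in>space \<mu>. act 0 x = x) \<and>
    (\<forall>g h. \<forall>x\<in>space \<mu>. act (g + h) x = act g (act h x)) \<and>
    (\<forall>g. equiv_measures (distr \<mu> \<mu> (act g)) \<mu>)"

definition semidirect_groupoid ::
  "('g::topological_group_add \<Rightarrow> 'x \<Rightarrow> 'x) \<Rightarrow> 'x measure \<Rightarrow> ('g \<times> 'x, 'x) groupoid" where
  "semidirect_groupoid act \<mu> =
    \<lparr>arrows = borel \<Otimes>\<^sub>M \<mu>, units = \<mu>,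
     src = (\<lambda>(g, x). x), tgt = (\<lambda>(g, x). act g x),
     unit_arrow = (\<lambda>x. (0, x)),
     gcomp = (\<lambda>(h, y) (g, x). (h + g, x)),
     ginv = (\<lambda>(g, x). (- g, act g x))\<rparr>"

text \<open>
  Since \<open>Lb\<close> is multiplicative only almost everywhere, the formula
  \<open>(g \<cdot> l) x = L (g, g\<^sup>-\<^sup>1 x) (l (g\<^sup>-\<^sup>1 x))\<close> determines the \<open>G\<close>-action on the \<open>L\<^sup>\<infinity>\<close>-space only for
  almost every \<open>g\<close>: a single group element corresponds to a null set of arrows, on which \<open>Lb\<close> may be
  changed at will.  If \<open>Lb\<close> is multiplicative everywhere and \<open>\<rho>\<close> is a representation, then the formula
  for almost every \<open>g\<close> implies the formula for every \<open>g\<close>, since every \<open>g\<close> is a product of two elements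
  of a given conull set.
\<close>

definition acts_by_cocycle ::
  "'g measure \<Rightarrow> ('g::topological_group_add \<Rightarrow> 'x \<Rightarrow> 'x) \<Rightarrow> 'x measure \<Rightarrow>
    ('g \<times> 'x \<Rightarrow> 'e::real_normed_vector \<Rightarrow>\<^sub>L 'e) \<Rightarrow>
    ('g \<Rightarrow> ('x \<Rightarrow> 'e \<Rightarrow>\<^sub>L real) set \<Rightarrow> ('x \<Rightarrow> 'e \<Rightarrow>\<^sub>L real) set) \<Rightarrow> bool" where
  "acts_by_cocycle \<eta> act \<mu> Lb \<rho> \<longleftrightarrow>
    (AE g in \<eta>. \<forall>A\<in>vcarrier (Linf \<mu>). \<forall>l\<in>A.
      (\<lambda>x. contragredient (semidirect_groupoid act \<mu>) Lb (g, act (- g) x) (l (act (- g) x))) \<in> \<rho> g A)"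

text \<open>
  A tuple of arrows of \<open>G \<ltimes> X\<close> with common target \<open>x\<close> has the form
  \<open>((g\<^sub>0, g\<^sub>0\<^sup>-\<^sup>1 x), \<dots>, (g\<^sub>k, g\<^sub>k\<^sup>-\<^sup>1 x))\<close>.  This identifies functions on such tuples with
  \<open>L\<^sup>\<infinity>(X, E)\<close>-valued functions on \<open>G\<^sup>k\<^sup>+\<^sup>1\<close>.
\<close>

definition represents ::
  "'g measure \<Rightarrow> ('g::topological_group_add \<Rightarrow> 'x \<Rightarrow> 'x) \<Rightarrow> nat \<Rightarrow>
    ((nat \<Rightarrow> 'g \<times> 'x) \<Rightarrow> 'e::real_normed_vector \<Rightarrow>\<^sub>L real) set \<Rightarrow>
    ((nat \<Rightarrow> 'g) \<Rightarrow> ('x \<Rightarrow> 'e \<Rightarrow>\<^sub>L real) set) \<Rightarrow> bool" where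
  "represents \<eta> act k A c \<longleftrightarrow>
    (\<exists>f\<in>A. AE \<gamma> in PiM {..<Suc k} (\<lambda>_. \<eta>).
      (\<lambda>x. f (\<lambda>i\<in>{..<Suc k}. (\<gamma> i, act (- \<gamma> i) x))) \<in> c \<gamma>)"

text \<open>
  The canonical isomorphism is the inverse of the map induced on cohomology by the inclusion of
  continuous bounded cochains into essentially bounded ones.
\<close>

definition inverts_inclusion ::
  "'g measure \<Rightarrow> ('g::topological_group_add \<Rightarrow> 'x \<Rightarrow> 'x) \<Rightarrow> 'x measure \<Rightarrow>
    ('g \<times> 'x) measure \<Rightarrow> ('x \<Rightarrow> ('g \<times> 'x) measure) \<Rightarrow>
    ('g \<times> 'x \<Rightarrow> 'e::real_normed_vector \<Rightarrow>\<^sub>L 'e) \<Rightarrow>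
    ('g \<Rightarrow> ('x \<Rightarrow> 'e \<Rightarrow>\<^sub>L real) set \<Rightarrow> ('x \<Rightarrow> 'e \<Rightarrow>\<^sub>L real) set) \<Rightarrow> nat \<Rightarrow>
    (((nat \<Rightarrow> 'g \<times> 'x) \<Rightarrow> 'e \<Rightarrow>\<^sub>L real) set set \<Rightarrow>
     ((nat \<Rightarrow> 'g) \<Rightarrow> ('x \<Rightarrow> 'e \<Rightarrow>\<^sub>L real) set) set) \<Rightarrow> bool" where
  "inverts_inclusion \<eta> act \<mu> \<nu> \<kappa> Lb \<rho> k \<Phi> \<longleftrightarrow>
    (let \<G> = semidirect_groupoid act \<mu>;
         C = mb_cochains \<G> \<nu> \<kappa> Lb; d = mb_coboundary \<G> \<nu> \<kappa>;
         C' = cb_cochains (Linf \<mu>) \<rho>; d' = cb_coboundary (Linf \<mu>)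
     in \<forall>c\<in>cocycles C' d' k. \<exists>A\<in>cocycles C d k.
          represents \<eta> act k A c \<and> \<Phi> (cohomology_class C d k A) = cohomology_class C' d' k c)"

end

(*
  A tuple of arrows of G |x X with common target x is a tuple in G together with the point x, so a
  cochain is a function F (ga, x); the bounded measurable F that are invariant almost everywhere
  represent the classes on the groupoid side, and those with ga \<mapsto> [F (ga, _)] norm continuous
  represent the continuous cochains of G.  Let R F (ga, x) be the average of F (ga + h, x) over h,
  with independent coordinates h i distributed by a continuous probability density on G.  R
  does not increase norms, commutes with left translations, turns bounded measurable cochains into
  continuous ones (Scheffe), and averaging the prism between ga and ga + h gives an equivariant
  homotopy from the identity to R.  Hence the inclusion of continuous cochains induces an isometric
  isomorphism.  The action on L\<^sup>\<infinity>(X, E) is obtained from the almost multiplicative operators on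
  L\<^sup>1(X, E\<^sup>\<flat>): these agree almost everywhere with an honest representation, which is
  continuous because it is measurable.
*)

theory Submission
  imports Defs
begin

text \<open>The obstacle throughout is the uncountable union of null sets. As \<open>Lb\<close> is
  multiplicative only for almost every pair, the cocycle formula fixes the action only for almost
  every group element, and on the non-separable L\<infinity> orbit maps need be neither continuous
  nor measurable. On the separable predual they are measurable, an almost multiplicative family of
  injective operators has a multiplicative correction there, and the adjoint of the correction is
  the action. For cochains the same obstacle separates identities at almost every tuple (groupoid
  side) from identities at every tuple (continuous side). Averaging bridges the two: for each single
  ga the law of ga + h is absolutely continuous, and left Haar invariance moves the dependence on ga
  from F into the density. Conversely, a continuous cochain takes values in classes and must first
  receive one jointly measurable representative. Coboundaries are reflected since a bounded
  primitive becomes continuous after smoothing, and the homotopy applied to a continuous cochain is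
  continuous. For the isometry, representatives are bounded at every point by exactly the norm of
  their class.\<close>

abbreviation (input) Iff (infixr "<->" 25) where "A <-> B == (A::bool) = B"
notation (input) LIMSEQ (infix "---->" 60)
notation (input) pair_measure (infixr "\<otimes>" 80)
notation (input) measurable (infixr "->M" 60)

section \<open>Seminormed function spaces and their quotients\<close>

text \<open>The linear part of \<open>normed_vspace\<close>. The space of all functions on a set
  with values in a normed space has only this structure, its supremum norm being possibly infinite,
  and quotients of continuous cochains are taken inside such a space.\<close>

locale vspace =
	fixes V :: "'v seminormed_space"
	assumes zero_closed:"vzero V : vcarrier V"
		and add_closed:"[|u : vcarrier V; v : vcarrier V|] ==> vadd V u v : vcarrier V"
		and scale_closed:"v : vcarrier V ==> vscale V r v : vcarrier V"
		and add_assoc:"[|u : vcarrier V; v : vcarrier V; w : vcarrier V|] ==>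
			vadd V (vadd V u v) w = vadd V u (vadd V v w)"
		and add_commute:"[|u : vcarrier V; v : vcarrier V|] ==> vadd V u v = vadd V v u"
		and add_zero:"v : vcarrier V ==> vadd V (vzero V) v = v"
		and add_uminus:"v : vcarrier V ==> vadd V v (vscale V (-1) v) = vzero V"
		and scale_add_right:"[|u : vcarrier V; v : vcarrier V|] ==>
			vscale V r (vadd V u v) = vadd V (vscale V r u) (vscale V r v)"
		and scale_add_left:"v : vcarrier V ==>
			vscale V (r + s) v = vadd V (vscale V r v) (vscale V s v)"
		and scale_scale:"v : vcarrier V ==> vscale V r (vscale V s v) = vscale V (r * s) v"
		and scale_one:"v : vcarrier V ==> vscale V 1 v = v"
begin

lemma add_zero_right:"v : vcarrier V ==> vadd V v (vzero V) = v"
	using add_commute add_zero zero_closed by simp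

lemma add_left_commute:"[|u : vcarrier V; v : vcarrier V; w : vcarrier V|] ==>
		vadd V u (vadd V v w) = vadd V v (vadd V u w)"
	by(metis add_assoc add_commute)

lemma add_cancel_left:
	assumes "u : vcarrier V" "v : vcarrier V" "w : vcarrier V" "vadd V u v = vadd V u w"
	shows "v = w"
proof -
	have "vadd V (vscale V (-1) u) (vadd V u v) = vadd V (vscale V (-1) u) (vadd V u w)"
		using assms by simp
	moreover have *: "vadd V (vscale V (-1) u) (vadd V u x) = x" if "x : vcarrier V" for x
		using that assms(1) scale_closed
		by(metis add_assoc add_commute add_uminus add_zero)
	ultimately show ?thesis using *[OF assms(2)] *[OF assms(3)] by metis
qed

lemma scale_zero_left:"v : vcarrier V ==> vscale V 0 v = vzero V"
	using scale_add_left[of v 1 "-1"] by(simp add: scale_one add_uminus)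


end

sublocale normed_vspace < vspace
	by unfold_locales
		(fact zero_closed add_closed scale_closed add_assoc add_commute add_zero add_uminus
			 scale_add_right scale_add_left scale_scale scale_one)+

context normed_vspace
begin

lemma norm_nonneg:"v : vcarrier V ==> 0 <= vnorm V v"
	using norm_triangle[of v "vscale V (-1) v"] norm_eq_zero_iff[OF zero_closed]
	by(simp add: add_uminus scale_closed norm_scale zero_closed)

lemma norm_zero:"vnorm V (vzero V) = 0"
	using norm_eq_zero_iff zero_closed by auto

lemma diff_eq_zero_iff:
	assumes "u : vcarrier V" "v : vcarrier V"
	shows "vadd V u (vscale V (-1) v) = vzero V <-> u = v"
proof
	assume "vadd V u (vscale V (-1) v) = vzero V"
	then have "vadd V (vscale V (-1) v) u = vadd V (vscale V (-1) v) v"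
		using assms by(metis add_commute add_uminus scale_closed)
	then show "u = v" using assms add_cancel_left scale_closed by blast
qed (use assms add_uminus in auto)

lemma dist_commute:
	assumes "u : vcarrier V" "v : vcarrier V"
	shows "vnorm V (vadd V u (vscale V (-1) v)) = vnorm V (vadd V v (vscale V (-1) u))"
proof -
	have "vscale V (-1) (vadd V u (vscale V (-1) v)) = vadd V v (vscale V (-1) u)"
		using assms by(simp add: scale_add_right scale_closed scale_scale scale_one add_commute)
	then show ?thesis
		using norm_scale[of "vadd V u (vscale V (-1) v)" "-1"] assms
		by(simp add: add_closed scale_closed)
qed

lemma dist_triangle:
	assumes "u : vcarrier V" "v : vcarrier V" "w : vcarrier V"
	shows "vnorm V (vadd V u (vscale V (-1) w)) <=
		vnorm V (vadd V u (vscale V (-1) v)) + vnorm V (vadd V v (vscale V (-1) w))"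
proof -
	have c:"vscale V (-1) v : vcarrier V" "vscale V (-1) w : vcarrier V"
		using assms scale_closed by auto
	have "vadd V (vadd V u (vscale V (-1) v)) (vadd V v (vscale V (-1) w))
			= vadd V u (vadd V (vscale V (-1) v) (vadd V v (vscale V (-1) w)))"
		using assms c by(simp add: add_assoc add_closed)
	also have "vadd V (vscale V (-1) v) (vadd V v (vscale V (-1) w)) = vscale V (-1) w"
		using assms c by(metis add_assoc add_commute add_uminus add_zero)
	finally show ?thesis
		using norm_triangle[of "vadd V u (vscale V (-1) v)" "vadd V v (vscale V (-1) w)"] assms c
		by(simp add: add_closed)
qed

lemma Metric_space_vdist:"Metric_space (vcarrier V) (vdist V)"
proof
	show "0 <= vdist V x y" for x y
		by(auto simp: vdist_def intro!: norm_nonneg add_closed scale_closed)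
	show "vdist V x y = vdist V y x" for x y
		by(auto simp: vdist_def dist_commute)
	show "x : vcarrier V ==> y : vcarrier V ==> (vdist V x y = 0) = (x = y)" for x y
		by(simp add: vdist_def norm_eq_zero_iff add_closed scale_closed diff_eq_zero_iff)
	show "x : vcarrier V ==> y : vcarrier V ==> z : vcarrier V ==>
			vdist V x z <= vdist V x y + vdist V y z" for x y z
		by(simp add: vdist_def dist_triangle)
qed

lemma topspace_norm_topology:"topspace (norm_topology V) = vcarrier V"
	unfolding norm_topology_def using Metric_space.topspace_mtopology[OF Metric_space_vdist] .

end

text \<open>Common source of \<open>Linf\<close> and \<open>L1\<close>: in both, the functions
  vanishing almost everywhere are exactly those of seminorm zero, so both are instances of one
  quotient.\<close>

locale seminormed_functions =
	fixes S :: "('a => 'b::real_vector) set" and p :: "('a => 'b) => real"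
	assumes zero_mem:"(%x. 0) : S"
		and add_mem:"f : S ==> g : S ==> (%x. f x + g x) : S"
		and scale_mem:"f : S ==> (%x. r *\<^sub>R f x) : S"
		and p_triangle:"f : S ==> g : S ==> p (%x. f x + g x) <= p f + p g"
		and p_scale:"f : S ==> p (%x. r *\<^sub>R f x) = \<bar>r\<bar> * p f"
begin

definition "cls f = {g : S. p (%x. g x - f x) = 0}"

abbreviation "Q \<equiv> quotient_vspace (function_vspace S p) {f : S. p f = 0}"

lemma diff_mem:"f : S ==> g : S ==> (%x. f x - g x) : S"
	using add_mem[OF _ scale_mem[of g "-1"],of f] by simp

lemma p_zero:"p (%x. 0) = 0"
	using p_scale[OF zero_mem,of 0] by simp

lemma p_nonneg:"f : S ==> 0 <= p f"
	using p_triangle[OF _ scale_mem[of f "-1"],of f] p_scale[of f "-1"] by(simp add: p_zero)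

lemma p_diff_commute:"f : S ==> g : S ==> p (%x. f x - g x) = p (%x. g x - f x)"
	using p_scale[OF diff_mem,of f g "-1"] by simp

lemma p_diff_triangle:
	"f : S ==> g : S ==> h : S ==> p (%x. f x - h x) <= p (%x. f x - g x) + p (%x. g x - h x)"
	using p_triangle[OF diff_mem diff_mem,of f g g h] by simp

lemma cls_self:"f : S ==> f : cls f"
	by(simp add: cls_def p_zero)

lemma cls_eq_iff:"f : S ==> g : S ==> cls f = cls g <-> p (%x. f x - g x) = 0"
proof
	assume f:"f : S" and g:"g : S" and e:"cls f = cls g"
	then have "f : cls g" using cls_self by metis
	then show "p (%x. f x - g x) = 0" by(simp add: cls_def)
next
	have *: "cls f <= cls g" if f:"f : S" and g:"g : S" and e:"p (%x. f x - g x) = 0" for f g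
	proof
		fix h assume "h : cls f"
		then have h:"h : S" "p (%x. h x - f x) = 0" by(auto simp: cls_def)
		then have "p (%x. h x - g x) <= 0" using p_diff_triangle[of h f g] f g e by simp
		then show "h : cls g" using h p_nonneg[OF diff_mem,of h g] g by(simp add: cls_def)
	qed
	assume "f : S" "g : S" "p (%x. f x - g x) = 0"
	then show "cls f = cls g" using *[of f g] *[of g f] p_diff_commute[of f g] by auto
qed

lemma mem_cls_iff:"f : S ==> g : cls f <-> g : S & cls g = cls f"
	using cls_eq_iff[of g f] by(auto simp: cls_def)

lemma vcoset_eq_cls:
	assumes "f : S" shows "vcoset (function_vspace S p) {f : S. p f = 0} f = cls f"
proof -
	have "g : (%n x. f x + n x) ` {f : S. p f = 0}" if "g : cls f" for g
		using that diff_mem[of g f] assms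
		by(intro image_eqI[of _ _ "%x. g x - f x"]) (auto simp: cls_def)
	then show ?thesis
		using assms add_mem by(auto simp: vcoset_def function_vspace_def cls_def)
qed

lemma carrier_Q:"vcarrier Q = cls ` S"
	using vcoset_eq_cls by(auto simp: quotient_vspace_def function_vspace_def image_iff)

lemma zero_Q:"vzero Q = cls (%x. 0)"
	by(auto simp: quotient_vspace_def cls_def)

lemma add_Q:
	assumes f:"f : S" and g:"g : S" shows "vadd Q (cls f) (cls g) = cls (%x. f x + g x)"
proof -
	have "h : {(%x. a x + b x) | a b. a : cls f & b : cls g}" if "h : cls (%x. f x + g x)" for h
	proof -
		have h:"h : S" "p (%x. h x - (f x + g x)) = 0" using that by(auto simp: cls_def)
		have "(%x. h x - g x) : cls f" "g : cls g"
			using h diff_mem[OF h(1) g] cls_self[OF g] by(auto simp: cls_def diff_diff_eq add.commute)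
		then show ?thesis by(intro CollectI exI[of _ "%x. h x - g x"] exI[of _ g]) auto
	qed
	moreover have "(%x. a x + b x) : cls (%x. f x + g x)" if "a : cls f" "b : cls g" for a b
	proof -
		have ab:"a : S" "b : S" "p (%x. a x - f x) = 0" "p (%x. b x - g x) = 0"
			using that by(auto simp: cls_def)
		have "p (%x. (a x - f x) + (b x - g x)) <= 0"
			using p_triangle[OF diff_mem diff_mem,of a f b g] ab f g by simp
		then have "p (%x. (a x + b x) - (f x + g x)) <= 0" by(simp add: algebra_simps)
		then show ?thesis
			using p_nonneg[OF diff_mem[OF add_mem[OF ab(1,2)] add_mem[OF f g]]] add_mem[OF ab(1,2)]
			by(simp add: cls_def)
	qed
	ultimately show ?thesis
		by(auto simp: quotient_vspace_def function_vspace_def)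
qed

lemma scale_Q:
	assumes f:"f : S" shows "vscale Q r (cls f) = cls (%x. r *\<^sub>R f x)"
proof -
	have "h : {(%x. r *\<^sub>R a x + n x) | a n. a : cls f & n : S & p n = 0}"
		if "h : cls (%x. r *\<^sub>R f x)" for h
	proof -
		have h:"h : S" "p (%x. h x - r *\<^sub>R f x) = 0" using that by(auto simp: cls_def)
		have "f : cls f" "(%x. h x - r *\<^sub>R f x) : S"
			using diff_mem[OF h(1) scale_mem[OF f]] cls_self[OF f] by auto
		then show ?thesis using h(2)
			by(intro CollectI exI[of _ f] exI[of _ "%x. h x - r *\<^sub>R f x"]) auto
	qed
	moreover have "(%x. r *\<^sub>R a x + n x) : cls (%x. r *\<^sub>R f x)"
		if "a : cls f" "n : S" "p n = 0" for a n
	proof -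
		have a:"a : S" "p (%x. a x - f x) = 0" using that by(auto simp: cls_def)
		have "p (%x. r *\<^sub>R (a x - f x) + n x) <= 0"
			using p_triangle[OF scale_mem[OF diff_mem[OF a(1) f]] that(2)]
				p_scale[OF diff_mem[OF a(1) f]] a that by simp
		then have "p (%x. (r *\<^sub>R a x + n x) - r *\<^sub>R f x) <= 0" by(simp add: algebra_simps)
		then show ?thesis
			using p_nonneg[OF diff_mem[OF add_mem[OF scale_mem[OF a(1),of r] that(2)] scale_mem[OF f,of r]]]
				add_mem[OF scale_mem[OF a(1),of r] that(2)]
			by(simp add: cls_def)
	qed
	ultimately show ?thesis
		by(auto simp: quotient_vspace_def function_vspace_def)
qed

text \<open>The seminorm is constant on a class, so the infimum that defines the quotient norm runs
  over a single value.\<close>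

lemma norm_Q:
	assumes f:"f : S" shows "vnorm Q (cls f) = p f"
proof -
	have "p g = p f" if "g : cls f" for g
	proof -
		have g:"g : S" "p (%x. g x - f x) = 0" using that by(auto simp: cls_def)
		have "p (%x. f x + (g x - f x)) <= p f + 0"
			using p_triangle[OF f diff_mem[OF g(1) f]] unfolding g(2) .
		moreover have "p (%x. g x + (f x - g x)) <= p g + 0"
			using p_triangle[OF g(1) diff_mem[OF f g(1)]] unfolding p_diff_commute[OF f g(1)] g(2) .
		ultimately show ?thesis by simp
	qed
	then have "p ` cls f = {p f}" using cls_self[OF f] by blast
	then show ?thesis by(simp add: quotient_vspace_def function_vspace_def)
qed

lemma normed_vspace_Q:"normed_vspace Q"
proof -
	have C:"A : vcarrier Q <-> (EX f:S. A = cls f)" for A by(auto simp: carrier_Q)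
	show ?thesis
	proof
		show "vzero Q : vcarrier Q" unfolding C zero_Q using zero_mem by blast
		fix A assume A:"A : vcarrier Q"
		then obtain f where f:"f : S" "A = cls f" unfolding C by blast
		show "vscale Q r A : vcarrier Q" for r
			unfolding C f(2) scale_Q[OF f(1)] using scale_mem[OF f(1)] by blast
		show "vadd Q (vzero Q) A = A"
			unfolding f(2) zero_Q add_Q[OF zero_mem f(1)] by simp
		show "vadd Q A (vscale Q (- 1) A) = vzero Q"
			unfolding f(2) zero_Q scale_Q[OF f(1)] add_Q[OF f(1) scale_mem[OF f(1)]] by simp
		show "vscale Q (r + s) A = vadd Q (vscale Q r A) (vscale Q s A)" for r s
			unfolding f(2) scale_Q[OF f(1)] add_Q[OF scale_mem[OF f(1)] scale_mem[OF f(1)]]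
			by(simp add: scaleR_add_left)
		show "vscale Q r (vscale Q s A) = vscale Q (r * s) A" for r s
			unfolding f(2) scale_Q[OF f(1)] scale_Q[OF scale_mem[OF f(1)]] by simp
		show "vscale Q 1 A = A" unfolding f(2) scale_Q[OF f(1)] by simp
		show "(vnorm Q A = 0) = (A = vzero Q)"
			unfolding f(2) zero_Q norm_Q[OF f(1)] cls_eq_iff[OF f(1) zero_mem] by simp
		show "vnorm Q (vscale Q r A) = \<bar>r\<bar> * vnorm Q A" for r
			unfolding f(2) scale_Q[OF f(1)] norm_Q[OF f(1)] norm_Q[OF scale_mem[OF f(1)]]
			by(rule p_scale[OF f(1)])
		fix B assume B:"B : vcarrier Q"
		then obtain g where g:"g : S" "B = cls g" unfolding C by blast
		note fg = f(2) g(2) add_Q[OF f(1) g(1)] add_Q[OF g(1) f(1)]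
		show "vadd Q A B : vcarrier Q" unfolding C fg using add_mem[OF f(1) g(1)] by blast
		show "vadd Q A B = vadd Q B A" unfolding fg by(simp add: add.commute)
		show "vscale Q r (vadd Q A B) = vadd Q (vscale Q r A) (vscale Q r B)" for r
			unfolding fg scale_Q[OF f(1)] scale_Q[OF g(1)] scale_Q[OF add_mem[OF f(1) g(1)]]
				add_Q[OF scale_mem[OF f(1)] scale_mem[OF g(1)]]
			by(simp add: scaleR_add_right)
		show "vnorm Q (vadd Q A B) <= vnorm Q A + vnorm Q B"
			unfolding fg norm_Q[OF f(1)] norm_Q[OF g(1)] norm_Q[OF add_mem[OF f(1) g(1)]]
			by(rule p_triangle[OF f(1) g(1)])
		fix D assume D:"D : vcarrier Q"
		then obtain h where h:"h : S" "D = cls h" unfolding C by blast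
		show "vadd Q (vadd Q A B) D = vadd Q A (vadd Q B D)"
			unfolding fg h(2) add_Q[OF g(1) h(1)] add_Q[OF f(1) add_mem[OF g(1) h(1)]]
				add_Q[OF add_mem[OF f(1) g(1)] h(1)]
			by(simp add: add.assoc)
	qed
qed

lemma diff_Q:
	"f : S ==> g : S ==> vadd Q (cls f) (vscale Q (-1) (cls g)) = cls (%x. f x - g x)"
	using add_Q[OF _ scale_mem[of g "-1"],of f] scale_Q[of g "-1"] by simp

lemma vdist_Q:"f : S ==> g : S ==> vdist Q (cls f) (cls g) = p (%x. f x - g x)"
	by(simp add: vdist_def carrier_Q diff_Q norm_Q diff_mem)

end


section \<open>Weak-star measurable functions\<close>

text \<open>The codomain is an arbitrary normed space, so that one notion covers weak-star
  measurable functionals and strongly measurable operator families such as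
  \<open>Lb\<close>.\<close>

definition wmeas :: "'a measure => ('a => 'b::real_normed_vector \<Rightarrow>\<^sub>L 'c::real_normed_vector) => bool" where
	"wmeas M f <-> (ALL v. (%x. blinfun_apply (f x) v) : borel_measurable M)"

lemma wmeasD:"wmeas M f ==> (%x. blinfun_apply (f x) v) : borel_measurable M"
	by(simp add: wmeas_def)

text \<open>Approximate \<open>u\<close> by simple functions: on each level set \<open>f\<close> is
  applied to a fixed vector, and each operator \<open>f x\<close> is continuous, so the limit may be
  taken pointwise.\<close>

lemma wmeas_apply:
	fixes f :: "'a => 'b::{real_normed_vector,second_countable_topology} \<Rightarrow>\<^sub>L
		'c::{real_normed_vector,second_countable_topology}"
	assumes f:"wmeas M f" and u:"u : borel_measurable M"
	shows "(%x. blinfun_apply (f x) (u x)) : borel_measurable M"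
proof -
	obtain s where s:"!!i. simple_function M (s i)" "!!x. x : space M ==> (%i. s i x) ----> u x"
		using borel_measurable_implies_sequence_metric[OF u,of 0] by blast
	show ?thesis
	proof(rule borel_measurable_LIMSEQ_metric)
		show "(%i. blinfun_apply (f x) (s i x)) ----> blinfun_apply (f x) (u x)" if "x : space M" for x
			using s(2)[OF that] by(intro tendsto_intros)
		show "(%x. blinfun_apply (f x) (s i x)) : borel_measurable M" for i
		proof -
			have fin:"finite (s i ` space M)" using simple_functionD(1)[OF s(1)] .
			have ms:"s i -` {y} Int space M : sets M" for y using simple_functionD(2)[OF s(1)] .
			have "(%x. \<Sum>y\<in>s i ` space M. indicator (s i -` {y} Int space M) x *\<^sub>R blinfun_apply (f x) y)
					: borel_measurable M"
				using ms wmeasD[OF f] by(intro borel_measurable_sum borel_measurable_scaleR) auto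
			moreover have "(\<Sum>y\<in>s i ` space M. indicator (s i -` {y} Int space M) x *\<^sub>R blinfun_apply (f x) y)
					= blinfun_apply (f x) (s i x)" if "x : space M" for x
			proof -
				have "(\<Sum>y\<in>s i ` space M. indicator (s i -` {y} Int space M) x *\<^sub>R blinfun_apply (f x) y)
					= (\<Sum>y\<in>{s i x}. indicator (s i -` {y} Int space M) x *\<^sub>R blinfun_apply (f x) y)"
					using fin that by(intro sum.mono_neutral_right) (auto simp: indicator_def)
				then show ?thesis using that by(simp add: indicator_def)
			qed
			ultimately show ?thesis by(subst (asm) measurable_cong) auto
		qed
	qed
qed

lemma wmeas_add:"wmeas M f ==> wmeas M g ==> wmeas M (%x. f x + g x)"
	for f :: "'a => 'b::real_normed_vector \<Rightarrow>\<^sub>L 'c::{real_normed_vector,second_countable_topology}"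
	by(auto simp: wmeas_def plus_blinfun.rep_eq intro!: borel_measurable_add)

lemma wmeas_scaleR:"wmeas M f ==> wmeas M (%x. r *\<^sub>R f x)"
	for f :: "'a => 'b::real_normed_vector \<Rightarrow>\<^sub>L 'c::{real_normed_vector,second_countable_topology}"
	by(auto simp: wmeas_def scaleR_blinfun.rep_eq intro!: borel_measurable_scaleR)

lemma wmeas_diff:"wmeas M f ==> wmeas M g ==> wmeas M (%x. f x - g x)"
	for f :: "'a => 'b::real_normed_vector \<Rightarrow>\<^sub>L 'c::{real_normed_vector,second_countable_topology}"
	by(auto simp: wmeas_def minus_blinfun.rep_eq intro!: borel_measurable_diff)

lemma wmeas_sum:"(!!i. i : I ==> wmeas M (f i)) ==> wmeas M (%x. \<Sum>i\<in>I. f i x)"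
	for f :: "'i => 'a => 'b::real_normed_vector \<Rightarrow>\<^sub>L 'c::{real_normed_vector,second_countable_topology}"
	by(auto simp: wmeas_def blinfun.sum_left intro!: borel_measurable_sum)

lemma wmeas_zero:"wmeas M (%x. 0)"
	by(auto simp: wmeas_def)

lemma wmeas_compose:"wmeas M f ==> T : N ->M M ==> wmeas N (%x. f (T x))"
	by(auto simp: wmeas_def intro: measurable_compose)

lemma wmeas_cong:"(!!x. x : space M ==> f x = g x) ==> wmeas M f <-> wmeas M g"
	by(auto simp: wmeas_def cong: measurable_cong)

lemma wmeas_blinfun_compose:
	fixes f :: "'a => 'b::{real_normed_vector,second_countable_topology} \<Rightarrow>\<^sub>L
		'c::{real_normed_vector,second_countable_topology}"
		and T :: "'a => 'd::real_normed_vector \<Rightarrow>\<^sub>L 'b"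
	shows "wmeas M f ==> wmeas M T ==> wmeas M (%x. f x o\<^sub>L T x)"
	unfolding wmeas_def[of M "%x. f x o\<^sub>L T x"] by(auto intro!: wmeas_apply wmeasD)

lemma countable_dense_seq:
	obtains d :: "nat => 'a::{second_countable_topology,metric_space}"
	where "!!x e. 0 < e ==> EX i. dist (d i) x < e"
proof -
	obtain D :: "'a set" where D:"countable D" "!!X. open X ==> X ~= {} ==> EX d:D. d : X"
		using countable_dense_setE by blast
	have ne:"D ~= {}" using D(2)[of UNIV] by auto
	have "EX i. dist (from_nat_into D i) x < e" if "0 < e" for x e
	proof -
		obtain y where "y : D" "y : ball x e" using D(2)[of "ball x e"] \<open>0 < e\<close> by auto
		then show ?thesis using D(1) from_nat_into_to_nat_on[of D y]
			by(intro exI[of _ "to_nat_on D y"]) (auto simp: dist_commute)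
	qed
	then show thesis using that by blast
qed

lemma blinfun_norm_le_dense:
	fixes l :: "'b::real_normed_vector \<Rightarrow>\<^sub>L 'c::real_normed_vector"
	assumes d:"!!x e. 0 < e ==> EX i. dist (d i) x < e" and C:"0 <= C"
		and le:"!!i::nat. norm (blinfun_apply l (d i)) <= C * norm (d i)"
	shows "norm l <= C"
proof(rule norm_blinfun_bound[OF C])
	fix v
	have "closed {v. norm (blinfun_apply l v) <= C * norm v}"
		by(intro closed_Collect_le continuous_intros)
	moreover have "v : closure (range d)"
		using d by(auto simp: closure_approachable)
	moreover have "range d <= {v. norm (blinfun_apply l v) <= C * norm v}" using le by auto
	ultimately show "norm (blinfun_apply l v) <= C * norm v"
		using closure_minimal by blast
qed

text \<open>By separability the operator norm is tested on a dense sequence, so a bound on it is a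
  countable conjunction of measurable conditions.\<close>

lemma wmeas_norm [measurable_dest]:
	fixes f :: "'a => 'b::{real_normed_vector,second_countable_topology} \<Rightarrow>\<^sub>L
		'c::{real_normed_vector,second_countable_topology}"
	assumes f:"wmeas M f" shows "(%x. norm (f x)) : borel_measurable M"
proof(rule borel_measurable_iff_le[THEN iffD2],rule allI)
	fix C :: real
	obtain d :: "nat => 'b" where d:"!!x e. 0 < e ==> EX i. dist (d i) x < e"
		using countable_dense_seq by blast
	show "{x : space M. norm (f x) <= C} : sets M"
	proof(cases "0 <= C")
		case True
		have "norm (f x) <= C <-> (ALL i. norm (blinfun_apply (f x) (d i)) <= C * norm (d i))" for x
			using blinfun_norm_le_dense[of d C "f x"] d True
			by(metis (no_types,lifting) mult_right_mono norm_blinfun norm_ge_zero order_trans)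
		then have "{x : space M. norm (f x) <= C} =
				{x : space M. ALL i. norm (blinfun_apply (f x) (d i)) <= C * norm (d i)}" by auto
		also have "... : sets M" using wmeasD[OF f] by measurable
		finally show ?thesis .
	next
		case False
		then have "~ norm (f x) <= C" for x using norm_ge_zero[of "f x"] by linarith
		then show ?thesis by simp
	qed
qed

lemma wmeas_eq_set:
	fixes f :: "'a => 'b::{real_normed_vector,second_countable_topology} \<Rightarrow>\<^sub>L
		'c::{real_normed_vector,second_countable_topology}"
	assumes "wmeas M f" "wmeas M g" shows "{x : space M. f x = g x} : sets M"
proof -
	have "{x : space M. norm (f x - g x) = 0} : sets M"
		using wmeas_norm[OF wmeas_diff[OF assms]] by measurable
	then show ?thesis by simp
qed

lemma wmeas_If:
	assumes "wmeas M f" "wmeas M g" "{x : space M. P x} : sets M"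
	shows "wmeas M (%x. if P x then f x else g x)"
	unfolding wmeas_def
proof
	fix v
	have "(%x. if P x then blinfun_apply (f x) v else blinfun_apply (g x) v) : borel_measurable M"
		using assms by(intro measurable_If) (auto simp: wmeas_def)
	then show "(%x. blinfun_apply (if P x then f x else g x) v) : borel_measurable M"
		by(rule measurable_cong[THEN iffD1,rotated]) auto
qed


section \<open>The spaces \<open>L\<^sup>\<infinity>\<close> and \<open>L\<^sup>1\<close>\<close>

lemma Linf_functions_iff:
	"f : Linf_functions M <-> wmeas M f & (EX C. AE x in M. norm (f x) <= C)"
	by(simp add: Linf_functions_def wmeas_def)

lemma Linf_functionsI:"wmeas M f ==> AE x in M. norm (f x) <= C ==> f : Linf_functions M"
	by(auto simp: Linf_functions_iff)

lemma Linf_norm_le:"0 <= C ==> AE x in M. norm (f x) <= C ==> Linf_norm M f <= C"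
	unfolding Linf_norm_def by(intro cInf_lower bdd_belowI[of _ 0]) auto

lemma Linf_norm_nonneg:"f : Linf_functions M ==> 0 <= Linf_norm M f"
proof -
	assume "f : Linf_functions M"
	then obtain C where "AE x in M. norm (f x) <= C" by(auto simp: Linf_functions_iff)
	then have "AE x in M. norm (f x) <= \<bar>C\<bar>" by eventually_elim auto
	then show ?thesis unfolding Linf_norm_def
	proof(intro cInf_greatest)
		show "{C. 0 <= C & (AE x in M. norm (f x) <= C)} ~= {}"
			using \<open>AE x in M. norm (f x) <= \<bar>C\<bar>\<close> abs_ge_zero by blast
	qed auto
qed

text \<open>The infimum is attained: countably many constants decreasing to it suffice, and their
  exceptional sets are united.\<close>

lemma AE_le_Linf_norm:
	assumes f:"f : Linf_functions M" shows "AE x in M. norm (f x) <= Linf_norm M f"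
proof -
	let ?S = "{C. 0 <= C & (AE x in M. norm (f x) <= C)}"
	obtain C where "AE x in M. norm (f x) <= C" using f by(auto simp: Linf_functions_iff)
	then have "AE x in M. norm (f x) <= \<bar>C\<bar>" by eventually_elim auto
	then have ne:"?S ~= {}" using abs_ge_zero by blast
	have "AE x in M. norm (f x) <= Linf_norm M f + 1 / real (Suc n)" for n
	proof -
		obtain C where C:"C : ?S" "C < Linf_norm M f + 1 / real (Suc n)"
			using cInf_lessD[OF ne,of "Linf_norm M f + 1 / real (Suc n)"] by(auto simp: Linf_norm_def)
		then have "AE x in M. norm (f x) <= C" by auto
		from this show ?thesis by(rule eventually_mono) (use C(2) in auto)
	qed
	then have "AE x in M. ALL n. norm (f x) <= Linf_norm M f + 1 / real (Suc n)"
		by(simp add: AE_all_countable)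
	then show ?thesis
	proof eventually_elim
		case (elim x)
		have "(%n. Linf_norm M f + 1 / real (Suc n)) ----> Linf_norm M f + 0"
			by(intro tendsto_add tendsto_const LIMSEQ_Suc lim_1_over_n)
		then show ?case using elim by(intro LIMSEQ_le_const[where a="norm (f x)"]) auto
	qed
qed

lemma Linf_norm_eq_0_iff:
	assumes "f : Linf_functions M" shows "Linf_norm M f = 0 <-> (AE x in M. f x = 0)"
proof
	assume "Linf_norm M f = 0"
	then show "AE x in M. f x = 0" using AE_le_Linf_norm[OF assms] by simp
next
	assume "AE x in M. f x = 0"
	then have "Linf_norm M f <= 0" by(intro Linf_norm_le) (auto elim: eventually_mono)
	then show "Linf_norm M f = 0" using Linf_norm_nonneg[OF assms] by simp
qed

lemma Linf_norm_cong_AE:"AE x in M. f x = g x ==> Linf_norm M f = Linf_norm M g"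
proof -
	assume "AE x in M. f x = g x"
	then have "(AE x in M. norm (f x) <= C) <-> (AE x in M. norm (g x) <= C)" for C
		by(intro eventually_subst) (auto elim: eventually_mono)
	then show ?thesis by(simp add: Linf_norm_def)
qed

interpretation Linf: seminormed_functions "Linf_functions M" "Linf_norm M"
	for M :: "'a measure"
proof
	show zero:"(%x. 0) : Linf_functions M"
		by(rule Linf_functionsI[where C=0]) (auto simp: wmeas_zero)
	show add:"(%x. f x + g x) : Linf_functions M"
		and "Linf_norm M (%x. f x + g x) <= Linf_norm M f + Linf_norm M g"
		if fg:"f : Linf_functions M" "g : Linf_functions M" for f g :: "'a => 'b \<Rightarrow>\<^sub>L real"
	proof -
		have *: "AE x in M. norm (f x + g x) <= Linf_norm M f + Linf_norm M g"
			using AE_le_Linf_norm[OF fg(1)] AE_le_Linf_norm[OF fg(2)]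
			by eventually_elim (metis add_mono norm_triangle_le)
		show "(%x. f x + g x) : Linf_functions M"
			using * fg by(intro Linf_functionsI wmeas_add) (auto simp: Linf_functions_iff)
		show "Linf_norm M (%x. f x + g x) <= Linf_norm M f + Linf_norm M g"
			using * fg by(intro Linf_norm_le) (auto intro: add_nonneg_nonneg Linf_norm_nonneg)
	qed
	have scale_le:"(%x. r *\<^sub>R f x) : Linf_functions M & Linf_norm M (%x. r *\<^sub>R f x) <= \<bar>r\<bar> * Linf_norm M f"
		if f:"f : Linf_functions M" for f :: "'a => 'b \<Rightarrow>\<^sub>L real" and r
	proof -
		have *: "AE x in M. norm (r *\<^sub>R f x) <= \<bar>r\<bar> * Linf_norm M f"
			using AE_le_Linf_norm[OF f] by eventually_elim (auto intro: mult_left_mono)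
		show ?thesis
			using * f Linf_norm_nonneg[OF f]
			by(intro conjI Linf_functionsI[OF wmeas_scaleR] Linf_norm_le) (auto simp: Linf_functions_iff)
	qed
	show "(%x. r *\<^sub>R f x) : Linf_functions M" if "f : Linf_functions M" for f :: "'a => 'b \<Rightarrow>\<^sub>L real" and r
		using scale_le[OF that] by simp
	show "Linf_norm M (%x. r *\<^sub>R f x) = \<bar>r\<bar> * Linf_norm M f" if f:"f : Linf_functions M"
		for f :: "'a => 'b \<Rightarrow>\<^sub>L real" and r
	proof(cases "r = 0")
		case True
		then show ?thesis using Linf_norm_eq_0_iff[OF zero] by simp
	next
		case False
		\<comment> \<open>The bound for the factor \<open>1/r\<close> supplies the reverse
		  inequality.\<close>
		have "Linf_norm M (%x. (1/r) *\<^sub>R (r *\<^sub>R f x)) <= \<bar>1/r\<bar> * Linf_norm M (%x. r *\<^sub>R f x)"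
			using scale_le[of "%x. r *\<^sub>R f x" "1/r"] scale_le[OF f,of r] by auto
		then have "\<bar>r\<bar> * Linf_norm M f <= Linf_norm M (%x. r *\<^sub>R f x)"
			using False by(simp add: field_simps)
		then show ?thesis using scale_le[OF f,of r] by auto
	qed
qed

lemma Linf_null_eq:"{f : Linf_functions M. AE x in M. f x = 0} = {f : Linf_functions M. Linf_norm M f = 0}"
	using Linf_norm_eq_0_iff by blast

abbreviation Lcls :: "'a measure => ('a => 'e::real_normed_vector \<Rightarrow>\<^sub>L real) => ('a => 'e \<Rightarrow>\<^sub>L real) set" where
	"Lcls \<equiv> Linf.cls"

lemma Lcls_eq_iff:
	"f : Linf_functions M ==> g : Linf_functions M ==> Lcls M f = Lcls M g <-> (AE x in M. f x = g x)"
	using Linf_norm_eq_0_iff[OF Linf.diff_mem] by(simp add: Linf.cls_eq_iff)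

lemma mem_Lcls_iff:
	"f : Linf_functions M ==> g : Lcls M f <-> g : Linf_functions M & (AE x in M. g x = f x)"
	using Lcls_eq_iff[of g M f] Linf.mem_cls_iff[of f M g] by blast

lemmas carrier_Linf = Linf.carrier_Q[folded Linf_null_eq,folded Linf_def]
	and zero_Linf = Linf.zero_Q[folded Linf_null_eq,folded Linf_def]
	and add_Linf = Linf.add_Q[folded Linf_null_eq,folded Linf_def]
	and scale_Linf = Linf.scale_Q[folded Linf_null_eq,folded Linf_def]
	and norm_Linf = Linf.norm_Q[folded Linf_null_eq,folded Linf_def]
	and normed_vspace_Linf = Linf.normed_vspace_Q[folded Linf_null_eq,folded Linf_def]
	and vdist_Linf = Linf.vdist_Q[folded Linf_null_eq,folded Linf_def]

interpretation L1: seminormed_functions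
	"{f. integrable M (f :: 'a => 'e::{banach,second_countable_topology})}" "%f. LINT x|M. norm (f x)"
	for M :: "'a measure"
proof
	fix f g :: "'a => 'e" assume "f : {f. integrable M f}" "g : {f. integrable M f}"
	then show "(LINT x|M. norm (f x + g x)) <= (LINT x|M. norm (f x)) + (LINT x|M. norm (g x))"
		using Bochner_Integration.integral_add[of M "%x. norm (f x)" "%x. norm (g x)"]
			integral_mono[of M "%x. norm (f x + g x)" "%x. norm (f x) + norm (g x)"]
		by(simp add: norm_triangle_ineq)
qed auto

lemma L1_null_eq:
	fixes M :: "'a measure"
	shows "{f :: 'a => 'e::{banach,second_countable_topology}. integrable M f & (AE x in M. f x = 0)} =
		{f : {f. integrable M f}. (LINT x|M. norm (f x)) = 0}"
proof -
	have "(LINT x|M. norm (f x)) = 0 <-> (AE x in M. f x = 0)" if "integrable M f" for f :: "'a => 'e"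
		using integral_nonneg_eq_0_iff_AE[of M "%x. norm (f x)"] that by simp
	then show ?thesis by blast
qed

abbreviation "L1cls \<equiv> L1.cls"

lemmas carrier_L1 = L1.carrier_Q[folded L1_null_eq,folded L1_def]
	and zero_L1 = L1.zero_Q[folded L1_null_eq,folded L1_def]
	and add_L1 = L1.add_Q[folded L1_null_eq,folded L1_def]
	and scale_L1 = L1.scale_Q[folded L1_null_eq,folded L1_def]
	and norm_L1 = L1.norm_Q[folded L1_null_eq,folded L1_def]
	and normed_vspace_L1 = L1.normed_vspace_Q[folded L1_null_eq,folded L1_def]
	and vdist_L1 = L1.vdist_Q[folded L1_null_eq,folded L1_def]

lemma L1cls_eq_iff:
	"integrable M f ==> integrable M g ==> L1cls M f = L1cls M g <-> (AE x in M. f x = g x)"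
	by(simp add: L1.cls_eq_iff integral_nonneg_eq_0_iff_AE)

lemma mem_L1cls_iff:
	"integrable M f ==> g : L1cls M f <-> integrable M g & (AE x in M. g x = f x)"
	by(auto simp: L1.mem_cls_iff L1cls_eq_iff)

section \<open>Haar measure and almost homomorphisms\<close>

locale haar_group =
	fixes eta :: "'g::{topological_group_add,t2_space,second_countable_topology} measure"
	assumes locally_compact:"locally_compact_space (euclidean :: 'g topology)"
		and left_haar:"left_haar_measure eta"
begin

lemma sets_eta [measurable_cong]: "sets eta = sets borel"
	using left_haar by(simp add: left_haar_measure_def)

lemma space_eta [simp]: "space eta = UNIV"
	using sets_eq_imp_space_eq[OF sets_eta] by simp

lemma uminus_borel [measurable]: "uminus : borel ->M (borel :: 'g measure)"
	by(intro borel_measurable_continuous_onI continuous_intros)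

lemma distr_add:"distr eta borel (%h. g + h) = eta"
	using left_haar by(simp add: left_haar_measure_def)

text \<open>Local compactness puts an open set of finite measure around every point, and second
  countability extracts a countable subcover. This is the source of sigma-finiteness.\<close>

lemma countable_finite_open_cover:
	obtains \<U> where "countable \<U>" "\<Union>\<U> = (UNIV :: 'g set)"
		"!!U. U : \<U> ==> open U & emeasure eta U < \<infinity>"
proof -
	let ?F = "{U :: 'g set. open U & emeasure eta U < \<infinity>}"
	have "EX U:?F. x : U" for x
	proof -
		obtain U K where UK:"open U" "compact K" "x : U" "U <= K"
			using locally_compact[unfolded locally_compact_space_def,rule_format,of x] by auto
		have "emeasure eta U <= emeasure eta K"
			using UK by(intro emeasure_mono) (auto simp: sets_eta compact_imp_closed)
		also have "... < \<infinity>" using left_haar UK(2) by(auto simp: left_haar_measure_def)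
		finally show ?thesis using UK by auto
	qed
	then have cover:"\<Union>?F = UNIV" by blast
	obtain \<U> where "\<U> <= ?F" "countable \<U>" "\<Union>\<U> = \<Union>?F"
		using Lindelof[of ?F] by(metis (no_types,lifting) mem_Collect_eq)
	then show thesis using cover by(intro that[of \<U>]) auto
qed

sublocale sigma_finite_measure eta
proof -
	obtain \<U> where "countable \<U>" "\<Union>\<U> = (UNIV :: 'g set)"
		"!!U. U : \<U> ==> open U & emeasure eta U < \<infinity>" by(rule countable_finite_open_cover) blast
	then show "sigma_finite_measure eta"
		by unfold_locales (intro exI[of _ \<U>],auto simp: sets_eta less_top[symmetric])
qed

lemma AE_const:"(AE g in eta. P) <-> P"
proof
	assume a:"AE g in eta. P"
	show P
	proof(rule ccontr)
		assume "~ P"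
		then have "AE g in eta. False" using a by simp
		then have "emeasure eta (space eta) = 0" using AE_iff_null[of eta "%_. False"] by auto
		then show False using left_haar by(auto simp: left_haar_measure_def)
	qed
qed auto

lemma AE_ex:"AE g in eta. P g ==> EX g. P g"
	using AE_const[of "EX g. P g"] by(auto elim: eventually_mono)

lemma AE_translate:
	assumes "AE h in eta. P h" shows "AE h in eta. P (g + h)"
proof -
	have "AE h in distr eta borel (%h. g + h). P h" using assms unfolding distr_add .
	then show ?thesis by(rule AE_distrD[rotated]) measurable
qed

text \<open>Fubini replaces the modular function: for some \<open>g\<close> almost every
  \<open>h\<close> satisfies \<open>- h + g ~: N\<close>, and translating \<open>h\<close> by
  \<open>g\<close> on the left turns \<open>- h + g\<close> into \<open>- h\<close>.\<close>

lemma AE_uminus: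
	assumes "AE h in eta. P h" shows "AE h in eta. P (- h)"
proof -
	interpret pair_sigma_finite eta eta ..
	obtain N where N:"N : null_sets eta" "!!h. h ~: N ==> P h"
		using assms by(elim AE_E3) auto
	have [measurable]: "N : sets borel" using N(1) sets_eta by auto
	have AE_N:"AE h in eta. h ~: N" using N(1) by(rule AE_not_in)
	have "AE h in eta. AE g in eta. - h + g ~: N" using AE_translate[OF AE_N] by simp
	then have "AE g in eta. AE h in eta. - h + g ~: N"
		by(subst (asm) AE_commute) measurable
	then obtain g where "AE h in eta. - h + g ~: N" using AE_ex by blast
	from AE_translate[OF this,of g] have "AE h in eta. - h ~: N"
		by(simp add: minus_add add.assoc)
	then show ?thesis by eventually_elim (rule N(2))
qed


text \<open>For almost every \<open>a\<close> both \<open>a\<close> and \<open>- a + g\<close> lie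
  in the given conull set, since inversion and left translations preserve null sets.\<close>

lemma AE_decompose:
	assumes "AE h in eta. P h" obtains a b where "P a" "P b" "g = a + b"
proof -
	have "AE a in eta. P (- (- g + a))" by(rule AE_translate,rule AE_uminus) fact
	then have "AE a in eta. P a & P (- a + g)" using assms by eventually_elim (simp add: minus_add)
	then obtain a where "P a" "P (- a + g)" using AE_ex by blast
	then show thesis by(rule that) (simp add: add.assoc[symmetric])
qed

lemma AE_subgroup:
	assumes "AE h in eta. P h" and "!!a b. P a ==> P b ==> P (a + b)" shows "P g"
	using AE_decompose[OF assms(1),of g] assms(2) by metis

text \<open>If \<open>V\<close> were null, countably many null translates of it would cover the
  group by Lindelof.\<close>

lemma open_pos: assumes "open V" "V ~= {}" shows "emeasure eta V > 0"
proof(rule ccontr)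
	assume "~ emeasure eta V > 0"
	then have V0:"emeasure eta V = 0" by(simp add: not_less)
	have [measurable]: "V : sets borel" using assms by auto
	obtain v where v:"v : V" using assms(2) by auto
	let ?T = "%g. (%h. g + h) -` V"
	have op:"open (?T g)" for g
		using assms(1) by(intro open_vimage continuous_intros)
	have "emeasure eta (?T g) = emeasure (distr eta borel (%h. g + h)) V" for g
		by(subst emeasure_distr) auto
	then have nul:"?T g : null_sets eta" for g
		using V0 op[of g] by(auto simp: null_sets_def distr_add sets_eta)
	have "\<Union>(range ?T) = UNIV"
	proof -
		have "h : ?T (v - h)" for h using v by(simp add: algebra_simps)
		then show ?thesis by blast
	qed
	moreover obtain \<F> where "\<F> <= range ?T" "countable \<F>" "\<Union>\<F> = \<Union>(range ?T)"
		using Lindelof[of "range ?T"] op by(metis (no_types,lifting) imageE)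
	ultimately have "UNIV : null_sets eta"
		using nul null_sets_UN'[of \<F> "%x. x" eta] by auto
	then show False using left_haar by(auto simp: left_haar_measure_def null_sets_def)
qed

text \<open>A normalised Urysohn function at 0, supported in an open set of finite measure. Finite
  measure makes it integrable; positivity on a nonempty open set makes its integral nonzero.\<close>

lemma continuous_density:
	obtains ps :: "'g => real" where "continuous_on UNIV ps" "!!x. 0 <= ps x" "integrable eta ps"
		"(LINT x|eta. ps x) = 1"
proof -
	obtain \<U> where "\<Union>\<U> = (UNIV :: 'g set)" and U': "!!U. U : \<U> ==> open U & emeasure eta U < \<infinity>"
		by(rule countable_finite_open_cover) blast
	then obtain U where U:"open U" "emeasure eta U < \<infinity>" "0 : U" by(metis UNIV_I Union_iff)
	have H:"Hausdorff_space (euclidean :: 'g topology)"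
		using hausdorff by(auto simp: Hausdorff_space_def disjnt_def)
	have "completely_regular_space (euclidean :: 'g topology)"
		using locally_compact_regular_imp_completely_regular_space[OF locally_compact] H by blast
	then obtain f where f:"continuous_map (euclidean :: 'g topology) (top_of_set {0..1::real}) f"
			"f 0 = 0" "f ` (- U) <= {1}"
		using U unfolding completely_regular_space_def by(metis Compl_iff DiffI UNIV_I Compl_eq_Diff_UNIV closedin_closed_eq closed_Compl closed_closedin topspace_euclidean)
	have fc:"continuous_on UNIV f" and f01:"!!x. 0 <= f x & f x <= 1"
		using f(1) by(auto simp: continuous_map_in_subtopology Pi_iff)
	define phi where "phi x = 1 - f x" for x
	have c:"continuous_on UNIV phi" unfolding phi_def by(intro continuous_intros fc)
	have m [measurable]: "phi : borel_measurable borel" by(rule borel_measurable_continuous_onI[OF c])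
	have le:"norm (phi x) <= norm (indicator U x :: real)" for x
		using f01[of x] f(3) by(auto simp: phi_def indicator_def)
	have int:"integrable eta phi"
	proof(rule Bochner_Integration.integrable_bound)
		show "integrable eta (indicator U :: 'g => real)"
			using U by(intro integrable_real_indicator) (auto simp: sets_eta)
	qed (use le in auto)
	have phi0:"0 <= phi x" for x using f01 by(simp add: phi_def)
	have "(LINT x|eta. phi x) ~= 0"
	proof
		assume "(LINT x|eta. phi x) = 0"
		then have "AE x in eta. phi x = 0"
			using integral_nonneg_eq_0_iff_AE[OF int] phi0 by auto
		moreover have "open {x. phi x > 0}"
			using c by(intro open_Collect_less continuous_intros)
		moreover have "0 : {x. phi x > 0}" using f(2) by(simp add: phi_def)
		ultimately have "emeasure eta {x. phi x > 0} > 0" using open_pos by blast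
		moreover have "AE x in eta. ~ phi x > 0"
			using \<open>AE x in eta. phi x = 0\<close> by eventually_elim simp
		then have "emeasure eta {x. phi x > 0} = 0"
			using emeasure_eq_0_AE[of "%x. phi x > 0" eta] by simp
		ultimately show False by simp
	qed
	moreover have "(LINT x|eta. phi x) >= 0" using phi0 by(intro integral_nonneg_AE) auto
	ultimately have pos:"(LINT x|eta. phi x) > 0" by simp
	show thesis
	proof(rule that[of "%x. phi x / (LINT x|eta. phi x)"])
		show "continuous_on UNIV (%x. phi x / (LINT x|eta. phi x))"
			using pos by(intro continuous_intros c) auto
	qed (use phi0 pos int in auto)
qed

text \<open>The sets whose translates are continuous in measure form a Dynkin class that contains the
	open sets, by dominated convergence.\<close>

lemma translation_continuous:
	fixes D :: "'g set"
	assumes D:"open D" "emeasure eta D < \<infinity>" and g:"g ----> 0" and A:"A : sets borel"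
	shows "(%n. LINT x|eta. \<bar>indicator (A Int D) (- g n + x) - indicator (A Int D) x\<bar>) ----> (0::real)"
proof -
	define d :: "'g set => nat => real" where
		"d A n = (LINT x|eta. \<bar>indicator (A Int D) (- g n + x) - indicator (A Int D) x\<bar>)" for A n
	have [measurable]: "D : sets borel" using D by auto
	have fin:"emeasure eta (A Int D) < \<infinity>" if "A : sets borel" for A
		using that D(2) emeasure_mono[of "A Int D" D eta] by(auto simp: sets_eta intro: le_less_trans)
	have int0:"integrable eta (indicator (A Int D) :: 'g => real)" if "A : sets borel" for A
		using that fin[OF that] by(intro integrable_real_indicator) (auto simp: sets_eta)
	have trans:"integrable eta (%x. f (h + x)) & (LINT x|eta. f (h + x)) = (LINT x|eta. f x)"
		if "integrable eta f" for f :: "'g => real" and h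
	proof -
		have [measurable]: "f : borel_measurable borel"
			using that borel_measurable_integrable[OF that] by(simp cong: measurable_cong_sets add: sets_eta)
		have "integrable (distr eta borel (%x. h + x)) f" using that by(simp add: distr_add)
		then have "integrable eta (%x. f (h + x))" by(subst (asm) integrable_distr_eq) auto
		moreover have "(LINT x|distr eta borel (%x. h + x). f x) = (LINT x|eta. f (h + x))"
			by(subst integral_distr) auto
		ultimately show ?thesis by(simp add: distr_add)
	qed
	have int:"integrable eta (%x. indicator (A Int D) (- g n + x) :: real)" if "A : sets borel" for A n
		using trans[OF int0[OF that]] by auto
	have intd:"integrable eta (%x. \<bar>indicator (A Int D) (- g n + x) - indicator (A Int D) x\<bar> :: real)"
		if "A : sets borel" for A n
		using int[OF that] int0[OF that] by auto
	have d_nonneg:"0 <= d A n" for A n unfolding d_def by(intro integral_nonneg_AE) auto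
	\<comment> \<open>The sign \<open>s\<close> treats disjoint unions (\<open>s = 1\<close>) and
	  complements (\<open>s = -1\<close>) together.\<close>
	have d_add:"d C n <= d A n + d B n"
		if "A : sets borel" "B : sets borel" "C : sets borel"
			"!!x. indicator (C Int D) x = (indicator (A Int D) x + s * indicator (B Int D) x :: real)" "\<bar>s\<bar> = 1"
		for A B C n s
	proof -
		have "d C n <= (LINT x|eta. \<bar>indicator (A Int D) (- g n + x) - indicator (A Int D) x\<bar> +
				\<bar>indicator (B Int D) (- g n + x) - indicator (B Int D) x\<bar>)"
			unfolding d_def
		proof(intro integral_mono intd that Bochner_Integration.integrable_add)
			fix x
			have "\<bar>s * (indicator (B Int D) (- g n + x) - indicator (B Int D) x)\<bar>
					= \<bar>indicator (B Int D) (- g n + x) - indicator (B Int D) x :: real\<bar>"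
				using that(5) by(simp add: abs_mult)
			then show "\<bar>indicator (C Int D) (- g n + x) - indicator (C Int D) x\<bar>
					<= \<bar>indicator (A Int D) (- g n + x) - indicator (A Int D) x\<bar> +
						\<bar>indicator (B Int D) (- g n + x) - indicator (B Int D) x :: real\<bar>"
				unfolding that(4) by(simp add: algebra_simps)
		qed
		then show ?thesis unfolding d_def
			using Bochner_Integration.integral_add[OF intd[OF that(1),of n] intd[OF that(2),of n]] by simp
	qed
	have d_open:"d A ----> 0" if "open A" for A
	proof -
		have A[measurable]: "A : sets borel" using that by auto
		\<comment> \<open>Translation preserves the integral of the indicator, so the positive and
		  negative parts of the difference have the same integral and \<open>d A n\<close> is twice the
		  integral of \<open>?m n\<close>. This part is dominated by the fixed indicator of
		  \<open>A Int D\<close>, and openness makes it vanish eventually at each point.\<close>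
		let ?m = "%n x. max 0 (indicator (A Int D) x - indicator (A Int D) (- g n + x)) :: real"
		have intm:"integrable eta (?m n)" for n using int[OF A] int0[OF A] by auto
		have d_eq:"d A n = 2 * (LINT x|eta. ?m n x)" for n
		proof -
			have "d A n = (LINT x|eta. 2 * ?m n x + (indicator (A Int D) (- g n + x) - indicator (A Int D) x))"
				unfolding d_def by(intro Bochner_Integration.integral_cong) (auto simp: indicator_def)
			also have "... = 2 * (LINT x|eta. ?m n x) +
					((LINT x|eta. indicator (A Int D) (- g n + x)) - (LINT x|eta. indicator (A Int D) x))"
				using intm int[OF A] int0[OF A] by simp
			finally show ?thesis using trans[OF int0[OF A],of "- g n"] by simp
		qed
		have "(%n. LINT x|eta. ?m n x) ----> (LINT x|eta. 0)"
		proof(rule integral_dominated_convergence[where w="indicator (A Int D)"])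
			show "AE x in eta. (%n. ?m n x) ----> 0"
			proof(rule AE_I2)
				fix x
				show "(%n. ?m n x) ----> 0"
				proof(cases "x : A Int D")
					case True
					have "(%n. - g n + x) ----> - 0 + x" by(intro tendsto_intros g)
					then have "eventually (%n. - g n + x : A Int D) sequentially"
						using True that D(1) by(intro topological_tendstoD) auto
					then have "eventually (%n. ?m n x = 0) sequentially"
						by eventually_elim (use True in auto)
					then show ?thesis by(rule tendsto_eventually)
				qed simp
			qed
			show "AE x in eta. norm (?m n x) <= indicator (A Int D) x" for n
				by(auto simp: indicator_def)
		qed (use int0[OF A] intm in \<open>auto intro: borel_measurable_integrable\<close>)
		then have "(%n. 2 * (LINT x|eta. ?m n x)) ----> 0"
			by(intro tendsto_mult_right_zero) simp
		then show ?thesis by(simp only: d_eq [symmetric])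
	qed
	have "Int_stable {S :: 'g set. open S}" "{S :: 'g set. open S} <= Pow UNIV" "A : sigma_sets UNIV {S. open S}"
		using A by(auto simp: Int_stable_def borel_def)
	then have "d A ----> 0"
	proof(induction rule: sigma_sets_induct_disjoint)
		case (basic A)
		then show ?case using d_open by simp
	next
		case empty
		then show ?case using d_open[of "{}"] by simp
	next
		case (compl A)
		have A:"A : sets borel" using compl(1) by(simp add: borel_def)
		have "d (UNIV - A) n <= d UNIV n + d A n" for n
			using A by(intro d_add[where s="-1"]) (auto simp: indicator_def)
		moreover have "(%n. d UNIV n + d A n) ----> 0 + 0"
			using d_open[of UNIV] compl by(intro tendsto_add) auto
		ultimately show ?case
			by(intro tendsto_sandwich[of "%_. 0" "d (UNIV - A)" _ "%n. d UNIV n + d A n"]) (auto simp: d_nonneg)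
	next
		case (union A)
		have A:"A i : sets borel" for i using union(2) by(auto simp: borel_def)
		have fins:"d (\<Union>i<N. A i) ----> 0" for N
		proof(induction N)
			case 0
			then show ?case using d_open[of "{}"] by simp
		next
			case (Suc N)
			have "A N Int (\<Union>i<N. A i) = {}"
			proof -
				have "A N Int A i = {}" if "i < N" for i
					using union(1) that by(auto simp: disjoint_family_on_def)
				then show ?thesis by blast
			qed
			then have "d (\<Union>i<Suc N. A i) n <= d (\<Union>i<N. A i) n + d (A N) n" for n
				using A by(intro d_add[where s=1]) (auto simp: indicator_def lessThan_Suc)
			moreover have "(%n. d (\<Union>i<N. A i) n + d (A N) n) ----> 0 + 0"
				using Suc union(3) by(intro tendsto_add)
			ultimately show ?case
				by(intro tendsto_sandwich[of "%_. 0" "d (\<Union>i<Suc N. A i)" _ "%n. d (\<Union>i<N. A i) n + d (A N) n"])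
					(auto simp: d_nonneg)
		qed
		let ?U = "\<Union>i. A i"
		have U:"?U : sets borel" using A by auto
		define R where "R N = ?U - (\<Union>i<N. A i)" for N
		have R:"R N : sets borel" for N using A by(auto simp: R_def)
		have tail:"(%N. LINT x|eta. indicator (R N Int D) x) ----> (LINT x|eta. (0::real))"
		proof(rule integral_dominated_convergence[where w="indicator (UNIV Int D)"])
			show "AE x in eta. (%N. indicator (R N Int D) x :: real) ----> 0"
			proof(rule AE_I2)
				fix x
				have "EX N. ALL M>=N. x ~: R M"
				proof(cases "x : ?U")
					case True
					then obtain i where "x : A i" by blast
					then have "x ~: R M" if "M >= Suc i" for M using that by(auto simp: R_def)
					then show ?thesis by blast
				qed (simp add: R_def)
				then have "eventually (%N. (indicator (R N Int D) x :: real) = 0) sequentially"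
					unfolding eventually_sequentially by(metis IntD1 indicator_simps(2))
				then show "(%N. indicator (R N Int D) x :: real) ----> 0" by(rule tendsto_eventually)
			qed
			show "integrable eta (indicator (UNIV Int D) :: _ => real)" by(rule int0) auto
			show "(indicator (R N Int D) :: 'g => real) : borel_measurable eta" for N
				using int0[OF R] by(rule borel_measurable_integrable)
		qed (auto simp: indicator_def)
		\<comment> \<open>The bound is uniform in the translation, so the tail can be made small before
		  \<open>n\<close> is chosen.\<close>
		have dR:"d (R N) n <= 2 * (LINT x|eta. indicator (R N Int D) x)" for N n
		proof -
			have "d (R N) n <= (LINT x|eta. indicator (R N Int D) (- g n + x) + indicator (R N Int D) x)"
				unfolding d_def
				by(intro integral_mono intd int int0 R Bochner_Integration.integrable_add)
					(auto simp: indicator_def)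
			then show ?thesis using trans[OF int0[OF R,of N],of "- g n"] int[OF R,of N n] int0[OF R,of N] by simp
		qed
		show ?case
		proof(rule LIMSEQ_I)
			fix e :: real assume e:"0 < e"
			have "eventually (%N. (LINT x|eta. indicator (R N Int D) x) < e / 4) sequentially"
				using order_tendstoD(2)[OF tail,of "e / 4"] e by simp
			then obtain N where N:"(LINT x|eta. indicator (R N Int D) x) < e / 4"
				by(auto simp: eventually_sequentially)
			have "eventually (%n. d (\<Union>i<N. A i) n < e / 2) sequentially"
				using order_tendstoD(2)[OF fins,of "e / 2" N] e by simp
			then obtain n0 where n0:"!!n. n >= n0 ==> d (\<Union>i<N. A i) n < e / 2"
				by(auto simp: eventually_sequentially)
			have "d ?U n <= d (\<Union>i<N. A i) n + d (R N) n" for n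
				using A R U by(intro d_add[where s=1]) (auto simp: indicator_def R_def)
			have "norm (d ?U n - 0) < e" if "n >= n0" for n
				using n0[OF that] dR[of N n] N d_nonneg[of ?U n] \<open>!!n. d ?U n <= d (\<Union>i<N. A i) n + d (R N) n\<close>[of n]
				by simp
			then show "EX n0. ALL n>=n0. norm (d ?U n - 0) < e" by blast
		qed
	qed
	then show ?thesis by(simp only: d_def[abs_def])
qed

text \<open>If \<open>g n + b = a\<close> had no solution in \<open>B\<close>, the indicator of
  \<open>B Int D\<close> and its translate would have disjoint supports, so their L1 distance would
  be at least the measure of \<open>B Int D\<close>; this contradicts continuity of translation.
  Cutting by \<open>D\<close> keeps that measure finite and positive.\<close>

lemma steinhaus:
	assumes B:"B : sets borel" "emeasure eta B > 0"
	shows "eventually (%g. EX a:B. EX b:B. g + b = a) (nhds 0)"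
proof -
	obtain \<U> where \<U>: "countable \<U>" "\<Union>\<U> = (UNIV :: 'g set)"
		"!!U. U : \<U> ==> open U & emeasure eta U < \<infinity>" by(rule countable_finite_open_cover) blast
	have "EX D:\<U>. emeasure eta (B Int D) ~= 0"
	proof(rule ccontr)
		assume "~ ?thesis"
		then have "(\<Union>D\<in>\<U>. B Int D) : null_sets eta"
			using B \<U> by(intro null_sets_UN') (auto simp: null_sets_def sets_eta)
		moreover have "(\<Union>D\<in>\<U>. B Int D) = B" using \<U>(2) by auto
		ultimately show False using B by auto
	qed
	then obtain D where D:"open D" "emeasure eta D < \<infinity>" "emeasure eta (B Int D) ~= 0"
		using \<U>(3) by blast
	have [measurable]: "D : sets borel" "B : sets borel" using D B by auto
	have fin:"emeasure eta (B Int D) < \<infinity>"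
		using D(2) emeasure_mono[of "B Int D" D eta] by(auto simp: sets_eta intro: le_less_trans)
	let ?f = "indicator (B Int D) :: 'g => real"
	have int:"integrable eta ?f"
		using fin by(intro integrable_real_indicator) (auto simp: sets_eta)
	have c:"(LINT x|eta. ?f x) > 0"
		using fin D(3) by(simp add: measure_def enn2real_positive_iff zero_less_iff_neq_zero)
	have int2:"integrable eta (%x. ?f (h + x))" for h
	proof -
		have "integrable (distr eta borel (%x. h + x)) ?f" using int by(simp add: distr_add)
		then show ?thesis by(subst (asm) integrable_distr_eq) auto
	qed
	show ?thesis
	proof(subst eventually_nhds_iff_sequentially,intro allI impI)
		fix g :: "nat => 'g" assume g:"g ----> 0"
		have "eventually (%n. (LINT x|eta. \<bar>?f (- g n + x) - ?f x\<bar>) < (LINT x|eta. ?f x)) sequentially"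
			using order_tendstoD(2)[OF translation_continuous[OF D(1,2) g B(1)] c] .
		then show "eventually (%n. EX a:B. EX b:B. g n + b = a) sequentially"
		proof eventually_elim
			case (elim n)
			show ?case
			proof(rule ccontr)
				assume "~ ?case"
				moreover have "g n + (- g n + x) = x" for x by(simp add: add.assoc[symmetric])
				ultimately have *: "?f (- g n + x) = 0 | ?f x = 0" for x
					by(metis IntD1 indicator_simps(2))
				have "(LINT x|eta. ?f x) <= (LINT x|eta. \<bar>?f (- g n + x) - ?f x\<bar>)"
				proof(rule integral_mono)
					show "?f x <= \<bar>?f (- g n + x) - ?f x\<bar>" for x using *[of x] by auto
				qed (use int int2 in auto)
				then show False using elim by simp
			qed
		qed
	qed
qed

text \<open>\<open>V g\<close> is the unique self-map of \<open>S\<close> that sends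
  \<open>U k x\<close> to \<open>U (g + k) x\<close> for almost every \<open>k\<close>. Uniqueness
  turns relations valid for almost every parameter into relations valid for all. The quantifier over
  \<open>S\<close> stands inside the almost-everywhere statement, so one null set serves all
  points.\<close>

lemma strictify:
	fixes U :: "'g => 's => 's"
	assumes U:"!!g x. x : S ==> U g x : S" and inj:"!!g. inj_on (U g) S"
		and mult:"AE z in eta\<otimes>eta. ALL x:S. U (fst z + snd z) x = U (fst z) (U (snd z) x)"
	obtains V where "!!g. bij_betw (V g) S S" "!!x. x : S ==> V 0 x = x"
		"!!g h x. x : S ==> V (g + h) x = V g (V h x)"
		"AE g in eta. ALL x:S. V g x = U g x"
proof -
	interpret P: pair_sigma_finite eta eta ..
	define M where "M g h <-> (ALL x:S. U (g + h) x = U g (U h x))" for g h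
	obtain N where N:"N : null_sets (eta\<otimes>eta)" "!!g h. (g,h) ~: N ==> M g h"
		using mult by(elim AE_E3) (auto simp: M_def space_pair_measure)
	have [measurable]: "N : sets (borel\<otimes>borel)"
		using N(1) sets_pair_measure_cong[OF sets_eta sets_eta] by auto
	have "AE z in eta\<otimes>eta. (fst z,snd z) ~: N" using AE_not_in[OF N(1)] by simp
	then have AE_N:"AE g in eta. AE h in eta. (g,h) ~: N" by(subst P.AE_pair_iff) measurable
	have AE_M:"AE g in eta. AE h in eta. M g h"
		using AE_N by(rule eventually_mono) (auto elim!: eventually_mono intro: N(2))
	have sub:"U (g + h) ` S <= U g ` S" if "M g h" for g h
		using that U by(auto simp: M_def)
	have shear:"AE g in eta. AE k in eta. (g,- g + k) ~: N"
		using AE_N by(rule eventually_mono) (rule AE_translate)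
	text \<open>Almost all operators have the same range,and injectivity forces this range to be \<open>S\<close>.\<close>
	have "AE k in eta. AE g in eta. U k ` S <= U g ` S"
	proof -
		have "AE k in eta. AE g in eta. (g,- g + k) ~: N"
			using shear by(subst (asm) P.AE_commute) measurable
		then show ?thesis
		proof(rule eventually_mono)
			fix k assume "AE g in eta. (g,- g + k) ~: N"
			then show "AE g in eta. U k ` S <= U g ` S"
				by(rule eventually_mono) (use sub[OF N(2)] in \<open>fastforce simp: add.assoc[symmetric]\<close>)
		qed
	qed
	moreover have "AE k in eta. AE g in eta. U g ` S <= U k ` S"
		using shear
	proof(rule eventually_mono)
		fix k assume "AE g in eta. (k,- k + g) ~: N"
		then show "AE g in eta. U g ` S <= U k ` S"
			by(rule eventually_mono) (use sub[OF N(2)] in \<open>fastforce simp: add.assoc[symmetric]\<close>)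
	qed
	ultimately have "AE k in eta. AE g in eta. U g ` S = U k ` S"
	proof eventually_elim
		case (elim k)
		then show ?case by eventually_elim auto
	qed
	then obtain g1 where R:"AE h in eta. U h ` S = U g1 ` S" using AE_ex by blast
	have "AE g in eta. U g ` S = U g1 ` S & (AE h in eta. M g h)"
		using R AE_M by eventually_elim auto
	from AE_ex[OF this] obtain g where g:"U g ` S = U g1 ` S" "AE h in eta. M g h"
		by(elim exE conjE)
	have "AE h in eta. U h ` S = U g1 ` S & U (g + h) ` S = U g1 ` S & M g h"
		using R AE_translate[OF R,of g] g(2) by eventually_elim auto
	from AE_ex[OF this] obtain h where h:"U h ` S = U g1 ` S" "U (g + h) ` S = U g1 ` S" "M g h"
		by(elim exE conjE)
	have "U (g + h) ` S = (%x. U g (U h x)) ` S"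
		using h(3) unfolding M_def by(intro image_cong refl) blast
	then have "U (g + h) ` S = U g ` (U h ` S)" by(simp only: image_image)
	\<comment> \<open>Let Y be the common range. The image of Y under \<open>U g\<close> is the range
	  of \<open>U (g + h)\<close>, that is Y again, and this is also the image of \<open>S\<close>
	  under \<open>U g\<close>; injectivity then cancels \<open>U g\<close>.\<close>
	then have "U g ` (U g1 ` S) = U g ` S" using h(1,2) g(1) by simp
	moreover have "U g1 ` S <= S" using U by auto
	ultimately have "U g1 ` S = S" using inj_on_image_eq_iff[OF inj[of g],of "U g1 ` S" S] by blast
	then have surj:"AE k in eta. U k ` S = S" using R by simp
	define C where "C g T <-> (ALL x:S. T x : S) & (AE k in eta. ALL x:S. T (U k x) = U (g + k) x)" for g T
	have ex:"EX T. C g T" for g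
	proof -
		have "AE h in eta. U h ` S = S & (AE k in eta. M h k) & (AE k in eta. M (g + h) k)"
			using surj AE_M AE_translate[OF AE_M,of g] by eventually_elim auto
		from AE_ex[OF this] obtain h where h:"U h ` S = S" "AE k in eta. M h k" "AE k in eta. M (g + h) k"
			by(elim exE conjE)
		\<comment> \<open>The required property at \<open>k = h\<close> forces this value. Writing
		  \<open>k\<close> as \<open>h + k'\<close> and using multiplicativity at \<open>h\<close> and at
		  \<open>g + h\<close> shows that it holds for almost every \<open>k\<close>.\<close>
		define T where "T x = U (g + h) (inv_into S (U h) x)" for x
		have "T x : S" if "x : S" for x
			using that h(1) by(auto simp: T_def intro!: U inv_into_into)
		moreover have "AE k in eta. ALL x:S. T (U (h + k) x) = U (g + (h + k)) x"
			using h(2,3)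
		proof eventually_elim
			case (elim k)
			show ?case
			proof
				fix x assume x:"x : S"
				have "T (U (h + k) x) = T (U h (U k x))" using elim(1) x by(simp add: M_def)
				also have "... = U (g + h) (U k x)" using U[OF x] inj by(simp add: T_def)
				also have "... = U (g + (h + k)) x" using elim(2) x by(simp add: M_def add.assoc)
				finally show "T (U (h + k) x) = U (g + (h + k)) x" .
			qed
		qed
		from AE_translate[OF this,of "- h"] have "AE k in eta. ALL x:S. T (U k x) = U (g + k) x"
			by(simp add: add.assoc[symmetric])
		ultimately show ?thesis unfolding C_def by blast
	qed
	have uniq:"T x = T' x" if C:"C g T" "C g T'" and x:"x : S" for g T T' x
	proof -
		have "AE k in eta. U k ` S = S & (ALL x:S. T (U k x) = U (g + k) x) & (ALL x:S. T' (U k x) = U (g + k) x)"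
			using surj C unfolding C_def by(auto intro: AE_conjI)
		from AE_ex[OF this] obtain k where k:"U k ` S = S" "ALL x:S. T (U k x) = U (g + k) x" "ALL x:S. T' (U k x) = U (g + k) x"
			by(elim exE conjE)
		obtain y where "y : S" "x = U k y" using k(1) x by blast
		then show ?thesis using k(2,3) by simp
	qed
	define V where "V g = (SOME T. C g T)" for g
	have V:"C g (V g)" for g unfolding V_def using ex by(rule someI_ex)
	have V0:"V 0 x = x" if "x : S" for x
		using that by(intro uniq[OF V,of 0 "%x. x"]) (auto simp: C_def)
	have Vadd:"V (g + h) x = V g (V h x)" if "x : S" for g h x
	proof(rule uniq[OF V _ that])
		have "AE k in eta. ALL x:S. V h (U k x) = U (h + k) x" "AE k in eta. ALL x:S. V g (U k x) = U (g + k) x"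
			using V unfolding C_def by auto
		from this(1) AE_translate[OF this(2),of h]
		have "AE k in eta. ALL x:S. V g (V h (U k x)) = U (g + h + k) x"
			by eventually_elim (simp add: add.assoc)
		then show "C (g + h) (%x. V g (V h x))" using V unfolding C_def by auto
	qed
	show thesis
	proof(rule that[of V])
		show "bij_betw (V g) S S" for g
		proof(rule bij_betwI[where g="V (- g)"])
			show "V g : S \<rightarrow> S" "V (- g) : S \<rightarrow> S" using V unfolding C_def by auto
			show "V (- g) (V g x) = x" "V g (V (- g) x) = x" if "x : S" for x
				using Vadd[OF that,of "- g" g] Vadd[OF that,of g "- g"] V0[OF that] by simp_all
		qed
		show "AE g in eta. ALL x:S. V g x = U g x"
			using AE_M
		proof(rule eventually_mono)
			fix g assume "AE k in eta. M g k"
			then have "AE k in eta. ALL x:S. U g (U k x) = U (g + k) x"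
				by(rule eventually_mono) (simp add: M_def)
			then have "C g (U g)" using U unfolding C_def by auto
			then show "ALL x:S. V g x = U g x" using uniq[OF V] by blast
		qed
	qed (use V0 Vadd in auto)
qed

end

section \<open>Duality between \<open>L\<^sup>1\<close> and \<open>L\<^sup>\<infinity>\<close>\<close>

text \<open>Test the integrals on the very set where the inequality fails: there the integrand is
  nonnegative with nonpositive integral.\<close>

lemma AE_le_if_set_integral_le:
	fixes h k :: "'a => real"
	assumes h:"integrable M h" and k:"integrable M k"
		and le:"!!A. A : sets M ==> (LINT x|M. indicator A x * h x) <= (LINT x|M. indicator A x * k x)"
	shows "AE x in M. h x <= k x"
proof -
	define A where "A = {x : space M. k x < h x}"
	have [measurable]: "h : borel_measurable M" "k : borel_measurable M" using h k by auto
	have A:"A : sets M" unfolding A_def by measurable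
	have i:"integrable M (%x. indicator A x * h x)" "integrable M (%x. indicator A x * k x)"
		using integrable_mult_indicator[OF A h] integrable_mult_indicator[OF A k] by simp_all
	have "(LINT x|M. indicator A x * (h x - k x)) <= 0"
		using le[OF A] i by(simp add: right_diff_distrib)
	moreover have nn:"0 <= indicator A x * (h x - k x)" for x by(auto simp: A_def indicator_def)
	ultimately have "(LINT x|M. indicator A x * (h x - k x)) = 0"
		using integral_nonneg_AE[of "%x. indicator A x * (h x - k x)" M] by(simp add: order_antisym)
	moreover have "integrable M (%x. indicator A x * (h x - k x))"
		using i by(simp add: right_diff_distrib)
	ultimately have "AE x in M. indicator A x * (h x - k x) = 0"
		using integral_nonneg_eq_0_iff_AE nn by blast
	then show ?thesis
		using AE_space by eventually_elim (auto simp: A_def indicator_def split: if_splits)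
qed

lemma integral_tendsto_of_dist:
	fixes ps :: "('a => 'e::{banach,second_countable_topology}) => real"
	assumes diff:"!!f g. integrable M f ==> integrable M g ==> ps (%x. f x - g x) = ps f - ps g"
		and bound:"!!f. integrable M f ==> \<bar>ps f\<bar> <= C * (LINT x|M. norm (f x))"
		and f:"integrable M f" and s:"!!i. integrable M (s i)"
		and lim:"(%i. LINT x|M. norm (s i x - f x)) ----> 0"
	shows "(%i. ps (s i)) ----> ps f"
proof(rule LIM_zero_cancel,rule tendsto_0_le[OF lim,of _ "\<bar>C\<bar>"],rule always_eventually,rule allI)
	fix i
	have "\<bar>ps (s i) - ps f\<bar> <= C * (LINT x|M. norm (s i x - f x))"
		using bound[of "%x. s i x - f x"] diff[OF s f,of i] f s by simp
	also have "... <= \<bar>C\<bar> * \<bar>LINT x|M. norm (s i x - f x)\<bar>" by(metis abs_ge_self abs_mult)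
	finally show "norm (ps (s i) - ps f) <= norm (LINT x|M. norm (s i x - f x)) * \<bar>C\<bar>" by(simp add: mult.commute)
qed

lemma Linf_L1_integrable:
	fixes f :: "'a => 'e::{banach,second_countable_topology}"
	assumes l:"l : Linf_functions M" and f:"integrable M f"
	shows "integrable M (%x. blinfun_apply (l x) (f x))"
		and "\<bar>LINT x|M. blinfun_apply (l x) (f x)\<bar> <= Linf_norm M l * (LINT x|M. norm (f x))"
proof -
	have le:"AE x in M. norm (blinfun_apply (l x) (f x)) <= Linf_norm M l * norm (f x)"
		using AE_le_Linf_norm[OF l]
		by eventually_elim (meson mult_right_mono norm_blinfun norm_ge_zero order_trans)
	have m:"(%x. blinfun_apply (l x) (f x)) : borel_measurable M"
		using l f by(intro wmeas_apply) (auto simp: Linf_functions_iff)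
	show i:"integrable M (%x. blinfun_apply (l x) (f x))"
		by(rule Bochner_Integration.integrable_bound[of M "%x. Linf_norm M l * norm (f x)",OF _ m])
			(use f le Linf_norm_nonneg[OF l] in \<open>auto elim: eventually_mono\<close>)
	have "\<bar>LINT x|M. blinfun_apply (l x) (f x)\<bar> <= (LINT x|M. norm (blinfun_apply (l x) (f x)))"
		using integral_norm_bound[of M "%x. blinfun_apply (l x) (f x)"] by simp
	also have "... <= (LINT x|M. Linf_norm M l * norm (f x))"
		using i f le by(intro integral_mono_AE) auto
	finally show "\<bar>LINT x|M. blinfun_apply (l x) (f x)\<bar> <= Linf_norm M l * (LINT x|M. norm (f x))" by simp
qed

lemma Linf_L1_pairing_eq:
	fixes f :: "'a => 'e::{banach,second_countable_topology}"
	assumes l:"l : Linf_functions M" and f:"integrable M f"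
	shows "Linf_L1_pairing M (Lcls M l) (L1cls M f) = (LINT x|M. blinfun_apply (l x) (f x))"
	unfolding Linf_L1_pairing_def
proof(rule the_equality)
	have "(LINT x|M. blinfun_apply (l x) (f x)) = (LINT x|M. blinfun_apply (l' x) (f' x))"
		if "l' : Lcls M l" "f' : L1cls M f" for l' f'
	proof -
		have *: "l' : Linf_functions M" "AE x in M. l' x = l x" "integrable M f'" "AE x in M. f' x = f x"
			using that l f by(auto simp: mem_Lcls_iff mem_L1cls_iff)
		show ?thesis
		proof(rule integral_cong_AE)
			show "(%x. blinfun_apply (l x) (f x)) : borel_measurable M" "(%x. blinfun_apply (l' x) (f' x)) : borel_measurable M"
				using Linf_L1_integrable(1)[OF l f] Linf_L1_integrable(1)[OF *(1,3)] by auto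
			show "AE x in M. blinfun_apply (l x) (f x) = blinfun_apply (l' x) (f' x)"
				using *(2,4) by eventually_elim simp
		qed
	qed
	then show "ALL l':Lcls M l. ALL f':L1cls M f. (LINT x|M. blinfun_apply (l x) (f x)) = (LINT x|M. blinfun_apply (l' x) (f' x))"
		by blast
	show "r = (LINT x|M. blinfun_apply (l x) (f x))"
		if "ALL l:Lcls M l. ALL f:L1cls M f. r = (LINT x|M. blinfun_apply (l x) (f x))" for r
		using that Linf.cls_self[OF l] L1.cls_self[of f M] f by blast
qed

text \<open>A bounded functional on \<open>L\<^sup>1\<close> is an integral against densities \<open>l v\<close>, one for each vector
	\<open>v\<close>, obtained from the Radon--Nikodym theorem applied to the positive measure
	\<open>A \<mapsto> ps (1\<^sub>A v) + C |v| M(A)\<close>.  For almost every \<open>x\<close> the function \<open>v \<mapsto> l v x\<close> is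
	linear up to the error controlled by the norm on a countable dense set.\<close>

lemma (in finite_measure) L1_functional_density:
	fixes ps :: "('a => 'e::{banach,second_countable_topology}) => real"
	assumes add:"!!f g. integrable M f ==> integrable M g ==> ps (%x. f x + g x) = ps f + ps g"
		and scale:"!!r f. integrable M f ==> ps (%x. r *\<^sub>R f x) = r * ps f"
		and bound:"!!f. integrable M f ==> \<bar>ps f\<bar> <= C * (LINT x|M. norm (f x))" and C:"0 <= C"
	obtains l where "integrable M l"
		"!!A. A : sets M ==> ps (%x. indicator A x *\<^sub>R v) = (LINT x|M. indicator A x * l x)"
proof -
	have diff:"ps (%x. f x - g x) = ps f - ps g" if "integrable M f" "integrable M g" for f g
		using add[OF that(1),of "%x. (-1) *\<^sub>R g x"] scale[OF that(2),of "-1"] that by simp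
	define m where "m A = ps (%x. indicator A x *\<^sub>R v) + C * norm v * measure M A" for A
	have int:"integrable M (%x. indicator A x *\<^sub>R v)" if "A : sets M" for A
		using that by(intro integrable_scaleR_left integrable_real_indicator) (auto simp: less_top[symmetric])
	have nrm:"(LINT x|M. norm (indicator A x *\<^sub>R v)) = measure M A * norm v" if "A : sets M" for A
		using that by simp
	have m_nonneg:"0 <= m A" if "A : sets M" for A
		using bound[OF int[OF that]] unfolding nrm[OF that] by(simp add: m_def algebra_simps)
	have m_le:"m A <= 2 * C * norm v * measure M A" if "A : sets M" for A
		using bound[OF int[OF that]] unfolding nrm[OF that] by(simp add: m_def algebra_simps)
	have m_Un:"m (A Un B) = m A + m B" if "A : sets M" "B : sets M" "A Int B = {}" for A B
	proof -
		have "(%x. indicator (A Un B) x *\<^sub>R v) = (%x. indicator A x *\<^sub>R v + indicator B x *\<^sub>R v)"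
			using that(3) by(auto simp: indicator_def fun_eq_iff of_bool_def)
		then show ?thesis using add[OF int[OF that(1)] int[OF that(2)]] finite_measure_Union[OF that]
			by(simp add: m_def algebra_simps)
	qed
	have m_empty:"m {} = 0" using m_le[of "{}"] m_nonneg[of "{}"] by simp
	have m_sums:"(%i. m (A i)) sums m (\<Union>i. A i)" if A:"range A <= sets M" "disjoint_family A" for A :: "nat => 'a set"
	proof -
		have As:"A i : sets M" for i using A by auto
		let ?R = "%n. (\<Union>i. A i) - (\<Union>i<n. A i)"
		have part:"(\<Sum>i<n. m (A i)) = m (\<Union>i<n. A i)" for n
		proof(induction n)
			case (Suc n)
			have "A n Int A i = {}" if "i < n" for i using A(2) that by(auto simp: disjoint_family_on_def)
			then have "(\<Union>i<n. A i) Int A n = {}" by blast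
			then have "m ((\<Union>i<n. A i) Un A n) = m (\<Union>i<n. A i) + m (A n)"
				using As by(intro m_Un) auto
			then show ?case using Suc by(simp add: lessThan_Suc Un_commute)
		qed (simp add: m_empty)
		have split:"m (\<Union>i. A i) = m (\<Union>i<n. A i) + m (?R n)" for n
		proof -
			have "(\<Union>i<n. A i) Un ?R n = (\<Union>i. A i)" by blast
			then show ?thesis using m_Un[of "\<Union>i<n. A i" "?R n"] As by auto
		qed
		have "(%n. measure M (?R n)) ----> measure M (\<Inter>n. ?R n)"
			using As by(intro finite_Lim_measure_decseq) (auto simp: decseq_def)
		moreover have "(\<Inter>n. ?R n) = {}" by auto
		ultimately have "(%n. measure M (?R n)) ----> 0" by(simp only: measure_empty)
		then have lim:"(%n. 2 * C * norm v * measure M (?R n)) ----> 0" by(rule tendsto_mult_right_zero)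
		have "(%n. m (?R n)) ----> 0"
			by(rule tendsto_sandwich[OF _ _ tendsto_const lim]) (use As m_nonneg m_le in \<open>auto intro!: always_eventually\<close>)
		then have "(%n. m (\<Union>i. A i) - m (?R n)) ----> m (\<Union>i. A i) - 0" by(intro tendsto_intros)
		moreover have "m (\<Union>i. A i) - m (?R n) = m (\<Union>i<n. A i)" for n using split[of n] by linarith
		ultimately show ?thesis unfolding sums_def part by simp
	qed
	define N where "N = measure_of (space M) (sets M) (%A. ennreal (m A))"
	have sN[simp]: "sets N = sets M" by(simp add: N_def)
	have eN:"emeasure N A = ennreal (m A)" if "A : sets M" for A
		unfolding N_def
	proof(rule emeasure_measure_of_sigma)
		show "sigma_algebra (space M) (sets M)" by(rule sets.sigma_algebra_axioms)
		show "positive (sets M) (%A. ennreal (m A))" by(simp add: positive_def m_empty)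
		show "countably_additive (sets M) (%A. ennreal (m A))"
		proof(rule countably_additiveI)
			fix A :: "nat => 'a set" assume A:"range A <= sets M" "disjoint_family A"
			then have s:"(%i. m (A i)) sums m (\<Union>i. A i)" by(rule m_sums)
			have "(\<Sum>i. ennreal (m (A i))) = ennreal (\<Sum>i. m (A i))"
				using A s by(intro suminf_ennreal2) (auto intro!: m_nonneg simp: sums_iff)
			then show "(\<Sum>i. ennreal (m (A i))) = ennreal (m (\<Union>i. A i))" using s by(simp add: sums_iff)
		qed
	qed (use that in auto)
	have ac:"absolutely_continuous M N"
		unfolding absolutely_continuous_def
	proof
		fix A assume "A : null_sets M"
		then have A:"A : sets M" "measure M A = 0" by(auto simp: null_sets_def measure_def)
		then have "m A = 0" using m_le[OF A(1)] m_nonneg[OF A(1)] by simp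
		then show "A : null_sets N" using A eN by(auto simp: null_sets_def)
	qed
	interpret N: finite_measure N
		by(rule finite_measureI) (simp add: eN sets_eq_imp_space_eq[OF sN])
	let ?D = "RN_deriv M N"
	have dens:"density M ?D = N" by(rule density_RN_deriv[OF ac]) simp
	have fin:"AE x in M. ?D x ~= \<infinity>"
		using RN_deriv_finite[OF N.sigma_finite_measure_axioms ac] by simp
	define d where "d x = enn2real (?D x)" for x
	have d_meas[measurable]: "d : borel_measurable M" unfolding d_def by measurable
	have nn:"(\<integral>\<^sup>+x. ennreal (indicator A x * d x) \<partial>M) = ennreal (m A)" if A:"A : sets M" for A
	proof -
		have "(\<integral>\<^sup>+x. ennreal (indicator A x * d x) \<partial>M) = (\<integral>\<^sup>+x. ?D x * indicator A x \<partial>M)"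
			by(rule nn_integral_cong_AE,use fin in eventually_elim)
				(auto simp: indicator_def d_def less_top)
		also have "... = emeasure (density M ?D) A" using A by(simp add: emeasure_density)
		finally show ?thesis using eN[OF A] by(simp add: dens)
	qed
	have d_int:"integrable M (%x. indicator A x * d x) & (LINT x|M. indicator A x * d x) = m A" if A:"A : sets M" for A
	proof -
		have "has_bochner_integral M (%x. indicator A x * d x) (m A)"
			using A nn[OF A] m_nonneg[OF A] by(intro has_bochner_integral_nn_integral) (auto simp: d_def)
		then show ?thesis by(simp add: has_bochner_integral_iff)
	qed
	have "integrable M (%x. indicator (space M) x * d x)" using d_int by blast
	then have di:"integrable M d" by(rule Bochner_Integration.integrable_cong[THEN iffD1,rotated -1]) auto
	\<comment> \<open>Subtract the multiple of \<open>M\<close> that was added to make the set function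
	  positive.\<close>
	show thesis
	proof(rule that[of "%x. d x - C * norm v"])
		show "integrable M (%x. d x - C * norm v)" using di by auto
		fix A assume A:"A : sets M"
		have "(LINT x|M. indicator A x * (d x - C * norm v))
				= (LINT x|M. indicator A x * d x - indicator A x * (C * norm v))" by(simp add: right_diff_distrib)
		also have "... = m A - measure M A * (C * norm v)"
			using d_int[OF A] A by(subst Bochner_Integration.integral_diff) (auto simp: less_top[symmetric])
		also have "... = ps (%x. indicator A x *\<^sub>R v)" by(simp add: m_def)
		finally show "ps (%x. indicator A x *\<^sub>R v) = (LINT x|M. indicator A x * (d x - C * norm v))" by simp
	qed
qed

lemma (in finite_measure) L1_functional_representation:
	fixes ps :: "('a => 'e::{banach,second_countable_topology}) => real"
	assumes add:"!!f g. integrable M f ==> integrable M g ==> ps (%x. f x + g x) = ps f + ps g"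
		and scale:"!!r f. integrable M f ==> ps (%x. r *\<^sub>R f x) = r * ps f"
		and bound:"!!f. integrable M f ==> \<bar>ps f\<bar> <= C * (LINT x|M. norm (f x))" and C:"0 <= C"
	obtains l where "wmeas M l" "!!x. norm (l x) <= C"
		"!!f. integrable M f ==> ps f = (LINT x|M. blinfun_apply (l x) (f x))"
proof -
	have diff:"ps (%x. f x - g x) = ps f - ps g" if "integrable M f" "integrable M g" for f g
		using add[OF that(1),of "%x. (-1) *\<^sub>R g x"] scale[OF that(2),of "-1"] that by simp
	have int:"integrable M (%x. indicator A x *\<^sub>R v)" if "A : sets M" for A and v :: 'e
		using that by(intro integrable_scaleR_left integrable_real_indicator) (auto simp: less_top[symmetric])
	have "ALL v. EX l. integrable M l & (ALL A:sets M. ps (%x. indicator A x *\<^sub>R v) = (LINT x|M. indicator A x * l x))"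
		using L1_functional_density[OF add scale bound C] by metis
	then obtain Lam where Lam:"!!v. integrable M (Lam v)"
		"!!v A. A : sets M ==> ps (%x. indicator A x *\<^sub>R v) = (LINT x|M. indicator A x * Lam v x)" by metis
	have [measurable]: "Lam v : borel_measurable M" for v using Lam(1)[of v] by auto
	have iA:"integrable M (%x. indicator A x * Lam v x)" if "A : sets M" for A v
		using integrable_mult_indicator[OF that Lam(1)[of v]] by simp
	\<comment> \<open>\<open>u\<close> is kept independent of
	  \<open>a *\<^sub>R v + b *\<^sub>R w\<close> because a dense sequence need not contain linear
	  combinations of its terms; the error is bounded by the distance between the two vectors.\<close>
	have lin1:"AE x in M. a * Lam v x + b * Lam w x - Lam u x <= C * norm (a *\<^sub>R v + b *\<^sub>R w - u)" for a b v w u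
	proof(rule AE_le_if_set_integral_le)
		show "integrable M (%x. a * Lam v x + b * Lam w x - Lam u x)" using Lam(1) by auto
		fix A assume A:"A : sets M"
		have "(LINT x|M. indicator A x * (a * Lam v x + b * Lam w x - Lam u x))
			= (LINT x|M. a * (indicator A x * Lam v x) + b * (indicator A x * Lam w x) - indicator A x * Lam u x)"
			by(intro Bochner_Integration.integral_cong) (auto simp: algebra_simps)
		also have "... = a * ps (%x. indicator A x *\<^sub>R v) + b * ps (%x. indicator A x *\<^sub>R w) - ps (%x. indicator A x *\<^sub>R u)"
			using iA[OF A] Lam(2)[OF A] by simp
		also have "... = ps (%x. (a *\<^sub>R indicator A x *\<^sub>R v + b *\<^sub>R indicator A x *\<^sub>R w) - indicator A x *\<^sub>R u)"
			using int[OF A] diff[of "%x. a *\<^sub>R indicator A x *\<^sub>R v + b *\<^sub>R indicator A x *\<^sub>R w" "%x. indicator A x *\<^sub>R u"]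
				add[of "%x. a *\<^sub>R indicator A x *\<^sub>R v" "%x. b *\<^sub>R indicator A x *\<^sub>R w"]
				scale[of "%x. indicator A x *\<^sub>R v" a] scale[of "%x. indicator A x *\<^sub>R w" b]
			by(simp del: scaleR_scaleR)
		also have "(%x. (a *\<^sub>R indicator A x *\<^sub>R v + b *\<^sub>R indicator A x *\<^sub>R w) - indicator A x *\<^sub>R u) = (%x. indicator A x *\<^sub>R (a *\<^sub>R v + b *\<^sub>R w - u))"
			by(auto simp: algebra_simps)
		also have "ps ... <= C * (LINT x|M. norm (indicator A x *\<^sub>R (a *\<^sub>R v + b *\<^sub>R w - u)))"
			using bound[OF int[OF A]] by(metis abs_le_D1)
		also have "... = (LINT x|M. indicator A x * (C * norm (a *\<^sub>R v + b *\<^sub>R w - u)))"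
			using A by simp
		finally show "(LINT x|M. indicator A x * (a * Lam v x + b * Lam w x - Lam u x)) <= (LINT x|M. indicator A x * (C * norm (a *\<^sub>R v + b *\<^sub>R w - u)))" .
	qed auto
	have lin:"AE x in M. \<bar>a * Lam v x + b * Lam w x - Lam u x\<bar> <= C * norm (a *\<^sub>R v + b *\<^sub>R w - u)" for a b v w u
	proof -
		have "AE x in M. - a * Lam v x + - b * Lam w x - - 1 * Lam u x <= C * norm (a *\<^sub>R v + b *\<^sub>R w - u)"
		proof -
			\<comment> \<open>The three instances add up to the reversed inequality: \<open>Lam (- u)\<close>
			  is compared with \<open>- Lam u\<close> through \<open>Lam 0\<close>, which the last instance
			  makes nonpositive.\<close>
			have "AE x in M. (- a) * Lam v x + (- b) * Lam w x - Lam (- u) x <= C * norm ((- a) *\<^sub>R v + (- b) *\<^sub>R w - (- u))"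
				by(rule lin1)
			moreover have "AE x in M. 1 * Lam u x + 1 * Lam (- u) x - Lam 0 x <= C * norm (1 *\<^sub>R u + 1 *\<^sub>R (- u) - 0)"
				by(rule lin1)
			moreover have "AE x in M. 2 * Lam 0 x + 0 * Lam 0 x - Lam 0 x <= C * norm (2 *\<^sub>R 0 + 0 *\<^sub>R 0 - (0 :: 'e))"
				by(rule lin1)
			ultimately show ?thesis
			proof eventually_elim
				case (elim x)
				have "norm ((- a) *\<^sub>R v + (- b) *\<^sub>R w - (- u)) = norm (a *\<^sub>R v + b *\<^sub>R w - u)"
					using norm_minus_cancel[of "a *\<^sub>R v + b *\<^sub>R w - u"] by(simp add: algebra_simps)
				then show ?case using elim by simp
			qed
		qed
		then show ?thesis using lin1[of a v b w u] by eventually_elim (simp add: abs_le_iff)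
	qed
	obtain D :: "nat => 'e" where D:"!!x e. 0 < e ==> EX i. dist (D i) x < e"
		using countable_dense_seq by blast
	have "AE x in M. ALL a:\<rat>. ALL b:\<rat>. ALL i j k. \<bar>a * Lam (D i) x + b * Lam (D j) x - Lam (D k) x\<bar> <= C * norm (a *\<^sub>R D i + b *\<^sub>R D j - D k)"
		by(simp add: AE_ball_countable countable_rat AE_all_countable lin)
	then obtain N where N:"N : null_sets M"
		"!!x a b i j k. x : space M ==> x ~: N ==> a : \<rat> ==> b : \<rat> ==>
			\<bar>a * Lam (D i) x + b * Lam (D j) x - Lam (D k) x\<bar> <= C * norm (a *\<^sub>R D i + b *\<^sub>R D j - D k)"
		by(elim AE_E3) auto
	have "ALL v k. EX i. dist (D i) v < 1 / real (Suc k)" using D by simp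
	then obtain n where n:"!!v k. dist (D (n v k)) v < 1 / real (Suc k)" by metis
	have Dn:"(%k. D (n v k)) ----> v" for v
	proof(rule metric_LIMSEQ_I)
		fix r :: real assume "r > 0"
		then obtain k0 where "1 / real (Suc k0) < r" using nat_approx_posE by blast
		then have "dist (D (n v k)) v < r" if "k >= k0" for k
			using n[of v k] frac_le[of 1 1 "real (Suc k0)" "real (Suc k)"] that by simp
		then show "EX k0. ALL k>=k0. dist (D (n v k)) v < r" by blast
	qed
	\<comment> \<open>Extension by continuity from the dense sequence, along which the densities are
	  Lipschitz with constant \<open>C\<close> outside \<open>N\<close>.\<close>
	define L where "L x v = lim (%k. Lam (D (n v k)) x)" for x v
	define G where "G = space M - N"
	have [measurable]: "N : sets M" using N(1) by auto
	have est:"\<bar>a * Lam (D i) x + b * Lam (D j) x - Lam (D k) x\<bar> <= C * norm (a *\<^sub>R D i + b *\<^sub>R D j - D k)"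
		if "x : G" "a : \<rat>" "b : \<rat>" for x a b i j k using N(2) that by(auto simp: G_def)
	have Lip:"\<bar>Lam (D i) x - Lam (D k) x\<bar> <= C * dist (D i) (D k)" if "x : G" for x i k
		using est[OF that,of 1 0 i i k] by(simp add: dist_norm)
	have L:"(%k. Lam (D (n v k)) x) ----> L x v" if x:"x : G" for x v
	proof -
		have "Cauchy (%k. Lam (D (n v k)) x)"
		proof(rule metric_CauchyI)
			fix e :: real assume e:"e > 0"
			have "e / (C + 1) > 0" using e C by simp
			moreover have "Cauchy (%k. D (n v k))" using Dn LIMSEQ_imp_Cauchy by blast
			ultimately obtain M0 where M0:"!!i j. i >= M0 ==> j >= M0 ==> dist (D (n v i)) (D (n v j)) < e / (C + 1)"
				unfolding Cauchy_def by metis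
			have "dist (Lam (D (n v i)) x) (Lam (D (n v j)) x) < e" if "i >= M0" "j >= M0" for i j
			proof -
				have "dist (Lam (D (n v i)) x) (Lam (D (n v j)) x) <= C * dist (D (n v i)) (D (n v j))"
					using Lip[OF x] by(simp add: dist_real_def)
				also have "... <= (C + 1) * dist (D (n v i)) (D (n v j))" by(intro mult_right_mono) auto
				also have "... < (C + 1) * (e / (C + 1))" using M0[OF that] C by(intro mult_strict_left_mono) auto
				finally show ?thesis using C by simp
			qed
			then show "EX M. ALL m>=M. ALL n'>=M. dist (Lam (D (n v m)) x) (Lam (D (n v n')) x) < e" by blast
		qed
		then show ?thesis unfolding L_def using Cauchy_convergent convergent_LIMSEQ_iff by blast
	qed
	have L_lin:"a * L x v + b * L x w = L x (a *\<^sub>R v + b *\<^sub>R w)" if x:"x : G" for a b x v w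
	proof -
		\<comment> \<open>Outside \<open>N\<close> the estimate is known for rational coefficients only;
		  real coefficients are reached as limits.\<close>
		have "ALL c. EX q. (ALL k::nat. q k : \<rat>) & q ----> (c::real)"
		proof
			fix c :: real
			have "c : closure \<rat>" using Rats_closure_real by simp
			then show "EX q. (ALL k::nat. q k : \<rat>) & q ----> c" using closure_sequential by blast
		qed
		then obtain q where q:"!!c k. q c k : \<rat>" "!!c. q c ----> (c::real)" by metis
		let ?u = "a *\<^sub>R v + b *\<^sub>R w"
		have 1:"(%k. \<bar>q a k * Lam (D (n v k)) x + q b k * Lam (D (n w k)) x - Lam (D (n ?u k)) x\<bar>)
				----> \<bar>a * L x v + b * L x w - L x ?u\<bar>"
			by(intro tendsto_intros q L x)
		have 2:"(%k. C * norm (q a k *\<^sub>R D (n v k) + q b k *\<^sub>R D (n w k) - D (n ?u k))) ----> C * norm (a *\<^sub>R v + b *\<^sub>R w - ?u)"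
			by(intro tendsto_intros q Dn)
		have "\<bar>a * L x v + b * L x w - L x ?u\<bar> <= C * norm (a *\<^sub>R v + b *\<^sub>R w - ?u)"
			by(rule LIMSEQ_le[OF 1 2]) (use est[OF x] q(1) in blast)
		then show ?thesis by simp
	qed
	have L_Lip:"\<bar>L x v - L x w\<bar> <= C * norm (v - w)" if x:"x : G" for x v w
	proof -
		have 1:"(%k. \<bar>Lam (D (n v k)) x - Lam (D (n w k)) x\<bar>) ----> \<bar>L x v - L x w\<bar>"
			by(intro tendsto_intros L x)
		have 2:"(%k. C * dist (D (n v k)) (D (n w k))) ----> C * dist v w" by(intro tendsto_intros Dn)
		show ?thesis using LIMSEQ_le[OF 1 2] Lip[OF x] by(auto simp: dist_norm)
	qed
	have L0:"L x 0 = 0" if "x : G" for x using L_lin[OF that,of 0 0 0 0] by simp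
	have bl:"bounded_linear (L x)" if x:"x : G" for x
	proof(rule bounded_linear_intro[of _ C])
		show "L x (v + w) = L x v + L x w" for v w using L_lin[OF x,of 1 v 1 w] by simp
		show "L x (r *\<^sub>R v) = r *\<^sub>R L x v" for r v using L_lin[OF x,of r v 0 v] by simp
		show "norm (L x v) <= norm v * C" for v using L_Lip[OF x,of v 0] L0[OF x] by(simp add: mult.commute)
	qed
	define l where "l x = (if x : G then Blinfun (L x) else 0)" for x
	have lG:"blinfun_apply (l x) v = L x v" if "x : G" for x v
		using that bl by(simp add: l_def bounded_linear_Blinfun_apply)
	have norm_l:"norm (l x) <= C" for x
	proof(cases "x : G")
		case True
		then show ?thesis
			using L_Lip[OF True,of _ 0] L0[OF True] C by(intro norm_blinfun_bound) (auto simp: lG)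
	qed (simp add: l_def C)
	have wm:"wmeas M l"
		unfolding wmeas_def
	proof
		fix v
		have "(%x. if x : G then lim (%k. Lam (D (n v k)) x) else 0) : borel_measurable M"
			unfolding G_def by measurable
		moreover have "blinfun_apply (l x) v = (if x : G then lim (%k. Lam (D (n v k)) x) else 0)" for x
			using lG[of x v] by(auto simp: L_def l_def)
		ultimately show "(%x. blinfun_apply (l x) v) : borel_measurable M" by simp
	qed
	\<comment> \<open>The exceptional set may depend on \<open>v\<close>; for simple functions, where
	  only finitely many vectors occur, this is enough.\<close>
	have AE_l:"AE x in M. blinfun_apply (l x) v = Lam v x" for v
	proof -
		have "AE x in M. \<bar>Lam (D k) x - Lam v x\<bar> <= C * dist (D k) v" for k
			using lin[of 1 "D k" 0 0 v] by(simp add: dist_norm)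
		then have "AE x in M. ALL k. \<bar>Lam (D k) x - Lam v x\<bar> <= C * dist (D k) v" by(simp add: AE_all_countable)
		moreover have "AE x in M. x : G" using AE_not_in[OF N(1)] AE_space by eventually_elim (simp add: G_def)
		ultimately show ?thesis
		proof eventually_elim
			case (elim x)
			have 1:"(%k. \<bar>Lam (D (n v k)) x - Lam v x\<bar>) ----> \<bar>L x v - Lam v x\<bar>"
				by(intro tendsto_intros L elim)
			have 2:"(%k. C * dist (D (n v k)) v) ----> C * dist v v" by(intro tendsto_intros Dn)
			show ?case using LIMSEQ_le[OF 1 2] elim lG by auto
		qed
	qed
	have lLinf:"l : Linf_functions M" using wm norm_l by(intro Linf_functionsI[where C=C]) auto
	have "ps f = (LINT x|M. blinfun_apply (l x) (f x))" if "integrable M f" for f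
		using that
	proof(induction rule: integrable_induct)
		case (base A c)
		have "ps (%x. indicator A x *\<^sub>R c) = (LINT x|M. indicator A x * Lam c x)" using Lam(2)[OF base(1)] .
		also have "... = (LINT x|M. blinfun_apply (l x) (indicator A x *\<^sub>R c))"
			using base(1) wmeasD[OF wm,of c] AE_l[of c]
			by(intro integral_cong_AE) (auto simp: blinfun.scaleR_right)
		finally show ?case .
	next
		case (add f g)
		then show ?case
			using assms(1) Linf_L1_integrable(1)[OF lLinf] by(simp add: blinfun.add_right)
	next
		case (lim f s)
		have "(%i. LINT x|M. norm (s i x - f x)) ----> (LINT x|M. 0)"
		proof(rule integral_dominated_convergence[where w="%x. 3 * norm (f x)"])
			show "AE x in M. (%i. norm (s i x - f x)) ----> 0"
				using lim(2) by(intro AE_I2 tendsto_norm_zero LIM_zero)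
			show "AE x in M. norm (norm (s i x - f x)) <= 3 * norm (f x)" for i
			proof(rule AE_I2)
				fix x assume "x : space M"
				then show "norm (norm (s i x - f x)) <= 3 * norm (f x)"
					using lim(3)[of x i] norm_triangle_ineq4[of "s i x" "f x"] by simp
			qed
		qed (use lim in auto)
		then have d:"(%i. LINT x|M. norm (s i x - f x)) ----> 0" by simp
		have "(%i. ps (s i)) ----> ps f"
			by(rule integral_tendsto_of_dist[OF diff bound lim(4,1) d])
		moreover have "(%i. LINT x|M. blinfun_apply (l x) (s i x)) ----> (LINT x|M. blinfun_apply (l x) (f x))"
			by(rule integral_tendsto_of_dist[where C="Linf_norm M l",OF _ Linf_L1_integrable(2)[OF lLinf] lim(4,1) d])
				(auto simp: blinfun.diff_right Linf_L1_integrable(1)[OF lLinf])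
		ultimately show ?case using lim(5) LIMSEQ_unique by auto
	qed
	then show thesis using that wm norm_l by blast
qed

section \<open>Completeness and separability of L1 with values in a separable Banach space\<close>

lemma L1_mcomplete:
	"Metric_space.mcomplete (vcarrier (L1 M :: ('a => 'e::{banach,second_countable_topology}) set seminormed_space)) (vdist (L1 M))"
proof -
	let ?L = "L1 M :: ('a => 'e) set seminormed_space"
	interpret L: normed_vspace ?L by(rule normed_vspace_L1)
	interpret Metric_space "vcarrier ?L" "vdist ?L" by(rule L.Metric_space_vdist)
	show ?thesis
		unfolding mcomplete_def
	proof(intro allI impI)
		fix \<sigma> assume Cau:"MCauchy \<sigma>"
		then have "\<sigma> n : vcarrier ?L" for n by(auto simp: MCauchy_def)
		then have "ALL n. EX f. integrable M f & \<sigma> n = L1cls M f"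
			by(auto simp: carrier_L1)
		then obtain f where f:"!!n. integrable M (f n)" "!!n. \<sigma> n = L1cls M (f n)" by metis
		have dist:"vdist ?L (\<sigma> m) (\<sigma> n) = (LINT x|M. norm (f m x - f n x))" for m n
			using f by(simp add: vdist_L1)
		have "EX r. strict_mono r & (ALL k::nat. vdist ?L (\<sigma> (r (Suc k))) (\<sigma> (r k)) < (1/2) ^ k)"
		proof -
			have "EX N. ALL m n. N <= m --> N <= n --> vdist ?L (\<sigma> m) (\<sigma> n) < (1/2) ^ k" for k
				using Cau unfolding MCauchy_def by simp
			then obtain N where N:"!!k m n. N k <= m ==> N k <= n ==> vdist ?L (\<sigma> m) (\<sigma> n) < (1/2) ^ k"
				by metis
			\<comment> \<open>The recursion forces both strict monotonicity and \<open>N k <= r k\<close>, so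
			  consecutive distances along \<open>r\<close> are below \<open>(1/2) ^ k\<close>. The
			  telescoping series of differences then converges absolutely at almost every point, as in the
			  Riesz-Fischer theorem.\<close>
			define r where "r = rec_nat (N 0) (%k y. max (Suc y) (N (Suc k)))"
			have rS:"r (Suc k) = max (Suc (r k)) (N (Suc k))" for k by(simp add: r_def)
			have "strict_mono r" by(simp add: strict_mono_Suc_iff rS less_max_iff_disj)
			moreover have "N k <= r k" for k by(cases k) (auto simp: r_def)
			then have "vdist ?L (\<sigma> (r (Suc k))) (\<sigma> (r k)) < (1/2) ^ k" for k
				using N[of k "r (Suc k)" "r k"] by(simp add: rS order_trans[of "N k" "r k"] le_max_iff_disj le_Suc_eq)
			ultimately show ?thesis by blast
		qed
		then obtain r where r:"strict_mono r" "!!k. vdist ?L (\<sigma> (r (Suc k))) (\<sigma> (r k)) < (1/2) ^ k" by blast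
		define h where "h k x = f (r (Suc k)) x - f (r k) x" for k x
		have h:"integrable M (h k)" for k unfolding h_def using f by auto
		have hn:"(LINT x|M. norm (h k x)) < (1/2) ^ k" for k
			using r(2)[of k] unfolding dist h_def .
		have hpos:"0 <= (LINT x|M. norm (h k x))" for k by(intro integral_nonneg_AE) auto
		have sumh:"summable (%k. LINT x|M. norm (h k x))"
		proof(rule summable_comparison_test)
			show "EX N. ALL n>=N. norm (LINT x|M. norm (h n x)) <= (1/2) ^ n"
				using hn hpos by(intro exI[of _ 0]) (auto intro: less_imp_le)
			show "summable (%n. (1/2::real) ^ n)" by(rule summable_geometric) simp
		qed
		have [measurable]: "h k : borel_measurable M" for k using h by auto
		have AEsum:"AE x in M. summable (%k. norm (h k x))"
		proof -
			have "(\<integral>\<^sup>+x. (\<Sum>k. ennreal (norm (h k x))) \<partial>M) = (\<Sum>k. \<integral>\<^sup>+x. ennreal (norm (h k x)) \<partial>M)"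
				by(rule nn_integral_suminf) measurable
			also have "... = (\<Sum>k. ennreal (LINT x|M. norm (h k x)))"
				using h by(intro suminf_cong nn_integral_eq_integral) auto
			also have "... = ennreal (\<Sum>k. LINT x|M. norm (h k x))"
				by(rule suminf_ennreal2[OF hpos sumh])
			finally have "(\<integral>\<^sup>+x. (\<Sum>k. ennreal (norm (h k x))) \<partial>M) ~= \<infinity>" by simp
			then have "AE x in M. (\<Sum>k. ennreal (norm (h k x))) ~= \<infinity>"
				by(intro nn_integral_PInf_AE) auto
			then show ?thesis
				by eventually_elim (auto intro: summable_suminf_not_top)
		qed
		define F where "F x = f (r 0) x + (\<Sum>k. h k x)" for x
		have intS:"integrable M (%x. \<Sum>k. h (k + N) x)" for N
		proof(rule integrable_suminf)
			show "AE x in M. summable (%k. norm (h (k + N) x))"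
				using AEsum by eventually_elim (rule summable_ignore_initial_segment)
			show "summable (%k. LINT x|M. norm (h (k + N) x))"
				using sumh by(rule summable_ignore_initial_segment)
		qed (rule h)
		have F:"integrable M F" unfolding F_def using intS[of 0] f by auto
		have est:"(LINT x|M. norm (f (r N) x - F x)) <= 2 * (1/2) ^ N" for N
		proof -
			have sumN:"summable (%k. LINT x|M. norm (h (k + N) x))" using sumh by(rule summable_ignore_initial_segment)
			have AEN:"AE x in M. summable (%k. norm (h (k + N) x))"
				using AEsum by eventually_elim (rule summable_ignore_initial_segment)
			have iN:"integrable M (%x. \<Sum>k. norm (h (k + N) x))"
				using sumN AEN h by(intro integrable_suminf) auto
			have "AE x in M. norm (f (r N) x - F x) <= (\<Sum>k. norm (h (k + N) x))"
				using AEsum AEN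
			proof eventually_elim
				case (elim x)
				have "summable (%k. h k x)" using elim(1) by(rule summable_norm_cancel)
				then have "(\<Sum>k. h k x) = (\<Sum>k. h (k + N) x) + (\<Sum>k<N. h k x)"
					by(rule suminf_split_initial_segment)
				moreover have "(\<Sum>k<N. h k x) = f (r N) x - f (r 0) x"
					unfolding h_def by(rule sum_lessThan_telescope)
				ultimately have "f (r N) x - F x = - (\<Sum>k. h (k + N) x)" by(simp add: F_def)
				then show ?case using summable_norm[OF elim(2)] by simp
			qed
			then have "(LINT x|M. norm (f (r N) x - F x)) <= (LINT x|M. (\<Sum>k. norm (h (k + N) x)))"
				using f F iN by(intro integral_mono_AE) auto
			also have "... = (\<Sum>k. LINT x|M. norm (h (k + N) x))"
				using sumN AEN h by(intro integral_suminf) auto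
			also have "... <= (\<Sum>k. (1/2) ^ (k + N))"
				proof(rule suminf_le[OF less_imp_le[OF hn] sumN])
				show "summable (%k. (1/2::real) ^ (k + N))"
					by(rule summable_ignore_initial_segment,rule summable_geometric) simp
			qed
			also have "... = 2 * (1/2) ^ N"
				using suminf_mult2[of "%k. (1/2::real)^k" "(1/2)^N"] by(simp add: power_add suminf_geometric summable_geometric)
			finally show ?thesis .
		qed
		have "limitin mtopology (\<sigma> \<circ> r) (L1cls M F) sequentially"
			unfolding limitin_metric_dist_null
		proof(intro conjI)
			show "L1cls M F : vcarrier ?L" using F by(auto simp: carrier_L1)
			show "\<forall>\<^sub>F x in sequentially. (\<sigma> \<circ> r) x : vcarrier ?L" using f by(auto simp: carrier_L1)
			have "vdist ?L ((\<sigma> \<circ> r) N) (L1cls M F) = (LINT x|M. norm (f (r N) x - F x))" for N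
				using f F by(simp add: vdist_L1)
			moreover have "(%N. LINT x|M. norm (f (r N) x - F x)) ----> 0"
			proof(rule tendsto_sandwich[of "%_. 0" _ _ "%N. 2 * (1/2) ^ N"])
				show "(%N. 2 * (1/2::real) ^ N) ----> 0"
					by(intro tendsto_mult_right_zero LIMSEQ_power_zero) simp
			qed (auto intro!: always_eventually integral_nonneg_AE est)
			ultimately show "((%x. vdist ?L ((\<sigma> \<circ> r) x) (L1cls M F)) \<longlongrightarrow> 0) sequentially" by simp
		qed
		then show "EX x. limitin mtopology \<sigma> x sequentially"
			using MCauchy_convergent_subsequence[OF Cau r(1)] by blast
	qed
qed

text \<open>Finite intersections of a countable base, the empty intersection giving the whole space;
  points are separated because metrizable spaces are T1. Countability lets almost-everywhere
  identities between measures be tested set by set with a single null set.\<close>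

lemma standard_borel_countable_generator:
	assumes "standard_borel M"
	obtains \<P> where "countable \<P>" "\<P> <= sets M" "Int_stable \<P>" "space M : \<P>"
		"sets M = sigma_sets (space M) \<P>"
		"!!x y. x : space M ==> y : space M ==> x ~= y ==> EX P:\<P>. x : P & y ~: P"
proof -
	obtain T where T:"completely_metrizable_space T" "second_countable T" "topspace T = space M"
		"sets M = sigma_sets (topspace T) {U. openin T U}"
		using assms unfolding standard_borel_def by blast
	obtain \<B> where B:"countable \<B>" "!!V. V : \<B> ==> openin T V"
		"!!U x. openin T U ==> x : U ==> EX V:\<B>. x : V & V <= U"
		using T(2) unfolding second_countable_def by metis
	define \<P> where "\<P> = (%F. space M Int \<Inter>F) ` {F. finite F & F <= \<B>}"
	have BM:"V : sets M" "V <= space M" if "V : \<B>" for V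
		using B(2)[OF that] T openin_subset[of T V] by(auto intro: sigma_sets.Basic)
	show thesis
	proof
		show "countable \<P>" unfolding \<P>_def using B(1) countable_Collect_finite_subset by blast
		show P:"\<P> <= sets M"
		proof
			fix P assume "P : \<P>"
			then obtain F where F:"finite F" "F <= \<B>" "P = space M Int \<Inter>F" by(auto simp: \<P>_def)
			show "P : sets M"
			proof(cases "F = {}")
				case False
				then have "(\<Inter>V\<in>F. V) : sets M" using F BM(1) by(intro sets.finite_INT) auto
				then show ?thesis using F(3) by auto
			qed (use F in auto)
		qed
		show "space M : \<P>" unfolding \<P>_def by(intro image_eqI[of _ _ "{}"]) auto
		show "Int_stable \<P>"
		proof(rule Int_stableI)
			fix a b assume "a : \<P>" "b : \<P>"
			then obtain F G where "finite F" "F <= \<B>" "finite G" "G <= \<B>" "a = space M Int \<Inter>F" "b = space M Int \<Inter>G"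
				by(auto simp: \<P>_def)
			then show "a Int b : \<P>" unfolding \<P>_def by(intro image_eqI[of _ _ "F Un G"]) auto
		qed
		have B_P:"V : \<P>" if "V : \<B>" for V
			unfolding \<P>_def using that BM(2)[OF that] by(intro image_eqI[of _ _ "{V}"]) auto
		show "sets M = sigma_sets (space M) \<P>"
		proof
			have "U : sigma_sets (space M) \<P>" if "openin T U" for U
			proof -
				have "U = \<Union>{V\<in>\<B>. V <= U}" using B(3)[OF that] by blast
				moreover have "\<Union>{V\<in>\<B>. V <= U} : sigma_sets (space M) \<P>"
					using B(1) B_P by(intro sigma_sets_UNION) (auto intro: sigma_sets.Basic)
				ultimately show ?thesis by simp
			qed
			then show "sets M <= sigma_sets (space M) \<P>"
				unfolding T(4) T(3) by(intro sigma_sets_mono) auto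
			show "sigma_sets (space M) \<P> <= sets M" by(rule sets.sigma_sets_subset[OF P])
		qed
		show "EX P:\<P>. x : P & y ~: P" if "x : space M" "y : space M" "x ~= y" for x y
		proof -
			have "t1_space T"
				using T(1) by(simp add: completely_metrizable_imp_metrizable_space metrizable_imp_Hausdorff_space Hausdorff_imp_t1_space)
			then have "EX U. openin T U & x : U & y ~: U"
				using that unfolding t1_space_def T(3) by simp
			then obtain U where "openin T U" "x : U" "y ~: U" by(elim exE conjE)
			then show ?thesis using B(3)[of U x] B_P by blast
		qed
	qed
qed

text \<open>The dense set consists of finite sums of
  \<open>indicator (P Int X i) x *\<^sub>R c\<close>, with \<open>P\<close> in a countable generator
  closed under intersections, \<open>X i\<close> an exhaustion of finite measure and
  \<open>c\<close> in a dense set. The approximable functions \<open>K\<close> are stable under sums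
  and L1 limits, which carries the Dynkin induction from the generator to all measurable
  sets.\<close>

lemma L1_separable:
	assumes "standard_borel M" "sigma_finite_measure M"
	shows "separable_space (norm_topology (L1 M :: ('a => 'e::{banach,second_countable_topology}) set seminormed_space))"
proof -
	let ?L = "L1 M :: ('a => 'e) set seminormed_space"
	interpret L: normed_vspace ?L by(rule normed_vspace_L1)
	interpret Metric_space "vcarrier ?L" "vdist ?L" by(rule L.Metric_space_vdist)
	interpret sigma_finite_measure M by fact
	obtain \<P> where P:"countable \<P>" "\<P> <= sets M" "Int_stable \<P>" "sets M = sigma_sets (space M) \<P>"
		using standard_borel_countable_generator[OF assms(1)] by metis
	obtain X :: "nat => 'a set" where X:"range X <= sets M" "(\<Union>i. X i) = space M" "!!i. emeasure M (X i) ~= \<infinity>" "incseq X"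
		using sigma_finite_incseq by metis
	obtain D :: "'e set" where D:"countable D" "!!S. open S ==> S ~= {} ==> EX d:D. d : S"
		using countable_dense_setE by blast
	define step where "step t = (%x. case t of (P,i,c) => indicator (P Int X i) x *\<^sub>R c)" for t :: "'a set \<times> nat \<times> 'e"
	define S where "S = (%ts x. \<Sum>t\<leftarrow>ts. step t x) ` lists (insert (space M) \<P> \<times> UNIV \<times> D)"
	have Xm[measurable]: "X i : sets M" for i using X(1) by auto
	have int:"integrable M (%x. indicator (A Int X i) x *\<^sub>R c)" if "A : sets M" for A i and c :: 'e
	proof -
		have "emeasure M (A Int X i) < \<infinity>"
			using emeasure_mono[of "A Int X i" "X i" M] X(3)[of i] that by(auto simp: less_top[symmetric] top_unique)
		then show ?thesis using that by(intro integrable_scaleR_left integrable_real_indicator) auto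
	qed
	have S_int:"integrable M s" if "s : S" for s
	proof -
		obtain ts where ts:"ts : lists (insert (space M) \<P> \<times> UNIV \<times> D)" "s = (%x. \<Sum>t\<leftarrow>ts. step t x)"
			using \<open>s : S\<close> unfolding S_def by(elim imageE)
		have "integrable M (%x. \<Sum>t\<leftarrow>ts. step t x)" using ts(1)
			by(induction ts) (use P(2) in \<open>auto simp: step_def intro!: int\<close>)
		then show ?thesis by(simp add: ts(2))
	qed
	have S_add:"(%x. s x + t x) : S" if st:"s : S" "t : S" for s t
	proof -
		obtain ts where "ts : lists (insert (space M) \<P> \<times> UNIV \<times> D)" "s = (%x. \<Sum>t\<leftarrow>ts. step t x)"
			using st(1) unfolding S_def by(elim imageE)
		moreover obtain us where "us : lists (insert (space M) \<P> \<times> UNIV \<times> D)" "t = (%x. \<Sum>t\<leftarrow>us. step t x)"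
			using st(2) unfolding S_def by(elim imageE)
		ultimately show ?thesis unfolding S_def by(intro image_eqI[of _ _ "ts @ us"]) auto
	qed
	define K where "K f <-> integrable M f & (ALL e>0. EX s:S. (LINT x|M. norm (f x - s x)) < e)" for f :: "'a => 'e"
	have K_add:"K (%x. f x + g x)" if Kfg:"K f" "K g" for f g
		unfolding K_def
	proof(intro conjI allI impI)
		show "integrable M (%x. f x + g x)" using Kfg by(auto simp: K_def)
		fix e :: real assume "e > 0"
		then have "e / 2 > 0" by simp
		obtain s where s:"s : S" "(LINT x|M. norm (f x - s x)) < e / 2"
			using Kfg(1) \<open>e / 2 > 0\<close> unfolding K_def by blast
		obtain t where t:"t : S" "(LINT x|M. norm (g x - t x)) < e / 2"
			using Kfg(2) \<open>e / 2 > 0\<close> unfolding K_def by blast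
		note st = s(1) t(1) s(2) t(2)
		have i:"integrable M f" "integrable M g" "integrable M s" "integrable M t" using Kfg st S_int by(auto simp: K_def)
		have "(LINT x|M. norm (f x + g x - (s x + t x))) <= (LINT x|M. norm (f x - s x) + norm (g x - t x))"
			using i by(intro integral_mono) (auto simp: norm_diff_triangle_ineq)
		also have "... < e" using i st by simp
		finally show "EX s:S. (LINT x|M. norm (f x + g x - s x)) < e" using S_add[OF st(1,2)] by(intro bexI[of _ "%x. s x + t x"])
	qed
	have K_lim:"K f" if intf:"integrable M f" and Kg:"!!n. K (g n)" and lim:"(%n. LINT x|M. norm (f x - g n x)) ----> 0" for f g
		unfolding K_def
	proof(intro conjI allI impI)
		fix e :: real assume "e > 0"
		then have "eventually (%n. (LINT x|M. norm (f x - g n x)) < e / 2) sequentially"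
			using order_tendstoD(2)[OF lim,of "e/2"] by simp
		then obtain n where n:"(LINT x|M. norm (f x - g n x)) < e / 2" by(auto simp: eventually_sequentially)
		have "e / 2 > 0" using \<open>e > 0\<close> by simp
		then obtain s where s:"s : S" "(LINT x|M. norm (g n x - s x)) < e / 2" using Kg[of n] unfolding K_def by blast
		have i:"integrable M (g n)" "integrable M s" using Kg s S_int by(auto simp: K_def)
		have "(LINT x|M. norm (f x - s x)) <= (LINT x|M. norm (f x - g n x) + norm (g n x - s x))"
			using i intf by(intro integral_mono) (auto intro: norm_diff_triangle_le)
		also have "... < e" using i intf n s by simp
		finally show "EX s:S. (LINT x|M. norm (f x - s x)) < e" using s by blast
	qed (rule intf)
	have mX:"measure M (A Int X i) <= measure M (X i)" if "A : sets M" for A i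
		using X(3)[of i] that by(intro measure_mono_fmeasurable) (auto simp: fmeasurable_def less_top[symmetric])
	have nrm:"(LINT x|M. norm (indicator (A Int X i) x *\<^sub>R c)) = measure M (A Int X i) * norm c"
		if "A : sets M" for A i and c :: 'e
		using that by simp
	have K_base:"K (%x. indicator (A Int X i) x *\<^sub>R c)" if A:"A : insert (space M) \<P>" for A i c
		unfolding K_def
	proof(intro conjI allI impI)
		have Am:"A : sets M" using A P(2) by auto
		show "integrable M (%x. indicator (A Int X i) x *\<^sub>R c)" by(rule int[OF Am])
		fix e :: real assume e:"e > 0"
		\<comment> \<open>Adding 1 keeps the denominator positive when \<open>X i\<close> is null.\<close>
		let ?de = "e / (measure M (X i) + 1)"
		have "?de > 0" using e by(simp add: add_nonneg_pos)
		then obtain d where d:"d : D" "dist c d < ?de" using D(2)[of "ball c ?de"] by auto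
		have "(%x. \<Sum>t\<leftarrow>[(A,i,d)]. step t x) : S" using d A unfolding S_def by(intro imageI) auto
		then have "(%x. indicator (A Int X i) x *\<^sub>R d) : S" by(simp add: step_def)
		moreover have "(LINT x|M. norm (indicator (A Int X i) x *\<^sub>R c - indicator (A Int X i) x *\<^sub>R d)) < e"
		proof -
			have "(LINT x|M. norm (indicator (A Int X i) x *\<^sub>R c - indicator (A Int X i) x *\<^sub>R d)) = measure M (A Int X i) * dist c d"
				using nrm[OF Am,of i "c - d"] by(simp add: scaleR_diff_right dist_norm)
			also have "... <= measure M (X i) * dist c d" using mX[OF Am] by(intro mult_right_mono) auto
			also have "... <= (measure M (X i) + 1) * dist c d" by(intro mult_right_mono) auto
			also have "... < (measure M (X i) + 1) * ?de" using d(2) by(intro mult_strict_left_mono) (auto simp: add_nonneg_pos)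
			also have "... = e"
			proof -
				have "measure M (X i) + 1 ~= 0" using measure_nonneg[of M "X i"] by linarith
				then show ?thesis by simp
			qed
			finally show ?thesis .
		qed
		ultimately show "EX s:S. (LINT x|M. norm (indicator (A Int X i) x *\<^sub>R c - s x)) < e"
			by(intro bexI[of _ "%x. indicator (A Int X i) x *\<^sub>R d"])
	qed
	have P_Pow:"\<P> <= Pow (space M)" using P(2) sets.space_closed by blast
	have K_set:"K (%x. indicator (A Int X i) x *\<^sub>R c)" if A:"A : sets M" for A i c
		using P(3) P_Pow A[unfolded P(4)]
	proof(induction arbitrary: c rule: sigma_sets_induct_disjoint)
		case (basic A)
		then show ?case using K_base by simp
	next
		case empty
		have "K (%x. indicator (space M Int X i) x *\<^sub>R 0)" by(rule K_base) simp
		then show ?case by simp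
	next
		case (compl A)
		have Am:"A : sets M" using compl P(4) by simp
		have "K (%x. indicator (space M Int X i) x *\<^sub>R c + indicator (A Int X i) x *\<^sub>R (- c))"
			by(rule K_add[OF K_base compl(2)]) simp
		moreover have "indicator (space M Int X i) x *\<^sub>R c + indicator (A Int X i) x *\<^sub>R (- c) = indicator ((space M - A) Int X i) x *\<^sub>R c" for x
			using sets.sets_into_space[OF Am] sets.sets_into_space[OF Xm[of i]] by(auto simp: indicator_def)
		ultimately show ?case by simp
	next
		case (union A)
		have Am:"A n : sets M" for n using union P(4) by auto
		let ?U = "\<Union>n. A n"
		have U:"?U : sets M" using Am by auto
		have fin:"K (%x. indicator ((\<Union>n<N. A n) Int X i) x *\<^sub>R c)" for N
		proof(induction N)
			case 0
			have "K (%x. indicator (space M Int X i) x *\<^sub>R 0)" by(rule K_base) simp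
			then show ?case by simp
		next
			case (Suc N)
			have "A N Int A j = {}" if "j < N" for j using union(1) that by(auto simp: disjoint_family_on_def)
			then have "indicator ((\<Union>n<N. A n) Int X i) x *\<^sub>R c + indicator (A N Int X i) x *\<^sub>R c = indicator ((\<Union>n<Suc N. A n) Int X i) x *\<^sub>R c" for x
				by(fastforce simp: indicator_def lessThan_Suc)
			then show ?case using K_add[OF Suc union(3)[of N c]] by simp
		qed
		have "(%N. LINT x|M. norm (indicator (?U Int X i) x *\<^sub>R c - indicator ((\<Union>n<N. A n) Int X i) x *\<^sub>R c)) ----> (LINT x|M. 0)"
		proof(rule integral_dominated_convergence[where w="%x. norm (indicator (?U Int X i) x *\<^sub>R c)"])
			show "integrable M (%x. norm (indicator (?U Int X i) x *\<^sub>R c))" using int[OF U] by(rule integrable_norm)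
			show "AE x in M. (%N. norm (indicator (?U Int X i) x *\<^sub>R c - indicator ((\<Union>n<N. A n) Int X i) x *\<^sub>R c)) ----> 0"
			proof(rule AE_I2)
				fix x
				have "EX N0. ALL N>=N0. (x : ?U <-> x : (\<Union>n<N. A n))"
				proof(cases "x : ?U")
					case True
					then obtain j where "x : A j" by blast
					then have "ALL N>=Suc j. x : (\<Union>n<N. A n)" by force
					then show ?thesis using True by blast
				qed auto
				then have "eventually (%N. norm (indicator (?U Int X i) x *\<^sub>R c - indicator ((\<Union>n<N. A n) Int X i) x *\<^sub>R c) = 0) sequentially"
				proof(elim exE)
					fix N0 assume N0:"ALL N>=N0. (x : ?U <-> x : (\<Union>n<N. A n))"
					have "indicator ((\<Union>n<N. A n) Int X i) x = (indicator (?U Int X i) x :: real)" if "N >= N0" for N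
						using N0[rule_format,OF that] unfolding indicator_def Int_iff by simp
					then show ?thesis unfolding eventually_sequentially by(intro exI[of _ N0]) simp
				qed
				then show "(%N. norm (indicator (?U Int X i) x *\<^sub>R c - indicator ((\<Union>n<N. A n) Int X i) x *\<^sub>R c)) ----> 0"
					by(rule tendsto_eventually)
			qed
			show "AE x in M. norm (norm (indicator (?U Int X i) x *\<^sub>R c - indicator ((\<Union>n<N. A n) Int X i) x *\<^sub>R c)) <= norm (indicator (?U Int X i) x *\<^sub>R c)" for N
				by(intro AE_I2) (auto simp: indicator_def)
		qed (use Am U in measurable)
		then show ?case by(intro K_lim[OF int[OF U] fin]) simp
	qed
	have K_all:"K f" if "integrable M f" for f
		using that
	proof(induction rule: integrable_induct)
		case (base A c)
		show ?case
		proof(rule K_lim[of _ "%i x. indicator (A Int X i) x *\<^sub>R c"])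
			show i:"integrable M (%x. indicator A x *\<^sub>R c)" using base by auto
			have "(%i. LINT x|M. norm (indicator A x *\<^sub>R c - indicator (A Int X i) x *\<^sub>R c)) ----> (LINT x|M. 0)"
			proof(rule integral_dominated_convergence[where w="%x. norm (indicator A x *\<^sub>R c)"])
				show "AE x in M. (%i. norm (indicator A x *\<^sub>R c - indicator (A Int X i) x *\<^sub>R c)) ----> 0"
				proof(rule AE_I2)
					fix x assume "x : space M"
					then obtain j where "x : X j" using X(2) by blast
					then have "x : X i" if "i >= j" for i using X(4) that by(auto simp: incseq_def)
					then have "eventually (%i. norm (indicator A x *\<^sub>R c - indicator (A Int X i) x *\<^sub>R c) = 0) sequentially"
						by(auto simp: eventually_sequentially indicator_def intro!: exI[of _ j])
					then show "(%i. norm (indicator A x *\<^sub>R c - indicator (A Int X i) x *\<^sub>R c)) ----> 0"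
						by(rule tendsto_eventually)
				qed
				show "integrable M (%x. norm (indicator A x *\<^sub>R c))" using i by(rule integrable_norm)
				show "AE x in M. norm (norm (indicator A x *\<^sub>R c - indicator (A Int X i) x *\<^sub>R c)) <= norm (indicator A x *\<^sub>R c)" for i
					by(intro AE_I2) (auto simp: indicator_def)
			qed (use base in measurable)
			then show "(%i. LINT x|M. norm (indicator A x *\<^sub>R c - indicator (A Int X i) x *\<^sub>R c)) ----> 0" by simp
		qed (rule K_set[OF base(1)])
	next
		case (add f g)
		then show ?case using K_add by blast
	next
		case (lim f s)
		have "(%i. LINT x|M. norm (f x - s i x)) ----> (LINT x|M. 0)"
		proof(rule integral_dominated_convergence[where w="%x. 3 * norm (f x)"])
			show "AE x in M. (%i. norm (f x - s i x)) ----> 0"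
			proof(rule AE_I2)
				fix x assume x:"x : space M"
				have "(%i. f x - s i x) ----> f x - f x" by(intro tendsto_intros lim(2) x)
				then show "(%i. norm (f x - s i x)) ----> 0" by(simp add: tendsto_norm_zero)
			qed
			show "AE x in M. norm (norm (f x - s i x)) <= 3 * norm (f x)" for i
			proof(rule AE_I2)
				fix x assume "x : space M"
				then show "norm (norm (f x - s i x)) <= 3 * norm (f x)"
					using lim(3)[of x i] norm_triangle_ineq4[of "f x" "s i x"] by simp
			qed
		qed (use lim in auto)
		then show ?case using lim by(intro K_lim[of f s]) auto
	qed
	have "countable S" unfolding S_def
		using P(1) D(1) by(intro countable_image countable_lists countable_SIGMA) auto
	then have "countable (L1cls M ` S)" by simp
	moreover have "L1cls M ` S <= vcarrier ?L" using S_int by(auto simp: carrier_L1)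
	moreover have "norm_topology ?L closure_of (L1cls M ` S) = vcarrier ?L"
	proof -
		have "EX y:L1cls M ` S. y : mball x r" if x:"x : vcarrier ?L" and r:"r > 0" for x r
		proof -
			obtain f where f:"integrable M f" "x = L1cls M f" using x by(auto simp: carrier_L1)
			obtain s where s:"s : S" "(LINT x|M. norm (f x - s x)) < r"
				using K_all[OF f(1)] r unfolding K_def by blast
			have "L1cls M s : mball x r"
			proof -
				have "L1cls M s : vcarrier ?L" using S_int[OF s(1)] by(simp add: carrier_L1)
				moreover have "vdist ?L x (L1cls M s) < r" using f s S_int[OF s(1)] by(simp add: vdist_L1)
				ultimately show ?thesis using x by(simp only: in_mball simp_thms)
			qed
			then show ?thesis using s(1) by blast
		qed
		then show ?thesis unfolding norm_topology_def metric_closure_of by blast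
	qed
	ultimately show ?thesis unfolding separable_space_def by(auto simp: L.topspace_norm_topology)
qed

section \<open>The dual of L1 over a sigma-finite measure\<close>

lemma (in sigma_finite_measure) L1_functional_representation_sigma:
	fixes ps :: "('a => 'e::{banach,second_countable_topology}) => real"
	assumes add:"!!f g. integrable M f ==> integrable M g ==> ps (%x. f x + g x) = ps f + ps g"
		and scale:"!!r f. integrable M f ==> ps (%x. r *\<^sub>R f x) = r * ps f"
		and bound:"!!f. integrable M f ==> \<bar>ps f\<bar> <= C * (LINT x|M. norm (f x))" and C:"0 <= C"
	obtains l where "l : Linf_functions M"
		"!!f. integrable M f ==> ps f = (LINT x|M. blinfun_apply (l x) (f x))"
proof -
	obtain w :: "'a => real" where w[measurable]: "w : borel_measurable M"
		and w0:"!!x. w x > 0" "!!x. w x <= 1" and wi:"integrable M w"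
		using obtain_positive_integrable_function by metis
	have w_nn:"!!x. 0 <= w x" using w0(1) less_imp_le by blast
	\<comment> \<open>Multiplication by the positive integrable \<open>w\<close> is an isometry from L1
	  of the finite measure \<open>P\<close> onto L1 of \<open>M\<close>, and a functional has the same
	  representing density \<open>l\<close> in both pictures.\<close>
	define P where "P = density M (%x. ennreal (w x))"
	have iP:"integrable P f <-> integrable M (%x. w x *\<^sub>R f x)" if "f : borel_measurable M"
		for f :: "'a => 'c::{banach,second_countable_topology}"
		unfolding P_def using that w_nn by(intro integrable_density) auto
	have LP:"(LINT x|P. f x) = (LINT x|M. w x *\<^sub>R f x)" if "f : borel_measurable M"
		for f :: "'a => 'c::{banach,second_countable_topology}"
		unfolding P_def using that w_nn by(intro integral_density) auto
	have mP:"f : borel_measurable M" if "integrable P f" for f :: "'a => 'c::{banach,second_countable_topology}"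
		using borel_measurable_integrable[OF that] by(simp add: P_def)
	have i:"integrable M (%x. w x *\<^sub>R f x)" if "integrable P f" for f :: "'a => 'c::{banach,second_countable_topology}"
		using iP[OF mP[OF that]] that by simp
	interpret P: finite_measure P
	proof(rule finite_measureI)
		have "emeasure P (space P) = (\<integral>\<^sup>+x. ennreal (w x) \<partial>M)"
			unfolding P_def by(subst emeasure_density) (auto intro!: nn_integral_cong)
		also have "... = ennreal (LINT x|M. w x)" using wi w_nn by(intro nn_integral_eq_integral) auto
		finally show "emeasure P (space P) ~= \<infinity>" by simp
	qed
	have h1:"ps (%x. w x *\<^sub>R (f x + g x)) = ps (%x. w x *\<^sub>R f x) + ps (%x. w x *\<^sub>R g x)"
			if "integrable P f" "integrable P g" for f g
			using add[OF i[OF that(1)] i[OF that(2)]] by(simp add: scaleR_add_right)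
	have h2:"ps (%x. w x *\<^sub>R (r *\<^sub>R f x)) = r * ps (%x. w x *\<^sub>R f x)" if "integrable P f" for r f
			using scale[OF i[OF that],of r] by(simp add: mult.commute)
	have h3:"\<bar>ps (%x. w x *\<^sub>R f x)\<bar> <= C * (LINT x|P. norm (f x))" if "integrable P f" for f
			using bound[OF i[OF that]] LP[of "%x. norm (f x)"] mP[OF that] w_nn by simp
	obtain l where l:"wmeas P l" "!!x. norm (l x) <= C"
		"!!f. integrable P f ==> ps (%x. w x *\<^sub>R f x) = (LINT x|P. blinfun_apply (l x) (f x))"
	proof(rule P.L1_functional_representation[OF h1 h2 h3 C])
		fix l :: "'a => 'e \<Rightarrow>\<^sub>L real"
		assume a:"wmeas P l" "!!x. norm (l x) <= C"
			"!!f. integrable P f ==> ps (%x. w x *\<^sub>R f x) = (LINT x|P. blinfun_apply (l x) (f x))"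
		show thesis by(rule that[OF a])
	qed
	have lM:"wmeas M l" using l(1) by(simp add: wmeas_def P_def)
	have "ps f = (LINT x|M. blinfun_apply (l x) (f x))" if f:"integrable M f" for f
	proof -
		have [measurable]: "f : borel_measurable M" using f by auto
		have e:"w x *\<^sub>R (1 / w x) *\<^sub>R f x = f x" for x using w0(1)[of x] by simp
		have mm:"(%x. (1 / w x) *\<^sub>R f x) : borel_measurable M" by measurable
		have "integrable M (%x. w x *\<^sub>R ((1 / w x) *\<^sub>R f x))" using f by(simp only: e)
		then have "integrable P (%x. (1 / w x) *\<^sub>R f x)" using iP[OF mm] by blast
		from l(3)[OF this] have "ps f = (LINT x|P. blinfun_apply (l x) ((1 / w x) *\<^sub>R f x))" by(simp only: e)
		also have "... = (LINT x|M. w x *\<^sub>R blinfun_apply (l x) ((1 / w x) *\<^sub>R f x))"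
			by(rule LP[OF wmeas_apply[OF lM mm]])
		also have "... = (LINT x|M. blinfun_apply (l x) (f x))"
			by(simp only: blinfun.scaleR_right[symmetric] e)
		finally show ?thesis .
	qed
	moreover have "l : Linf_functions M" using l(2) by(intro Linf_functionsI[OF lM]) auto
	ultimately show thesis by(intro that)
qed

text \<open>Testing on \<open>indicator A x *\<^sub>R (w x *\<^sub>R v)\<close>, with
  \<open>w\<close> positive and integrable, gives the pointwise bound for one \<open>v\<close>; a
  countable dense set of vectors turns it into a bound of the operator norm. The case
  \<open>C = 0\<close> expresses that L1 separates the elements of L\<infinity>.\<close>

lemma (in sigma_finite_measure) Linf_bound_iff:
	fixes l :: "'a => 'e::{banach,second_countable_topology} \<Rightarrow>\<^sub>L real"
	assumes l:"l : Linf_functions M" and C:"0 <= C"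
	shows "(ALL f. integrable M f --> \<bar>LINT x|M. blinfun_apply (l x) (f x)\<bar> <= C * (LINT x|M. norm (f x)))
		<-> (AE x in M. norm (l x) <= C)"
proof
	assume "AE x in M. norm (l x) <= C"
	then have "Linf_norm M l <= C" by(rule Linf_norm_le[OF C])
	then have "Linf_norm M l * (LINT x|M. norm (f x)) <= C * (LINT x|M. norm (f x))" for f :: "'a => 'e"
		by(intro mult_right_mono integral_nonneg_AE) auto
	then show "ALL f. integrable M f --> \<bar>LINT x|M. blinfun_apply (l x) (f x)\<bar> <= C * (LINT x|M. norm (f x))"
		using order_trans[OF Linf_L1_integrable(2)[OF l]] by blast
next
	assume *: "ALL f. integrable M f --> \<bar>LINT x|M. blinfun_apply (l x) (f x)\<bar> <= C * (LINT x|M. norm (f x))"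
	obtain w :: "'a => real" where w[measurable]: "w : borel_measurable M"
		and w0:"!!x. w x > 0" "!!x. w x <= 1" and wi:"integrable M w"
		using obtain_positive_integrable_function by metis
	have le:"AE x in M. blinfun_apply (l x) v <= C * norm v" for v
	proof -
		have iv:"integrable M (%x. w x *\<^sub>R v)" using wi by simp
		have "AE x in M. blinfun_apply (l x) (w x *\<^sub>R v) <= w x * (C * norm v)"
		proof(rule AE_le_if_set_integral_le)
			show "integrable M (%x. blinfun_apply (l x) (w x *\<^sub>R v))" by(rule Linf_L1_integrable(1)[OF l iv])
			show "integrable M (%x. w x * (C * norm v))" using wi by simp
			fix A assume A:"A : sets M"
			have iA:"integrable M (%x. indicator A x *\<^sub>R (w x *\<^sub>R v))" by(rule integrable_mult_indicator[OF A iv])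
			have "(LINT x|M. indicator A x * blinfun_apply (l x) (w x *\<^sub>R v)) = (LINT x|M. blinfun_apply (l x) (indicator A x *\<^sub>R (w x *\<^sub>R v)))"
				by(simp add: blinfun.scaleR_right mult.assoc)
			also have "... <= C * (LINT x|M. norm (indicator A x *\<^sub>R (w x *\<^sub>R v)))"
				using *[rule_format,OF iA] by(metis abs_le_D1)
			also have "... = (LINT x|M. C * norm (indicator A x *\<^sub>R (w x *\<^sub>R v)))" by simp
			also have "... = (LINT x|M. indicator A x * (w x * (C * norm v)))"
				using w0(1)[THEN less_imp_le] by(intro Bochner_Integration.integral_cong) (auto simp: indicator_def)
			finally show "(LINT x|M. indicator A x * blinfun_apply (l x) (w x *\<^sub>R v)) <= (LINT x|M. indicator A x * (w x * (C * norm v)))" .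
		qed
		then show ?thesis
			by(rule eventually_mono) (use w0(1) in \<open>auto simp: blinfun.scaleR_right\<close>)
	qed
	obtain D :: "nat => 'e" where D:"!!x e. 0 < e ==> EX i. dist (D i) x < e"
		using countable_dense_seq by blast
	have "AE x in M. ALL i. blinfun_apply (l x) (D i) <= C * norm (D i)" by(simp add: AE_all_countable le)
	moreover have "AE x in M. ALL i. blinfun_apply (l x) (- D i) <= C * norm (- D i)" by(simp only: AE_all_countable le simp_thms)
	ultimately show "AE x in M. norm (l x) <= C"
	proof eventually_elim
		case (elim x)
		show ?case
		proof(rule blinfun_norm_le_dense[OF D C])
			show "norm (blinfun_apply (l x) (D i)) <= C * norm (D i)" for i
				using elim(1)[rule_format,of i] elim(2)[rule_format,of i] by(simp add: blinfun.minus_right abs_le_iff)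
		qed
	qed
qed

lemma (in sigma_finite_measure) Linf_iso_dual_L1:
	"isometric_iso (Linf M) (dual_vspace (L1 M :: ('a => 'e::{banach,second_countable_topology}) set seminormed_space))
		 (%A. \<lambda>B\<in>vcarrier (L1 M). Linf_L1_pairing M A B)"
proof -
	let ?W = "L1 M :: ('a => 'e) set seminormed_space"
	let ?Phi = "%A. \<lambda>B\<in>vcarrier ?W. Linf_L1_pairing M A B"
	interpret W: normed_vspace ?W by(rule normed_vspace_L1)
	have cW:"B : vcarrier ?W <-> (EX f. integrable M f & B = L1cls M f)" for B by(auto simp: carrier_L1)
	have cV:"A : vcarrier (Linf M) <-> (EX l:Linf_functions M. A = Lcls M l)" for A :: "('a => 'e \<Rightarrow>\<^sub>L real) set"
		by(auto simp: carrier_Linf)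
	have W_mem:"L1cls M f : vcarrier ?W" if "integrable M f" for f
		using that unfolding cW by(intro exI[of _ f] conjI refl)
	have W_cases: thesis if "B : vcarrier ?W" "!!f. integrable M f ==> B = L1cls M f ==> thesis" for B thesis
		using that(1) unfolding cW by(elim exE conjE) (rule that(2))
	have V_cases: thesis if "A : vcarrier (Linf M)" "!!l. l : Linf_functions M ==> A = Lcls M l ==> thesis"
		for A :: "('a => 'e \<Rightarrow>\<^sub>L real) set" and thesis
		using that(1) unfolding cV by(elim bexE) (rule that(2))
	have P:"?Phi (Lcls M l) (L1cls M f) = (LINT x|M. blinfun_apply (l x) (f x))" if "l : Linf_functions M" "integrable M f" for l f
	proof -
		have "L1cls M f : vcarrier ?W" by(rule W_mem[OF that(2)])
		then show ?thesis using Linf_L1_pairing_eq[OF that] by(simp only: restrict_apply')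
	qed
	have int:"integrable M (%x. blinfun_apply (l x) (f x))" if "l : Linf_functions M" "integrable M f" for l and f :: "'a => 'e"
		using Linf_L1_integrable(1)[OF that] .
	have ext:"phi = ps" if "phi : extensional (vcarrier ?W)" "ps : extensional (vcarrier ?W)"
		"!!f. integrable M f ==> phi (L1cls M f) = ps (L1cls M f)" for phi ps :: "('a => 'e) set => real"
	proof(rule extensionalityI[OF that(1,2)])
		fix B assume "B : vcarrier ?W"
		then obtain f where "integrable M f" "B = L1cls M f" by(rule W_cases)
		then show "phi B = ps B" using that(3) by simp
	qed
	have bound_iff:"(ALL B:vcarrier ?W. \<bar>?Phi (Lcls M l) B\<bar> <= C * vnorm ?W B) <-> (AE x in M. norm (l x) <= C)"
		if "l : Linf_functions M" "0 <= C" for l C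
	proof -
		have "(ALL B:vcarrier ?W. \<bar>?Phi (Lcls M l) B\<bar> <= C * vnorm ?W B) \<longleftrightarrow>
			(ALL f. integrable M f --> \<bar>?Phi (Lcls M l) (L1cls M f)\<bar> <= C * vnorm ?W (L1cls M f))"
		proof(intro iffI allI impI ballI)
			fix f :: "'a => 'e" assume "ALL B:vcarrier ?W. \<bar>?Phi (Lcls M l) B\<bar> <= C * vnorm ?W B" "integrable M f"
			then show "\<bar>?Phi (Lcls M l) (L1cls M f)\<bar> <= C * vnorm ?W (L1cls M f)"
				using W_mem[of f] by(metis (no_types))
		next
			fix B assume *: "ALL f. integrable M f --> \<bar>?Phi (Lcls M l) (L1cls M f)\<bar> <= C * vnorm ?W (L1cls M f)"
				"B : vcarrier ?W"
			from *(2) obtain f where "integrable M f" "B = L1cls M f" by(rule W_cases)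
			then show "\<bar>?Phi (Lcls M l) B\<bar> <= C * vnorm ?W B" using *(1)[rule_format,of f] by(simp only:)
		qed
		also have "... <-> (ALL f. integrable M f --> \<bar>LINT x|M. blinfun_apply (l x) (f x)\<bar> <= C * (LINT x|M. norm (f x)))"
			by(intro all_cong1 imp_cong refl) (simp only: P[OF that(1)] norm_L1 mem_Collect_eq)
		finally show ?thesis unfolding Linf_bound_iff[OF that] .
	qed
	\<comment> \<open>Both norms are infima of the same set of constants.\<close>
	have norm:"vnorm (dual_vspace ?W) (?Phi (Lcls M l)) = Linf_norm M l" if "l : Linf_functions M" for l
		unfolding dual_vspace_def Linf_norm_def[of M l] seminormed_space.select_convs
		by(intro arg_cong[where f=Inf] Collect_cong conj_cong refl bound_iff[OF that])
	have mem:"?Phi (Lcls M l) : vcarrier (dual_vspace ?W)" if l:"l : Linf_functions M" for l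
	proof -
		have "?Phi (Lcls M l) (vadd ?W B B') = ?Phi (Lcls M l) B + ?Phi (Lcls M l) B'"
			if "B : vcarrier ?W" "B' : vcarrier ?W" for B B'
		proof -
			obtain f where f:"integrable M f" "B = L1cls M f" using \<open>B : vcarrier ?W\<close> by(rule W_cases)
			obtain g where g:"integrable M g" "B' = L1cls M g" using \<open>B' : vcarrier ?W\<close> by(rule W_cases)
			have "vadd ?W B B' = L1cls M (%x. f x + g x)" using f g add_L1[of f M g] by simp
			moreover have "integrable M (%x. f x + g x)" using f g by simp
			ultimately show ?thesis
				using P[OF l,of "%x. f x + g x"] P[OF l f(1)] P[OF l g(1)] int[OF l f(1)] int[OF l g(1)] f(2) g(2)
				by(simp only: blinfun.add_right Bochner_Integration.integral_add)
		qed
		moreover have "?Phi (Lcls M l) (vscale ?W r B) = r * ?Phi (Lcls M l) B" if "B : vcarrier ?W" for B r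
		proof -
			obtain f where f:"integrable M f" "B = L1cls M f" using \<open>B : vcarrier ?W\<close> by(rule W_cases)
			have "vscale ?W r B = L1cls M (%x. r *\<^sub>R f x)" using f scale_L1[of f M r] by simp
			moreover have "integrable M (%x. r *\<^sub>R f x)" using f by simp
			moreover have "(LINT x|M. blinfun_apply (l x) (r *\<^sub>R f x)) = r * (LINT x|M. blinfun_apply (l x) (f x))"
				by(simp add: blinfun.scaleR_right)
			ultimately show ?thesis
				using P[OF l,of "%x. r *\<^sub>R f x"] P[OF l f(1)] f(2) by(simp only:)
		qed
		moreover have "EX C. ALL B:vcarrier ?W. \<bar>?Phi (Lcls M l) B\<bar> <= C * vnorm ?W B"
			using bound_iff[OF l Linf_norm_nonneg[OF l]] AE_le_Linf_norm[OF l] by blast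
		moreover have "?Phi (Lcls M l) : extensional (vcarrier ?W)" by(rule restrict_extensional)
		ultimately show ?thesis unfolding dual_vspace_def by simp
	qed
	have surj:"EX l:Linf_functions M. phi = ?Phi (Lcls M l)" if memphi:"phi : vcarrier (dual_vspace ?W)" for phi
	proof -
		have phi:"phi : extensional (vcarrier ?W)"
			 "!!u v. u : vcarrier ?W ==> v : vcarrier ?W ==> phi (vadd ?W u v) = phi u + phi v"
			 "!!r v. v : vcarrier ?W ==> phi (vscale ?W r v) = r * phi v"
			 and "EX C. ALL v:vcarrier ?W. \<bar>phi v\<bar> <= C * vnorm ?W v"
			 using memphi unfolding dual_vspace_def by simp_all
		from this(4) obtain C0 where phi4:"ALL v:vcarrier ?W. \<bar>phi v\<bar> <= C0 * vnorm ?W v" by(elim exE)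
		have le:"C0 * a <= \<bar>C0\<bar> * a" if "0 <= a" for a using that by(intro mult_right_mono) auto
		have h1:"phi (L1cls M (%x. f x + g x)) = phi (L1cls M f) + phi (L1cls M g)" if "integrable M f" "integrable M g" for f g
				using phi(2)[of "L1cls M f" "L1cls M g"] that add_L1[of f M g] by(auto simp: cW)
		have h2:"phi (L1cls M (%x. r *\<^sub>R f x)) = r * phi (L1cls M f)" if "integrable M f" for r f
				using phi(3)[of "L1cls M f" r] that scale_L1[of f M r] by(auto simp: cW)
		have h3:"\<bar>phi (L1cls M f)\<bar> <= \<bar>C0\<bar> * (LINT x|M. norm (f x))" if "integrable M f" for f
			proof -
				have "\<bar>phi (L1cls M f)\<bar> <= C0 * vnorm ?W (L1cls M f)" by(rule phi4[rule_format,OF W_mem[OF that]])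
				also have "... = C0 * (LINT x|M. norm (f x))" using norm_L1[of f M] that by simp
				also have "... <= \<bar>C0\<bar> * (LINT x|M. norm (f x))" by(rule le) (auto intro: integral_nonneg_AE)
				finally show ?thesis .
			qed
		obtain l where l:"l : Linf_functions M" "!!f. integrable M f ==> phi (L1cls M f) = (LINT x|M. blinfun_apply (l x) (f x))"
		proof(rule L1_functional_representation_sigma[OF h1 h2 h3 abs_ge_zero])
			fix l assume a:"l : Linf_functions M" "!!f. integrable M f ==> phi (L1cls M f) = (LINT x|M. blinfun_apply (l x) (f x))"
			show thesis by(rule that[OF a])
		qed
		have "phi = ?Phi (Lcls M l)"
			by(rule ext[OF phi(1) restrict_extensional]) (simp only: P[OF l(1)] l(2))
		then show ?thesis using l(1) by blast
	qed
	have vadd_dual:"?Phi (vadd (Linf M) (Lcls M l) (Lcls M l')) = vadd (dual_vspace ?W) (?Phi (Lcls M l)) (?Phi (Lcls M l'))"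
		if l:"l : Linf_functions M" "l' : Linf_functions M" for l l'
	proof(rule ext)
		show "?Phi (vadd (Linf M) (Lcls M l) (Lcls M l')) : extensional (vcarrier ?W)" by(rule restrict_extensional)
		show "vadd (dual_vspace ?W) (?Phi (Lcls M l)) (?Phi (Lcls M l')) : extensional (vcarrier ?W)"
			by(simp add: dual_vspace_def)
		fix f :: "'a => 'e" assume f:"integrable M f"
		have "?Phi (vadd (Linf M) (Lcls M l) (Lcls M l')) (L1cls M f) = (LINT x|M. blinfun_apply (l x + l' x) (f x))"
			using P[OF Linf.add_mem[OF l] f] l by(simp only: add_Linf)
		also have "... = ?Phi (Lcls M l) (L1cls M f) + ?Phi (Lcls M l') (L1cls M f)"
			using P[OF l(1) f] P[OF l(2) f] int[OF l(1) f] int[OF l(2) f] by(simp add: plus_blinfun.rep_eq del: restrict_apply)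
		also have "... = vadd (dual_vspace ?W) (?Phi (Lcls M l)) (?Phi (Lcls M l')) (L1cls M f)"
			using W_mem[OF f] by(simp add: dual_vspace_def)
		finally show "?Phi (vadd (Linf M) (Lcls M l) (Lcls M l')) (L1cls M f) = vadd (dual_vspace ?W) (?Phi (Lcls M l)) (?Phi (Lcls M l')) (L1cls M f)" .
	qed
	have vscale_dual:"?Phi (vscale (Linf M) r (Lcls M l)) = vscale (dual_vspace ?W) r (?Phi (Lcls M l))"
		if l:"l : Linf_functions M" for l r
	proof(rule ext)
		show "?Phi (vscale (Linf M) r (Lcls M l)) : extensional (vcarrier ?W)" by(rule restrict_extensional)
		show "vscale (dual_vspace ?W) r (?Phi (Lcls M l)) : extensional (vcarrier ?W)"
			by(simp add: dual_vspace_def)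
		fix f :: "'a => 'e" assume f:"integrable M f"
		have "?Phi (vscale (Linf M) r (Lcls M l)) (L1cls M f) = (LINT x|M. blinfun_apply (r *\<^sub>R l x) (f x))"
			using P[OF Linf.scale_mem[OF l] f] l by(simp only: scale_Linf)
		also have "... = r * ?Phi (Lcls M l) (L1cls M f)"
			using P[OF l f] int[OF l f] by(simp add: scaleR_blinfun.rep_eq del: restrict_apply)
		also have "... = vscale (dual_vspace ?W) r (?Phi (Lcls M l)) (L1cls M f)"
			using W_mem[OF f] by(simp add: dual_vspace_def)
		finally show "?Phi (vscale (Linf M) r (Lcls M l)) (L1cls M f) = vscale (dual_vspace ?W) r (?Phi (Lcls M l)) (L1cls M f)" .
	qed
	have inj:"Lcls M l = Lcls M l'" if l:"l : Linf_functions M" "l' : Linf_functions M"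
		and eq:"?Phi (Lcls M l) = ?Phi (Lcls M l')" for l l'
	proof -
		let ?d = "%x. l x - l' x"
		have d:"?d : Linf_functions M" by(rule Linf.diff_mem[OF l])
		have "(LINT x|M. blinfun_apply (?d x) (f x)) = 0" if f:"integrable M f" for f
		proof -
			have "(LINT x|M. blinfun_apply (l x) (f x)) = (LINT x|M. blinfun_apply (l' x) (f x))"
				using P[OF l(1) f] P[OF l(2) f] eq by metis
			then show ?thesis using int[OF l(1) f] int[OF l(2) f] by(simp add: minus_blinfun.rep_eq)
		qed
		then have "AE x in M. norm (?d x) <= 0" by(subst Linf_bound_iff[OF d order_refl,symmetric]) simp
		then have "AE x in M. l x = l' x" by(rule eventually_mono) simp
		then show ?thesis using Lcls_eq_iff[OF l] by simp
	qed
	show ?thesis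
		unfolding isometric_iso_def
	proof(intro conjI ballI allI)
		show "bij_betw ?Phi (vcarrier (Linf M)) (vcarrier (dual_vspace ?W))"
			unfolding bij_betw_def
		proof
			show "inj_on ?Phi (vcarrier (Linf M))"
			proof(rule inj_onI)
				fix A B :: "('a => 'e \<Rightarrow>\<^sub>L real) set"
				assume AB:"A : vcarrier (Linf M)" "B : vcarrier (Linf M)" "?Phi A = ?Phi B"
				obtain l where l:"l : Linf_functions M" "A = Lcls M l" using AB(1) by(rule V_cases)
				obtain l' where l': "l' : Linf_functions M" "B = Lcls M l'" using AB(2) by(rule V_cases)
				show "A = B" using inj[OF l(1) l'(1)] AB(3) unfolding l(2) l'(2) by(simp only:)
			qed
			show "?Phi ` vcarrier (Linf M) = vcarrier (dual_vspace ?W)"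
			proof(intro equalityI subsetI)
				fix phi assume "phi : ?Phi ` vcarrier (Linf M)"
				then obtain A where A:"A : vcarrier (Linf M)" "phi = ?Phi A" by(elim imageE)
				obtain l where "l : Linf_functions M" "A = Lcls M l" using A(1) by(rule V_cases)
				then show "phi : vcarrier (dual_vspace ?W)" using mem A(2) by(simp only:)
			next
				fix phi assume "phi : vcarrier (dual_vspace ?W)"
				then obtain l where l:"l : Linf_functions M" "phi = ?Phi (Lcls M l)" using surj by(metis (no_types))
				have "Lcls M l : vcarrier (Linf M)" unfolding cV using l(1) by blast
				then show "phi : ?Phi ` vcarrier (Linf M)" unfolding l(2) by(rule imageI)
			qed
		qed
		show "?Phi (vadd (Linf M) u v) = vadd (dual_vspace ?W) (?Phi u) (?Phi v)"
			if "u : vcarrier (Linf M)" "v : vcarrier (Linf M)" for u v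
		proof -
			obtain l where l:"l : Linf_functions M" "u = Lcls M l" using \<open>u : _\<close> by(rule V_cases)
			obtain l' where l': "l' : Linf_functions M" "v = Lcls M l'" using \<open>v : _\<close> by(rule V_cases)
			show ?thesis unfolding l(2) l'(2) by(rule vadd_dual[OF l(1) l'(1)])
		qed
		show "?Phi (vscale (Linf M) r v) = vscale (dual_vspace ?W) r (?Phi v)"
			if "v : vcarrier (Linf M)" for r v
		proof -
			obtain l where l:"l : Linf_functions M" "v = Lcls M l" using \<open>v : _\<close> by(rule V_cases)
			show ?thesis unfolding l(2) by(rule vscale_dual[OF l(1)])
		qed
		show "vnorm (dual_vspace ?W) (?Phi v) = vnorm (Linf M) v" if "v : vcarrier (Linf M)" for v
		proof -
			obtain l where l:"l : Linf_functions M" "v = Lcls M l" using \<open>v : _\<close> by(rule V_cases)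
			show ?thesis unfolding l(2) norm_Linf[OF l(1)] by(rule norm[OF l(1)])
		qed
	qed
qed

text \<open>\<open>rho g\<close> is the adjoint of \<open>rhob (- g)\<close>; the inversion restores
  the order of products. Since \<open>rhob (- g)\<close> permutes the vectors of \<open>W\<close>
  and preserves their norms, a functional and its translate have the same bounding constants, hence
  the same norm.\<close>

lemma adjoint_representation:
	fixes rhob :: "'g::topological_group_add => 'w => 'w"
	assumes V:"normed_vspace V" and W:"normed_vspace W"
		and iso:"isometric_iso V (dual_vspace W) (%v. \<lambda>w\<in>vcarrier W. b v w)"
		and rep:"isometric_rep W rhob"
	obtains rho where "isometric_rep V rho"
		"!!g v w. v : vcarrier V ==> w : vcarrier W ==> b (rho g v) w = b v (rhob (- g) w)"
proof -
	interpret V: normed_vspace V by fact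
	interpret W: normed_vspace W by fact
	let ?Phi = "%v. \<lambda>w\<in>vcarrier W. b v w"
	have bij:"bij_betw ?Phi (vcarrier V) (vcarrier (dual_vspace W))"
		and add:"!!u v w. u : vcarrier V ==> v : vcarrier V ==> w : vcarrier W ==> b (vadd V u v) w = b u w + b v w"
		and scale:"!!r v w. v : vcarrier V ==> w : vcarrier W ==> b (vscale V r v) w = r * b v w"
		and norm:"!!v. v : vcarrier V ==> vnorm (dual_vspace W) (?Phi v) = vnorm V v"
		using iso unfolding isometric_iso_def dual_vspace_def
		by(auto simp: fun_eq_iff restrict_def split: if_splits)
	have R1:"rhob g w : vcarrier W" if "w : vcarrier W" for g w
	proof -
		have "bij_betw (rhob g) (vcarrier W) (vcarrier W)"
			using rep unfolding isometric_rep_def isometric_iso_def by blast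
		then show ?thesis using bij_betwE that by blast
	qed
	have R:"!!g. rhob g ` vcarrier W = vcarrier W"
		"!!g u v. u : vcarrier W ==> v : vcarrier W ==> rhob g (vadd W u v) = vadd W (rhob g u) (rhob g v)"
		"!!g r v. v : vcarrier W ==> rhob g (vscale W r v) = vscale W r (rhob g v)"
		"!!g v. v : vcarrier W ==> vnorm W (rhob g v) = vnorm W v"
		"!!v. v : vcarrier W ==> rhob 0 v = v"
		"!!g h v. v : vcarrier W ==> rhob (g + h) v = rhob g (rhob h v)"
		using rep unfolding isometric_rep_def isometric_iso_def bij_betw_def by auto
	have inj:"u = v" if "u : vcarrier V" "v : vcarrier V" "!!w. w : vcarrier W ==> b u w = b v w" for u v
	proof -
		have "?Phi u = ?Phi v" using that(3) by(auto simp: fun_eq_iff)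
		then show ?thesis using bij that(1,2) unfolding bij_betw_def inj_on_def by blast
	qed
	have lin:"?Phi v : vcarrier (dual_vspace W)" if "v : vcarrier V" for v
		using bij that unfolding bij_betw_def by blast
	have ex:"EX u:vcarrier V. ALL w:vcarrier W. b u w = b v (rhob (- g) w)" if v:"v : vcarrier V" for g v
	proof -
		let ?f = "\<lambda>w\<in>vcarrier W. b v (rhob (- g) w)"
		have l:"!!w w'. w : vcarrier W ==> w' : vcarrier W ==> b v (vadd W w w') = b v w + b v w'"
			"!!r w. w : vcarrier W ==> b v (vscale W r w) = r * b v w"
			and "EX C. ALL w:vcarrier W. \<bar>b v w\<bar> <= C * vnorm W w"
			using lin[OF v] by(auto simp: dual_vspace_def W.add_closed W.scale_closed)
		then obtain C where C:"!!w. w : vcarrier W ==> \<bar>b v w\<bar> <= C * vnorm W w" by blast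
		have "\<bar>b v (rhob (- g) w)\<bar> <= C * vnorm W w" if "w : vcarrier W" for w
			using C[OF R1[OF that,of "- g"]] R(4)[OF that] by simp
		then have "?f : vcarrier (dual_vspace W)"
			by(auto simp: dual_vspace_def W.add_closed W.scale_closed R R1 l intro!: exI[of _ C])
		then have "?f : ?Phi ` vcarrier V" using bij unfolding bij_betw_def by(simp only:)
		then obtain u where u:"u : vcarrier V" "?f = ?Phi u" by(elim imageE)
		have "b u w = b v (rhob (- g) w)" if "w : vcarrier W" for w
			using fun_cong[OF u(2),of w] that by simp
		then show ?thesis using u(1) by(intro bexI[of _ u] ballI)
	qed
	define rho where "rho g = (\<lambda>v\<in>vcarrier V. SOME u. u : vcarrier V & (ALL w:vcarrier W. b u w = b v (rhob (- g) w)))" for g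
	have rho:"rho g v : vcarrier V & (ALL w:vcarrier W. b (rho g v) w = b v (rhob (- g) w))" if "v : vcarrier V" for g v
		unfolding rho_def restrict_apply'[OF that]
		by(rule someI_ex) (use ex[OF that,of g] in \<open>simp only: Bex_def\<close>)
	have rhoc:"!!g v. v : vcarrier V ==> rho g v : vcarrier V"
		and rhob:"!!g v w. v : vcarrier V ==> w : vcarrier W ==> b (rho g v) w = b v (rhob (- g) w)"
		using rho by auto
	have rho0:"rho 0 v = v" if "v : vcarrier V" for v
		using that by(intro inj) (auto simp: rhob R R1 rhoc)
	have rho_add:"rho (g + h) v = rho g (rho h v)" if "v : vcarrier V" for g h v
	proof(rule inj)
		fix w assume w:"w : vcarrier W"
		show "b (rho (g + h) v) w = b (rho g (rho h v)) w"
			unfolding rhob[OF that w] rhob[OF rhoc[OF that] w] rhob[OF that R1[OF w]] minus_add R(6)[OF w] ..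
	qed (simp_all add: rhoc that)
	have nrm:"vnorm V (rho g v) = vnorm V v" if v:"v : vcarrier V" for g v
	proof -
		have "(ALL w:vcarrier W. \<bar>b (rho g v) w\<bar> <= C * vnorm W w) <-> (ALL w:vcarrier W. \<bar>b v w\<bar> <= C * vnorm W w)" for C
		proof -
			have "(ALL w:vcarrier W. \<bar>b (rho g v) w\<bar> <= C * vnorm W w) \<longleftrightarrow>
					(ALL w:vcarrier W. \<bar>b v (rhob (- g) w)\<bar> <= C * vnorm W (rhob (- g) w))"
				using rhob[OF v] R(4) by auto
			also have "... <-> (ALL w:rhob (- g) ` vcarrier W. \<bar>b v w\<bar> <= C * vnorm W w)" by blast
			finally show ?thesis unfolding R(1) .
		qed
		then have "vnorm (dual_vspace W) (?Phi (rho g v)) = vnorm (dual_vspace W) (?Phi v)"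
			unfolding dual_vspace_def by simp
		then show ?thesis using norm v rhoc by simp
	qed
	show thesis
	proof(rule that[of rho])
		show "isometric_rep V rho"
			unfolding isometric_rep_def isometric_iso_def
		proof(intro conjI allI ballI)
			show "rho g : extensional (vcarrier V)" for g by(simp add: rho_def)
			show "bij_betw (rho g) (vcarrier V) (vcarrier V)" for g
			proof(rule bij_betwI[where g="rho (- g)"])
				show "rho (- g) (rho g v) = v" "rho g (rho (- g) v) = v" if "v : vcarrier V" for v
					using rho_add[OF that,of "- g" g] rho_add[OF that,of g "- g"] rho0[OF that] by simp_all
			qed (auto simp: rhoc)
			show "rho g (vadd V u v) = vadd V (rho g u) (rho g v)" if "u : vcarrier V" "v : vcarrier V" for g u v
				using that by(intro inj) (auto simp: rhoc V.add_closed rhob add R R1)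
			show "rho g (vscale V r v) = vscale V r (rho g v)" if "v : vcarrier V" for g r v
				using that by(intro inj) (auto simp: rhoc V.scale_closed rhob scale R R1)
		qed (auto simp: nrm rho0 rho_add)
	qed (use rhob in auto)
qed

section \<open>Nonsingular maps between finite powers\<close>

lemma AE_equiv_measures:"equiv_measures M N ==> (AE x in M. P x) <-> (AE x in N. P x)"
	unfolding equiv_measures_def
	using absolutely_continuous_AE[of M N P] absolutely_continuous_AE[of N M P] by auto

lemma AE_PiM_Suc:
	assumes N:"sigma_finite_measure N"
		and Q:"{ga : space (PiM {..<Suc n} (%_. N)). Q ga} : sets (PiM {..<Suc n} (%_. N))"
	shows "(AE ga in PiM {..<Suc n} (%_. N). Q ga) \<longleftrightarrow>
		(AE ga in PiM {..<n} (%_. N). AE y in N. Q (ga(n := y)))"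
proof -
	interpret N: sigma_finite_measure N by fact
	interpret product_sigma_finite "%_. N" by unfold_locales
	let ?P = "PiM {..<n} (%_. N)" and ?S = "PiM {..<Suc n} (%_. N)"
	let ?A = "{ga : space ?S. ~ Q ga}"
	have A[measurable]: "?A : sets ?S" using Q by(rule sets.sets_Collect_neg)
	have Sn:"{..<Suc n} = insert n {..<n}" by auto
	have upd:"(%z. (fst z)(n := snd z)) : ?P\<otimes>N ->M ?S"
		unfolding Sn by(rule measurable_fun_upd[of _ "{..<n}"]) auto
	have updc:"(%y. ga(n := y)) : N ->M ?S" if "ga : space ?P" for ga
		using measurable_compose[OF measurable_Pair1'[OF that] upd] by simp
	have sp:"ga(n := y) : space ?S" if "ga : space ?P" "y : space N" for ga y
		using measurable_space[OF updc[OF that(1)] that(2)] .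
	have "(AE ga in ?S. Q ga) <-> emeasure ?S ?A = 0"
		by(rule AE_iff_measurable[OF A refl])
	also have "... <-> (\<integral>\<^sup>+ga. indicator ?A ga \<partial>?S) = 0" by simp
	also have "(\<integral>\<^sup>+ga. indicator ?A ga \<partial>?S) = (\<integral>\<^sup>+ga. (\<integral>\<^sup>+y. indicator ?A (ga(n := y)) \<partial>N) \<partial>?P)"
		using product_nn_integral_insert[of "{..<n}" n "indicator ?A"] A unfolding Sn by simp
	also have "... = 0 <-> (AE ga in ?P. (\<integral>\<^sup>+y. indicator ?A (ga(n := y)) \<partial>N) = 0)"
	proof(rule nn_integral_0_iff_AE)
		have "(%(ga,y). indicator ?A ((fst (ga,y))(n := snd (ga,y))) :: ennreal) : borel_measurable (?P\<otimes>N)"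
			using measurable_compose[OF upd borel_measurable_indicator[OF A]] by(simp add: case_prod_beta')
		then show "(%ga. \<integral>\<^sup>+y. indicator ?A (ga(n := y)) \<partial>N) : borel_measurable ?P"
			by(intro N.borel_measurable_nn_integral) simp
	qed
	also have "... <-> (AE ga in ?P. AE y in N. Q (ga(n := y)))"
	proof(rule AE_cong)
		fix ga assume ga:"ga : space ?P"
		have "(%y. indicator ?A (ga(n := y)) :: ennreal) : borel_measurable N"
			by(rule measurable_compose[OF updc[OF ga] borel_measurable_indicator[OF A]])
		then have "(\<integral>\<^sup>+y. indicator ?A (ga(n := y)) \<partial>N) = 0 <-> (AE y in N. indicator ?A (ga(n := y)) = (0::ennreal))"
			by(rule nn_integral_0_iff_AE)
		also have "... <-> (AE y in N. Q (ga(n := y)))"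
			by(rule AE_cong) (use sp[OF ga] in \<open>auto simp: indicator_def\<close>)
		finally show "(\<integral>\<^sup>+y. indicator ?A (ga(n := y)) \<partial>N) = 0 <-> (AE y in N. Q (ga(n := y)))" .
	qed
	finally show ?thesis .
qed

text \<open>The image of \<open>M\<close> under \<open>f i\<close> need not be sigma-finite, so
  products of image measures are avoided: induction on the number of coordinates treats the last one
  by Fubini.\<close>

lemma PiM_nonsingular:
	fixes n :: nat
	assumes M:"sigma_finite_measure M" and N:"sigma_finite_measure N"
		and f[measurable]: "!!i. f i : M ->M N"
		and null:"!!i A. A : null_sets N ==> AE x in M. f i x ~: A"
	shows "A : null_sets (PiM {..<n} (%_. N)) ==>
		AE ga in PiM {..<n} (%_. M). (\<lambda>i\<in>{..<n}. f i (ga i)) ~: A"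
proof(induction n arbitrary: A)
	case 0
	have "emeasure (PiM {} (%_. N)) {%_. undefined} = 1" by(simp add: PiM_empty)
	then have "(%_. undefined) ~: A"
		using 0 emeasure_mono[of "{%_. undefined}" A "PiM {} (%_. N)"] by(auto simp: null_sets_def PiM_empty)
	then show ?case by(simp add: restrict_def)
next
	case (Suc n)
	interpret N: sigma_finite_measure N by fact
	let ?S = "%n. PiM {..<n} (%_. N)"
	have A[measurable]: "A : sets (?S (Suc n))" using Suc.prems by auto
	have mN:"{ga : space (?S (Suc n)). ga ~: A} : sets (?S (Suc n))" by measurable
	have upd[measurable]: "(%z. (fst z)(n := snd z)) : ?S n\<otimes>N ->M ?S (Suc n)"
		unfolding lessThan_Suc by(rule measurable_fun_upd[of _ "{..<n}"]) auto
	have "AE ga in ?S n. AE y in N. ga(n := y) ~: A"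
		using AE_PiM_Suc[OF N mN] AE_not_in[OF Suc.prems] by simp
	then obtain B where B:"B : null_sets (?S n)" "!!ga. ga : space (?S n) ==> ga ~: B ==> AE y in N. ga(n := y) ~: A"
		by(elim AE_E3) auto
	have step:"AE y in M. (\<lambda>i\<in>{..<Suc n}. f i ((ga(n := y)) i)) ~: A"
		if ga:"ga : space (PiM {..<n} (%_. M))" and nB:"(\<lambda>i\<in>{..<n}. f i (ga i)) ~: B" for ga
	proof -
		let ?ga = "\<lambda>i\<in>{..<n}. f i (ga i)"
		have "?ga : space (?S n)"
			using ga measurable_space[OF f] by(auto simp: space_PiM PiE_iff)
		then have "AE y in N. ?ga(n := y) ~: A" using B(2) nB by blast
		then obtain C where C:"C : null_sets N" "!!y. y : space N ==> y ~: C ==> ?ga(n := y) ~: A"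
			by(elim AE_E3) auto
		have "AE y in M. f n y ~: C" by(rule null[OF C(1)])
		then show ?thesis using AE_space
		proof eventually_elim
			case (elim y)
			have "(\<lambda>i\<in>{..<Suc n}. f i ((ga(n := y)) i)) = ?ga(n := f n y)" by(auto simp: restrict_def fun_eq_iff)
			then show ?case using C(2)[OF measurable_space[OF f elim(2)] elim(1)] by simp
		qed
	qed
	have [measurable]: "(%ga. \<lambda>i\<in>{..<Suc n}. f i (ga i)) : PiM {..<Suc n} (%_. M) ->M ?S (Suc n)"
		by(intro measurable_restrict) measurable
	have "AE ga in PiM {..<n} (%_. M). AE y in M. (\<lambda>i\<in>{..<Suc n}. f i ((ga(n := y)) i)) ~: A"
		using Suc.IH[OF B(1)] AE_space
		by eventually_elim (rule step)
	then show ?case by(subst AE_PiM_Suc[OF M]) measurable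
qed

text \<open>Haar measure may be infinite, in which case its powers have no useful marginals. A
  probability measure with the same null sets gives access to disintegrations and marginals.\<close>

lemma (in haar_group) equivalent_probability:
	obtains th where "prob_space th" "sets th = sets borel" "!!P. (AE g in th. P g) <-> (AE g in eta. P g)"
proof -
	obtain w :: "'g => real" where w[measurable]: "w : borel_measurable eta"
		and w0:"!!x. w x > 0" and wi:"integrable eta w"
		using obtain_positive_integrable_function by metis
	have W:"(LINT x|eta. w x) > 0"
	proof -
		have "(LINT x|eta. w x) ~= 0"
		proof
			assume "(LINT x|eta. w x) = 0"
			then have "AE x in eta. w x = 0"
				using integral_nonneg_eq_0_iff_AE[OF wi] w0[THEN less_imp_le] by simp
			from AE_ex[OF this] obtain x where "w x = 0" by(elim exE)
			then show False using w0[of x] by simp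
		qed
		moreover have "(LINT x|eta. w x) >= 0" using w0[THEN less_imp_le] by(intro integral_nonneg_AE) auto
		ultimately show ?thesis by simp
	qed
	define v where "v x = w x / (LINT x|eta. w x)" for x
	have v0:"v x > 0" for x using W w0 by(simp add: v_def)
	have v[measurable]: "v : borel_measurable eta" unfolding v_def by measurable
	define th where "th = density eta (%x. ennreal (v x))"
	have sl[measurable_cong,simp]: "sets th = sets borel" by(simp add: th_def sets_eta)
	interpret l: prob_space th
	proof
		have "emeasure th (space th) = (\<integral>\<^sup>+x. ennreal (v x) \<partial>eta)"
			unfolding th_def by(subst emeasure_density) (auto intro!: nn_integral_cong)
		also have "... = ennreal (LINT x|eta. v x)"
			using wi v0[THEN less_imp_le] by(intro nn_integral_eq_integral) (auto simp: v_def)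
		also have "(LINT x|eta. v x) = 1" using W by(simp add: v_def)
		finally show "emeasure th (space th) = 1" by simp
	qed
	have AE_l:"(AE g in th. P g) <-> (AE g in eta. P g)" for P
		unfolding th_def by(subst AE_density) (auto simp: v0)
	show thesis by(rule that[OF l.prob_space_axioms sl AE_l])
qed

section \<open>The standing hypotheses\<close>

locale semidirect_module =
	fixes eta :: "'g::{topological_group_add,t2_space,second_countable_topology} measure"
		and act :: "'g => 'x => 'x"
		and mu :: "'x measure"
		and nu :: "('g \<times> 'x) measure"
		and kap :: "'x => ('g \<times> 'x) measure"
		and Lb :: "'g \<times> 'x => 'e::{banach,second_countable_topology} \<Rightarrow>\<^sub>L 'e"
	assumes lc:"locally_compact_space (euclidean :: 'g topology)"
		and haar:"left_haar_measure eta"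
		and G_space:"lebesgue_G_space act mu"
		and nu_equiv:"equiv_measures nu (eta\<otimes>mu)"
		and groupoid:"measured_groupoid (semidirect_groupoid act mu) nu kap"
		and module:"measurable_coefficient_module (semidirect_groupoid act mu) nu kap Lb"
begin

sublocale haar_group eta by unfold_locales (rule lc,rule haar)

abbreviation "\<G> \<equiv> semidirect_groupoid act mu"

sublocale mu: sigma_finite_measure mu using G_space by(simp add: lebesgue_G_space_def)
sublocale mg: measured_groupoid \<G> nu kap by(rule groupoid)
sublocale nu: prob_space nu by(rule mg.prob_nu)
sublocale eta_mu: pair_sigma_finite eta mu ..

lemma sb_mu:"standard_borel mu"
	using G_space by(simp add: lebesgue_G_space_def)

lemma G_simps [simp]:
	"arrows \<G> = borel\<otimes>mu" "units \<G> = mu" "src \<G> a = snd a" "tgt \<G> a = act (fst a) (snd a)"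
	"gcomp \<G> a b = (fst a + fst b,snd b)" "ginv \<G> a = (- fst a,act (fst a) (snd a))"
	by(simp_all add: semidirect_groupoid_def case_prod_beta)

lemma tgt_G:"tgt \<G> = (%a. act (fst a) (snd a))"
	by(simp add: fun_eq_iff)

lemma act_measurable:"(%z. act (fst z) (snd z)) : borel\<otimes>mu ->M mu"
	using G_space by(simp add: lebesgue_G_space_def case_prod_beta')

lemma act_measurable' [measurable (raw)]:
	"f : M ->M borel ==> h : M ->M mu ==> (%z. act (f z) (h z)) : M ->M mu"
	using measurable_compose[OF measurable_Pair act_measurable,of f M h] by simp

lemma act_space [simp]: "x : space mu ==> act g x : space mu"
	using measurable_space[OF act_measurable,of "(g,x)"] by(simp add: space_pair_measure)

lemma act_0 [simp]: "x : space mu ==> act 0 x = x"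
	using G_space by(simp add: lebesgue_G_space_def)

lemma act_add:"x : space mu ==> act (g + h) x = act g (act h x)"
	using G_space by(simp add: lebesgue_G_space_def)

lemma act_inv [simp]: "x : space mu ==> act (- g) (act g x) = x" "x : space mu ==> act g (act (- g) x) = x"
	using act_add[of x "- g" g] act_add[of x g "- g"] by simp_all

lemma AE_act: assumes "AE x in mu. P x" shows "AE x in mu. P (act g x)"
proof -
	have "equiv_measures (distr mu mu (act g)) mu" using G_space by(simp add: lebesgue_G_space_def)
	then have "AE x in distr mu mu (act g). P x" using AE_equiv_measures assms by blast
	then show ?thesis by(rule AE_distrD[rotated]) measurable
qed

lemma AE_act_iff:"(AE x in mu. P (act g x)) <-> (AE x in mu. P x)"
proof
	assume "AE x in mu. P (act g x)"
	then have "AE x in mu. P (act g (act (- g) x))" by(rule AE_act)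
	then show "AE x in mu. P x" using AE_space by eventually_elim simp
qed (rule AE_act)

text \<open>Points of a standard Borel space are separated by countably many measurable sets, so
  disagreement of two maps is a countable union of measurable conditions. It makes the tuples with
  common target a measurable set.\<close>

lemma eq_measurable:
	assumes [measurable]: "f : M ->M mu" "h : M ->M mu"
	shows "{z : space M. f z = h z} : sets M"
proof -
	obtain \<P> where P:"countable \<P>" "\<P> <= sets mu"
		"!!x y. x : space mu ==> y : space mu ==> x ~= y ==> EX P:\<P>. x : P & y ~: P"
		using standard_borel_countable_generator[OF sb_mu] by metis
	have "f z = h z <-> (ALL P:\<P>. f z : P --> h z : P)" if "z : space M" for z
		using P(3)[of "f z" "h z"] measurable_space[OF assms(1) that] measurable_space[OF assms(2) that] by metis
	then have "{z : space M. f z = h z} = space M - (\<Union>P\<in>\<P>. {z : space M. f z : P & h z ~: P})"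
		by auto
	also have "... : sets M"
	proof(intro sets.Diff sets.top sets.countable_UN''[OF P(1)])
		fix P assume "P : \<P>"
		then have [measurable]: "P : sets mu" using P(2) by blast
		show "{z : space M. f z : P & h z ~: P} : sets M" by measurable
	qed
	finally show ?thesis .
qed

abbreviation "mu1 \<equiv> unit_measure \<G> nu"

lemma sets_arrows_eta:"sets (borel\<otimes>mu) = sets (eta\<otimes>mu)"
	by(intro sets_pair_measure_cong) (simp_all add: sets_eta)

lemma sets_nu [measurable_cong]: "sets nu = sets (borel\<otimes>mu)"
	using mg.sets_nu by simp

lemma sets_mu1 [measurable_cong,simp]: "sets mu1 = sets mu"
	by(simp add: unit_measure_def)

lemma space_mu1 [simp]: "space mu1 = space mu"
	by(simp add: unit_measure_def)

lemma tgt_nu:"(%a. act (fst a) (snd a)) : nu ->M mu"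
	using act_measurable by(simp add: measurable_cong_sets[OF sets_nu refl])

sublocale mu1: prob_space mu1
	unfolding unit_measure_def tgt_G using tgt_nu by(intro nu.prob_space_distr) simp

text \<open>\<open>mu1\<close> has the null sets of the image of \<open>eta \<otimes> mu\<close>
  under the action. Each \<open>act g\<close> preserves the class of \<open>mu\<close>, so after
  Fubini the condition no longer depends on \<open>g\<close>.\<close>

lemma AE_mu1_measurable:
	assumes P:"{x : space mu. P x} : sets mu"
	shows "(AE x in mu1. P x) <-> (AE x in mu. P x)"
proof -
	have [measurable]: "Measurable.pred mu P" using P by(simp add: pred_def)
	have "(AE x in mu1. P x) <-> (AE a in nu. P (act (fst a) (snd a)))"
		unfolding unit_measure_def tgt_G G_simps(2) by(rule AE_distr_iff[OF tgt_nu P])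
	also have "... <-> (AE a in eta\<otimes>mu. P (act (fst a) (snd a)))"
		by(rule AE_equiv_measures[OF nu_equiv])
	also have "... <-> (AE g in eta. AE x in mu. P (act g x))"
		by(rule eta_mu.AE_pair_iff[symmetric]) measurable
	also have "... <-> (AE x in mu. P x)" unfolding AE_act_iff AE_const ..
	finally show ?thesis .
qed

lemma null_sets_mu1:"null_sets mu1 = null_sets mu"
proof -
	have "A : null_sets mu1 <-> A : null_sets mu" if A:"A : sets mu" for A
	proof -
		have "{x : space mu. x ~: A} : sets mu" using A by measurable
		from AE_mu1_measurable[OF this] show ?thesis using A AE_iff_null_sets[of A mu] AE_iff_null_sets[of A mu1] by simp
	qed
	then show ?thesis by(auto simp: null_sets_def)
qed

lemma AE_mu1:"(AE x in mu1. P x) <-> (AE x in mu. P x)"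
	by(rule AE_equiv_measures) (simp add: equiv_measures_def absolutely_continuous_def null_sets_mu1)

lemma sb_arrows:"standard_borel (borel\<otimes>mu :: ('g \<times> 'x) measure)"
	using mg.standard_borel_arrows by simp

lemma kernel:"kap : mu ->M prob_algebra (borel\<otimes>mu)"
	using mg.kernel by simp

lemma prob_kappa:"x : space mu ==> prob_space (kap x)"
	and sets_kappa:"x : space mu ==> sets (kap x) = sets (borel\<otimes>mu)"
	using measurable_space[OF kernel,of x] by(auto simp: space_prob_algebra)

lemma emeasure_kappa:"A : sets (borel\<otimes>mu) ==> (%x. emeasure (kap x) A) : borel_measurable mu"
	by(rule measurable_compose[OF measurable_prob_algebraD[OF kernel] measurable_emeasure_subprob_algebra])

lemma kappa_supported:"AE x in mu1. AE a in kap x. act (fst a) (snd a) = x"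
	using mg.fibre_supported by simp

lemma emeasure_nu:"A : sets (borel\<otimes>mu) ==> emeasure nu A = (\<integral>\<^sup>+x. emeasure (kap x) A \<partial>mu1)"
proof -
	assume A:"A : sets (borel\<otimes>mu)"
	have "kap : mu1 ->M prob_algebra (borel\<otimes>mu)"
		using kernel by(simp add: measurable_cong_sets[OF sets_mu1 refl])
	moreover have "mu1 : space (prob_algebra mu1)"
		by(simp add: space_prob_algebra mu1.prob_space_axioms)
	ultimately show ?thesis
		using emeasure_bind_prob_algebra[of mu1 mu1 kap "borel\<otimes>mu" A] A
		by(subst mg.disintegration) simp
qed

text \<open>The measure \<open>nu\<close> is equivalent to the image of \<open>mu1 \<times> th\<close>, for a probability
	measure \<open>th\<close> equivalent to \<open>eta\<close>, under \<open>(x, g) \<mapsto> (g, g\<inverse> x)\<close>.  Uniqueness of the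
	disintegration identifies the fibre measures up to a positive density.\<close>

lemma kappa_null_sets:
	"AE x in mu. ALL A:sets (borel\<otimes>mu). emeasure (kap x) A = 0 <-> (AE g in eta. (g,act (- g) x) ~: A)"
proof -
	obtain th where th:"prob_space th" and sl[measurable_cong,simp]: "sets th = sets borel"
		and AE_l:"!!P. (AE g in th. P g) <-> (AE g in eta. P g)"
	proof(rule equivalent_probability)
		fix th assume a:"prob_space th" "sets th = sets borel" "!!P. (AE g in th. P g) <-> (AE g in eta. P g)"
		show thesis by(rule that[OF a])
	qed
	interpret l: prob_space th by(rule th)
	interpret ml: pair_prob_space mu1 th ..
	let ?A = "borel\<otimes>mu :: ('g \<times> 'x) measure"
	let ?j = "%z. (snd z,act (- snd z) (fst z)) :: 'g \<times> 'x"
	have j[measurable]: "?j : mu1\<otimes>th ->M ?A"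
	proof -
		have "?j : mu\<otimes>borel ->M ?A" by measurable
		then show ?thesis by(simp add: measurable_cong_sets[OF sets_pair_measure_cong[OF sets_mu1 sl] refl])
	qed
	have jx[measurable]: "(%g. (g,act (- g) x)) : th ->M ?A" if "x : space mu" for x
		using that by measurable
	\<comment> \<open>A model for the class of \<open>nu\<close>: choose a unit \<open>x\<close> and an
	  independent group element \<open>g\<close>, and take the arrow \<open>(g, act (- g) x)\<close>,
	  whose target is \<open>x\<close>.\<close>
	define nu' where "nu' = distr (mu1\<otimes>th) ?A ?j"
	have s'[simp,measurable_cong]: "sets nu' = sets ?A" by(simp add: nu'_def)
	interpret n': prob_space nu' unfolding nu'_def by(rule ml.prob_space_distr) (rule j)
	have null': "A : null_sets nu' <-> A : null_sets (eta\<otimes>mu)" if A[measurable]: "A : sets ?A" for A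
	proof -
		have A': "A : sets (eta\<otimes>mu)" using A sets_arrows_eta by simp
		have "A : null_sets nu' <-> (AE a in nu'. a ~: A)" using A by(intro AE_iff_null_sets) simp
		also have "... <-> (AE z in mu1\<otimes>th. ?j z ~: A)"
			unfolding nu'_def by(rule AE_distr_iff[OF j]) measurable
		also have "... <-> (AE x in mu1. AE g in th. (g,act (- g) x) ~: A)"
		proof -
			have "{z : space (mu1\<otimes>th). ?j z ~: A} : sets (mu1\<otimes>th)" using j A by(intro predE) (rule pred_sets1[OF _ j,of "%a. a ~: A"],measurable)
			then show ?thesis using ml.AE_pair_iff[of "%x g. (g,act (- g) x) ~: A"] by simp
		qed
		also have "... <-> (AE x in mu. AE g in eta. (g,act (- g) x) ~: A)" unfolding AE_l AE_mu1 ..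
		also have "... <-> (AE g in eta. AE x in mu. (g,act (- g) x) ~: A)"
			by(rule eta_mu.AE_commute[symmetric]) measurable
		also have "... <-> (AE g in eta. AE x in mu. (g,x) ~: A)"
			by(subst AE_act_iff[of "%x. (_,x) ~: A"]) simp
		also have "... <-> (AE z in eta\<otimes>mu. z ~: A)"
			using A' by(subst eta_mu.AE_pair_iff) auto
		also have "... <-> A : null_sets (eta\<otimes>mu)" using A' by(intro AE_iff_null_sets[symmetric]) simp
		finally show ?thesis .
	qed
	have null:"A : null_sets nu <-> A : null_sets nu'" if A:"A : sets ?A" for A
		using null'[OF A] nu_equiv by(auto simp: equiv_measures_def absolutely_continuous_def)
	have "absolutely_continuous nu' nu"
		unfolding absolutely_continuous_def
	proof
		fix A assume A:"A : null_sets nu'"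
		then have "A : sets ?A" using s' by(auto simp: null_sets_def)
		from null[OF this] A show "A : null_sets nu" by simp
	qed
	then have dens:"density nu' (RN_deriv nu' nu) = nu"
		by(rule n'.density_RN_deriv) (simp add: sets_nu)
	define D where "D = RN_deriv nu' nu"
	have D[measurable]: "D : borel_measurable ?A"
		unfolding D_def using borel_measurable_RN_deriv[of nu' nu] by(simp add: measurable_cong_sets[OF s' refl])
	have D0:"AE a in nu'. D a ~= 0"
	proof -
		let ?Z = "{a : space ?A. D a = 0}"
		have Z[measurable]: "?Z : sets ?A" by measurable
		have "emeasure nu ?Z = (\<integral>\<^sup>+a. D a * indicator ?Z a \<partial>nu')"
			by(subst dens[symmetric],subst emeasure_density) (auto simp: D_def[symmetric])
		also have "... = (\<integral>\<^sup>+a. 0 \<partial>nu')" by(intro nn_integral_cong) (auto simp: indicator_def)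
		finally have "?Z : null_sets nu" by(auto simp: null_sets_def sets_nu)
		then have "?Z : null_sets nu'" using null[OF Z] by simp
		from AE_not_in[OF this] AE_space[of nu'] show ?thesis
			by eventually_elim (simp add: sets_eq_imp_space_eq[OF s'])
	qed
	have D0x:"AE x in mu1. AE g in th. D (g,act (- g) x) ~= 0"
		using ml.AE_pair[OF AE_distrD[OF j D0[unfolded nu'_def]]] by simp
	have DI:"(%z. D (?j z) * indicator A (?j z)) : borel_measurable (mu1\<otimes>th)" if "A : sets ?A" for A
	proof -
		have [measurable]: "A : sets ?A" by fact
		have "(%a. D a * indicator A a) : borel_measurable ?A" by measurable
		from measurable_compose[OF j this] show ?thesis by simp
	qed
	let ?I = "%A x. \<integral>\<^sup>+g. D (g,act (- g) x) * indicator A (g,act (- g) x) \<partial>th"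
	have Im:"?I A : borel_measurable mu1" if "A : sets ?A" for A
		using l.borel_measurable_nn_integral[of "%x g. D (g,act (- g) x) * indicator A (g,act (- g) x)" mu1] DI[OF that]
		by(simp add: case_prod_beta)
	have eqA:"AE x in mu1. emeasure (kap x) A = ?I A x" if A:"A : sets ?A" for A
	proof -
		have ek:"(%x. emeasure (kap x) A) : borel_measurable mu1" using emeasure_kappa[OF A] by(simp add: measurable_cong_sets[OF sets_mu1 refl])
		have "density mu1 (%x. emeasure (kap x) A) = density mu1 (?I A)"
		proof(rule measure_eqI)
			fix B assume "B : sets (density mu1 (%x. emeasure (kap x) A))"
			then have B[measurable]: "B : sets mu" by simp
			\<comment> \<open>The arrows of \<open>A\<close> with target in \<open>B\<close>. The fibre
			  measure over \<open>x\<close> sees all of \<open>A\<close> if \<open>x : B\<close> and nothing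
			  otherwise, so varying \<open>B\<close> compares the two functions of \<open>x\<close> under the
			  integral and uniqueness of densities applies.\<close>
			let ?T = "A Int {a : space ?A. act (fst a) (snd a) : B}"
			have T:"?T : sets ?A" using A by measurable
			have "emeasure nu ?T = (\<integral>\<^sup>+x. emeasure (kap x) A * indicator B x \<partial>mu1)"
				unfolding emeasure_nu[OF T]
			proof(rule nn_integral_cong_AE,use kappa_supported AE_space in eventually_elim)
				case (elim x)
				then have x:"x : space mu" by simp
				show ?case
				proof(cases "x : B")
					case True
					have "emeasure (kap x) ?T = emeasure (kap x) A"
					proof(rule emeasure_eq_AE)
						show "AE a in kap x. (a : ?T) = (a : A)"
							using elim(1) AE_space[of "kap x"]
							by eventually_elim (use True in \<open>simp add: sets_eq_imp_space_eq[OF sets_kappa[OF x]]\<close>)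
					qed (use T A in \<open>simp_all add: sets_kappa[OF x]\<close>)
					then show ?thesis using True by simp
				next
					case False
					have "emeasure (kap x) ?T = emeasure (kap x) {}"
					proof(rule emeasure_eq_AE)
						show "AE a in kap x. (a : ?T) = (a : {})"
							using elim(1) by eventually_elim (use False in simp)
					qed (use T in \<open>simp_all add: sets_kappa[OF x]\<close>)
					then show ?thesis using False by simp
				qed
			qed
			moreover have "emeasure nu ?T = (\<integral>\<^sup>+x. ?I A x * indicator B x \<partial>mu1)"
			proof -
				have "emeasure nu ?T = (\<integral>\<^sup>+a. D a * indicator ?T a \<partial>nu')"
					using T by(subst dens[symmetric],subst emeasure_density) (auto simp: D_def[symmetric])
				also have "... = (\<integral>\<^sup>+z. D (?j z) * indicator ?T (?j z) \<partial>(mu1\<otimes>th))"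
				proof -
					have [measurable]: "?T : sets ?A" by(rule T)
					have "(%a. D a * indicator ?T a) : borel_measurable ?A" by measurable
					then show ?thesis unfolding nu'_def using nn_integral_distr[OF j,of "%a. D a * indicator ?T a"] by simp
				qed
				also have "... = (\<integral>\<^sup>+x. \<integral>\<^sup>+g. D (g,act (- g) x) * indicator ?T (g,act (- g) x) \<partial>th \<partial>mu1)"
					using l.nn_integral_fst[OF DI[OF T]] by simp
				also have "... = (\<integral>\<^sup>+x. ?I A x * indicator B x \<partial>mu1)"
				proof(rule nn_integral_cong)
					fix x assume "x : space mu1"
					then have x:"x : space mu" by simp
					have "?I A x * indicator B x = (\<integral>\<^sup>+g. (D (g,act (- g) x) * indicator A (g,act (- g) x)) * indicator B x \<partial>th)"
					proof(rule nn_integral_multc[symmetric])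
						have [measurable]: "A : sets ?A" by(rule A)
						have "(%a. D a * indicator A a) : borel_measurable ?A" by measurable
						from measurable_compose[OF jx[OF x] this]
						show "(%g. D (g,act (- g) x) * indicator A (g,act (- g) x)) : borel_measurable th" .
					qed
					also have "... = (\<integral>\<^sup>+g. D (g,act (- g) x) * indicator ?T (g,act (- g) x) \<partial>th)"
						using x by(intro nn_integral_cong) (auto simp: indicator_def space_pair_measure)
					finally show "(\<integral>\<^sup>+g. D (g,act (- g) x) * indicator ?T (g,act (- g) x) \<partial>th) = ?I A x * indicator B x" ..
				qed
				finally show ?thesis .
			qed
			ultimately show "emeasure (density mu1 (%x. emeasure (kap x) A)) B = emeasure (density mu1 (?I A)) B"
				using B ek Im[OF A] by(simp add: emeasure_density)
		qed simp
		then show ?thesis using mu1.density_unique_iff[OF ek Im[OF A]] by simp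
	qed
	obtain \<P> where P:"countable \<P>" "\<P> <= sets ?A" "Int_stable \<P>" "sets ?A = sigma_sets (space ?A) \<P>"
			and PA:"space ?A : \<P>"
		using standard_borel_countable_generator[OF sb_arrows] by metis
	have "AE x in mu1. ALL A:insert (space ?A) \<P>. emeasure (kap x) A = ?I A x"
	proof(subst AE_ball_countable)
		show "ALL A:insert (space ?A) \<P>. AE x in mu1. emeasure (kap x) A = ?I A x"
			using P(2) by(intro ballI eqA) (auto simp: sets.top)
	qed (use P(1) in simp)
	then have "AE x in mu1. ALL A:sets ?A. emeasure (kap x) A = 0 <-> (AE g in eta. (g,act (- g) x) ~: A)"
		using D0x AE_space
	proof eventually_elim
		case (elim x)
		then have x:"x : space mu" by simp
		interpret kx: prob_space "kap x" by(rule prob_kappa[OF x])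
		\<comment> \<open>The candidate for \<open>kap x\<close>: the image of \<open>th\<close> on the
		  fibre over \<open>x\<close>, with the density \<open>D\<close>, nonzero almost everywhere there.
		  Agreement with \<open>kap x\<close> on a countable generator closed under intersections
		  identifies the two.\<close>
		let ?E = "density (distr th ?A (%g. (g,act (- g) x))) D"
		have eE:"emeasure ?E A = ?I A x" if "A : sets ?A" for A
		proof -
			have [measurable]: "A : sets ?A" by fact
			have "(%a. D a * indicator A a) : borel_measurable ?A" by measurable
			then show ?thesis using nn_integral_distr[OF jx[OF x],of "%a. D a * indicator A a"] by(simp add: emeasure_density)
		qed
		have "kap x = ?E"
		proof(rule measure_eqI_generator_eq[OF P(3),where \<Omega>="space ?A" and A="%_. space ?A"])
			show "\<P> <= Pow (space ?A)" using P(2) sets.space_closed by blast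
			show "emeasure (kap x) X = emeasure ?E X" if "X : \<P>" for X
				using elim(1) eE[of X] that P(2) by auto
			show "sets (kap x) = sigma_sets (space ?A) \<P>" "sets ?E = sigma_sets (space ?A) \<P>"
				using P(4) sets_kappa[OF x] by simp_all
			show "range (%_. space ?A) <= \<P>" "(\<Union>i::nat. space ?A) = space ?A" using PA by auto
			show "emeasure (kap x) (space ?A) ~= \<infinity>" by simp
		qed
		show ?case
		proof
			fix A assume A[measurable]: "A : sets ?A"
			have "emeasure (kap x) A = 0 <-> (AE g in th. D (g,act (- g) x) * indicator A (g,act (- g) x) = 0)"
			proof -
				have "(%a. D a * indicator A a) : borel_measurable ?A" by measurable
				from measurable_compose[OF jx[OF x] this] show ?thesis
					unfolding \<open>kap x = ?E\<close> eE[OF A] by(rule nn_integral_0_iff_AE)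
			qed
			also have "... <-> (AE g in th. (g,act (- g) x) ~: A)"
			proof
				assume "AE g in th. D (g,act (- g) x) * indicator A (g,act (- g) x) = 0"
				then show "AE g in th. (g,act (- g) x) ~: A" using elim(2) by eventually_elim (auto simp: indicator_def split: if_splits)
			qed (auto elim!: eventually_mono)
			finally show "emeasure (kap x) A = 0 <-> (AE g in eta. (g,act (- g) x) ~: A)" unfolding AE_l .
		qed
	qed
	then show ?thesis unfolding AE_mu1 .
qed

end

section \<open>Homogeneous cochains\<close>

text \<open>The \<open>i\<close>-th simplex of the prism, with vertices
  \<open>ga 0, ..., ga i, ga' i, ..., ga' (n - 1)\<close>; the index \<open>j - 1\<close> repeats
  position \<open>i\<close> in the second tuple.\<close>

definition mixt :: "nat => nat => (nat => 'a) => (nat => 'a) => nat => 'a" where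
	"mixt n i ga ga' = (\<lambda>j\<in>{..<Suc n}. if j <= i then ga j else ga' (j - 1))"

definition cob :: "nat => ((nat => 'a) => 'v::real_vector) => (nat => 'a) => 'v" where
	"cob n f ga = (\<Sum>i<Suc n. (-1) ^ i *\<^sub>R f (omit n i ga))"

definition prism :: "nat => ((nat => 'a) => 'v::real_vector) => (nat => 'a) => (nat => 'a) => 'v" where
	"prism n f ga ga' = (\<Sum>i<n. (-1) ^ i *\<^sub>R f (mixt n i ga ga'))"

lemma omit_omit:"j < i ==> omit n j (omit (Suc n) i ga) = omit n (i - 1) (omit (Suc n) j ga)"
	by(auto simp: omit_def restrict_def fun_eq_iff)

lemma cob_cob:"cob (Suc n) (cob n f) ga = 0"
proof -
	define t where "t p = (-1) ^ (fst p + snd p) *\<^sub>R f (omit n (snd p) (omit (Suc n) (fst p) ga))" for p :: "nat \<times> nat"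
	let ?S = "{..<Suc (Suc n)} \<times> {..<Suc n}"
	let ?A = "{p : ?S. snd p < fst p}" and ?B = "{p : ?S. fst p <= snd p}"
	have "cob (Suc n) (cob n f) ga = (\<Sum>i<Suc (Suc n). \<Sum>j<Suc n. t (i,j))"
		by(simp only: cob_def t_def scaleR_sum_right scaleR_scaleR power_add fst_conv snd_conv)
	also have "... = sum t ?S" by(simp only: sum.cartesian_product case_prod_eta)
	also have "?S = ?A Un ?B" by auto
	also have "sum t (?A Un ?B) = sum t ?A + sum t ?B" by(intro sum.union_disjoint) auto
	\<comment> \<open>Exchanging two omissions lowers the larger index by one, which reverses the
	  sign.\<close>
	also have "sum t ?A = (\<Sum>p\<in>?B. - t p)"
	proof(rule sum.reindex_bij_witness[where i="%p. (Suc (snd p),fst p)" and j="%p. (snd p,fst p - 1)"])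
		fix p assume p:"p : ?A"
		then have "snd p < fst p" by simp
		then have "t p = (-1) ^ (fst p + snd p) *\<^sub>R f (omit n (fst p - 1) (omit (Suc n) (snd p) ga))"
			by(simp add: t_def omit_omit)
		moreover have "(-1::real) ^ (fst p + snd p) = - ((-1) ^ (snd p + (fst p - 1)))"
		proof -
			have e:"fst p + snd p = Suc (snd p + (fst p - 1))" using \<open>snd p < fst p\<close> by simp
			show ?thesis unfolding e by simp
		qed
		ultimately show "- t (snd p,fst p - 1) = t p" by(simp only: t_def fst_conv snd_conv scaleR_minus_left)
	qed auto
	also have "(\<Sum>p\<in>?B. - t p) + sum t ?B = 0" by(simp add: sum_negf)
	finally show ?thesis .
qed

lemma omit_mixt_diag:"omit (Suc m) i (mixt (Suc m) i ga ga') = (\<lambda>j\<in>{..<Suc m}. if j < i then ga j else ga' j)"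
	by(auto simp: omit_def mixt_def restrict_def fun_eq_iff)

lemma omit_mixt_Suc:"omit (Suc m) (Suc i) (mixt (Suc m) i ga ga') = (\<lambda>j\<in>{..<Suc m}. if j < Suc i then ga j else ga' j)"
	by(auto simp: omit_def mixt_def restrict_def fun_eq_iff)

lemma mixt_omit_le:"l <= i ==> i < m ==>
		mixt m i (omit m l ga) (omit m l ga') = omit (Suc m) l (mixt (Suc m) (Suc i) ga ga')"
	by(auto simp: omit_def mixt_def restrict_def fun_eq_iff)

lemma mixt_omit_gt:"i < l ==> i < m ==>
		mixt m i (omit m l ga) (omit m l ga') = omit (Suc m) (Suc l) (mixt (Suc m) i ga ga')"
	by(auto simp: omit_def mixt_def restrict_def fun_eq_iff)

text \<open>In the \<open>i\<close>-th simplex, the faces that omit position \<open>i\<close> or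
  \<open>i + 1\<close> interpolate between the two tuples and telescope. Every other face is a
  simplex of the prism over a face of the tuples, and these cancel in pairs against the second sum.
  Extensionality identifies the two ends of the telescope with \<open>ga'\<close> and
  \<open>ga\<close> themselves.\<close>

lemma prism_identity:
	assumes "ga : extensional {..<Suc m}" "ga' : extensional {..<Suc m}"
	shows "prism (Suc m) (cob (Suc m) f) ga ga' + (\<Sum>l<Suc m. (-1) ^ l *\<^sub>R prism m f (omit m l ga) (omit m l ga'))
		= f ga' - f ga"
proof -
	define a where "a i j = f (omit (Suc m) j (mixt (Suc m) i ga ga'))" for i j
	define t where "t p = (-1) ^ (fst p + snd p) *\<^sub>R a (fst p) (snd p)" for p :: "nat \<times> nat"
	define D where "D i = f (\<lambda>j\<in>{..<Suc m}. if j < i then ga j else ga' j)" for i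
	let ?S = "{..<Suc m} \<times> {..<Suc (Suc m)}" and ?U = "{..<Suc m} \<times> {..<m}"
	let ?A = "{p : ?S. snd p < fst p}" and ?B = "{p : ?S. Suc (fst p) < snd p}"
		and ?E = "(%i. (i,i)) ` {..<Suc m}" and ?E' = "(%i. (i,Suc i)) ` {..<Suc m}"
	define u where "u p = (-1) ^ (fst p + snd p) *\<^sub>R f (mixt m (snd p) (omit m (fst p) ga) (omit m (fst p) ga'))" for p :: "nat \<times> nat"
	let ?A' = "{p : ?U. fst p <= snd p}" and ?B' = "{p : ?U. snd p < fst p}"
	have "prism (Suc m) (cob (Suc m) f) ga ga' = (\<Sum>i<Suc m. \<Sum>j<Suc (Suc m). t (i,j))"
		by(simp only: prism_def cob_def t_def a_def scaleR_sum_right scaleR_scaleR power_add fst_conv snd_conv)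
	also have "... = sum t ?S" by(simp only: sum.cartesian_product case_prod_eta)
	also have "?S = (?E Un ?E') Un (?A Un ?B)" by(auto simp: image_iff)
	also have "sum t ((?E Un ?E') Un (?A Un ?B)) = sum t (?E Un ?E') + sum t (?A Un ?B)"
		by(intro sum.union_disjoint) auto
	also have "sum t (?E Un ?E') = sum t ?E + sum t ?E'" by(intro sum.union_disjoint) auto
	also have "sum t (?A Un ?B) = sum t ?A + sum t ?B" by(intro sum.union_disjoint) auto
	also have "sum t ?E = (\<Sum>i<Suc m. D i)"
		by(subst sum.reindex) (auto simp: inj_on_def t_def a_def D_def omit_mixt_diag mult_2[symmetric] simp del: sum.lessThan_Suc)
	also have "sum t ?E' = (\<Sum>i<Suc m. - D (Suc i))"
		by(subst sum.reindex) (auto simp: inj_on_def t_def a_def D_def omit_mixt_Suc mult_2[symmetric] simp del: sum.lessThan_Suc)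
	finally have 1:"prism (Suc m) (cob (Suc m) f) ga ga'
			= (\<Sum>i<Suc m. D i) + (\<Sum>i<Suc m. - D (Suc i)) + (sum t ?A + sum t ?B)" .
	have "(\<Sum>l<Suc m. (-1) ^ l *\<^sub>R prism m f (omit m l ga) (omit m l ga')) = (\<Sum>l<Suc m. \<Sum>i<m. u (l,i))"
		by(simp only: prism_def u_def scaleR_sum_right scaleR_scaleR power_add fst_conv snd_conv)
	also have "... = sum u ?U" by(simp only: sum.cartesian_product case_prod_eta)
	also have "?U = ?A' Un ?B'" by auto
	also have "sum u (?A' Un ?B') = sum u ?A' + sum u ?B'" by(intro sum.union_disjoint) auto
	also have "sum u ?A' = (\<Sum>p\<in>?A. - t p)"
	proof(rule sum.reindex_bij_witness[where i="%p. (snd p,fst p - 1)" and j="%p. (Suc (snd p),fst p)"])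
		fix p assume p:"p : ?A'"
		then have "fst p <= snd p" "snd p < m" by auto
		then show "- t (Suc (snd p),fst p) = u p"
			by(simp add: t_def u_def a_def mixt_omit_le add.commute)
	qed auto
	also have "sum u ?B' = (\<Sum>p\<in>?B. - t p)"
	proof(rule sum.reindex_bij_witness[where i="%p. (snd p - 1,fst p)" and j="%p. (snd p,Suc (fst p))"])
		fix p assume p:"p : ?B'"
		then have "snd p < fst p" "snd p < m" by auto
		then show "- t (snd p,Suc (fst p)) = u p"
			by(simp add: t_def u_def a_def mixt_omit_gt add.commute)
	qed auto
	finally have 2:"(\<Sum>l<Suc m. (-1) ^ l *\<^sub>R prism m f (omit m l ga) (omit m l ga')) = - sum t ?A - sum t ?B"
		by(simp add: sum_negf)
	have "(\<Sum>i<Suc m. D i) + (\<Sum>i<Suc m. - D (Suc i)) = (\<Sum>i<Suc m. D i - D (Suc i))"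
		by(simp only: sum_subtractf sum_negf) simp
	also have "... = D 0 - D (Suc m)" by(rule sum_lessThan_telescope')
	also have "D 0 = f ga'" unfolding D_def using assms(2)
		by(intro arg_cong[where f=f]) (auto simp: fun_eq_iff restrict_def extensional_def)
	also have "D (Suc m) = f ga" unfolding D_def using assms(1)
		by(intro arg_cong[where f=f]) (auto simp: fun_eq_iff restrict_def extensional_def)
	finally show ?thesis unfolding 1 2 by simp
qed

section \<open>Weak-star integrals\<close>

text \<open>The Gelfand integral. The integrand is only weak-star measurable, with values in a dual
  that need not be separable, so it is integrated against each vector separately.\<close>

definition winteg :: "'h measure => ('h => 'e::real_normed_vector \<Rightarrow>\<^sub>L real) => 'e \<Rightarrow>\<^sub>L real" where
	"winteg N G = Blinfun (%v. LINT h|N. blinfun_apply (G h) v)"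

lemma (in prob_space) winteg_integrable:
	fixes G :: "'a => 'e::real_normed_vector \<Rightarrow>\<^sub>L real"
	assumes "wmeas M G" "!!h. norm (G h) <= C"
	shows "integrable M (%h. blinfun_apply (G h) v)"
proof(rule Bochner_Integration.integrable_bound[of M "%h. C * norm v"])
	have "norm (blinfun_apply (G h) v) <= norm (C * norm v)" for h
		using norm_blinfun[of "G h" v] mult_right_mono[OF assms(2)[of h],of "norm v"]
			abs_ge_self[of "C * norm v"] by simp
	then show "AE h in M. norm (blinfun_apply (G h) v) <= norm (C * norm v)" by simp
qed (simp_all add: wmeasD[OF assms(1)])

lemma (in prob_space) winteg:
	assumes G:"wmeas M G" "!!h. norm (G h) <= C"
	shows winteg_apply:"blinfun_apply (winteg M G) v = (LINT h|M. blinfun_apply (G h) v)"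
		and winteg_norm:"norm (winteg M G) <= C"
proof -
	have C:"0 <= C" using G(2) norm_ge_zero order_trans by blast
	note i = winteg_integrable[OF G]
	have le:"norm (LINT h|M. blinfun_apply (G h) v) <= norm v * C" for v
	proof -
		have "norm (LINT h|M. blinfun_apply (G h) v) <= (LINT h|M. norm (blinfun_apply (G h) v))"
			by(rule integral_norm_bound)
		also have "... <= (LINT h|M. norm v * C)"
		proof(intro integral_mono integrable_norm i)
			show "norm (blinfun_apply (G h) v) <= norm v * C" for h
				using norm_blinfun[of "G h" v] mult_right_mono[OF G(2)[of h],of "norm v"] by(simp add: mult.commute)
		qed simp
		finally show ?thesis by(simp add: prob_space)
	qed
	have bl:"bounded_linear (%v. LINT h|M. blinfun_apply (G h) v)"
		by(rule bounded_linear_intro[of _ C]) (use i le in \<open>simp_all add: blinfun.add_right blinfun.scaleR_right\<close>)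
	show a:"blinfun_apply (winteg M G) v = (LINT h|M. blinfun_apply (G h) v)" for v
		unfolding winteg_def using bl by(simp add: bounded_linear_Blinfun_apply)
	show "norm (winteg M G) <= C"
		using le by(intro norm_blinfun_bound[OF C]) (simp add: a mult.commute)
qed

lemma (in prob_space) winteg_const:"winteg M (%h. l) = l"
	by(simp add: winteg_def prob_space blinfun_apply_inverse)

lemma winteg_cong_AE:
	assumes "wmeas N G" "wmeas N G'" "AE h in N. G h = G' h"
	shows "winteg N G = winteg N G'"
proof -
	have "(LINT h|N. blinfun_apply (G h) v) = (LINT h|N. blinfun_apply (G' h) v)" for v
		using assms by(intro integral_cong_AE wmeasD) (auto elim: eventually_mono)
	then show ?thesis by(simp add: winteg_def)
qed

lemma (in prob_space) winteg_compose:
	assumes G:"wmeas M G" "!!h. norm (G h) <= C"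
		and GT:"wmeas M (%h. G h o\<^sub>L T)"
	shows "winteg M G o\<^sub>L T = winteg M (%h. G h o\<^sub>L T)"
proof(rule blinfun_eqI)
	fix v
	have "norm (G h o\<^sub>L T) <= C * norm T" for h
		using norm_blinfun_compose[of "G h" T] G(2)[of h] mult_right_mono[of "norm (G h)" C "norm T"] by simp
	from winteg_apply[OF GT this] show "blinfun_apply (winteg M G o\<^sub>L T) v = blinfun_apply (winteg M (%h. G h o\<^sub>L T)) v"
		by(simp add: winteg_apply[OF G])
qed

lemma (in prob_space) winteg_sum:
	assumes "!!i. i : I ==> wmeas M (G i)" "!!i h. i : I ==> norm (G i h) <= C"
	shows "winteg M (%h. \<Sum>i\<in>I. c i *\<^sub>R G i h) = (\<Sum>i\<in>I. c i *\<^sub>R winteg M (G i))"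
proof(rule blinfun_eqI)
	fix v
	have "wmeas M (%h. \<Sum>i\<in>I. c i *\<^sub>R G i h)" using assms(1) by(intro wmeas_sum wmeas_scaleR)
	moreover have "norm (\<Sum>i\<in>I. c i *\<^sub>R G i h) <= (\<Sum>i\<in>I. \<bar>c i\<bar> * C)" for h
		using assms(2) by(intro sum_norm_le) (auto intro: mult_left_mono)
	ultimately have "blinfun_apply (winteg M (%h. \<Sum>i\<in>I. c i *\<^sub>R G i h)) v = (LINT h|M. blinfun_apply (\<Sum>i\<in>I. c i *\<^sub>R G i h) v)"
		by(rule winteg_apply)
	also have "... = (LINT h|M. (\<Sum>i\<in>I. c i * blinfun_apply (G i h) v))"
		by(simp add: blinfun.sum_left blinfun.scaleR_left)
	also have "... = (\<Sum>i\<in>I. c i * (LINT h|M. blinfun_apply (G i h) v))"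
		using winteg_integrable[OF assms] by(subst Bochner_Integration.integral_sum) auto
	also have "... = blinfun_apply (\<Sum>i\<in>I. c i *\<^sub>R winteg M (G i)) v"
		unfolding blinfun.sum_left blinfun.scaleR_left
		by(intro sum.cong refl) (simp add: winteg_apply[OF assms])
	finally show "blinfun_apply (winteg M (%h. \<Sum>i\<in>I. c i *\<^sub>R G i h)) v = blinfun_apply (\<Sum>i\<in>I. c i *\<^sub>R winteg M (G i)) v" .
qed

lemma (in prob_space) winteg_diff:
	assumes "wmeas M G" "!!h. norm (G h) <= C" "wmeas M G'" "!!h. norm (G' h) <= C'"
	shows "winteg M (%h. G h - G' h) = winteg M G - winteg M G'"
proof(rule blinfun_eqI)
	fix v
	have "norm (G h - G' h) <= C + C'" for h
		using norm_triangle_ineq4[of "G h" "G' h"] assms(2,4)[of h] by linarith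
	from winteg_apply[OF wmeas_diff[OF assms(1,3)] this]
	show "blinfun_apply (winteg M (%h. G h - G' h)) v = blinfun_apply (winteg M G - winteg M G') v"
		using winteg_integrable[OF assms(1,2)] winteg_integrable[OF assms(3,4)]
		by(simp add: minus_blinfun.rep_eq winteg_apply[OF assms(1,2)] winteg_apply[OF assms(3,4)])
qed

lemma (in prob_space) winteg_wmeas:
	assumes G:"wmeas (A\<otimes>M) (%p. G (fst p) (snd p))" and b:"!!a h. norm (G a h) <= C"
	shows "wmeas A (%a. winteg M (G a))"
	unfolding wmeas_def
proof
	fix v
	have "(%a. LINT h|M. blinfun_apply (G a h) v) : borel_measurable A"
		using wmeasD[OF G,of v] by(intro borel_measurable_lebesgue_integral) (simp add: case_prod_beta')
	moreover have "blinfun_apply (winteg M (G a)) v = (LINT h|M. blinfun_apply (G a h) v)" if "a : space A" for a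
	proof(rule winteg_apply[OF _ b])
		show "wmeas M (G a)" using wmeas_compose[OF G measurable_Pair1'[OF that]] by simp
	qed
	ultimately show "(%a. blinfun_apply (winteg M (G a)) v) : borel_measurable A"
		by(simp cong: measurable_cong)
qed

section \<open>Coordinates on the fibre powers of the semidirect groupoid\<close>

context semidirect_module
begin

sublocale pf: product_sigma_finite "%_::nat. eta" by unfold_locales

lemma sigma_finite_power:"sigma_finite_measure (PiM {..<n::nat} (%_. eta))"
	by(rule pf.sigma_finite) simp

sublocale pn: pair_sigma_finite "PiM {..<n::nat} (%_. eta)" mu for n
	by(rule pair_sigma_finite.intro[OF sigma_finite_power mu.sigma_finite_measure_axioms])

abbreviation "Tn n \<equiv> PiM {..<n::nat} (%_. eta)\<otimes>mu"
abbreviation "FP n \<equiv> fibre_power_measure \<G> nu kap n"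

definition J :: "nat => (nat => 'g) \<times> 'x => nat => 'g \<times> 'x" where
	"J n z = (\<lambda>i\<in>{..<n}. (fst z i,act (- fst z i) (snd z)))"

text \<open>Inverse of \<open>J n\<close>: an arrow with target \<open>x\<close> is determined by
  its group part, and the common target is read off arrow 0. Hence the hypothesis
  \<open>0 < n\<close> in what follows.\<close>

definition J' :: "nat => (nat => 'g \<times> 'x) => (nat => 'g) \<times> 'x" where
	"J' n a = (\<lambda>i\<in>{..<n}. fst (a i),act (fst (a 0)) (snd (a 0)))"

abbreviation "PA n \<equiv> PiM {..<n::nat} (%_. borel\<otimes>mu :: ('g \<times> 'x) measure)"

lemma space_Tn:"space (Tn n) = ({..<n} \<rightarrow>\<^sub>E UNIV) \<times> space mu"
	by(simp add: space_pair_measure space_PiM)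

lemma fibre_power_eq:"fibre_power \<G> n = {a : space (PA n). ALL i<n. ALL j<n. act (fst (a i)) (snd (a i)) = act (fst (a j)) (snd (a j))}"
	by(auto simp: fibre_power_def space_PiM)

lemma fibre_power_sets:"fibre_power \<G> n : sets (PA n)"
proof -
	have *: "{a : space (PA n). act (fst (a i)) (snd (a i)) = act (fst (a j)) (snd (a j))} : sets (PA n)"
		if "i < n" "j < n" for i j
	proof(rule eq_measurable)
		have [measurable]: "(%a. a i) : PA n ->M borel\<otimes>mu" "(%a. a j) : PA n ->M borel\<otimes>mu"
			using that by(auto intro!: measurable_component_singleton)
		show "(%a. act (fst (a i)) (snd (a i))) : PA n ->M mu" "(%a. act (fst (a j)) (snd (a j))) : PA n ->M mu"
			by measurable
	qed
	have "{a : space (PA n). ALL i:{..<n}. ALL j:{..<n}. act (fst (a i)) (snd (a i)) = act (fst (a j)) (snd (a j))} : sets (PA n)"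
	proof -
		have "{a : space (PA n). ALL i:{..<n}. ALL j:{..<n}. act (fst (a i)) (snd (a i)) = act (fst (a j)) (snd (a j))}
				= space (PA n) - (\<Union>i\<in>{..<n}. \<Union>j\<in>{..<n}. space (PA n) -
						{a : space (PA n). act (fst (a i)) (snd (a i)) = act (fst (a j)) (snd (a j))})" by auto
		also have "... : sets (PA n)"
			by(intro sets.Diff sets.top sets.finite_UN finite_lessThan) (simp add: *)
		finally show ?thesis .
	qed
	then show ?thesis unfolding fibre_power_eq by(simp only: Ball_def lessThan_iff)
qed

text \<open>Measurability is checked on boxes, where the measure is a finite product of measurable
  functions of \<open>x\<close>.\<close>

lemma power_kernel:"(%x. PiM {..<n} (%_. kap x)) : mu ->M prob_algebra (PA n)"
proof(rule measurable_prob_algebra_generated[OF sets_PiM Int_stable_prod_algebra prod_algebra_sets_into_space])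
	fix x assume x:"x : space mu"
	show "prob_space (PiM {..<n} (%_. kap x))" by(rule prob_space_PiM) (rule prob_kappa[OF x])
	show "sets (PiM {..<n} (%_. kap x)) = sets (PA n)" by(intro sets_PiM_cong refl sets_kappa[OF x])
next
	fix A assume "A : prod_algebra {..<n} (%_. borel\<otimes>mu :: ('g \<times> 'x) measure)"
	then obtain E where E:"A = Pi\<^sub>E {..<n} E" "E : (\<Pi> i\<in>{..<n}. sets (borel\<otimes>mu :: ('g \<times> 'x) measure))"
		by(rule prod_algebraE_all)
	have "emeasure (PiM {..<n} (%_. kap x)) A = (\<Prod>i<n. emeasure (kap x) (E i))" if x:"x : space mu" for x
	proof -
		interpret product_sigma_finite "%_::nat. kap x"
			by(intro product_sigma_finite.intro) (rule prob_space_imp_sigma_finite,rule prob_kappa[OF x])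
		show ?thesis unfolding E(1) using E(2) by(intro emeasure_PiM) (auto simp: sets_kappa[OF x])
	qed
	moreover have "(%x. \<Prod>i<n. emeasure (kap x) (E i)) : borel_measurable mu"
		using E(2) by(intro borel_measurable_prod_ennreal emeasure_kappa) auto
	ultimately show "(%x. emeasure (PiM {..<n} (%_. kap x)) A) : borel_measurable mu"
		by(subst measurable_cong) auto
qed

lemma power_bind:
	shows sets_power_bind:"sets (mu1 \<bind> (%x. PiM {..<n} (%_. kap x))) = sets (PA n)"
		and emeasure_power_bind:"A : sets (PA n) ==>
			emeasure (mu1 \<bind> (%x. PiM {..<n} (%_. kap x))) A = (\<integral>\<^sup>+x. emeasure (PiM {..<n} (%_. kap x)) A \<partial>mu1)"
proof -
	have K:"(%x. PiM {..<n} (%_. kap x)) : mu1 ->M prob_algebra (PA n)"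
		using power_kernel by(simp add: measurable_cong_sets[OF sets_mu1 refl])
	have m:"mu1 : space (prob_algebra mu1)"
		by(simp add: space_prob_algebra mu1.prob_space_axioms)
	show "sets (mu1 \<bind> (%x. PiM {..<n} (%_. kap x))) = sets (PA n)" by(rule sets_bind'[OF m K])
	show "A : sets (PA n) ==>
			emeasure (mu1 \<bind> (%x. PiM {..<n} (%_. kap x))) A = (\<integral>\<^sup>+x. emeasure (PiM {..<n} (%_. kap x)) A \<partial>mu1)"
		by(rule emeasure_bind_prob_algebra[OF m K])
qed

lemma sets_FP:"sets (FP n) = sets (restrict_space (PA n) (fibre_power \<G> n))"
	unfolding fibre_power_measure_def by(rule sets_restrict_space_cong[OF sets_power_bind])

lemma space_FP:"space (FP n) = fibre_power \<G> n"
	using sets_eq_imp_space_eq[OF sets_FP,of n] sets.sets_into_space[OF fibre_power_sets,of n]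
	by(simp add: space_restrict_space Int_absorb2)

lemma sets_FP_iff:"A : sets (FP n) <-> A : sets (PA n) & A <= fibre_power \<G> n"
	unfolding sets_FP using sets_restrict_space_iff[of "fibre_power \<G> n" "PA n" A] fibre_power_sets by auto

lemma emeasure_FP:
	assumes "A : sets (FP n)"
	shows "emeasure (FP n) A = (\<integral>\<^sup>+x. emeasure (PiM {..<n} (%_. kap x)) A \<partial>mu1)"
proof -
	have A:"A : sets (PA n)" "A <= fibre_power \<G> n" using assms by(auto simp: sets_FP_iff)
	have "emeasure (FP n) A = emeasure (mu1 \<bind> (%x. PiM {..<n} (%_. kap x))) A"
		unfolding fibre_power_measure_def using A fibre_power_sets
		by(intro emeasure_restrict_space) (auto simp: sets_power_bind)
	then show ?thesis using emeasure_power_bind[OF A(1)] by simp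
qed

lemma component_Tn:"i < n ==> (%z. fst z i) : Tn n ->M borel"
proof -
	assume "i < n"
	then have "(%ga. ga i) : PiM {..<n} (%_. eta) ->M eta" by(intro measurable_component_singleton) simp
	then show ?thesis using measurable_compose[OF measurable_fst[of "PiM {..<n} (%_. eta)" mu]]
		by(simp add: measurable_cong_sets[OF refl sets_eta])
qed

lemma J_fibre_power:"z : space (Tn n) ==> J n z : fibre_power \<G> n"
	by(auto simp: J_def fibre_power_def space_Tn space_pair_measure)

lemma J_measurable:"J n : Tn n ->M FP n"
proof -
	have "J n : Tn n ->M PA n"
		unfolding J_def
	proof(intro measurable_restrict)
		fix i assume "i : {..<n}"
		then have [measurable]: "(%z. fst z i) : Tn n ->M borel" by(intro component_Tn) simp
		show "(%z. (fst z i,act (- fst z i) (snd z))) : Tn n ->M borel\<otimes>mu" by measurable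
	qed
	then have "J n : Tn n ->M restrict_space (PA n) (fibre_power \<G> n)"
		by(intro measurable_restrict_space2) (auto simp: J_fibre_power)
	then show ?thesis by(simp add: measurable_cong_sets[OF refl sets_FP])
qed

lemma J'_measurable: assumes "0 < n" shows "J' n : FP n ->M Tn n"
proof -
	have "J' n : PA n ->M Tn n"
		unfolding J'_def
	proof(intro measurable_Pair measurable_restrict)
		have [measurable]: "(%a. a i) : PA n ->M borel\<otimes>mu" if "i < n" for i
			using that by(auto intro!: measurable_component_singleton)
		show "(%a. fst (a i)) : PA n ->M eta" if "i : {..<n}" for i
		proof -
			have [measurable]: "(%a. a i) : PA n ->M borel\<otimes>mu" using that by(auto intro!: measurable_component_singleton)
			show ?thesis unfolding measurable_cong_sets[OF refl sets_eta] by measurable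
		qed
		have [measurable]: "(%a. a 0) : PA n ->M borel\<otimes>mu" using assms by(auto intro!: measurable_component_singleton)
		show "(%a. act (fst (a 0)) (snd (a 0))) : PA n ->M mu" by measurable
	qed
	then have "J' n : restrict_space (PA n) (fibre_power \<G> n) ->M Tn n" by(rule measurable_restrict_space1)
	then show ?thesis by(simp add: measurable_cong_sets[OF sets_FP refl])
qed

lemma J'_J:"0 < n ==> z : space (Tn n) ==> J' n (J n z) = z"
	by(auto simp: J'_def J_def space_Tn fun_eq_iff restrict_def PiE_def extensional_def prod_eq_iff)

lemma J_J': "0 < n ==> a : space (FP n) ==> J n (J' n a) = a"
proof -
	assume n:"0 < n" and "a : space (FP n)"
	then have a:"a : space (PA n)" "!!i j. i < n ==> j < n ==> act (fst (a i)) (snd (a i)) = act (fst (a j)) (snd (a j))"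
		unfolding space_FP fibre_power_eq by blast+
	show ?thesis
	proof
		fix i show "J n (J' n a) i = a i"
		proof(cases "i < n")
			case True
			then have "snd (a i) : space mu" using a(1) by(auto simp: space_PiM space_pair_measure PiE_iff mem_Times_iff)
			then have "act (- fst (a i)) (act (fst (a 0)) (snd (a 0))) = snd (a i)"
				using a(2)[OF n True] by simp
			then show ?thesis using True by(simp add: J_def J'_def)
		next
			case False
			then show ?thesis using a(1) by(simp add: J_def space_PiM PiE_iff extensional_def)
		qed
	qed
qed

text \<open>For almost every \<open>x\<close> the measure \<open>kap x\<close> has the null sets of
  the image of \<open>eta\<close> under \<open>g \<mapsto> (g, act (- g) x)\<close>. This passes to
  finite powers by \<open>PiM_nonsingular\<close>, applied to that map in one direction and to
  \<open>fst\<close> in the other, and Fubini joins the fibres.\<close>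

lemma null_FP_iff:
	assumes A:"A : sets (FP n)"
	shows "emeasure (FP n) A = 0 <-> (AE z in Tn n. J n z ~: A)"
proof -
	have AP:"A : sets (PA n)" and Asub:"A <= fibre_power \<G> n" using A by(auto simp: sets_FP_iff)
	let ?K = "%x. PiM {..<n} (%_. kap x)" and ?E = "PiM {..<n} (%_. eta)"
	have meas:"(%x. emeasure (?K x) A) : borel_measurable mu1"
		using measurable_compose[OF measurable_prob_algebraD[OF power_kernel] measurable_emeasure_subprob_algebra[OF AP]]
		by(simp add: measurable_cong_sets[OF sets_mu1 refl])
	have "emeasure (FP n) A = 0 <-> (AE x in mu1. emeasure (?K x) A = 0)"
		unfolding emeasure_FP[OF A] by(rule nn_integral_0_iff_AE[OF meas])
	also have "... <-> (AE x in mu. emeasure (?K x) A = 0)" by(rule AE_mu1)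
	also have "... <-> (AE x in mu. AE ga in ?E. J n (ga,x) ~: A)"
	proof -
		have "AE x in mu. emeasure (?K x) A = 0 <-> (AE ga in ?E. J n (ga,x) ~: A)"
			using kappa_null_sets kappa_supported[unfolded AE_mu1] AE_space
		proof eventually_elim
			case (elim x)
			then have x:"x : space mu" by simp
			interpret kx: prob_space "kap x" by(rule prob_kappa[OF x])
			have sK:"sets (?K x) = sets (PA n)" by(intro sets_PiM_cong refl sets_kappa[OF x])
			have jx:"(%g. (g,act (- g) x)) : eta ->M kap x"
				unfolding measurable_cong_sets[OF sets_eta sets_kappa[OF x]] using x by measurable
			show ?case
			proof
				assume "emeasure (?K x) A = 0"
				then have "A : null_sets (?K x)" using AP sK by(auto simp: null_sets_def)
				then have "AE ga in ?E. (\<lambda>i\<in>{..<n}. (ga i,act (- ga i) x)) ~: A"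
					using elim(1)
					by(intro PiM_nonsingular[where f="%i g. (g,act (- g) x)",OF sigma_finite_measure_axioms kx.sigma_finite_measure_axioms jx])
						(auto simp: null_sets_def sets_kappa[OF x])
				then show "AE ga in ?E. J n (ga,x) ~: A" by(simp add: J_def)
			next
				assume "AE ga in ?E. J n (ga,x) ~: A"
				then obtain B where B:"B : null_sets ?E" "!!ga. ga : space ?E ==> ga ~: B ==> J n (ga,x) ~: A"
					by(elim AE_E3) auto
				\<comment> \<open>Under \<open>kap x\<close> the group part of an arrow is absolutely continuous
				  with respect to \<open>eta\<close>, which makes \<open>fst\<close> nonsingular from the fibre
				  to the group.\<close>
				have fst_null:"AE a in kap x. fst a ~: C" if "C : null_sets eta" for C
				proof -
					have C[measurable]: "C : sets borel" using that sets_eta by(auto simp: null_sets_def)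
					let ?C = "{a : space (borel\<otimes>mu :: ('g \<times> 'x) measure). fst a : C}"
					have CA:"?C : sets (borel\<otimes>mu)" by measurable
					have "AE g in eta. (g,act (- g) x) ~: ?C" using AE_not_in[OF that] by eventually_elim simp
					then have "emeasure (kap x) ?C = 0" using elim(1)[rule_format,OF CA] by simp
					then have "?C : null_sets (kap x)" using CA by(auto simp: null_sets_def sets_kappa[OF x])
					from AE_not_in[OF this] AE_space show ?thesis
						by eventually_elim (auto simp: sets_eq_imp_space_eq[OF sets_kappa[OF x]])
				qed
				have fstm:"fst : kap x ->M eta" unfolding measurable_cong_sets[OF sets_kappa[OF x] sets_eta] by measurable
				have 1:"AE a in ?K x. (\<lambda>i\<in>{..<n}. fst (a i)) ~: B"
					by(rule PiM_nonsingular[where f="%i. fst",OF kx.sigma_finite_measure_axioms sigma_finite_measure_axioms fstm fst_null B(1)])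
				have 2:"AE a in ?K x. ALL i:{..<n}. act (fst (a i)) (snd (a i)) = x"
				proof(rule AE_finite_allI)
					fix i assume "i : {..<n}"
					then show "AE a in ?K x. act (fst (a i)) (snd (a i)) = x"
						by(rule AE_PiM_component[where P="%b. act (fst b) (snd b) = x",OF prob_kappa[OF x] _ elim(2)])
				qed simp
				have "AE a in ?K x. a ~: A"
					using 1 2 AE_space
				proof eventually_elim
					case (elim a)
					have a:"a : {..<n} \<rightarrow>\<^sub>E UNIV \<times> space mu"
						using elim(3) sets_eq_imp_space_eq[OF sK] by(simp add: space_PiM space_pair_measure)
					have "J n (\<lambda>i\<in>{..<n}. fst (a i),x) = a"
					proof
						fix i
						show "J n (\<lambda>i\<in>{..<n}. fst (a i),x) i = a i"
						proof(cases "i < n")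
							case True
							then have "snd (a i) : space mu" "act (fst (a i)) (snd (a i)) = x" using a elim(2) by(auto simp: PiE_iff mem_Times_iff)
							then have "act (- fst (a i)) x = snd (a i)" by auto
							then show ?thesis using True by(simp add: J_def)
						next
							case False
							then show ?thesis using a by(simp add: J_def PiE_iff extensional_def)
						qed
					qed
					moreover have "(\<lambda>i\<in>{..<n}. fst (a i)) : space ?E" by(simp add: space_PiM)
					ultimately show ?case using B(2)[OF _ elim(1)] by simp
				qed
				then show "emeasure (?K x) A = 0"
					using AP sK AE_iff_null_sets[of A "?K x"] by(auto simp: null_sets_def)
			qed
		qed
		then show ?thesis by(rule eventually_subst)
	qed
	also have "... <-> (AE ga in ?E. AE x in mu. J n (ga,x) ~: A)"
	proof(rule pn.AE_commute[symmetric])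
		show "{z : space (Tn n). J n (fst z,snd z) ~: A} : sets (Tn n)"
		proof -
			have "{z : space (Tn n). J n (fst z,snd z) ~: A} = space (Tn n) - (J n -` A Int space (Tn n))" by auto
			then show ?thesis using measurable_sets[OF J_measurable A] by(simp only: sets.Diff sets.top)
		qed
	qed
	also have "... <-> (AE z in Tn n. J n z ~: A)"
	proof(subst pn.AE_pair_iff)
		show "{z : space (Tn n). J n (fst z,snd z) ~: A} : sets (Tn n)"
		proof -
			have "{z : space (Tn n). J n (fst z,snd z) ~: A} = space (Tn n) - (J n -` A Int space (Tn n))" by auto
			then show ?thesis using measurable_sets[OF J_measurable A] by(simp only: sets.Diff sets.top)
		qed
	qed simp
	finally show ?thesis .
qed

text \<open>Only null sets of the fibre powers enter the definitions of cochains, so from here on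
  the groupoid can be replaced by tuples of group elements together with a point.\<close>

lemma AE_FP_iff:
	assumes n:"0 < n"
	shows "(AE a in FP n. P a) <-> (AE z in Tn n. P (J n z))"
proof
	assume "AE a in FP n. P a"
	then obtain N where N:"N : null_sets (FP n)" "!!a. a : space (FP n) ==> a ~: N ==> P a"
		by(elim AE_E3) auto
	have "AE z in Tn n. J n z ~: N" using null_FP_iff[of N n] N(1) by(auto simp: null_sets_def)
	then show "AE z in Tn n. P (J n z)"
		using AE_space by eventually_elim (use N(2) J_fibre_power in \<open>simp add: space_FP\<close>)
next
	assume "AE z in Tn n. P (J n z)"
	then obtain N where N:"N : null_sets (Tn n)" "!!z. z : space (Tn n) ==> z ~: N ==> P (J n z)"
		by(elim AE_E3) auto
	let ?A = "J' n -` N Int space (FP n)"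
	have A:"?A : sets (FP n)" using N(1) by(intro measurable_sets[OF J'_measurable[OF n]]) auto
	have "AE z in Tn n. J n z ~: ?A"
		using AE_not_in[OF N(1)] AE_space by eventually_elim (simp add: J'_J[OF n])
	then have "?A : null_sets (FP n)" using null_FP_iff[OF A] A by(auto simp: null_sets_def)
	from AE_not_in[OF this] AE_space show "AE a in FP n. P a"
	proof eventually_elim
		case (elim a)
		have "J' n a : space (Tn n)" using measurable_space[OF J'_measurable[OF n] elim(2)] .
		moreover have "J' n a ~: N" using elim by simp
		ultimately show ?case using N(2)[of "J' n a"] J_J'[OF n elim(2)] by simp
	qed
qed

end

section \<open>The representation on \<open>L\<^sup>1\<close>\<close>

context semidirect_module
begin

sublocale ee: pair_sigma_finite eta eta ..

lemma Lb_wmeas:"wmeas (borel\<otimes>mu) Lb"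
	using module unfolding measurable_coefficient_module_def wmeas_def by simp

lemma Lb_norm:"x : space mu ==> norm (blinfun_apply (Lb (g,x)) v) = norm v"
	using module unfolding measurable_coefficient_module_def by(simp add: space_pair_measure)

lemma distr_pair_power:"distr (eta\<otimes>eta) (PiM {..<2::nat} (%_. eta)) (%p. \<lambda>i\<in>{..<2}. if i = 0 then fst p else snd p)
		= PiM {..<2} (%_. eta)"
proof(rule pf.PiM_eqI)
	let ?f = "%p. \<lambda>i\<in>{..<2::nat}. if i = 0 then fst p else snd p :: 'g"
	have m:"?f : eta\<otimes>eta ->M PiM {..<2} (%_. eta)"
	proof(rule measurable_restrict)
		show "(%p. if i = 0 then fst p else snd p) : eta\<otimes>eta ->M eta" for i :: nat by(cases "i = 0") simp_all
	qed
	fix A :: "nat => 'g set" assume A:"!!i. i : {..<2} ==> A i : sets eta"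
	have "?f p : Pi\<^sub>E {..<2} A <-> p : A 0 \<times> A 1" for p
		by(simp add: restrict_PiE_iff numeral_2_eq_2 lessThan_Suc mem_Times_iff conj_commute)
	then have "?f -` (Pi\<^sub>E {..<2} A) Int space (eta\<otimes>eta) = A 0 \<times> A 1"
		by(simp add: space_pair_measure vimage_def)
	then have "emeasure (distr (eta\<otimes>eta) (PiM {..<2} (%_. eta)) ?f) (Pi\<^sub>E {..<2} A) = emeasure (eta\<otimes>eta) (A 0 \<times> A 1)"
		using A by(subst emeasure_distr[OF m]) (auto intro!: sets_PiM_I_finite)
	also have "... = emeasure eta (A 0) * emeasure eta (A 1)" using A by(intro emeasure_pair_measure_Times) auto
	finally show "emeasure (distr (eta\<otimes>eta) (PiM {..<2} (%_. eta)) ?f) (Pi\<^sub>E {..<2} A) = (\<Prod>i<2. emeasure eta (A i))"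
		by(simp add: numeral_2_eq_2)
qed simp_all

text \<open>A composable pair comes from two arrows \<open>a 0\<close>, \<open>a 1\<close> with
  common target by inverting the first. Inverting its group part and moving the base point by
  \<open>- fst p\<close> brings the almost-everywhere cocycle identity into this form.\<close>

lemma Lb_mult:
	"AE p in eta\<otimes>eta. AE y in mu. Lb (fst p + snd p,act (- (fst p + snd p)) y) =
		Lb (fst p,act (- fst p) y) o\<^sub>L Lb (snd p,act (- snd p) (act (- fst p) y))"
proof -
	let ?phi = "%a :: nat => 'g \<times> 'x. ((- fst (a 0),act (fst (a 0)) (snd (a 0))),a 1)"
	have comp:"composable_measure \<G> nu kap = distr (FP 2) (restrict_space ((borel\<otimes>mu)\<otimes>(borel\<otimes>mu)) (composable \<G>)) ?phi"
		by(simp add: composable_measure_def)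
	have "?phi : PA 2 ->M (borel\<otimes>mu)\<otimes>(borel\<otimes>mu)"
	proof -
		have [measurable]: "(%a. a 0) : PA 2 ->M borel\<otimes>mu" "(%a. a 1) : PA 2 ->M borel\<otimes>mu"
			by(auto intro!: measurable_component_singleton)
		show ?thesis by measurable
	qed
	then have "?phi : FP 2 ->M (borel\<otimes>mu)\<otimes>(borel\<otimes>mu)"
		unfolding measurable_cong_sets[OF sets_FP refl] by(rule measurable_restrict_space1)
	then have phi:"?phi : FP 2 ->M restrict_space ((borel\<otimes>mu)\<otimes>(borel\<otimes>mu)) (composable \<G>)"
	proof(rule measurable_restrict_space2[rotated])
		show "?phi : space (FP 2) \<rightarrow> composable \<G>"
		proof
			fix a assume "a : space (FP 2)"
			then have a:"a : space (PA 2)" "act (fst (a 0)) (snd (a 0)) = act (fst (a 1)) (snd (a 1))"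
				unfolding space_FP fibre_power_eq by(blast,simp)
			then have "a 0 : UNIV \<times> space mu" "a 1 : UNIV \<times> space mu"
				by(auto simp: space_PiM PiE_iff space_pair_measure)
			then show "?phi a : composable \<G>" using a(2) by(auto simp: composable_def space_pair_measure)
		qed
	qed
	have "AE a in FP 2. Lb (- fst (a 0) + fst (a 1),snd (a 1)) = Lb (- fst (a 0),act (fst (a 0)) (snd (a 0))) o\<^sub>L Lb (a 1)"
	proof -
		have "AE p in composable_measure \<G> nu kap. Lb (gcomp \<G> (fst p) (snd p)) = Lb (fst p) o\<^sub>L Lb (snd p)"
			using module unfolding measurable_coefficient_module_def by(simp add: case_prod_beta')
		from AE_distrD[OF phi this[unfolded comp]] show ?thesis by simp
	qed
	then have "AE z in Tn 2. Lb (- fst z 0 + fst z 1,act (- fst z 1) (snd z)) = Lb (- fst z 0,snd z) o\<^sub>L Lb (fst z 1,act (- fst z 1) (snd z))"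
		unfolding AE_FP_iff[OF pos2] using AE_space
	proof eventually_elim
		case (elim z)
		have x:"snd z : space mu" using elim(2) by(auto simp: space_pair_measure)
		have J:"J 2 z 0 = (fst z 0,act (- fst z 0) (snd z))" "J 2 z 1 = (fst z 1,act (- fst z 1) (snd z))"
			by(simp_all add: J_def)
		show ?case using elim(1) unfolding J fst_conv snd_conv act_inv[OF x] .
	qed
	from pn.AE_pair[OF this]
	have "AE ga in PiM {..<2::nat} (%_. eta). AE x in mu. Lb (- ga 0 + ga 1,act (- ga 1) x) = Lb (- ga 0,x) o\<^sub>L Lb (ga 1,act (- ga 1) x)"
		by(simp only: fst_conv snd_conv)
	then have "AE ga in distr (eta\<otimes>eta) (PiM {..<2::nat} (%_. eta)) (%p. \<lambda>i\<in>{..<2}. if i = 0 then fst p else snd p).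
			AE x in mu. Lb (- ga 0 + ga 1,act (- ga 1) x) = Lb (- ga 0,x) o\<^sub>L Lb (ga 1,act (- ga 1) x)"
		unfolding distr_pair_power .
	then have "AE p in eta\<otimes>eta. AE x in mu. Lb (- fst p + snd p,act (- snd p) x) = Lb (- fst p,x) o\<^sub>L Lb (snd p,act (- snd p) x)"
	proof(rule AE_distrD[rotated,THEN eventually_mono])
		show "(%p. \<lambda>i\<in>{..<2::nat}. if i = 0 then fst p else snd p) : eta\<otimes>eta ->M PiM {..<2} (%_. eta)"
		proof(rule measurable_restrict)
			show "(%p. if i = 0 then fst p else snd p) : eta\<otimes>eta ->M eta" for i :: nat by(cases "i = 0") simp_all
		qed
	qed simp
	\<comment> \<open>The exceptional pairs are enclosed in a measurable null set, to which Fubini and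
	  inversion of the first coordinate can be applied.\<close>
	then obtain N where N:"N : null_sets (eta\<otimes>eta)" "!!a b. (a,b) ~: N ==>
			AE x in mu. Lb (- a + b,act (- b) x) = Lb (- a,x) o\<^sub>L Lb (b,act (- b) x)"
		by(elim AE_E3) (auto simp: space_pair_measure)
	have N_sets:"N : sets (borel\<otimes>borel)"
		using N(1) sets_pair_measure_cong[OF sets_eta sets_eta] by(auto simp: null_sets_def)
	have [measurable]: "N : sets (borel\<otimes>borel)" by(rule N_sets)
	have "AE z in eta\<otimes>eta. (fst z,snd z) ~: N" using AE_not_in[OF N(1)] by simp
	then have "AE a in eta. AE b in eta. (a,b) ~: N" by(subst ee.AE_pair_iff) measurable
	then have "AE a in eta. AE b in eta. (- a,b) ~: N" by(rule AE_uminus)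
	then have "AE p in eta\<otimes>eta. (- fst p,snd p) ~: N" by(subst (asm) ee.AE_pair_iff) measurable
	then show ?thesis
	proof eventually_elim
		case (elim p)
		from AE_act[OF N(2)[OF elim],of "- fst p"] show ?case
			using AE_space
			by eventually_elim (simp add: minus_add act_add[of _ "- snd p" "- fst p",simplified])
	qed
qed

section \<open>The Radon-Nikodym cocycle of the action and the weighted translation operators on
  L1\<close>

definition rn :: "'g => 'x => real" where
	"rn h y = enn2real (RN_deriv mu (distr mu mu (act h)) y)"

lemma act_h_measurable:"act h : mu ->M mu"
	by measurable

lemma rn_measurable [measurable]: "rn h : borel_measurable mu"
	unfolding rn_def by measurable

lemma rn_nonneg:"0 <= rn h y"
	by(simp add: rn_def)

text \<open>Moving a countable cover of finite measure by \<open>act h\<close> gives such a cover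
  for the image measure. This makes the Radon-Nikodym derivative finite, so that \<open>rn\<close>
  may be real valued.\<close>

lemma sigma_finite_distr_act:"sigma_finite_measure (distr mu mu (act h))"
proof -
	obtain A where A:"countable A" "A <= sets mu" "\<Union>A = space mu" "!!a. a : A ==> emeasure mu a ~= \<infinity>"
		using mu.sigma_finite_countable by blast
	let ?p = "%a. act (- h) -` a Int space mu"
	have p:"?p a : sets mu" if "a : A" for a
		using that A(2) by(intro measurable_sets[OF act_h_measurable]) auto
	have e:"emeasure (distr mu mu (act h)) (?p a) = emeasure mu a" if a:"a : A" for a
	proof -
		have "a <= space mu" using A(2) a sets.sets_into_space by blast
		then have "act h -` ?p a Int space mu = a" by(auto simp: subset_iff)
		then show ?thesis by(simp add: emeasure_distr[OF act_h_measurable p[OF a]])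
	qed
	show ?thesis
	proof
		show "EX B. countable B & B <= sets (distr mu mu (act h)) & \<Union>B = space (distr mu mu (act h)) &
				(ALL a:B. emeasure (distr mu mu (act h)) a ~= \<infinity>)"
		proof(intro exI[of _ "?p ` A"] conjI)
			have "\<Union>(?p ` A) = act (- h) -` \<Union>A Int space mu" by auto
			then show "\<Union>(?p ` A) = space (distr mu mu (act h))" using A(3) by auto
		qed (use A(1,4) p e in auto)
	qed
qed

lemma distr_act_density:"distr mu mu (act h) = density mu (%y. ennreal (rn h y))"
proof -
	have eq:"equiv_measures (distr mu mu (act h)) mu" using G_space by(simp add: lebesgue_G_space_def)
	then have ac:"absolutely_continuous mu (distr mu mu (act h))" by(simp add: equiv_measures_def)
	have "AE y in mu. RN_deriv mu (distr mu mu (act h)) y ~= \<infinity>"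
		by(rule mu.RN_deriv_finite[OF sigma_finite_distr_act ac]) simp
	then have "density mu (%y. ennreal (rn h y)) = density mu (RN_deriv mu (distr mu mu (act h)))"
		by(intro density_cong,measurable,eventually_elim) (simp add: rn_def less_top)
	then show ?thesis using mu.density_RN_deriv[OF ac] by simp
qed

lemma rn_integral:
	fixes phi :: "'x => 'c::{banach,second_countable_topology}"
	assumes [measurable]: "phi : borel_measurable mu"
	shows rn_integrable_iff:"integrable mu (%y. rn h y *\<^sub>R phi y) <-> integrable mu (%x. phi (act h x))"
		and rn_integral_eq:"(LINT y|mu. rn h y *\<^sub>R phi y) = (LINT x|mu. phi (act h x))"
proof -
	have "integrable mu (%y. rn h y *\<^sub>R phi y) <-> integrable (distr mu mu (act h)) phi"
		unfolding distr_act_density by(rule integrable_density[symmetric]) (auto simp: rn_nonneg)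
	also have "... <-> integrable mu (%x. phi (act h x))"
		by(rule integrable_distr_eq[OF act_h_measurable]) simp
	finally show "integrable mu (%y. rn h y *\<^sub>R phi y) <-> integrable mu (%x. phi (act h x))" .
	have "(LINT y|mu. rn h y *\<^sub>R phi y) = (LINT y|distr mu mu (act h). phi y)"
		unfolding distr_act_density by(rule integral_density[symmetric]) (auto simp: rn_nonneg)
	also have "... = (LINT x|mu. phi (act h x))"
		by(rule integral_distr[OF act_h_measurable]) simp
	finally show "(LINT y|mu. rn h y *\<^sub>R phi y) = (LINT x|mu. phi (act h x))" .
qed

lemma rn_add:"AE y in mu. rn (h + b) y = rn h y * rn b (act (- h) y)"
proof -
	have [measurable]: "act h : mu ->M mu" "act b : mu ->M mu" by measurable
	have m:"(%y. ennreal (rn b (act (- h) y))) : borel_measurable mu" by measurable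
	have "distr mu mu (act (h + b)) = distr mu mu (act h \<circ> act b)"
		by(rule distr_cong) (simp_all add: act_add)
	also have "... = distr (distr mu mu (act b)) mu (act h)" by(rule distr_distr[symmetric]) measurable
	also have "... = distr (density mu (%x. ennreal (rn b x))) mu (act h)" by(simp only: distr_act_density)
	also have "density mu (%x. ennreal (rn b x)) = density mu (%x. ennreal (rn b (act (- h) (act h x))))"
		by(rule density_cong) (auto intro!: AE_I2,measurable)
	also have "distr (density mu (%x. ennreal (rn b (act (- h) (act h x))))) mu (act h)
			= density (distr mu mu (act h)) (%y. ennreal (rn b (act (- h) y)))"
		by(rule density_distr[symmetric]) measurable
	also have "... = density mu (%y. ennreal (rn h y) * ennreal (rn b (act (- h) y)))"
		unfolding distr_act_density by(rule density_density_eq) measurable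
	finally have "density mu (%y. ennreal (rn (h + b) y)) = density mu (%y. ennreal (rn h y) * ennreal (rn b (act (- h) y)))"
		unfolding distr_act_density .
	then have "AE y in mu. ennreal (rn (h + b) y) = ennreal (rn h y) * ennreal (rn b (act (- h) y))"
		by(subst (asm) mu.density_unique_iff) measurable
	then show ?thesis
		by eventually_elim (simp add: ennreal_mult[symmetric] rn_nonneg)
qed

text \<open>The operator whose transpose is
  \<open>l \<mapsto> l (act h x) o\<^sub>L Lb (h,x)\<close>, as \<open>Uf_pairing\<close> shows; the
  Radon-Nikodym factor makes it isometric on L1.\<close>

definition Uf :: "'g => ('x => 'e) => 'x => 'e" where
	"Uf h f y = rn h y *\<^sub>R blinfun_apply (Lb (h,act (- h) y)) (f (act (- h) y))"

lemma Lb_section:"T : M ->M borel ==> S : M ->M mu ==> wmeas M (%z. Lb (T z,S z))"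
	by(rule wmeas_compose[OF Lb_wmeas,of "%z. (T z,S z)"]) (rule measurable_Pair)

lemma Uf_aux:"f : borel_measurable mu ==>
		(%y. blinfun_apply (Lb (h,act (- h) y)) (f (act (- h) y))) : borel_measurable mu"
	by(rule wmeas_apply[OF Lb_section[OF measurable_const act_h_measurable] measurable_compose[OF act_h_measurable]])
		simp_all

lemma Uf_integrable:"integrable mu f ==> integrable mu (Uf h f)"
	and Uf_norm:"integrable mu f ==> (LINT x|mu. norm (Uf h f x)) = (LINT x|mu. norm (f x))"
	and Uf_pairing:"l : Linf_functions mu ==> integrable mu f ==>
		(LINT x|mu. blinfun_apply (l x) (Uf h f x)) = (LINT x|mu. blinfun_apply (l (act h x)) (blinfun_apply (Lb (h,x)) (f x)))"
proof -
	assume f:"integrable mu f"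
	let ?phi = "%y. blinfun_apply (Lb (h,act (- h) y)) (f (act (- h) y))"
	have phi[measurable]: "?phi : borel_measurable mu" using f by(intro Uf_aux) auto
	have n:"norm (?phi (act h x)) = norm (f x)" if "x : space mu" for x
		using that by(simp add: Lb_norm)
	have "integrable mu (%x. ?phi (act h x))"
	proof(rule Bochner_Integration.integrable_bound[OF f])
		show "(%x. ?phi (act h x)) : borel_measurable mu" by(rule measurable_compose[OF act_h_measurable phi])
		show "AE x in mu. norm (?phi (act h x)) <= norm (f x)" by(rule AE_I2) (simp only: n order_refl)
	qed
	then show "integrable mu (Uf h f)" unfolding Uf_def[abs_def] by(subst rn_integrable_iff[OF phi])
	have "(LINT x|mu. norm (Uf h f x)) = (LINT x|mu. rn h x *\<^sub>R norm (?phi x))"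
		by(simp add: Uf_def rn_nonneg)
	also have "... = (LINT x|mu. norm (?phi (act h x)))" by(rule rn_integral_eq) measurable
	also have "... = (LINT x|mu. norm (f x))" by(rule Bochner_Integration.integral_cong) (simp_all add: Lb_norm)
	finally show "(LINT x|mu. norm (Uf h f x)) = (LINT x|mu. norm (f x))" .
	assume l:"l : Linf_functions mu"
	have "(LINT x|mu. blinfun_apply (l x) (Uf h f x)) = (LINT x|mu. rn h x *\<^sub>R blinfun_apply (l x) (?phi x))"
		by(simp add: Uf_def blinfun.scaleR_right)
	also have "... = (LINT x|mu. blinfun_apply (l (act h x)) (?phi (act h x)))"
		using l by(intro rn_integral_eq wmeas_apply phi) (auto simp: Linf_functions_iff)
	also have "... = (LINT x|mu. blinfun_apply (l (act h x)) (blinfun_apply (Lb (h,x)) (f x)))"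
		by(rule Bochner_Integration.integral_cong) auto
	finally show "(LINT x|mu. blinfun_apply (l x) (Uf h f x)) = (LINT x|mu. blinfun_apply (l (act h x)) (blinfun_apply (Lb (h,x)) (f x)))" .
qed

lemma Uf_cong:"AE x in mu. f x = f' x ==> AE x in mu. Uf h f x = Uf h f' x"
	unfolding Uf_def by(drule AE_act[of _ "- h"]) (auto elim: eventually_mono)

text \<open>The exceptional set of pairs comes from \<open>Lb_mult\<close> alone, since
  \<open>rn_add\<close> holds for every pair. It therefore serves all \<open>f\<close> at once, as
  \<open>strictify\<close> requires.\<close>

lemma Uf_mult:"AE p in eta\<otimes>eta. ALL f. AE y in mu. Uf (fst p + snd p) f y = Uf (fst p) (Uf (snd p) f) y"
	using Lb_mult
proof eventually_elim
	case (elim p)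
	show ?case
	proof
		fix f
		show "AE y in mu. Uf (fst p + snd p) f y = Uf (fst p) (Uf (snd p) f) y"
			using elim rn_add[of "fst p" "snd p"] AE_space
		proof eventually_elim
			case (elim y)
			have "act (- (fst p + snd p)) y = act (- snd p) (act (- fst p) y)"
				using act_add[OF elim(3),of "- snd p" "- fst p"] by(simp only: minus_add)
			then show ?case using elim(1,2) by(simp add: Uf_def blinfun.scaleR_right)
		qed
	qed
qed

abbreviation "W \<equiv> L1 mu :: ('x => 'e) set seminormed_space"
abbreviation "V \<equiv> Linf mu :: ('x => 'e \<Rightarrow>\<^sub>L real) set seminormed_space"

sublocale W: normed_vspace W by(rule normed_vspace_L1)
sublocale V: normed_vspace V by(rule normed_vspace_Linf)

definition U :: "'g => ('x => 'e) set => ('x => 'e) set" where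
	"U h B = L1cls mu (Uf h (SOME f. integrable mu f & B = L1cls mu f))"

lemma W_mem:"integrable mu f ==> L1cls mu f : vcarrier W"
	unfolding carrier_L1 by(rule imageI) simp

lemma W_cases:
	assumes "B : vcarrier W" obtains f where "integrable mu f" "B = L1cls mu f"
	using assms unfolding carrier_L1 by(elim imageE) simp

lemma V_mem:"l : Linf_functions mu ==> Lcls mu l : vcarrier V"
	unfolding carrier_Linf by(rule imageI)

lemma V_cases:
	assumes "A : vcarrier V" obtains l where "l : Linf_functions mu" "A = Lcls mu l"
	using assms unfolding carrier_Linf by(elim imageE) simp

lemma U_cls: assumes f:"integrable mu f" shows "U h (L1cls mu f) = L1cls mu (Uf h f)"
proof -
	define f' where "f' = (SOME f'. integrable mu f' & L1cls mu f = L1cls mu f')"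
	have f': "integrable mu f' & L1cls mu f = L1cls mu f'"
		unfolding f'_def by(rule someI[of _ f]) (simp add: f)
	then have "AE x in mu. f x = f' x" using L1cls_eq_iff[OF f,of f'] by simp
	then have "AE x in mu. Uf h f' x = Uf h f x" by(intro Uf_cong) (auto elim: eventually_mono)
	then have "L1cls mu (Uf h f') = L1cls mu (Uf h f)"
		using L1cls_eq_iff[OF Uf_integrable[of f' h] Uf_integrable[OF f,of h]] f' by simp
	then show ?thesis by(simp only: U_def f'_def)
qed

lemma U_closed:"B : vcarrier W ==> U h B : vcarrier W"
	by(elim W_cases) (simp add: U_cls W_mem Uf_integrable)

lemma U_add:"B : vcarrier W ==> B' : vcarrier W ==> U h (vadd W B B') = vadd W (U h B) (U h B')"
proof(elim W_cases)
	fix f f' assume f:"integrable mu f" "integrable mu f'" and B:"B = L1cls mu f" "B' = L1cls mu f'"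
	have "Uf h (%x. f x + f' x) = (%x. Uf h f x + Uf h f' x)"
		by(auto simp: Uf_def blinfun.add_right scaleR_add_right)
	then show ?thesis
		using f U_cls[of "%x. f x + f' x" h] unfolding B
		by(simp add: add_L1 U_cls Uf_integrable)
qed

lemma U_scale:"B : vcarrier W ==> U h (vscale W r B) = vscale W r (U h B)"
proof(elim W_cases)
	fix f assume f:"integrable mu f" and B:"B = L1cls mu f"
	have "Uf h (%x. r *\<^sub>R f x) = (%x. r *\<^sub>R Uf h f x)"
		by(auto simp: Uf_def blinfun.scaleR_right)
	then show ?thesis
		using f U_cls[of "%x. r *\<^sub>R f x" h] unfolding B
		by(simp add: scale_L1 U_cls Uf_integrable)
qed

lemma U_norm:"B : vcarrier W ==> vnorm W (U h B) = vnorm W B"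
	by(elim W_cases) (simp add: U_cls norm_L1 Uf_integrable Uf_norm)

lemma U_inj:"inj_on (U h) (vcarrier W)"
proof(rule inj_onI)
	fix B B' assume B:"B : vcarrier W" "B' : vcarrier W" "U h B = U h B'"
	let ?D = "vadd W B (vscale W (-1) B')"
	have D:"?D : vcarrier W" using B by(simp add: W.add_closed W.scale_closed)
	have "U h ?D = vzero W"
		using B by(simp add: U_add U_scale W.scale_closed W.add_uminus U_closed)
	then have "vnorm W ?D = 0" using U_norm[OF D,of h] W.norm_zero by simp
	then show "B = B'" using W.norm_eq_zero_iff[OF D] W.diff_eq_zero_iff[OF B(1,2)] by simp
qed

lemma U_mult:"AE p in eta\<otimes>eta. ALL B:vcarrier W. U (fst p + snd p) B = U (fst p) (U (snd p) B)"
	using Uf_mult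
proof eventually_elim
	case (elim p)
	show ?case
	proof
		fix B assume "B : vcarrier W"
		then obtain f where f:"integrable mu f" "B = L1cls mu f" by(rule W_cases)
		have "L1cls mu (Uf (fst p + snd p) f) = L1cls mu (Uf (fst p) (Uf (snd p) f))"
			unfolding L1cls_eq_iff[OF Uf_integrable[OF f(1)] Uf_integrable[OF Uf_integrable[OF f(1)]]]
			using elim by(rule spec)
		then show "U (fst p + snd p) B = U (fst p) (U (snd p) B)"
			unfolding f(2) U_cls[OF f(1)] U_cls[OF Uf_integrable[OF f(1)]] .
	qed
qed

text \<open>Measurability of the orbit maps needs a density that is jointly measurable in the group
	element and the point; it agrees with \<open>rn\<close> for almost every group element.\<close>

lemma joint_density:
	obtains D where "D : borel_measurable (eta\<otimes>mu)" "AE h in eta. AE y in mu. D (h,y) = ennreal (rn h y)"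
proof -
	let ?s = "%z. (fst z,act (fst z) (snd z)) :: 'g \<times> 'x"
	let ?P = "eta\<otimes>mu"
	have s:"?s : ?P ->M ?P"
		unfolding measurable_cong_sets[OF sets_arrows_eta[symmetric] sets_arrows_eta[symmetric]] by measurable
	\<comment> \<open>Each \<open>act h\<close> preserves null sets, so by Fubini the shear
	  \<open>?s\<close> does too, and the density on the product exists.\<close>
	have "absolutely_continuous ?P (distr ?P ?P ?s)"
		unfolding absolutely_continuous_def
	proof
		fix A assume A:"A : null_sets ?P"
		then have As:"A : sets ?P" by auto
		have "AE z in ?P. (fst z,snd z) ~: A" using AE_not_in[OF A] by simp
		then have "AE h in eta. AE x in mu. (h,x) ~: A" using eta_mu.AE_pair[of "%z. z ~: A"] by simp
		then have "AE h in eta. AE x in mu. (h,act h x) ~: A" by(rule eventually_mono) (rule AE_act)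
		moreover have "{z : space ?P. ?s z ~: A} : sets ?P"
		proof -
			have "{z : space ?P. ?s z ~: A} = space ?P - (?s -` A Int space ?P)" by auto
			then show ?thesis using measurable_sets[OF s As] by(simp only: sets.Diff sets.top)
		qed
		ultimately have "AE z in ?P. ?s z ~: A" using eta_mu.AE_pair_measure[of "%z. ?s z ~: A"] by simp
		then have "?s -` A Int space ?P : null_sets ?P"
			using measurable_sets[OF s As] by(subst AE_iff_null_sets) auto
		then show "A : null_sets (distr ?P ?P ?s)" by(simp add: null_sets_distr_iff[OF s] As)
	qed
	then have dens:"density ?P (RN_deriv ?P (distr ?P ?P ?s)) = distr ?P ?P ?s"
		by(rule eta_mu.P.density_RN_deriv) simp
	define D where "D = RN_deriv ?P (distr ?P ?P ?s)"
	have D:"D : borel_measurable ?P" unfolding D_def by measurable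
	obtain w :: "'x => real" where w[measurable]: "w : borel_measurable mu"
		and w0:"!!x. w x > 0" and wi:"integrable mu w"
		using mu.obtain_positive_integrable_function by metis
	\<comment> \<open>After the shear this weight becomes \<open>w x\<close>. It makes the two measures
	  compared for fixed \<open>h\<close> finite, so that agreement on a countable generator is enough,
	  and being positive and finite it cancels at the end.\<close>
	let ?w = "%z. ennreal (w (act (- fst z) (snd z)))"
	have wP:"?w : borel_measurable ?P"
		unfolding measurable_cong_sets[OF sets_arrows_eta[symmetric] refl] by measurable
	have int:"(\<integral>\<^sup>+z. D z * phi z \<partial>?P) = (\<integral>\<^sup>+z. phi (?s z) \<partial>?P)" if "phi : borel_measurable ?P" for phi
	proof -
		have "(\<integral>\<^sup>+z. D z * phi z \<partial>?P) = (\<integral>\<^sup>+z. phi z \<partial>density ?P D)"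
			using D that by(intro nn_integral_density[symmetric]) auto
		also have "... = (\<integral>\<^sup>+z. phi z \<partial>distr ?P ?P ?s)" using dens by(simp add: D_def)
		also have "... = (\<integral>\<^sup>+z. phi (?s z) \<partial>?P)" using that by(intro nn_integral_distr[OF s]) simp
		finally show ?thesis .
	qed
	let ?I = "%C h. \<integral>\<^sup>+y. D (h,y) * (?w (h,y) * indicator C y) \<partial>mu"
	let ?I' = "%C h. \<integral>\<^sup>+x. ennreal (w x) * indicator C (act h x) \<partial>mu"
	have eqC:"AE h in eta. ?I C h = ?I' C h" if C:"C : sets mu" for C
	proof -
		have C2:"(%z. indicator C (snd z) :: ennreal) : borel_measurable ?P"
			using C by(intro measurable_compose[OF measurable_snd]) simp
		have m1:"(%z. D z * (?w z * indicator C (snd z))) : borel_measurable ?P"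
			using D wP C2 by(intro borel_measurable_times_ennreal)
		have m2:"(%z. ennreal (w (snd z)) * indicator C (act (fst z) (snd z))) : borel_measurable ?P"
		proof -
			have [measurable]: "C : sets mu" by(rule C)
			show ?thesis unfolding measurable_cong_sets[OF sets_arrows_eta[symmetric] refl] by measurable
		qed
		have I:"?I C : borel_measurable eta" using mu.borel_measurable_nn_integral_fst[OF m1] by simp
		have I': "?I' C : borel_measurable eta" using mu.borel_measurable_nn_integral_fst[OF m2] by simp
		have "density eta (?I C) = density eta (?I' C)"
		proof(rule measure_eqI)
			fix K assume "K : sets (density eta (?I C))"
			then have K:"K : sets eta" by simp
			have K1:"(%z. indicator K (fst z) :: ennreal) : borel_measurable ?P"
				using K by(intro measurable_compose[OF measurable_fst]) simp
			have "emeasure (density eta (?I C)) K = (\<integral>\<^sup>+h. ?I C h * indicator K h \<partial>eta)"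
				by(rule emeasure_density[OF I K])
			also have "... = (\<integral>\<^sup>+h. \<integral>\<^sup>+y. D (h,y) * (?w (h,y) * indicator C y) * indicator K h \<partial>mu \<partial>eta)"
				using measurable_Pair2[OF m1] by(intro nn_integral_cong nn_integral_multc[symmetric]) simp
			also have "... = (\<integral>\<^sup>+z. D z * (?w z * indicator C (snd z)) * indicator K (fst z) \<partial>?P)"
				using mu.nn_integral_fst[OF borel_measurable_times_ennreal[OF m1 K1]] by simp
			also have "... = (\<integral>\<^sup>+z. D z * (?w z * indicator C (snd z) * indicator K (fst z)) \<partial>?P)" by(simp add: mult.assoc)
			also have "... = (\<integral>\<^sup>+z. ?w (?s z) * indicator C (snd (?s z)) * indicator K (fst (?s z)) \<partial>?P)"
				by(intro int borel_measurable_times_ennreal wP C2 K1)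
			also have "... = (\<integral>\<^sup>+z. ennreal (w (snd z)) * indicator C (act (fst z) (snd z)) * indicator K (fst z) \<partial>?P)"
				by(intro nn_integral_cong) (auto simp: space_pair_measure)
			also have "... = (\<integral>\<^sup>+h. \<integral>\<^sup>+x. ennreal (w x) * indicator C (act h x) * indicator K h \<partial>mu \<partial>eta)"
				using mu.nn_integral_fst[OF borel_measurable_times_ennreal[OF m2 K1]] by simp
			also have "... = (\<integral>\<^sup>+h. ?I' C h * indicator K h \<partial>eta)"
				using measurable_Pair2[OF m2] by(intro nn_integral_cong nn_integral_multc) simp
			also have "... = emeasure (density eta (?I' C)) K" by(rule emeasure_density[OF I' K,symmetric])
			finally show "emeasure (density eta (?I C)) K = emeasure (density eta (?I' C)) K" .
		qed simp
		then show ?thesis using density_unique_iff[OF I I'] by simp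
	qed
	obtain \<P> where P:"countable \<P>" "\<P> <= sets mu" "Int_stable \<P>" "space mu : \<P>" "sets mu = sigma_sets (space mu) \<P>"
		using standard_borel_countable_generator[OF sb_mu] by metis
	have "AE h in eta. ALL C:\<P>. ?I C h = ?I' C h"
		using P(1,2) eqC by(subst AE_ball_countable) auto
	then have "AE h in eta. AE y in mu. D (h,y) = ennreal (rn h y)"
	proof eventually_elim
		case (elim h)
		have Dh:"(%y. D (h,y)) : borel_measurable mu" using measurable_compose[OF measurable_Pair1' D,of h] by simp
		have wh:"(%y. ennreal (w (act (- h) y))) : borel_measurable mu" by measurable
		let ?M1 = "density mu (%y. D (h,y) * ennreal (w (act (- h) y)))"
		let ?M2 = "density mu (%y. ennreal (rn h y) * ennreal (w (act (- h) y)))"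
		have e1:"emeasure ?M1 C = ?I C h" if "C : sets mu" for C
			using Dh wh that by(subst emeasure_density) (auto simp: mult.assoc)
		have e2:"emeasure ?M2 C = ?I' C h" if C:"C : sets mu" for C
		proof -
			have mC:"(%y. ennreal (w (act (- h) y)) * indicator C y) : borel_measurable mu"
				using wh C by(intro borel_measurable_times_ennreal) auto
			have "emeasure ?M2 C = (\<integral>\<^sup>+y. ennreal (rn h y) * (ennreal (w (act (- h) y)) * indicator C y) \<partial>mu)"
				using wh C by(subst emeasure_density) (auto simp: mult.assoc)
			also have "... = (\<integral>\<^sup>+y. ennreal (w (act (- h) y)) * indicator C y \<partial>distr mu mu (act h))"
				unfolding distr_act_density using mC by(intro nn_integral_density[symmetric]) auto
			also have "... = (\<integral>\<^sup>+x. ennreal (w (act (- h) (act h x))) * indicator C (act h x) \<partial>mu)"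
				using mC by(intro nn_integral_distr[OF act_h_measurable]) simp
			also have "... = ?I' C h" by(rule nn_integral_cong) simp
			finally show ?thesis .
		qed
		have "?M1 = ?M2"
		proof(rule measure_eqI_generator_eq[OF P(3),where \<Omega>="space mu" and A="%_. space mu"])
			show "\<P> <= Pow (space mu)" using P(2) sets.space_closed by blast
			show "emeasure ?M1 X = emeasure ?M2 X" if "X : \<P>" for X
				using elim[rule_format,OF that] e1[of X] e2[of X] P(2) that by auto
			show "sets ?M1 = sigma_sets (space mu) \<P>" "sets ?M2 = sigma_sets (space mu) \<P>" using P(5) by simp_all
			show "range (%_. space mu) <= \<P>" "(\<Union>i::nat. space mu) = space mu" using P(4) by auto
			have "emeasure ?M1 (space mu) = (\<integral>\<^sup>+x. ennreal (w x) \<partial>mu)"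
				using elim[rule_format,OF P(4)] e1[of "space mu"] by(simp cong: nn_integral_cong)
			also have "... = ennreal (LINT x|mu. w x)"
				using wi w0[THEN less_imp_le] by(intro nn_integral_eq_integral) auto
			finally show "emeasure ?M1 (space mu) ~= \<infinity>" by simp
		qed
		then have "AE y in mu. D (h,y) * ennreal (w (act (- h) y)) = ennreal (rn h y) * ennreal (w (act (- h) y))"
			using Dh wh by(subst (asm) mu.density_unique_iff) auto
		then show ?case
		proof eventually_elim
			case (elim y)
			have "ennreal (w (act (- h) y)) ~= 0" "ennreal (w (act (- h) y)) ~= \<infinity>" using w0[of "act (- h) y"] by auto
			then show ?case using elim by(metis ennreal_mult_cancel_left mult.commute infinity_ennreal_def)
		qed
	qed
	then show thesis by(rule that[OF D])
qed

end

lemma (in normed_vspace) continuous_map_norm_topology_iff: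
	"continuous_map X (norm_topology V) f <-> f : topspace X \<rightarrow> vcarrier V &
		(ALL x:topspace X. ALL e>0. EX S. openin X S & x : S & (ALL y:S. vdist V (f x) (f y) < e))"
proof -
	interpret Metric_space "vcarrier V" "vdist V" by(rule Metric_space_vdist)
	show ?thesis
	proof
		assume c:"continuous_map X (norm_topology V) f"
		then have f:"f : topspace X \<rightarrow> vcarrier V"
			unfolding continuous_map_def topspace_norm_topology by blast
		have "EX S. openin X S & x : S & (ALL y:S. vdist V (f x) (f y) < e)" if x:"x : topspace X" and e:"e > 0" for x e
		proof(intro exI conjI ballI)
			let ?S = "{y : topspace X. f y : mball (f x) e}"
			show "openin X ?S"
				using c openin_mball unfolding continuous_map_def norm_topology_def by blast
			have "f x : vcarrier V" using f x by(rule funcset_mem)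
			then show "x : ?S" using x e by simp
			fix y assume "y : ?S"
			then show "vdist V (f x) (f y) < e" by simp
		qed
		then show "f : topspace X \<rightarrow> vcarrier V &
			(ALL x:topspace X. ALL e>0. EX S. openin X S & x : S & (ALL y:S. vdist V (f x) (f y) < e))"
			using f by blast
	next
		assume a:"f : topspace X \<rightarrow> vcarrier V &
			(ALL x:topspace X. ALL e>0. EX S. openin X S & x : S & (ALL y:S. vdist V (f x) (f y) < e))"
		then have f:"f : topspace X \<rightarrow> vcarrier V" by(rule conjunct1)
		show "continuous_map X (norm_topology V) f"
			unfolding continuous_map_def topspace_norm_topology
		proof(intro conjI allI impI f)
			fix O' assume "openin (norm_topology V) O'"
			then have O': "openin mtopology O'" unfolding norm_topology_def .
			show "openin X {x : topspace X. f x : O'}"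
			proof(subst openin_subopen,intro ballI)
				fix x assume "x : {x : topspace X. f x : O'}"
				then have x:"x : topspace X" "f x : O'" by auto
				then obtain r where r:"r > 0" "mball (f x) r <= O'" using O' unfolding openin_mtopology by blast
				from a x(1) r(1) obtain S where S:"openin X S" "x : S" "ALL y:S. vdist V (f x) (f y) < r" by blast
				have "y : {x : topspace X. f x : O'}" if "y : S" for y
				proof -
					have y:"y : topspace X" using openin_subset[OF S(1)] that by blast
					have "f y : mball (f x) r" using f x(1) y S(3) that by(simp add: funcset_mem)
					then show ?thesis using r(2) y by blast
				qed
				then show "EX T. openin X T & x : T & T <= {x : topspace X. f x : O'}" using S(1,2) by blast
			qed
		qed
	qed
qed

section \<open>Continuity of orbit maps and the action on L\<infinity>\<close>

context semidirect_module
begin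

lemma vdist_W:"integrable mu f ==> integrable mu w ==> vdist W (L1cls mu f) (L1cls mu w) = (LINT x|mu. norm (f x - w x))"
	using vdist_L1[of f mu w] by simp

lemma orbit_dist_measurable:
	assumes f:"integrable mu f" and w:"integrable mu w"
	obtains m where "m : borel_measurable eta" "AE h in eta. vdist W (U h (L1cls mu f)) (L1cls mu w) = m h"
proof -
	obtain D where D:"D : borel_measurable (eta\<otimes>mu)" "AE h in eta. AE y in mu. D (h,y) = ennreal (rn h y)"
		by(rule joint_density)
	have [measurable]: "D : borel_measurable (borel\<otimes>mu)"
		using D(1) unfolding measurable_cong_sets[OF sets_arrows_eta[symmetric] refl] .
	have [measurable]: "f : borel_measurable mu" "w : borel_measurable mu" using f w by auto
	let ?F = "%z. norm (enn2real (D z) *\<^sub>R blinfun_apply (Lb (fst z,act (- fst z) (snd z))) (f (act (- fst z) (snd z))) - w (snd z))"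
	have b:"(%z. act (- fst z) (snd z)) : borel\<otimes>mu ->M mu" by measurable
	have "wmeas (borel\<otimes>mu) (%z. Lb (fst z,act (- fst z) (snd z)))"
		by(rule Lb_section[OF measurable_fst b])
	then have [measurable]: "(%z. blinfun_apply (Lb (fst z,act (- fst z) (snd z))) (f (act (- fst z) (snd z)))) : borel_measurable (borel\<otimes>mu)"
		by(rule wmeas_apply) measurable
	have F:"?F : borel_measurable (eta\<otimes>mu)"
		unfolding measurable_cong_sets[OF sets_arrows_eta[symmetric] refl] by measurable
	show thesis
	proof(rule that[of "%h. LINT y|mu. ?F (h,y)"])
		show "(%h. LINT y|mu. ?F (h,y)) : borel_measurable eta"
			using F by(intro mu.borel_measurable_lebesgue_integral) (simp add: case_prod_beta')
		show "AE h in eta. vdist W (U h (L1cls mu f)) (L1cls mu w) = (LINT y|mu. ?F (h,y))"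
			using D(2)
		proof eventually_elim
			case (elim h)
			have "vdist W (U h (L1cls mu f)) (L1cls mu w) = (LINT y|mu. norm (Uf h f y - w y))"
				unfolding U_cls[OF f] by(rule vdist_W[OF Uf_integrable[OF f] w])
			also have "... = (LINT y|mu. ?F (h,y))"
			proof(rule integral_cong_AE)
				show "(%y. norm (Uf h f y - w y)) : borel_measurable mu"
					using Uf_integrable[OF f,of h] by auto
				show "(%y. ?F (h,y)) : borel_measurable mu" using measurable_Pair2[OF F,of h] by simp
				show "AE y in mu. norm (Uf h f y - w y) = ?F (h,y)"
					using elim by eventually_elim (simp add: Uf_def rn_nonneg)
			qed
			finally show ?case .
		qed
	qed
qed

lemma W_countable_dense:
	obtains C where "countable C" "C <= vcarrier W" "!!B e. B : vcarrier W ==> e > 0 ==> EX c:C. vdist W B c < e"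
proof -
	interpret MS: Metric_space "vcarrier W" "vdist W" by(rule W.Metric_space_vdist)
	have "separable_space (norm_topology W)" by(rule L1_separable[OF sb_mu mu.sigma_finite_measure_axioms])
	then obtain C where C:"countable C" "C <= vcarrier W" "norm_topology W closure_of C = vcarrier W"
		unfolding separable_space_def W.topspace_norm_topology by(elim exE conjE)
	have "EX c:C. vdist W B c < e" if Be:"B : vcarrier W" "e > 0" for B e
	proof -
		have "B : MS.mtopology closure_of C" using C(3) Be(1) unfolding norm_topology_def by simp
		then have "ALL r>0. EX y:C. y : MS.mball B r" unfolding MS.metric_closure_of mem_Collect_eq by(rule conjunct2)
		then obtain y where "y : C" "y : MS.mball B e" using Be(2) by(elim allE[of _ e] impE bexE)
		then show ?thesis by(intro bexI[of _ y]) simp_all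
	qed
	from that[OF C(1,2) this] show thesis .
qed

text \<open>By separability some \<open>c\<close> is within \<open>e / 2\<close> of
  \<open>T (- h) B\<close> for all \<open>h\<close> in a set of positive measure. By Steinhaus every
  small \<open>g\<close> satisfies \<open>g + b = a\<close> with \<open>a\<close>, \<open>b\<close>
  in that set. Then \<open>T (- a) (T g B) = T (- b) B\<close>, and since \<open>T (- a)\<close> is
  isometric, the distance from \<open>T g B\<close> to \<open>B\<close> is that between two points
  close to \<open>c\<close>. Inverses are used because Steinhaus writes \<open>g\<close> as
  \<open>a - b\<close>.\<close>

lemma orbit_continuous_0:
	assumes closed:"!!g B. B : vcarrier W ==> T g B : vcarrier W"
		and add:"!!g h B. B : vcarrier W ==> T (g + h) B = T g (T h B)"
		and dist:"!!g B B'. B : vcarrier W ==> B' : vcarrier W ==> vdist W (T g B) (T g B') = vdist W B B'"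
		and TU:"AE g in eta. ALL B:vcarrier W. T g B = U g B"
		and B:"B : vcarrier W" and e:"e > 0"
	shows "eventually (%g. vdist W (T g B) B < e) (nhds 0)"
proof -
	interpret MS: Metric_space "vcarrier W" "vdist W" by(rule W.Metric_space_vdist)
	obtain f where f:"integrable mu f" "B = L1cls mu f" using B by(rule W_cases)
	obtain C where C:"countable C" "C <= vcarrier W" "!!B e. B : vcarrier W ==> e > 0 ==> EX c:C. vdist W B c < e"
	proof(rule W_countable_dense)
		fix C assume a:"countable C" "C <= vcarrier W" "!!B e. B : vcarrier W ==> e > 0 ==> EX c:C. vdist W B c < e"
		show thesis by(rule that[OF a])
	qed
	have "EX m. m : borel_measurable eta & (AE h in eta. vdist W (U h B) c = m h)" if c:"c : C" for c
	proof -
		have "c : vcarrier W" using c C(2) by blast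
		then obtain w where w:"integrable mu w" "c = L1cls mu w" by(rule W_cases)
		obtain m where "m : borel_measurable eta" "AE h in eta. vdist W (U h (L1cls mu f)) (L1cls mu w) = m h"
			by(rule orbit_dist_measurable[OF f(1) w(1)])
		then show ?thesis unfolding f(2) w(2) by blast
	qed
	then obtain m where m:"!!c. c : C ==> m c : borel_measurable eta" "!!c. c : C ==> AE h in eta. vdist W (U h B) c = m c h"
		by metis
	have "AE h in eta. ALL c:C. vdist W (U h B) c = m c h" using m(2) C(1) by(simp add: AE_ball_countable)
	then have "AE h in eta. ALL c:C. vdist W (T h B) c = m c h"
		using TU by eventually_elim (use B in simp)
	then have good:"AE h in eta. ALL c:C. vdist W (T (- h) B) c = m c (- h)" by(rule AE_uminus)
	then obtain N where N:"N : null_sets eta" "!!h. h ~: N ==> ALL c:C. vdist W (T (- h) B) c = m c (- h)"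
		by(elim AE_E3) auto
	let ?E = "%c. {h. m c (- h) < e / 2}"
	have Es:"?E c : sets borel" if "c : C" for c
	proof -
		have [measurable]: "m c : borel_measurable borel" using m(1)[OF that] by(simp add: measurable_cong_sets[OF sets_eta refl])
		show ?thesis by measurable
	qed
	have "EX c:C. emeasure eta (?E c) > 0"
	proof(rule ccontr)
		assume "~ ?thesis"
		then have "?E c : null_sets eta" if "c : C" for c using that Es[OF that] by(auto simp: null_sets_def sets_eta not_less)
		then have "AE h in eta. ALL c:C. h ~: ?E c" using C(1) by(simp only: AE_ball_countable) (blast intro: AE_not_in)
		then have "AE h in eta. (ALL c:C. h ~: ?E c) & (ALL c:C. vdist W (T (- h) B) c = m c (- h))" using good by(rule AE_conjI)
		from AE_ex[OF this] obtain h where h:"ALL c:C. h ~: ?E c" "ALL c:C. vdist W (T (- h) B) c = m c (- h)" by(elim exE conjE)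
		obtain c where "c : C" "vdist W (T (- h) B) c < e / 2"
			using C(3)[OF closed[OF B,of "- h"] half_gt_zero[OF e]] by(elim bexE)
		then show False using h by simp
	qed
	then obtain c where c:"c : C" "emeasure eta (?E c) > 0" by(elim bexE)
	have cW:"c : vcarrier W" using c(1) C(2) by blast
	have Nb:"N : sets borel" using N(1) sets_eta by(auto simp: null_sets_def)
	have "emeasure eta (?E c - N) = emeasure eta (?E c)" using N(1) Es[OF c(1)] by(intro emeasure_Diff_null_set) (simp_all add: sets_eta)
	then have "eventually (%g. EX a:?E c - N. EX b:?E c - N. g + b = a) (nhds 0)"
		using c(2) Es[OF c(1)] Nb by(intro steinhaus) auto
	then show ?thesis
	proof eventually_elim
		case (elim g)
		then obtain a b where ab:"a : ?E c - N" "b : ?E c - N" "g + b = a" by blast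
		have cl:"vdist W (T (- h) B) c < e / 2" if "h : ?E c - N" for h
			using N(2)[of h] c(1) that by simp
		have "- a + g = - b" unfolding ab(3)[symmetric] minus_add by(simp add: add.assoc)
		then have "T (- a) (T g B) = T (- b) B" using add[OF B,of "- a" g] by simp
		then have "vdist W (T g B) B = vdist W (T (- b) B) (T (- a) B)"
			using dist[OF closed[OF B,of g] B,of "- a"] by simp
		also have "... <= vdist W (T (- b) B) c + vdist W c (T (- a) B)"
			using closed[OF B] cW by(intro MS.triangle) auto
		also have "... < e" using cl[OF ab(1)] cl[OF ab(2)] MS.commute[of c "T (- a) B"] by simp
		finally show ?case .
	qed
qed

text \<open>The formula of \<open>acts_by_cocycle\<close> after inverting the arrow: the inverse of
  \<open>(g, act (- g) x)\<close> is \<open>(- g, x)\<close>.\<close>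

definition Tf :: "'g => ('x => 'e \<Rightarrow>\<^sub>L real) => 'x => 'e \<Rightarrow>\<^sub>L real" where
	"Tf g l x = l (act (- g) x) o\<^sub>L Lb (- g,x)"

lemma Tf_norm_le:"x : space mu ==> norm (Tf g l x) <= norm (l (act (- g) x))"
proof -
	assume x:"x : space mu"
	have "norm (Lb (- g,x)) <= 1" by(rule norm_blinfun_bound) (simp_all add: Lb_norm[OF x])
	then have "norm (l (act (- g) x)) * norm (Lb (- g,x)) <= norm (l (act (- g) x)) * 1"
		by(intro mult_left_mono) auto
	then show ?thesis unfolding Tf_def using norm_blinfun_compose[of "l (act (- g) x)" "Lb (- g,x)"] by simp
qed

lemma Tf_Linf: assumes l:"l : Linf_functions mu" shows "Tf g l : Linf_functions mu"
proof(rule Linf_functionsI)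
	have "wmeas mu l" using l by(simp add: Linf_functions_iff)
	then show "wmeas mu (Tf g l)" unfolding Tf_def[abs_def]
		by(intro wmeas_blinfun_compose wmeas_compose[OF _ act_h_measurable] Lb_section) simp_all
	show "AE x in mu. norm (Tf g l x) <= Linf_norm mu l"
		using AE_act[OF AE_le_Linf_norm[OF l],of "- g"] AE_space
		by eventually_elim (rule order_trans[OF Tf_norm_le])
qed

lemma cocycle_function_eq:
	fixes l :: "'x => 'e \<Rightarrow>\<^sub>L real"
	shows "x : space mu ==> contragredient \<G> Lb (g,act (- g) x) (l (act (- g) x)) = Tf g l x"
	by(simp add: contragredient_def Tf_def)

lemma cocycle_mem_iff:
	fixes l :: "'x => 'e \<Rightarrow>\<^sub>L real"
	assumes "A : vcarrier V" and l:"l : Linf_functions mu"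
	shows "(%x. contragredient \<G> Lb (g,act (- g) x) (l (act (- g) x))) : A <-> A = Lcls mu (Tf g l)"
proof -
	let ?c = "%x. contragredient \<G> Lb (g,act (- g) x) (l (act (- g) x))"
	obtain k where k:"k : Linf_functions mu" "A = Lcls mu k" using assms(1) by(rule V_cases)
	have AEc:"AE x in mu. ?c x = Tf g l x" by(rule AE_I2) (rule cocycle_function_eq)
	have "wmeas mu ?c"
		using Tf_Linf[OF l,of g] wmeas_cong[of mu ?c "Tf g l"] cocycle_function_eq by(simp add: Linf_functions_iff)
	moreover have "AE x in mu. norm (?c x) <= Linf_norm mu (Tf g l)"
		using AEc AE_le_Linf_norm[OF Tf_Linf[OF l,of g]] by eventually_elim simp
	ultimately have c:"?c : Linf_functions mu" by(rule Linf_functionsI)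
	have "Lcls mu ?c = Lcls mu (Tf g l)" using Lcls_eq_iff[OF c Tf_Linf[OF l,of g]] AEc by blast
	then show ?thesis using Linf.mem_cls_iff[OF k(1),of ?c] c unfolding k(2) by auto
qed

lemma acts_iff:
	assumes rep:"isometric_rep V rho"
	shows "acts_by_cocycle eta act mu Lb rho <-> (AE g in eta. ALL l:Linf_functions mu. rho g (Lcls mu l) = Lcls mu (Tf g l))"
	unfolding acts_by_cocycle_def
proof(rule AE_cong)
	fix g
	have cl:"rho g A : vcarrier V" if "A : vcarrier V" for A
		using rep that unfolding isometric_rep_def isometric_iso_def by(meson bij_betwE)
	show "(ALL A:vcarrier V. ALL l:A. (%x. contragredient \<G> Lb (g,act (- g) x) (l (act (- g) x))) : rho g A) \<longleftrightarrow>
		(ALL l:Linf_functions mu. rho g (Lcls mu l) = Lcls mu (Tf g l))"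
	proof(intro iffI ballI)
		fix l :: "'x => 'e \<Rightarrow>\<^sub>L real" assume *: "ALL A:vcarrier V. ALL l:A. (%x. contragredient \<G> Lb (g,act (- g) x) (l (act (- g) x))) : rho g A"
			and l:"l : Linf_functions mu"
		have "(%x. contragredient \<G> Lb (g,act (- g) x) (l (act (- g) x))) : rho g (Lcls mu l)"
			using *[rule_format,OF V_mem[OF l] Linf.cls_self[OF l]] .
		then show "rho g (Lcls mu l) = Lcls mu (Tf g l)" using cocycle_mem_iff[OF cl[OF V_mem[OF l]] l] by blast
	next
		fix A and l :: "'x => 'e \<Rightarrow>\<^sub>L real" assume *: "ALL l:Linf_functions mu. rho g (Lcls mu l) = Lcls mu (Tf g l)" and A:"A : vcarrier V" "l : A"
		obtain k where k:"k : Linf_functions mu" "A = Lcls mu k" using A(1) by(rule V_cases)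
		then have l:"l : Linf_functions mu" "Lcls mu l = A" using A(2) Linf.mem_cls_iff[OF k(1),of l] by auto
		have "rho g A = Lcls mu (Tf g l)" using *[rule_format,OF l(1)] l(2) by simp
		then show "(%x. contragredient \<G> Lb (g,act (- g) x) (l (act (- g) x))) : rho g A"
			using cocycle_mem_iff[OF cl[OF A(1)] l(1)] by blast
	qed
qed

lemma representation_exists:
	obtains rho where "coefficient_module V rho W (Linf_L1_pairing mu)" "acts_by_cocycle eta act mu Lb rho"
proof -
	obtain T where bij:"!!g. bij_betw (T g) (vcarrier W) (vcarrier W)"
		and T0:"!!B. B : vcarrier W ==> T 0 B = B"
		and T_add:"!!g h B. B : vcarrier W ==> T (g + h) B = T g (T h B)"
		and TU:"AE g in eta. ALL B:vcarrier W. T g B = U g B"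
	proof(rule strictify[of "vcarrier W" U,OF U_closed U_inj U_mult])
		fix T assume a:"!!g. bij_betw (T g) (vcarrier W) (vcarrier W)"
			"!!x. x : vcarrier W ==> T 0 x = x"
			"!!g h x. x : vcarrier W ==> T (g + h) x = T g (T h x)"
			"AE g in eta. ALL x:vcarrier W. T g x = U g x"
		show thesis by(rule that[OF a])
	qed
	have closed:"T g B : vcarrier W" if "B : vcarrier W" for g B using bij_betwE[OF bij] that by blast
	\<comment> \<open>\<open>T\<close> agrees with \<open>U\<close> only for almost every group
	  element, but every \<open>g\<close> is a sum of two good ones. So each \<open>T g\<close> is a
	  product of two of the operators \<open>U\<close> and inherits linearity and isometry.\<close>
	have TUU:"EX a b. ALL B:vcarrier W. T g B = U a (U b B)" for g
	proof -
		obtain a b where "ALL B:vcarrier W. T a B = U a B" "ALL B:vcarrier W. T b B = U b B" "g = a + b"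
			by(rule AE_decompose[OF TU])
		then have "ALL B:vcarrier W. T g B = U a (U b B)" using T_add U_closed by simp
		then show ?thesis by(intro exI)
	qed
	have T_vadd:"T g (vadd W B B') = vadd W (T g B) (T g B')" if "B : vcarrier W" "B' : vcarrier W" for g B B'
	proof -
		obtain a b where "ALL B:vcarrier W. T g B = U a (U b B)" using TUU[of g] by(elim exE)
		then show ?thesis using that by(simp add: W.add_closed U_add U_closed)
	qed
	have T_vscale:"T g (vscale W r B) = vscale W r (T g B)" if "B : vcarrier W" for g r B
	proof -
		obtain a b where "ALL B:vcarrier W. T g B = U a (U b B)" using TUU[of g] by(elim exE)
		then show ?thesis using that by(simp add: W.scale_closed U_scale U_closed)
	qed
	have T_norm:"vnorm W (T g B) = vnorm W B" if "B : vcarrier W" for g B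
	proof -
		obtain a b where "ALL B:vcarrier W. T g B = U a (U b B)" using TUU[of g] by(elim exE)
		then show ?thesis using that by(simp add: U_norm U_closed)
	qed
	have T_dist:"vdist W (T g B) (T g B') = vdist W B B'" if "B : vcarrier W" "B' : vcarrier W" for g B B'
	proof -
		have "vadd W (T g B) (vscale W (-1) (T g B')) = T g (vadd W B (vscale W (-1) B'))"
			using that by(simp add: T_vadd T_vscale W.scale_closed)
		then show ?thesis using that by(simp add: vdist_def closed T_norm W.add_closed W.scale_closed)
	qed
	define rhob where "rhob g = (\<lambda>B\<in>vcarrier W. T g B)" for g
	have rhob:"rhob g B = T g B" if "B : vcarrier W" for g B using that by(simp add: rhob_def)
	have repW:"isometric_rep W rhob"
		unfolding isometric_rep_def isometric_iso_def
	proof(intro conjI allI ballI)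
		show "rhob g : extensional (vcarrier W)" for g by(simp add: rhob_def)
		show "bij_betw (rhob g) (vcarrier W) (vcarrier W)" for g
			using bij[of g] by(rule bij_betw_cong[THEN iffD1,rotated]) (simp add: rhob)
	qed (simp_all add: rhob W.add_closed W.scale_closed T_vadd T_vscale T_norm T0 T_add closed)
	have cont:"continuous_map euclidean (norm_topology W) (%g. rhob g B)" if B:"B : vcarrier W" for B
		unfolding W.continuous_map_norm_topology_iff
	proof(intro conjI ballI allI impI)
		show "(%g. rhob g B) : topspace euclidean \<rightarrow> vcarrier W" using B by(simp add: rhob closed)
		fix g0 :: 'g and e :: real assume e:"e > 0"
		obtain S where S:"open S" "0 : S" "ALL g:S. vdist W (T g B) B < e"
			using orbit_continuous_0[of T,OF closed T_add T_dist TU B e] unfolding eventually_nhds by blast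
		show "EX S. openin euclidean S & g0 : S & (ALL g:S. vdist W (rhob g0 B) (rhob g B) < e)"
		proof(intro exI[of _ "(%g. - g0 + g) -` S"] conjI ballI)
			show "openin euclidean ((%g. - g0 + g) -` S)"
				unfolding open_openin[symmetric] by(intro open_vimage S(1) continuous_intros)
			show "g0 : (%g. - g0 + g) -` S" using S(2) by simp
			fix g assume g:"g : (%g. - g0 + g) -` S"
			have "g = g0 + (- g0 + g)" by(simp add: add.assoc[symmetric])
			then have "T g B = T g0 (T (- g0 + g) B)" using T_add[OF B,of g0 "- g0 + g"] by simp
			then have "vdist W (T g0 B) (T g B) = vdist W B (T (- g0 + g) B)"
				using T_dist[OF B closed[OF B]] by simp
			also have "... = vdist W (T (- g0 + g) B) B"
				by(rule Metric_space.commute[OF W.Metric_space_vdist])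
			finally show "vdist W (rhob g0 B) (rhob g B) < e" using S(3) g by(simp add: rhob B)
		qed
	qed
	note iso = mu.Linf_iso_dual_L1[where 'e='e]
	obtain rho where rep:"isometric_rep V rho" and adj:"!!g A B. A : vcarrier V ==> B : vcarrier W ==>
			Linf_L1_pairing mu (rho g A) B = Linf_L1_pairing mu A (rhob (- g) B)"
	proof(rule adjoint_representation[OF V.normed_vspace_axioms W.normed_vspace_axioms iso repW])
		fix rho assume a:"isometric_rep V rho" "!!g v w. v : vcarrier V ==> w : vcarrier W ==>
			Linf_L1_pairing mu (rho g v) w = Linf_L1_pairing mu v (rhob (- g) w)"
		show thesis by(rule that[OF a])
	qed
	have "separable_banach_vspace W"
		unfolding separable_banach_vspace_def
		by(intro conjI W.normed_vspace_axioms L1_mcomplete L1_separable[OF sb_mu mu.sigma_finite_measure_axioms])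
	then have cm:"coefficient_module V rho W (Linf_L1_pairing mu)"
		unfolding coefficient_module_def proof(intro conjI exI[of _ rhob] allI ballI)
		show "separable_banach_vspace W" by(rule \<open>separable_banach_vspace W\<close>)
	qed (use iso rep repW cont adj in \<open>simp_all\<close>)
	\<comment> \<open>The adjoint at \<open>g\<close> involves the operator at \<open>- g\<close>, so
	  the exceptional null set has to be inverted.\<close>
	have "AE g in eta. ALL B:vcarrier W. T (- g) B = U (- g) B" by(rule AE_uminus[OF TU])
	then have "AE g in eta. ALL l:Linf_functions mu. rho g (Lcls mu l) = Lcls mu (Tf g l)"
	proof eventually_elim
		case (elim g)
		show ?case
		proof
			fix l :: "'x => 'e \<Rightarrow>\<^sub>L real" assume l:"l : Linf_functions mu"
			have "rho g (Lcls mu l) : vcarrier V"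
				using rep V_mem[OF l] unfolding isometric_rep_def isometric_iso_def by(meson bij_betwE)
			then obtain k where k:"k : Linf_functions mu" "rho g (Lcls mu l) = Lcls mu k" by(rule V_cases)
			have Tl:"Tf g l : Linf_functions mu" by(rule Tf_Linf[OF l])
			have d:"(%x. k x - Tf g l x) : Linf_functions mu" by(rule Linf.diff_mem[OF k(1) Tl])
			have "(LINT x|mu. blinfun_apply (k x - Tf g l x) (f x)) = 0" if f:"integrable mu f" for f
			proof -
				have "(LINT x|mu. blinfun_apply (k x) (f x)) = Linf_L1_pairing mu (rho g (Lcls mu l)) (L1cls mu f)"
					unfolding k(2) by(rule Linf_L1_pairing_eq[OF k(1) f,symmetric])
				also have "... = Linf_L1_pairing mu (Lcls mu l) (U (- g) (L1cls mu f))"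
					using adj[OF V_mem[OF l] W_mem[OF f]] elim[rule_format,OF W_mem[OF f]] rhob[OF W_mem[OF f]] by simp
				also have "... = (LINT x|mu. blinfun_apply (l x) (Uf (- g) f x))"
					unfolding U_cls[OF f] by(rule Linf_L1_pairing_eq[OF l Uf_integrable[OF f]])
				also have "... = (LINT x|mu. blinfun_apply (l (act (- g) x)) (blinfun_apply (Lb (- g,x)) (f x)))"
					by(rule Uf_pairing[OF l f])
				also have "... = (LINT x|mu. blinfun_apply (Tf g l x) (f x))" by(simp add: Tf_def)
				finally show ?thesis
					using Linf_L1_integrable(1)[OF k(1) f] Linf_L1_integrable(1)[OF Tl f] by(simp add: minus_blinfun.rep_eq)
			qed
			then have "AE x in mu. norm (k x - Tf g l x) <= 0" by(subst mu.Linf_bound_iff[OF d order_refl,symmetric]) simp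
			then have "AE x in mu. k x = Tf g l x" by(rule eventually_mono) simp
			then show "rho g (Lcls mu l) = Lcls mu (Tf g l)" using Lcls_eq_iff[OF k(1) Tl] k(2) by simp
		qed
	qed
	then have "acts_by_cocycle eta act mu Lb rho" using acts_iff[OF rep] by blast
	then show thesis by(rule that[OF cm])
qed

text \<open>The group elements at which two solutions agree form a conull set closed under addition,
  hence everything.\<close>

lemma representation_unique:
	assumes "isometric_rep V rho" "acts_by_cocycle eta act mu Lb rho"
		and "isometric_rep V rho'" "acts_by_cocycle eta act mu Lb rho'"
	shows "rho = rho'"
proof
	fix g
	have ext:"rho g : extensional (vcarrier V)" "rho' g : extensional (vcarrier V)" for g
		using assms(1,3) unfolding isometric_rep_def by simp_all
	have add:"rho (a + b) A = rho a (rho b A)" "rho' (a + b) A = rho' a (rho' b A)" if "A : vcarrier V" for a b A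
		using assms(1,3) that unfolding isometric_rep_def by simp_all
	have "AE g in eta. rho g = rho' g"
		using assms(2)[unfolded acts_iff[OF assms(1)]] assms(4)[unfolded acts_iff[OF assms(3)]]
	proof eventually_elim
		case (elim g)
		show ?case
		proof(rule extensionalityI[OF ext])
			fix A assume "A : vcarrier V"
			then obtain l where "l : Linf_functions mu" "A = Lcls mu l" by(rule V_cases)
			then show "rho g A = rho' g A" using elim by simp
		qed
	qed
	then show "rho g = rho' g"
	proof(rule AE_subgroup[where P="%g. rho g = rho' g"])
		fix a b assume ab:"rho a = rho' a" "rho b = rho' b"
		show "rho (a + b) = rho' (a + b)"
			by(rule extensionalityI[OF ext]) (simp add: add ab)
	qed
qed

end

section \<open>Averaging operators\<close>

text \<open>
	\<open>sel m t ga de\<close> lists \<open>m\<close> entries of the tuples \<open>ga\<close> and \<open>de\<close>; faces and prisms are of this form.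
\<close>

definition sel :: "nat => (nat => nat + nat) => (nat => 'a) => (nat => 'a) => nat => 'a" where
	"sel m t ga de = (\<lambda>i\<in>{..<m}. case_sum ga de (t i))"

text \<open>Injectivity makes the selected entries independent, which is what lets a selection map
  product measures to product measures.\<close>

definition selects :: "nat => nat => (nat => nat + nat) => bool" where
	"selects n m t <-> inj_on t {..<m} & t ` {..<m} <= {..<n} <+> {..<n}"

lemma selectsE:
	assumes "selects n m t" "i < m"
	obtains j where "j < n" "t i = Inl j" | j where "j < n" "t i = Inr j"
	using assms unfolding selects_def by blast

lemma ball_Plus_iff:"(ALL s:A <+> B. Q s) <-> (ALL a:A. Q (Inl a)) & (ALL b:B. Q (Inr b))"
	by blast

lemma selects_Inr:"selects n n Inr"
	by(auto simp: selects_def)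

lemma sel_Inr:"sel n Inr ga de = restrict de {..<n}"
	by(simp add: sel_def)

definition mixt_index :: "nat => nat => nat + nat" where
	"mixt_index i j = (if j <= i then Inl j else Inr (j - 1))"

lemma selects_mixt:"i < n ==> selects n (Suc n) (mixt_index i)"
	by(auto simp: selects_def mixt_index_def inj_on_def split: if_splits)

lemma sel_mixt:"sel (Suc n) (mixt_index i) ga de = mixt n i ga de"
	by(auto simp: sel_def mixt_def mixt_index_def restrict_def fun_eq_iff)

lemma selects_omit:"selects (Suc n) n (%j. Inl (if j < i then j else Suc j))"
	by(auto simp: selects_def inj_on_def split: if_splits)

lemma sel_omit:"sel n (%j. Inl (if j < i then j else Suc j)) ga de = omit n i ga"
	by(auto simp: sel_def omit_def restrict_def fun_eq_iff)

lemma sel_measurable: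
	assumes t:"selects n m t"
	shows "(%p. sel m t (fst p) (snd p)) : PiM {..<n} (%_. M)\<otimes>PiM {..<n} (%_. M) ->M PiM {..<m} (%_. M)"
	unfolding sel_def
proof(rule measurable_restrict)
	fix i assume "i : {..<m}"
	then have "i < m" by simp
	with t show "(%p. case_sum (fst p) (snd p) (t i)) : PiM {..<n} (%_. M)\<otimes>PiM {..<n} (%_. M) ->M M"
		by(cases rule: selectsE)
			(simp_all add: measurable_compose[OF measurable_fst measurable_component_singleton]
				measurable_compose[OF measurable_snd measurable_component_singleton])
qed

text \<open>The preimage of a box is a box with the whole space in the coordinates that are not
  selected. For a probability measure these contribute the factor 1, and injectivity makes every
  side occur once.\<close>

lemma distr_sel:
	assumes th:"prob_space th" and t:"selects n m t"
	shows "distr (PiM {..<n} (%_. th)\<otimes>PiM {..<n} (%_. th)) (PiM {..<m} (%_. th)) (%p. sel m t (fst p) (snd p))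
		= PiM {..<m} (%_. th)" (is "distr (?P\<otimes>?P) _ ?s = _")
proof -
	interpret prob_space th by fact
	interpret product_prob_space "%_::nat. th" by unfold_locales
	interpret Pp: prob_space ?P by(rule prob_space_PiM) unfold_locales
	have ms:"?s : ?P\<otimes>?P ->M PiM {..<m} (%_. th)" by(rule sel_measurable[OF t])
	show ?thesis
	proof(rule PiM_eqI)
		fix A assume A:"!!i. i : {..<m} ==> A i : sets th"
		define C where "C s = (if s : t ` {..<m} then A (the_inv_into {..<m} t s) else space th)" for s
		let ?K = "{..<n} <+> {..<n}"
		have inj:"inj_on t {..<m}" and tK:"t ` {..<m} <= ?K" using t by(auto simp: selects_def)
		have Ct:"C (t i) = A i" if "i < m" for i using that inj by(simp add: C_def the_inv_into_f_f)
		have Cs:"C s : sets th" for s unfolding C_def using A inj by(auto simp: the_inv_into_f_f)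
		have "?s -` Pi\<^sub>E {..<m} A Int space (?P\<otimes>?P)
				= Pi\<^sub>E {..<n} (%j. C (Inl j)) \<times> Pi\<^sub>E {..<n} (%j. C (Inr j))" (is "?L = ?R")
		proof(intro set_eqI)
			fix p :: "(nat => 'a) \<times> (nat => 'a)"
			have "p : ?L <-> p : space (?P\<otimes>?P) & (ALL i<m. case_sum (fst p) (snd p) (t i) : A i)"
				by(auto simp: sel_def PiE_iff)
			also have "... <-> p : space (?P\<otimes>?P) & (ALL s:t ` {..<m}. case_sum (fst p) (snd p) s : C s)"
				using Ct by auto
			also have "... <-> p : space (?P\<otimes>?P) & (ALL s:?K. case_sum (fst p) (snd p) s : C s)"
			proof(intro conj_cong refl iffI ballI)
				fix s assume p:"p : space (?P\<otimes>?P)" and s:"s : ?K"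
					and *: "ALL s:t ` {..<m}. case_sum (fst p) (snd p) s : C s"
				show "case_sum (fst p) (snd p) s : C s"
				proof(cases "s : t ` {..<m}")
					case False
					then show ?thesis using p s by(auto simp: C_def space_pair_measure space_PiM PiE_iff)
				qed (use * in blast)
			qed (use tK in blast)
			also have "... <-> p : ?R"
			proof -
				have C:"C s <= space th" for s using sets.sets_into_space[OF Cs] .
				have "(ALL s:?K. case_sum (fst p) (snd p) s : C s) <-> (ALL j:{..<n}. fst p j : C (Inl j)) & (ALL j:{..<n}. snd p j : C (Inr j))"
					by(simp add: ball_Plus_iff)
				then show ?thesis by(auto simp: space_pair_measure space_PiM PiE_iff mem_Times_iff intro: C[THEN subsetD])
			qed
			finally show "p : ?L <-> p : ?R" .
		qed
		then have "emeasure (distr (?P\<otimes>?P) (PiM {..<m} (%_. th)) ?s) (Pi\<^sub>E {..<m} A)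
				= emeasure (?P\<otimes>?P) (Pi\<^sub>E {..<n} (%j. C (Inl j)) \<times> Pi\<^sub>E {..<n} (%j. C (Inr j)))"
			using A by(subst emeasure_distr[OF ms]) (auto intro!: sets_PiM_I_finite)
		also have "... = (\<Prod>j<n. emeasure th (C (Inl j))) * (\<Prod>j<n. emeasure th (C (Inr j)))"
			using Cs by(subst Pp.emeasure_pair_measure_Times) (auto intro!: sets_PiM_I_finite simp: emeasure_PiM)
		also have "... = (\<Prod>s\<in>?K. emeasure th (C s))"
			by(subst prod.Plus) (simp_all add: comp_def)
		also have "... = (\<Prod>s\<in>t ` {..<m}. emeasure th (C s))"
			using tK by(intro prod.mono_neutral_right) (auto simp: C_def prob_space.emeasure_space_1[OF th])
		also have "... = (\<Prod>i<m. emeasure th (A i))"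
			using inj Ct by(simp add: prod.reindex)
		finally show "emeasure (distr (?P\<otimes>?P) (PiM {..<m} (%_. th)) ?s) (Pi\<^sub>E {..<m} A) = (\<Prod>i\<in>{..<m}. emeasure th (A i))" .
	qed simp_all
qed

definition nonsingular :: "'a measure => 'b measure => ('a => 'b) => bool" where
	"nonsingular M N f <-> f : M ->M N & (ALL A:null_sets N. AE x in M. f x ~: A)"

lemma nonsingularD:
	assumes f:"nonsingular M N f" and P:"AE y in N. P y" shows "AE x in M. P (f x)"
proof -
	obtain A where A:"A : null_sets N" "!!y. y : space N ==> y ~: A ==> P y"
		using P by(elim AE_E3) auto
	have m:"f : M ->M N" and "AE x in M. f x ~: A" using f A(1) by(simp_all add: nonsingular_def)
	from this(2) AE_space show ?thesis
		by eventually_elim (rule A(2)[OF measurable_space[OF m]])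
qed

text \<open>The constant bound of \<open>winteg_norm\<close> cannot express convergence to zero; a
  variable bound \<open>K\<close> can, through dominated convergence.\<close>

lemma winteg_norm_integral:
	fixes G :: "'h => 'e::real_normed_vector \<Rightarrow>\<^sub>L real"
	assumes N:"prob_space N" and G:"wmeas N G" "!!h. norm (G h) <= C" and K:"integrable N K" "AE h in N. norm (G h) <= K h"
	shows "norm (winteg N G) <= (LINT h|N. K h)"
proof -
	interpret prob_space N by fact
	have "AE h in N. 0 <= K h" using K(2) by eventually_elim (use norm_ge_zero order_trans in blast)
	then have K0:"0 <= (LINT h|N. K h)" by(rule integral_nonneg_AE)
	show ?thesis
	proof(rule norm_blinfun_bound[OF K0])
		fix v
		have "norm (blinfun_apply (winteg N G) v) <= (LINT h|N. norm (blinfun_apply (G h) v))"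
			unfolding winteg_apply[OF G] by(rule integral_norm_bound)
		also have "... <= (LINT h|N. K h * norm v)"
		proof(rule integral_mono_AE)
			show "integrable N (%h. norm (blinfun_apply (G h) v))" by(rule integrable_norm[OF winteg_integrable[OF G]])
			show "integrable N (%h. K h * norm v)" using K(1) by simp
			show "AE h in N. norm (blinfun_apply (G h) v) <= K h * norm v"
				using K(2)
			proof eventually_elim
				case (elim h)
				then have "norm (G h) * norm v <= K h * norm v" by(rule mult_right_mono) simp
				then show ?case using norm_blinfun[of "G h" v] by linarith
			qed
		qed
		finally show "norm (blinfun_apply (winteg N G) v) <= (LINT h|N. K h) * norm v" by simp
	qed
qed

lemma winteg_distr:
	assumes T:"T : M ->M N" and G:"wmeas N G" and d:"distr M N T = N"
	shows "winteg M (%h. G (T h)) = winteg N G"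
proof -
	have "(LINT h|M. blinfun_apply (G (T h)) v) = (LINT h|N. blinfun_apply (G h) v)" for v
		using integral_distr[OF T wmeasD[OF G,of v]] by(simp add: d)
	then show ?thesis by(simp add: winteg_def)
qed

text \<open>The essential supremum is at most \<open>r\<close> exactly when the section of the set
  where the norm exceeds \<open>r\<close> is null, and measures of sections are measurable.\<close>

lemma (in sigma_finite_measure) Linf_norm_section_measurable:
	fixes K :: "'h \<times> 'a => 'e::{banach,second_countable_topology} \<Rightarrow>\<^sub>L real"
	assumes K:"wmeas (N\<otimes>M) K" and b:"!!z. norm (K z) <= C"
	shows "(%h. Linf_norm M (%x. K (h,x))) : borel_measurable N"
proof(subst borel_measurable_iff_le,intro allI)
	fix r :: real
	have mem:"(%x. K (h,x)) : Linf_functions M" if "h : space N" for h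
		by(rule Linf_functionsI[of _ _ C]) (simp_all add: b wmeas_compose[OF K measurable_Pair1'[OF that]])
	show "{h : space N. Linf_norm M (%x. K (h,x)) <= r} : sets N"
	proof(cases "0 <= r")
		case False
		have "~ Linf_norm M (%x. K (h,x)) <= r" if "h : space N" for h
			using Linf_norm_nonneg[OF mem[OF that]] False by linarith
		then have e:"{h : space N. Linf_norm M (%x. K (h,x)) <= r} = {}" by blast
		show ?thesis unfolding e by(rule sets.empty_sets)
	next
		case True
		have [measurable]: "(%z. norm (K z)) : borel_measurable (N\<otimes>M)" by(rule wmeas_norm[OF K])
		let ?A = "{z : space (N\<otimes>M). ~ norm (K z) <= r}"
		have A:"?A : sets (N\<otimes>M)" by measurable
		have "Linf_norm M (%x. K (h,x)) <= r <-> emeasure M (Pair h -` ?A) = 0" if h:"h : space N" for h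
		proof -
			have "Linf_norm M (%x. K (h,x)) <= r <-> (AE x in M. norm (K (h,x)) <= r)"
			proof
				assume le:"Linf_norm M (%x. K (h,x)) <= r"
				show "AE x in M. norm (K (h,x)) <= r"
					using AE_le_Linf_norm[OF mem[OF h]] by eventually_elim (use le in linarith)
			qed (rule Linf_norm_le[OF True])
			also have "... <-> emeasure M (Pair h -` ?A) = 0"
			proof(rule AE_iff_measurable)
				show "Pair h -` ?A : sets M" by(rule sets_Pair1[OF A])
				show "{x : space M. ~ norm (K (h,x)) <= r} = Pair h -` ?A" using h by(auto simp: space_pair_measure)
			qed
			finally show ?thesis .
		qed
		then have eq:"{h : space N. Linf_norm M (%x. K (h,x)) <= r} = {h : space N. emeasure M (Pair h -` ?A) = 0}" by blast
		have [measurable]: "(%h. emeasure M (Pair h -` ?A)) : borel_measurable N"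
			by(rule measurable_emeasure_Pair[OF A])
		show ?thesis unfolding eq by measurable
	qed
qed

section \<open>Selections, translations and faces of tuples up to null sets\<close>

context semidirect_module
begin

abbreviation "En n \<equiv> PiM {..<n::nat} (%_. eta)"

lemma space_En:"space (En n) = extensional {..<n}"
	by(auto simp: space_PiM PiE_def)

lemma power_probability:
	obtains th where "prob_space th" "sets th = sets eta"
		"!!n P. (AE ga in PiM {..<n::nat} (%_. th). P ga) <-> (AE ga in En n. P ga)"
proof -
	obtain th where th:"prob_space th" "sets th = sets borel" and ae:"!!P. (AE g in th. P g) <-> (AE g in eta. P g)"
	proof(rule equivalent_probability)
		fix th assume a:"prob_space th" "sets th = sets borel" "!!P. (AE g in th. P g) <-> (AE g in eta. P g)"
		show thesis by(rule that[OF a])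
	qed
	interpret T: prob_space th by fact
	have s:"sets th = sets eta" using th(2) sets_eta by simp
	have id:"(%x. x) : eta ->M th" "(%x. x) : th ->M eta" using s by(auto simp: measurable_ident_sets)
	have sp:"space (PiM {..<n} (%_. th)) = space (En n)" for n :: nat
		using sets_eq_imp_space_eq[OF s] by(simp add: space_PiM)
	have res:"(\<lambda>i\<in>{..<n}. ga i) = ga" if "ga : space (En n)" for ga and n :: nat
		using that by(simp add: space_En extensional_restrict)
	have 1:"AE ga in En n. P ga" if P:"AE ga in PiM {..<n::nat} (%_. th). P ga" for n P
	proof -
		obtain A where A:"A : null_sets (PiM {..<n} (%_. th))" "!!ga. ga : space (PiM {..<n} (%_. th)) ==> ga ~: A ==> P ga"
			using P by(elim AE_E3) auto
		have "AE ga in En n. (\<lambda>i\<in>{..<n}. ga i) ~: A"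
			by(rule PiM_nonsingular[OF sigma_finite_measure_axioms T.sigma_finite_measure_axioms id(1) _ A(1)])
				(simp add: ae[symmetric] AE_not_in)
		then show ?thesis using AE_space
			by eventually_elim (use A(2) sp res in simp)
	qed
	have 2:"AE ga in PiM {..<n::nat} (%_. th). P ga" if P:"AE ga in En n. P ga" for n P
	proof -
		obtain A where A:"A : null_sets (En n)" "!!ga. ga : space (En n) ==> ga ~: A ==> P ga"
			using P by(elim AE_E3) auto
		have "AE ga in PiM {..<n} (%_. th). (\<lambda>i\<in>{..<n}. ga i) ~: A"
			by(rule PiM_nonsingular[OF T.sigma_finite_measure_axioms sigma_finite_measure_axioms id(2) _ A(1)])
				(simp add: ae AE_not_in)
		then show ?thesis using AE_space
			by eventually_elim (use A(2) sp res in simp)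
	qed
	show thesis by(rule that[OF th(1) s]) (use 1 2 in blast)
qed

sublocale ep: pair_sigma_finite "En n" "En m" for n m
	by(rule pair_sigma_finite.intro[OF sigma_finite_power sigma_finite_power])

lemma AE_En_const:"(AE ga in En n. P) <-> P"
proof -
	obtain th where th:"prob_space th" "!!n P. (AE ga in PiM {..<n::nat} (%_. th). P ga) <-> (AE ga in En n. P ga)"
	proof(rule power_probability)
		fix th assume a:"prob_space th" "!!n P. (AE ga in PiM {..<n::nat} (%_. th). P ga) <-> (AE ga in En n. P ga)"
		show thesis by(rule that[OF a])
	qed
	interpret prob_space "PiM {..<n} (%_. th)" using th(1) by(rule prob_space_PiM)
	have "(AE ga in PiM {..<n} (%_. th). P) <-> (AE ga in En n. P)" by(rule th(2))
	then show ?thesis by simp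
qed

text \<open>Forgetting coordinates of an infinite product measure gives infinite values, so the null
  sets are computed with the equivalent probability measure \<open>th\<close>.\<close>

lemma sel_nonsingular:
	assumes t:"selects n m t" shows "nonsingular (En n\<otimes>En n) (En m) (%p. sel m t (fst p) (snd p))"
	unfolding nonsingular_def
proof(intro conjI ballI sel_measurable[OF t])
	fix A assume A:"A : null_sets (En m)"
	obtain th where th:"prob_space th" and s:"sets th = sets eta"
		and ae:"!!n P. (AE ga in PiM {..<n::nat} (%_. th). P ga) <-> (AE ga in En n. P ga)"
	proof(rule power_probability)
		fix th assume a:"prob_space th" "sets th = sets eta"
			"!!n P. (AE ga in PiM {..<n::nat} (%_. th). P ga) <-> (AE ga in En n. P ga)"
		show thesis by(rule that[OF a])
	qed
	let ?P = "%n::nat. PiM {..<n} (%_. th)" and ?s = "%p. sel m t (fst p) (snd p)"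
	interpret P: prob_space "?P k" for k using th by(rule prob_space_PiM)
	interpret PP: pair_sigma_finite "?P n" "?P n" ..
	have sP:"sets (?P n) = sets (En n)" for n :: nat by(rule sets_PiM_cong) (simp_all add: s)
	have sPP:"sets (?P n\<otimes>?P n) = sets (En n\<otimes>En n)" by(intro sets_pair_measure_cong sP)
	have ms:"?s : ?P n\<otimes>?P n ->M ?P m"
		by(rule sel_measurable[OF t])
	have "AE ga in ?P m. ga ~: A" using AE_not_in[OF A] ae by blast
	then have "AE ga in distr (?P n\<otimes>?P n) (?P m) ?s. ga ~: A" unfolding distr_sel[OF th t] .
	then have "AE p in ?P n\<otimes>?P n. ?s p ~: A" by(rule AE_distrD[OF ms])
	then have "AE ga in ?P n. AE de in ?P n. ?s (ga,de) ~: A" by(rule PP.AE_pair)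
	then have e:"AE ga in En n. AE de in En n. ?s (ga,de) ~: A" by(simp only: ae)
	have [measurable]: "A : sets (En m)" using A by auto
	note [measurable] = sel_measurable[OF t]
	show "AE p in En n\<otimes>En n. ?s p ~: A"
		by(rule ep.AE_pair_measure) (use e in \<open>simp_all,measurable\<close>)
qed

lemma nonsingular_pair:
	assumes M:"sigma_finite_measure M" and N:"sigma_finite_measure N" and f:"nonsingular M N f"
	shows "nonsingular (M\<otimes>mu) (N\<otimes>mu) (%z. (f (fst z),snd z))"
	unfolding nonsingular_def
proof(intro conjI ballI)
	interpret pM: pair_sigma_finite M mu using M mu.sigma_finite_measure_axioms by(rule pair_sigma_finite.intro)
	interpret pN: pair_sigma_finite N mu using N mu.sigma_finite_measure_axioms by(rule pair_sigma_finite.intro)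
	have [measurable]: "f : M ->M N" using f by(simp add: nonsingular_def)
	show m:"(%z. (f (fst z),snd z)) : M\<otimes>mu ->M N\<otimes>mu" by measurable
	fix A assume A:"A : null_sets (N\<otimes>mu)"
	then have [measurable]: "A : sets (N\<otimes>mu)" by auto
	have "AE y in N. AE x in mu. (y,x) ~: A" by(rule pN.AE_pair[OF AE_not_in[OF A]])
	then have "AE y in M. AE x in mu. (f y,x) ~: A" by(rule nonsingularD[OF f])
	then show "AE z in M\<otimes>mu. (f (fst z),snd z) ~: A"
		by(intro pM.AE_pair_measure) (simp_all,measurable)
qed

lemma omit_nonsingular:"nonsingular (En (Suc n)) (En n) (omit n i)"
	unfolding nonsingular_def
proof(intro conjI ballI)
	let ?t = "%j. Inl (if j < i then j else Suc j)"
	show "omit n i : En (Suc n) ->M En n"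
		unfolding omit_def by(rule measurable_restrict) (auto intro!: measurable_component_singleton)
	fix A assume "A : null_sets (En n)"
	then have "AE p in En (Suc n)\<otimes>En (Suc n). omit n i (fst p) ~: A"
		using sel_nonsingular[OF selects_omit[of n i]] unfolding nonsingular_def sel_omit by blast
	then have "AE ga in En (Suc n). AE de in En (Suc n). omit n i (fst (ga,de)) ~: A" by(rule ep.AE_pair)
	then show "AE ga in En (Suc n). omit n i ga ~: A" by(simp add: AE_En_const)
qed

definition shift :: "nat => (nat => 'g) => (nat => 'g) => nat => 'g" where
	"shift n ga h = (\<lambda>i\<in>{..<n}. ga i + h i)"

definition ltr :: "nat => 'g => (nat => 'g) => nat => 'g" where
	"ltr n g ga = (\<lambda>i\<in>{..<n}. - g + ga i)"

lemma shift_ltr:"shift n (ltr n g ga) h = ltr n g (shift n ga h)"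
	by(auto simp: shift_def ltr_def restrict_def fun_eq_iff add.assoc)

lemma sel_ltr:"selects n m t ==> sel m t (ltr n g ga) (ltr n g de) = ltr m g (sel m t ga de)"
proof(rule ext)
	fix i assume t:"selects n m t"
	show "sel m t (ltr n g ga) (ltr n g de) i = ltr m g (sel m t ga de) i"
	proof(cases "i < m")
		case True
		with t show ?thesis by(cases rule: selectsE) (simp_all add: True sel_def ltr_def)
	qed (simp add: sel_def ltr_def)
qed

lemma omit_ltr:"omit n i (ltr (Suc n) g ga) = ltr n g (omit n i ga)"
	by(auto simp: omit_def ltr_def restrict_def fun_eq_iff)

lemma ltr_in [simp]: "ltr n g ga : space (En n)" by(simp add: space_En ltr_def)
lemma shift_in [simp]: "shift n ga h : space (En n)" by(simp add: space_En shift_def)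
lemma sel_in [simp]: "sel n t ga de : space (En n)" by(simp add: space_En sel_def)
lemma omit_in [simp]: "omit n i ga : space (En n)" by(simp add: space_En omit_def)

lemma shift_measurable:"(%p. shift n (fst p) (snd p)) : En n\<otimes>En n ->M En n"
	unfolding shift_def
proof(rule measurable_restrict)
	fix i assume i:"i : {..<n}"
	have [measurable]: "(%p. fst p i) : En n\<otimes>En n ->M borel" "(%p. snd p i) : En n\<otimes>En n ->M borel"
		using measurable_compose[OF measurable_fst measurable_component_singleton[OF i,of "%_. eta"],of "En n"]
			measurable_compose[OF measurable_snd measurable_component_singleton[OF i,of "%_. eta"],of "En n"]
		by(simp_all add: measurable_cong_sets[OF refl sets_eta])
	have "(%p. fst p i + snd p i) : En n\<otimes>En n ->M borel" by measurable
	then show "(%p. fst p i + snd p i) : En n\<otimes>En n ->M eta" by(simp add: measurable_cong_sets[OF refl sets_eta])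
qed

text \<open>With \<open>ga\<close> fixed, \<open>h \<mapsto> ga i + h\<close> is a left translation
  in \<open>h\<close>, so left invariance of \<open>eta\<close> suffices although \<open>ga\<close>
  is moved on the right.\<close>

lemma distr_shift:"distr (En n) (En n) (shift n ga) = En n"
proof(rule pf.PiM_eqI)
	have "(%h. ga i + h i) : En n ->M eta" if "i < n" for i
	proof -
		have [measurable]: "(%h. h i) : En n ->M borel"
			using measurable_component_singleton[of i "{..<n}" "%_. eta"] that by(simp add: measurable_cong_sets[OF refl sets_eta])
		have "(%h. ga i + h i) : En n ->M borel" by measurable
		then show ?thesis by(simp add: measurable_cong_sets[OF refl sets_eta])
	qed
	then have m:"shift n ga : En n ->M En n" unfolding shift_def by(intro measurable_restrict) simp
	fix A assume A:"!!i. i : {..<n} ==> A i : sets eta"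
	let ?B = "%i. (%h. ga i + h) -` A i"
	have B:"?B i : sets eta" "emeasure eta (?B i) = emeasure eta (A i)" if i:"i : {..<n}" for i
	proof -
		have Ab:"A i : sets borel" using A[OF i] sets_eta by simp
		have mp:"(%h. ga i + h) : eta ->M borel" by(simp add: measurable_cong_sets[OF sets_eta refl])
		show "?B i : sets eta" using measurable_sets[OF mp Ab] by simp
		have "emeasure eta (A i) = emeasure (distr eta borel (%h. ga i + h)) (A i)" unfolding distr_add ..
		also have "... = emeasure eta (?B i)" using emeasure_distr[OF mp Ab] by simp
		finally show "emeasure eta (?B i) = emeasure eta (A i)" ..
	qed
	have "shift n ga -` Pi\<^sub>E {..<n} A Int space (En n) = Pi\<^sub>E {..<n} ?B"
		by(auto simp: space_PiM PiE_iff shift_def)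
	moreover have em:"emeasure (En n) (Pi\<^sub>E {..<n} ?B) = (\<Prod>i\<in>{..<n}. emeasure eta (A i))"
	proof -
		have "emeasure (En n) (Pi\<^sub>E {..<n} ?B) = (\<Prod>i\<in>{..<n}. emeasure eta (?B i))"
			by(rule pf.emeasure_PiM) (simp_all add: B)
		also have "... = (\<Prod>i\<in>{..<n}. emeasure eta (A i))" by(rule prod.cong[OF refl B(2)])
		finally show ?thesis .
	qed
	ultimately show "emeasure (distr (En n) (En n) (shift n ga)) (Pi\<^sub>E {..<n} A) = (\<Prod>i\<in>{..<n}. emeasure eta (A i))"
		using A B by(subst emeasure_distr[OF m]) (auto intro!: sets_PiM_I_finite simp: em)
qed simp_all

lemma shift_measurable1:"shift n ga : En n ->M En n"
proof -
	\<comment> \<open>\<open>ga\<close> may be defined beyond the index range, as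
	  \<open>%_. - g\<close> is below. Restricting it makes it a point of the product space and does
	  not change \<open>shift n ga\<close>.\<close>
	have "(\<lambda>i\<in>{..<n}. ga i) : space (En n)" by(simp add: space_En)
	from measurable_compose[OF measurable_Pair1'[OF this] shift_measurable]
	show ?thesis by(simp add: shift_def[abs_def] cong: restrict_cong)
qed

lemma AE_shift:"AE de in En n. P de ==> AE h in En n. P (shift n ga h)"
	using AE_distrD[OF shift_measurable1[of n ga],of P] unfolding distr_shift .

definition Tz :: "nat => 'g => (nat => 'g) \<times> 'x => (nat => 'g) \<times> 'x" where
	"Tz n g z = (ltr n g (fst z),act (- g) (snd z))"

text \<open>The translate of a cochain in the coordinates \<open>(ga,x)\<close>: invariance reads
  \<open>F = Tw n g F\<close>. As \<open>Lb\<close> is multiplicative only almost everywhere,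
  \<open>Tw\<close> need not be multiplicative in \<open>g\<close> for each single pair.\<close>

definition Tw :: "nat => 'g => ((nat => 'g) \<times> 'x => 'e \<Rightarrow>\<^sub>L real) => (nat => 'g) \<times> 'x => 'e \<Rightarrow>\<^sub>L real" where
	"Tw n g F z = F (Tz n g z) o\<^sub>L Lb (- g,snd z)"

lemma Tz_measurable:"(%p. Tz n (fst p) (snd p)) : borel\<otimes>Tn n ->M Tn n"
	unfolding Tz_def
proof(rule measurable_Pair)
	show "(%p. ltr n (fst p) (fst (snd p))) : borel\<otimes>Tn n ->M En n"
		unfolding ltr_def
	proof(rule measurable_restrict)
		fix i assume "i : {..<n}"
		then have "(%p. fst (snd p) i) : borel\<otimes>Tn n ->M (borel :: 'g measure)"
			using measurable_compose[OF measurable_snd component_Tn] by simp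
		then have "(%p. - fst p + fst (snd p) i) : borel\<otimes>Tn n ->M (borel :: 'g measure)" by measurable
		then show "(%p. - fst p + fst (snd p) i) : borel\<otimes>Tn n ->M eta" by(simp add: measurable_cong_sets[OF refl sets_eta])
	qed
	show "(%p. act (- fst p) (snd (snd p))) : borel\<otimes>Tn n ->M mu" by measurable
qed

lemma Tz_measurable1:"Tz n g : Tn n ->M Tn n"
	using measurable_compose[OF measurable_Pair1'[of g borel "Tn n"] Tz_measurable] by simp

lemma Tz_nonsingular:"nonsingular (Tn n) (Tn n) (Tz n g)"
	unfolding nonsingular_def
proof(intro conjI ballI Tz_measurable1)
	fix A assume A:"A : null_sets (Tn n)"
	then have [measurable]: "A : sets (Tn n)" by auto
	note [measurable] = Tz_measurable1[of n g]
	have l:"shift n (%_. - g) = ltr n g" by(simp add: shift_def ltr_def fun_eq_iff)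
	have "AE ga in En n. AE x in mu. (ga,x) ~: A" by(rule pn.AE_pair[OF AE_not_in[OF A]])
	from AE_shift[OF this,of "%_. - g"] have "AE ga in En n. AE x in mu. (ltr n g ga,x) ~: A" unfolding l .
	then have "AE ga in En n. AE x in mu. Tz n g (ga,x) ~: A"
		by(rule eventually_mono) (simp add: Tz_def AE_act[where P="%x. (ltr n g _,x) ~: A"])
	then show "AE z in Tn n. Tz n g z ~: A"
		by(intro pn.AE_pair_measure) (simp_all,measurable)
qed

lemma Tz_space:"z : space (Tn n) ==> Tz n g z : space (Tn n)"
	by(rule measurable_space[OF Tz_measurable1])

text \<open>The bound is required on the space only: values at other tuples are irrelevant.\<close>

definition bd :: "nat => real => ((nat => 'g) \<times> 'x => 'e \<Rightarrow>\<^sub>L real) => bool" where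
	"bd n C F <-> wmeas (Tn n) F & (ALL z:space (Tn n). norm (F z) <= C)"

lemma bdD:"bd n C F ==> wmeas (Tn n) F" "bd n C F ==> z : space (Tn n) ==> norm (F z) <= C"
	by(simp_all add: bd_def)

lemma space_TnI:"ga : space (En n) ==> x : space mu ==> (ga,x) : space (Tn n)"
	by(simp add: space_pair_measure)

lemma Tw_wmeas:"wmeas (Tn n) F ==> wmeas (borel\<otimes>Tn n) (%p. Tw n (fst p) F (snd p))"
	unfolding Tw_def
	by(intro wmeas_blinfun_compose wmeas_compose[OF _ Tz_measurable] Lb_section) simp_all

lemma Tw_wmeas1:"wmeas (Tn n) F ==> wmeas (Tn n) (Tw n g F)"
	using wmeas_compose[OF Tw_wmeas measurable_Pair1'[of g borel "Tn n"]] by simp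

lemma norm_compose_Lb:"x : space mu ==> norm (l o\<^sub>L Lb (- g,x)) <= norm l" for l :: "'e \<Rightarrow>\<^sub>L real"
	using Tf_norm_le[of x g "%_. l"] by(simp add: Tf_def)

lemma bd_Tw:"bd n C F ==> bd n C (Tw n g F)"
proof -
	assume F:"bd n C F"
	have "norm (Tw n g F z) <= C" if z:"z : space (Tn n)" for z
	proof -
		have "snd z : space mu" using z by(auto simp: space_pair_measure)
		from norm_compose_Lb[OF this,of "F (Tz n g z)" g] bdD(2)[OF F Tz_space[OF z,of g]]
		show ?thesis unfolding Tw_def by linarith
	qed
	then show ?thesis using Tw_wmeas1[OF bdD(1)[OF F]] by(simp add: bd_def)
qed

lemma bd_sum:
	assumes I:"finite I" and F:"!!i. i : I ==> bd n C (F i)"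
	shows "bd n (real (card I) * C) (%z. \<Sum>i\<in>I. (-1) ^ i *\<^sub>R F i z)"
	unfolding bd_def
proof(intro conjI ballI)
	show "wmeas (Tn n) (%z. \<Sum>i\<in>I. (-1) ^ i *\<^sub>R F i z)" using F by(intro wmeas_sum wmeas_scaleR bdD(1))
	fix z assume z:"z : space (Tn n)"
	show "norm (\<Sum>i\<in>I. (-1) ^ i *\<^sub>R F i z) <= real (card I) * C"
		by(intro sum_norm_bound) (simp add: bdD(2)[OF F z] power_abs)
qed

lemma bd_add:"bd n C F ==> bd n C' F' ==> bd n (C + C') (%z. F z + F' z)"
	unfolding bd_def by(intro conjI ballI wmeas_add norm_triangle_mono) simp_all


lemma bd_scale:"bd n C F ==> bd n (\<bar>r\<bar> * C) (%z. r *\<^sub>R F z)"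
	by(auto simp: bd_def intro!: wmeas_scaleR mult_left_mono)

definition cobF :: "nat => ((nat => 'g) \<times> 'x => 'e \<Rightarrow>\<^sub>L real) => (nat => 'g) \<times> 'x => 'e \<Rightarrow>\<^sub>L real" where
	"cobF n F z = (\<Sum>i<Suc n. (-1) ^ i *\<^sub>R F (omit n i (fst z),snd z))"

lemma cobF_cob:"cobF n F (ga,x) = cob n (%ga. F (ga,x)) ga"
	by(simp add: cobF_def cob_def)

lemma omit_pair_nonsingular:"nonsingular (Tn (Suc n)) (Tn n) (%z. (omit n i (fst z),snd z))"
	by(rule nonsingular_pair[OF sigma_finite_power sigma_finite_power omit_nonsingular])

lemma bd_omit:"bd n C F ==> bd (Suc n) C (%z. F (omit n i (fst z),snd z))"
proof -
	assume F:"bd n C F"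
	have m:"(%z. (omit n i (fst z),snd z)) : Tn (Suc n) ->M Tn n"
		using omit_pair_nonsingular by(simp add: nonsingular_def)
	show ?thesis unfolding bd_def
		using wmeas_compose[OF bdD(1)[OF F] m] bdD(2)[OF F] measurable_space[OF m] by simp
qed

lemma bd_cobF:"bd n C F ==> bd (Suc n) (real (Suc n) * C) (cobF n F)"
	unfolding cobF_def[abs_def] using bd_sum[of "{..<Suc n}" "Suc n" C "%i z. F (omit n i (fst z),snd z)"] bd_omit by simp

lemma cobF_Tw:"cobF n (Tw n g F) z = Tw (Suc n) g (cobF n F) z"
	unfolding cobF_def Tw_def Tz_def
	by(rule blinfun_eqI) (simp add: omit_ltr blinfun.sum_left blinfun.scaleR_left del: sum.lessThan_Suc)

lemma cobF_cong_AE: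
	assumes "AE z in Tn n. F z = F' z" shows "AE z in Tn (Suc n). cobF n F z = cobF n F' z"
proof -
	have "AE z in Tn (Suc n). ALL i:{..<Suc n}. F (omit n i (fst z),snd z) = F' (omit n i (fst z),snd z)"
		using nonsingularD[OF omit_pair_nonsingular assms] by(simp add: AE_ball_countable)
	then show ?thesis by(rule eventually_mono) (simp add: cobF_def del: sum.lessThan_Suc)
qed

end

section \<open>The averaging operator and its homotopy to the identity\<close>

context semidirect_module
begin

definition psi :: "'g => real" where
	"psi = (SOME ps. continuous_on UNIV ps & (ALL x. 0 <= ps x) & integrable eta ps & (LINT x|eta. ps x) = 1)"

lemma psi:"continuous_on UNIV psi" "0 <= psi x" "integrable eta psi" "(LINT x|eta. psi x) = 1"
proof -
	obtain ps :: "'g => real" where "continuous_on UNIV ps" "!!x. 0 <= ps x" "integrable eta ps" "(LINT x|eta. ps x) = 1"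
	proof(rule continuous_density)
		fix ps :: "'g => real" assume a:"continuous_on UNIV ps" "!!x. 0 <= ps x" "integrable eta ps" "(LINT x|eta. ps x) = 1"
		show thesis by(rule that[OF a])
	qed
	then have "EX ps::'g => real. continuous_on UNIV ps & (ALL x. 0 <= ps x) & integrable eta ps & (LINT x|eta. ps x) = 1"
		by(intro exI[of _ ps]) simp
	from someI_ex[OF this,folded psi_def]
	show "continuous_on UNIV psi" "0 <= psi x" "integrable eta psi" "(LINT x|eta. psi x) = 1" by simp_all
qed

lemma psi_measurable [measurable]: "psi : borel_measurable eta" using psi(3) by auto

definition \<pi> :: "'g measure" where "\<pi> = density eta (%x. ennreal (psi x))"

lemma sets_pi:"sets \<pi> = sets eta" by(simp add: \<pi>_def)

lemma nn_integral_psi:"(\<integral>\<^sup>+x. ennreal (psi x) \<partial>eta) = 1"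
	using nn_integral_eq_integral[OF psi(3)] psi(2,4) by simp

lemma prob_pi:"prob_space \<pi>"
proof
	show "emeasure \<pi> (space \<pi>) = 1"
		unfolding \<pi>_def by(subst emeasure_density) (simp_all add: nn_integral_psi sets.top[of eta,simplified])
qed

abbreviation "Pn n \<equiv> PiM {..<n::nat} (%_. \<pi>)"

lemma prob_Pn:"prob_space (Pn n)" by(rule prob_space_PiM[OF prob_pi])

lemma sets_Pn [measurable_cong]: "sets (Pn n) = sets (En n)"
	by(rule sets_PiM_cong) (simp_all add: sets_pi)


sublocale pr: prob_space "Pn n" for n by(rule prob_Pn)
sublocale pm: pair_sigma_finite "Pn n" mu for n ..

definition Psi :: "nat => (nat => 'g) => real" where "Psi n h = (\<Prod>i<n. psi (h i))"

lemma Psi_nonneg:"0 <= Psi n h" unfolding Psi_def by(intro prod_nonneg) (simp add: psi(2))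

lemma Psi_integrable:"integrable (En n) (Psi n)"
	unfolding Psi_def[abs_def] by(rule pf.product_integrable_prod) (simp_all add: psi(3))

lemma Psi_integral:"(LINT h|En n. Psi n h) = 1"
	unfolding Psi_def by(subst pf.product_integral_prod) (simp_all add: psi(3,4))

lemma Pn_density:"Pn n = density (En n) (%h. ennreal (Psi n h))"
proof -
	interpret prob_space \<pi> by(rule prob_pi)
	interpret pq: product_sigma_finite "%_::nat. \<pi>" by unfold_locales
	have "density (En n) (%h. ennreal (Psi n h)) = Pn n"
	proof(rule pq.PiM_eqI)
		show "sets (density (En n) (%h. ennreal (Psi n h))) = sets (Pn n)" by(simp add: sets_Pn)
		fix A :: "nat => 'g set" assume A:"!!i. i : {..<n} ==> A i : sets \<pi>"
		have m:"Pi\<^sub>E {..<n} A : sets (En n)" using A by(intro sets_PiM_I_finite) (simp_all add: sets_pi)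
		have "emeasure (density (En n) (%h. ennreal (Psi n h))) (Pi\<^sub>E {..<n} A)
				= (\<integral>\<^sup>+h. ennreal (Psi n h) * indicator (Pi\<^sub>E {..<n} A) h \<partial>En n)"
			using Psi_integrable m by(intro emeasure_density) auto
		also have "... = (\<integral>\<^sup>+h. (\<Prod>i\<in>{..<n}. ennreal (psi (h i)) * indicator (A i) (h i)) \<partial>En n)"
		proof(rule nn_integral_cong)
			fix h assume h:"h : space (En n)"
			have "(indicator (Pi\<^sub>E {..<n} A) h :: ennreal) = (\<Prod>i\<in>{..<n}. indicator (A i) (h i))"
				using h by(auto simp: space_PiM PiE_iff indicator_def prod_zero_iff intro!: prod.neutral[symmetric])
			moreover have "ennreal (Psi n h) = (\<Prod>i\<in>{..<n}. ennreal (psi (h i)))"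
				unfolding Psi_def by(simp add: prod_ennreal psi(2))
			ultimately show "ennreal (Psi n h) * indicator (Pi\<^sub>E {..<n} A) h = (\<Prod>i\<in>{..<n}. ennreal (psi (h i)) * indicator (A i) (h i))"
				by(simp add: prod.distrib)
		qed
		also have "... = (\<Prod>i\<in>{..<n}. \<integral>\<^sup>+x. ennreal (psi x) * indicator (A i) x \<partial>eta)"
			using A by(intro pf.product_nn_integral_prod) (auto simp: sets_pi)
		also have "... = (\<Prod>i\<in>{..<n}. emeasure \<pi> (A i))"
			using A unfolding \<pi>_def by(intro prod.cong refl emeasure_density[symmetric]) (auto simp: sets_pi)
		finally show "emeasure (density (En n) (%h. ennreal (Psi n h))) (Pi\<^sub>E {..<n} A) = (\<Prod>i\<in>{..<n}. emeasure \<pi> (A i))" .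
	qed simp
	then show ?thesis ..
qed

lemma AE_Pn:"AE h in En n. P h ==> AE h in Pn n. P h"
	unfolding Pn_density using Psi_integrable[of n] by(subst AE_density) (auto elim: eventually_mono)

text \<open>One operator for both purposes: \<open>t = Inr\<close> evaluates \<open>F\<close> on
  \<open>ga + h\<close> and gives the smoothing \<open>Rg\<close>, while
  \<open>t = mixt_index i\<close> evaluates it on a simplex of the prism from \<open>ga\<close> to
  \<open>ga + h\<close>.\<close>

definition Av :: "nat => nat => (nat => nat + nat) => ((nat => 'g) \<times> 'x => 'e \<Rightarrow>\<^sub>L real) => (nat => 'g) \<times> 'x => 'e \<Rightarrow>\<^sub>L real" where
	"Av n m t F z = winteg (Pn n) (%h. F (sel m t (fst z) (shift n (fst z) h),snd z))"

lemma path_measurable: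
	assumes t:"selects n m t" and ga:"ga : space (En n)"
	shows "(%h. sel m t ga (shift n ga h)) : Pn n ->M En m"
proof -
	have "(%h. (ga,shift n ga h)) : En n ->M En n\<otimes>En n"
		using ga by(intro measurable_Pair measurable_const shift_measurable1)
	from measurable_compose[OF this sel_measurable[OF t]]
	show ?thesis by(simp add: measurable_cong_sets[OF sets_Pn refl])
qed

lemma path_joint_measurable:
	assumes t:"selects n m t" and ga:"ga : space (En n)"
	shows "(%p. (sel m t ga (shift n ga (fst p)),snd p)) : Pn n\<otimes>mu ->M Tn m"
	by(rule measurable_Pair[OF measurable_compose[OF measurable_fst path_measurable[OF t ga]] measurable_snd])

lemma path_wmeas:
	assumes t:"selects n m t" and z:"z : space (Tn n)" and F:"wmeas (Tn m) F"
	shows "wmeas (Pn n) (%h. F (sel m t (fst z) (shift n (fst z) h),snd z))"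
proof -
	have z': "fst z : space (En n)" "snd z : space mu" using z by(auto simp: space_pair_measure)
	have "(%h. (sel m t (fst z) (shift n (fst z) h),snd z)) : Pn n ->M Tn m"
		using z'(2) by(intro measurable_Pair path_measurable[OF t z'(1)] measurable_const)
	then show ?thesis by(rule wmeas_compose[OF F])
qed


lemma path_bound:
	assumes z:"z : space (Tn n)" and F:"bd m C F"
	shows "norm (F (sel m t (fst z) de,snd z)) <= C"
	using z by(intro bdD(2)[OF F]) (auto simp: space_pair_measure)

lemma bd_Av:
	assumes t:"selects n m t" and F:"bd m C F" shows "bd n C (Av n m t F)"
	unfolding bd_def
proof(intro conjI ballI)
	fix z assume z:"z : space (Tn n)"
	show "norm (Av n m t F z) <= C"
		unfolding Av_def by(rule pr.winteg_norm[OF path_wmeas[OF t z bdD(1)[OF F]] path_bound[OF z F]])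
next
	define G where "G a h = F (sel m t (fst a) (shift n (fst a) h),snd a)" for a h
	\<comment> \<open>\<open>bd\<close> gives a bound on the space only, whereas
	  \<open>winteg_wmeas\<close> asks for one at all arguments; the truncation changes nothing on the
	  space.\<close>
	define G0 where "G0 a h = (if norm (G a h) <= C then G a h else 0)" for a h
	have a:"(%p. (fst (fst p),snd p)) : Tn n\<otimes>Pn n ->M En n\<otimes>En n"
		unfolding measurable_cong_sets[OF sets_pair_measure_cong[OF refl sets_Pn] refl] by measurable
	have b:"(%p. shift n (fst (fst p)) (snd p)) : Tn n\<otimes>Pn n ->M En n"
		using measurable_compose[OF a shift_measurable] by simp
	have c:"(%p. (fst (fst p),shift n (fst (fst p)) (snd p))) : Tn n\<otimes>Pn n ->M En n\<otimes>En n"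
		by(intro measurable_Pair b) measurable
	have e:"(%p. (sel m t (fst (fst p)) (shift n (fst (fst p)) (snd p)),snd (fst p))) : Tn n\<otimes>Pn n ->M Tn m"
		using measurable_compose[OF c sel_measurable[OF t]] by(intro measurable_Pair) simp_all
	have G:"wmeas (Tn n\<otimes>Pn n) (%p. G (fst p) (snd p))"
		unfolding G_def by(rule wmeas_compose[OF bdD(1)[OF F] e])
	have [measurable]: "(%p. norm (G (fst p) (snd p))) : borel_measurable (Tn n\<otimes>Pn n)" by(rule wmeas_norm[OF G])
	have "wmeas (Tn n) (%a. winteg (Pn n) (G0 a))"
	proof(rule pr.winteg_wmeas[where C="\<bar>C\<bar>"])
		show "wmeas (Tn n\<otimes>Pn n) (%p. G0 (fst p) (snd p))"
			unfolding G0_def by(intro wmeas_If G wmeas_zero) measurable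
		show "norm (G0 a h) <= \<bar>C\<bar>" for a h by(auto simp: G0_def intro: order_trans[OF _ abs_ge_self])
	qed
	moreover have "winteg (Pn n) (G0 z) = Av n m t F z" if z:"z : space (Tn n)" for z
	proof -
		have "G0 z = G z" using path_bound[OF z F] by(simp add: G0_def G_def fun_eq_iff)
		then show ?thesis unfolding Av_def G_def by simp
	qed
	ultimately show "wmeas (Tn n) (Av n m t F)" by(subst wmeas_cong) auto
qed

lemma Av_cong_section:
	assumes t:"selects n m t" and ga:"ga : space (En n)" and F:"bd m C F" and F': "bd m C' F'"
		and eq:"AE h in Pn n. AE x in mu. F (sel m t ga (shift n ga h),x) = F' (sel m t ga (shift n ga h),x)"
	shows "AE x in mu. Av n m t F (ga,x) = Av n m t F' (ga,x)"
proof -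
	let ?Q = "%h x. F (sel m t ga (shift n ga h),x) = F' (sel m t ga (shift n ga h),x)"
	have Q:"{p : space (Pn n\<otimes>mu). ?Q (fst p) (snd p)} : sets (Pn n\<otimes>mu)"
		by(intro wmeas_eq_set wmeas_compose[OF bdD(1)[OF F] path_joint_measurable[OF t ga]]
			wmeas_compose[OF bdD(1)[OF F'] path_joint_measurable[OF t ga]])
	have "AE x in mu. AE h in Pn n. ?Q h x" using pm.AE_commute[OF Q] eq by simp
	then show ?thesis using AE_space
	proof eventually_elim
		case (elim x)
		have z:"(ga,x) : space (Tn n)" by(rule space_TnI[OF ga elim(2)])
		show ?case unfolding Av_def
			by(rule winteg_cong_AE[OF path_wmeas[OF t z bdD(1)[OF F]] path_wmeas[OF t z bdD(1)[OF F']]])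
				(use elim(1) in simp)
	qed
qed

lemma Av_cong_AE:
	assumes t:"selects n m t" and F:"bd m C F" and F': "bd m C' F'" and eq:"AE z in Tn m. F z = F' z"
	shows "AE z in Tn n. Av n m t F z = Av n m t F' z"
proof(rule pn.AE_pair_measure)
	show "{z : space (Tn n). Av n m t F z = Av n m t F' z} : sets (Tn n)"
		by(intro wmeas_eq_set bdD(1)[OF bd_Av[OF t F]] bdD(1)[OF bd_Av[OF t F']])
	have "AE de in En m. AE x in mu. F (de,x) = F' (de,x)" using pn.AE_pair[OF eq] .
	from nonsingularD[OF sel_nonsingular[OF t] this]
	have "AE p in En n\<otimes>En n. AE x in mu. F (sel m t (fst p) (snd p),x) = F' (sel m t (fst p) (snd p),x)" .
	then have "AE ga in En n. AE de in En n. AE x in mu. F (sel m t ga de,x) = F' (sel m t ga de,x)"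
		using ep.AE_pair[of _ n n] by fastforce
	then show "AE ga in En n. AE x in mu. Av n m t F (ga,x) = Av n m t F' (ga,x)"
		using AE_space
	proof eventually_elim
		case (elim ga)
		show ?case by(rule Av_cong_section[OF t elim(2) F F' AE_Pn[OF AE_shift[OF elim(1)]]])
	qed
qed

lemma Av_cong_all:
	assumes t:"selects n m t" and F:"bd m C F" and F': "bd m C' F'"
		and eq:"!!de. de : space (En m) ==> AE x in mu. F (de,x) = F' (de,x)" and ga:"ga : space (En n)"
	shows "AE x in mu. Av n m t F (ga,x) = Av n m t F' (ga,x)"
	by(rule Av_cong_section[OF t ga F F']) (simp add: eq)

lemma Av_Tw:
	assumes t:"selects n m t" and F:"bd m C F" and z:"z : space (Tn n)"
	shows "Av n m t (Tw m g F) z = Tw n g (Av n m t F) z"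
proof -
	have z': "Tz n g z : space (Tn n)" by(rule Tz_space[OF z])
	let ?G = "%h. F (sel m t (fst (Tz n g z)) (shift n (fst (Tz n g z)) h),snd (Tz n g z))"
	have e:"Tw m g F (sel m t (fst z) (shift n (fst z) h),snd z) = ?G h o\<^sub>L Lb (- g,snd z)" for h
		unfolding Tw_def Tz_def by(simp add: shift_ltr sel_ltr[OF t])
	have "wmeas (Pn n) (%h. Tw m g F (sel m t (fst z) (shift n (fst z) h),snd z))"
		by(rule path_wmeas[OF t z Tw_wmeas1[OF bdD(1)[OF F]]])
	then have "wmeas (Pn n) (%h. ?G h o\<^sub>L Lb (- g,snd z))" unfolding e .
	from pr.winteg_compose[OF path_wmeas[OF t z' bdD(1)[OF F]] path_bound[OF z' F] this]
	show ?thesis unfolding Av_def e by(simp add: Tw_def)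
qed

abbreviation "Rg n \<equiv> Av n n Inr"

lemma sel_Inr_shift:"sel n Inr ga (shift n ga h) = shift n ga h"
	unfolding sel_Inr by(simp add: shift_def)

text \<open>An identity at almost every tuple yields one at every tuple \<open>ga\<close>, because
  the law of \<open>ga + h\<close> is absolutely continuous. The homotopy \<open>Hm\<close> lacks
  this property, since prism simplices keep entries of \<open>ga\<close>; hence its two congruence
  rules.\<close>

lemma Rg_cong:
	assumes F:"bd n C F" and F': "bd n C' F'" and eq:"AE z in Tn n. F z = F' z" and ga:"ga : space (En n)"
	shows "AE x in mu. Rg n F (ga,x) = Rg n F' (ga,x)"
proof(rule Av_cong_section[OF selects_Inr ga F F'])
	have "AE de in En n. AE x in mu. F (de,x) = F' (de,x)" using pn.AE_pair[OF eq] .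
	from AE_Pn[OF AE_shift[OF this]]
	show "AE h in Pn n. AE x in mu. F (sel n Inr ga (shift n ga h),x) = F' (sel n Inr ga (shift n ga h),x)"
		unfolding sel_Inr_shift .
qed

text \<open>The prism operator averaged over \<open>h\<close>; in degree \<open>0\<close> it is the
  empty sum.\<close>

definition Hm :: "nat => ((nat => 'g) \<times> 'x => 'e \<Rightarrow>\<^sub>L real) => (nat => 'g) \<times> 'x => 'e \<Rightarrow>\<^sub>L real" where
	"Hm n F z = (\<Sum>i<n. (-1) ^ i *\<^sub>R Av n (Suc n) (mixt_index i) F z)"

lemma bd_Hm:"bd (Suc n) C F ==> bd n (real n * C) (Hm n F)"
	unfolding Hm_def[abs_def] using bd_sum[of "{..<n}" n C "%i. Av n (Suc n) (mixt_index i) F"] bd_Av[OF selects_mixt] by simp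

lemma Hm_cong_AE:
	assumes F:"bd (Suc n) C F" and F': "bd (Suc n) C' F'" and eq:"AE z in Tn (Suc n). F z = F' z"
	shows "AE z in Tn n. Hm n F z = Hm n F' z"
proof -
	have "AE z in Tn n. ALL i:{..<n}. Av n (Suc n) (mixt_index i) F z = Av n (Suc n) (mixt_index i) F' z"
		using Av_cong_AE[OF selects_mixt F F' eq] by(simp add: AE_ball_countable)
	then show ?thesis by(rule eventually_mono) (simp add: Hm_def)
qed

lemma Hm_cong_all:
	assumes F:"bd (Suc n) C F" and F': "bd (Suc n) C' F'"
		and eq:"!!de. de : space (En (Suc n)) ==> AE x in mu. F (de,x) = F' (de,x)" and ga:"ga : space (En n)"
	shows "AE x in mu. Hm n F (ga,x) = Hm n F' (ga,x)"
proof -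
	have "AE x in mu. ALL i:{..<n}. Av n (Suc n) (mixt_index i) F (ga,x) = Av n (Suc n) (mixt_index i) F' (ga,x)"
		using Av_cong_all[OF selects_mixt F F' eq ga] by(simp add: AE_ball_countable)
	then show ?thesis by(rule eventually_mono) (simp add: Hm_def)
qed

lemma Hm_Tw:
	assumes F:"bd (Suc n) C F" and z:"z : space (Tn n)"
	shows "Hm n (Tw (Suc n) g F) z = Tw n g (Hm n F) z"
proof -
	have "Hm n (Tw (Suc n) g F) z = (\<Sum>i<n. (-1) ^ i *\<^sub>R Tw n g (Av n (Suc n) (mixt_index i) F) z)"
		unfolding Hm_def by(intro sum.cong refl arg_cong2[where f=scaleR] Av_Tw[OF selects_mixt F z]) simp
	also have "... = Tw n g (Hm n F) z"
		unfolding Tw_def Hm_def by(rule blinfun_eqI) (simp add: blinfun.sum_left blinfun.scaleR_left)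
	finally show ?thesis .
qed

lemma distr_omit_Pn:"distr (Pn (Suc n)) (Pn n) (omit n i) = Pn n"
proof -
	let ?t = "%j. if j < i then j else Suc j"
	have "distr (PiM {..<Suc n} (%_. \<pi>)) (PiM {..<n} (%i. \<pi>)) (%\<omega>. \<lambda>j\<in>{..<n}. \<omega> (?t j)) = PiM {..<n} (%i. \<pi>)"
		by(rule distr_PiM_reindex[of "{..<Suc n}" "%_. \<pi>" ?t "{..<n}"]) (auto simp: prob_pi inj_on_def split: if_splits)
	moreover have "(%\<omega>::nat => 'g. \<lambda>j\<in>{..<n}. \<omega> (?t j)) = omit n i" by(auto simp: omit_def restrict_def fun_eq_iff)
	ultimately show ?thesis by(simp only:)
qed

lemma omit_shift:"omit n i (shift (Suc n) ga h) = shift n (omit n i ga) (omit n i h)"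
	by(auto simp: omit_def shift_def restrict_def fun_eq_iff)

text \<open>Integrating the prism identity between \<open>ga\<close> and \<open>ga + h\<close>: the averaging operator is homotopic to the identity.\<close>

lemma prism_average:
	assumes F:"bd (Suc m) C F" and z:"z : space (Tn (Suc m))"
	shows "Hm (Suc m) (cobF (Suc m) F) z + cobF m (Hm m F) z = Rg (Suc m) F z - F z"
proof -
	obtain ga x where zz:"z = (ga,x)" by(cases z)
	have ga:"ga : space (En (Suc m))" and x:"x : space mu" using z unfolding zz by(auto simp: space_pair_measure)
	define Kc where "Kc = real (Suc (Suc m)) * C"
	define f where "f ga = F (ga,x)" for ga
	let ?n = "Suc m" and ?S = "shift (Suc m) ga"
	define A where "A h = prism ?n (cob ?n f) ga (?S h)" for h
	define B where "B l h = prism m f (omit m l ga) (omit m l (?S h))" for l h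
	have fC:"norm (f de) <= C" if "de : space (En ?n)" for de
		unfolding f_def by(rule bdD(2)[OF F space_TnI[OF that x]])
	have fS:"wmeas (Pn ?n) (%h. f (?S h))"
		using path_wmeas[OF selects_Inr z bdD(1)[OF F]] by(simp add: zz f_def sel_Inr_shift)
	have bc:"bd (Suc ?n) Kc (cobF ?n F)" unfolding Kc_def by(rule bd_cobF[OF F])
	have cF:"cobF ?n F (de,x) = cob ?n f de" for de unfolding cobF_cob f_def ..
	have Ai:"wmeas (Pn ?n) (%h. cob ?n f (mixt ?n i ga (?S h)))" if "i < ?n" for i
		using path_wmeas[OF selects_mixt[OF that] z bdD(1)[OF bc]] by(simp add: zz sel_mixt cF)
	have Ab:"norm (cob ?n f (mixt ?n i ga (?S h))) <= Kc" for i h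
		using path_bound[OF z bc,of "mixt_index i" "?S h"] by(simp add: zz sel_mixt cF)
	have A_int:"winteg (Pn ?n) A = Hm ?n (cobF ?n F) z"
		unfolding A_def prism_def Hm_def Av_def
		by(subst pr.winteg_sum[of _ ?n _ "Kc"]) (simp_all add: Ai Ab zz sel_mixt cF del: sum.lessThan_Suc)
	have Aw:"wmeas (Pn ?n) A" unfolding A_def prism_def using Ai by(intro wmeas_sum wmeas_scaleR) simp
	have Abd:"norm (A h) <= real ?n * (Kc)" for h
		unfolding A_def prism_def using Ab sum_norm_bound[of "{..<?n}" "%i. (-1) ^ i *\<^sub>R cob ?n f (mixt ?n i ga (?S h))" "Kc"]
		by(simp add: power_abs del: sum.lessThan_Suc)
	have zl:"(omit m l ga,x) : space (Tn m)" for l by(rule space_TnI[OF omit_in x])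
	have om:"omit m l : Pn ?n ->M Pn m" for l
		using omit_nonsingular[of m l] by(simp add: nonsingular_def measurable_cong_sets[OF sets_Pn sets_Pn])
	have Bl:"wmeas (Pn m) (%h. prism m f (omit m l ga) (shift m (omit m l ga) h))" for l
		unfolding prism_def
	proof(intro wmeas_sum wmeas_scaleR)
		fix i assume "i : {..<m}"
		then have "i < m" by simp
		from path_wmeas[OF selects_mixt[OF this] zl[of l] bdD(1)[OF F]]
		show "wmeas (Pn m) (%h. f (mixt m i (omit m l ga) (shift m (omit m l ga) h)))" by(simp add: f_def sel_mixt)
	qed
	have B_eq:"B l h = prism m f (omit m l ga) (shift m (omit m l ga) (omit m l h))" for l h
		unfolding B_def omit_shift ..
	have Bw:"wmeas (Pn ?n) (B l)" for l unfolding B_eq[abs_def] by(rule wmeas_compose[OF Bl om])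
	\<comment> \<open>\<open>B l\<close> depends on \<open>h\<close> only through the tuple with entry
	  \<open>l\<close> omitted, and that tuple again has independent entries of law
	  \<open>\<pi>\<close>. So the integral over \<open>m + 1\<close> increments equals one over
	  \<open>m\<close>.\<close>
	have B_int:"winteg (Pn ?n) (B l) = Hm m F (omit m l ga,x)" for l
	proof -
		have "winteg (Pn ?n) (B l) = winteg (Pn m) (%h. prism m f (omit m l ga) (shift m (omit m l ga) h))"
			unfolding B_eq[abs_def] by(rule winteg_distr[OF om Bl distr_omit_Pn])
		also have "... = (\<Sum>i<m. (-1) ^ i *\<^sub>R winteg (Pn m) (%h. f (mixt m i (omit m l ga) (shift m (omit m l ga) h))))"
			unfolding prism_def
		proof(rule pr.winteg_sum)
			fix i assume "i : {..<m}"
			then have "i < m" by simp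
			from path_wmeas[OF selects_mixt[OF this] zl[of l] bdD(1)[OF F]]
			show "wmeas (Pn m) (%h. f (mixt m i (omit m l ga) (shift m (omit m l ga) h)))" by(simp add: f_def sel_mixt)
		next
			fix i h show "norm (f (mixt m i (omit m l ga) (shift m (omit m l ga) h))) <= C"
				by(rule fC) (simp add: mixt_def space_En)
		qed
		finally show ?thesis by(simp add: Hm_def Av_def sel_mixt f_def)
	qed
	have Bb:"norm (B l h) <= real m * C" for l h
		unfolding B_def prism_def
		using sum_norm_bound[of "{..<m}" "%i. (-1) ^ i *\<^sub>R f (mixt m i (omit m l ga) (omit m l (?S h)))" C] fC
		by(simp add: power_abs mixt_def space_En)
	\<comment> \<open>The sign is moved into the coefficients, so that the prisms over faces enter as
	  one subtracted sum.\<close>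
	have "A h - (\<Sum>l<?n. (- ((-1) ^ l)) *\<^sub>R B l h) = f (?S h) - f ga" for h
		using prism_identity[of ga m "?S h" f] ga shift_in[of ?n ga h]
		by(simp add: A_def B_def space_En sum_negf del: sum.lessThan_Suc)
	then have "winteg (Pn ?n) (%h. A h - (\<Sum>l<?n. (- ((-1) ^ l)) *\<^sub>R B l h)) = winteg (Pn ?n) (%h. f (?S h) - f ga)"
		by simp
	also have "... = winteg (Pn ?n) (%h. f (?S h)) - winteg (Pn ?n) (%h. f ga)"
		by(rule pr.winteg_diff[OF fS fC _ order_refl]) (simp_all add: wmeas_def)
	also have "... = Rg ?n F z - F z" by(simp add: pr.winteg_const Av_def zz sel_Inr_shift f_def)
	finally have 1:"winteg (Pn ?n) (%h. A h - (\<Sum>l<?n. (- ((-1) ^ l)) *\<^sub>R B l h)) = Rg ?n F z - F z" .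
	have "winteg (Pn ?n) (%h. A h - (\<Sum>l<?n. (- ((-1) ^ l)) *\<^sub>R B l h))
			= winteg (Pn ?n) A - winteg (Pn ?n) (%h. \<Sum>l<?n. (- ((-1) ^ l)) *\<^sub>R B l h)"
	proof(rule pr.winteg_diff[OF Aw Abd])
		show "wmeas (Pn ?n) (%h. \<Sum>l<?n. (- ((-1) ^ l)) *\<^sub>R B l h)" using Bw by(intro wmeas_sum wmeas_scaleR)
		show "norm (\<Sum>l<?n. (- ((-1) ^ l)) *\<^sub>R B l h) <= real (card {..<?n}) * (real m * C)" for h
			by(rule sum_norm_bound) (simp add: Bb power_abs)
	qed
	also have "winteg (Pn ?n) (%h. \<Sum>l<?n. (- ((-1) ^ l)) *\<^sub>R B l h) = (\<Sum>l<?n. (- ((-1) ^ l)) *\<^sub>R winteg (Pn ?n) (B l))"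
		by(rule pr.winteg_sum[OF Bw Bb])
	also have "... = - cobF m (Hm m F) z" unfolding B_int cobF_def zz by(simp add: sum_negf del: sum.lessThan_Suc)
	finally show ?thesis using 1 A_int by simp
qed

lemma cobF_cobF:"cobF (Suc n) (cobF n F) z = 0"
proof(cases z)
	case (Pair ga x)
	then show ?thesis using cob_cob[of n "%ga. F (ga,x)" ga] by(simp add: cobF_cob)
qed

end

section \<open>Continuity\<close>

context semidirect_module
begin

lemma section_mem:"bd n C F ==> ga : space (En n) ==> (%x. F (ga,x)) : Linf_functions mu"
	by(rule Linf_functionsI[of _ _ C])
		(auto intro!: bdD(2) space_TnI wmeas_compose[OF bdD(1) measurable_Pair1'])

lemma section_norm:"bd n C F ==> ga : space (En n) ==> 0 <= C ==> Linf_norm mu (%x. F (ga,x)) <= C"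
	by(rule Linf_norm_le) (auto intro!: bdD(2) space_TnI)

lemma bd_mono:"bd n C F ==> C <= C' ==> bd n C' F"
	unfolding bd_def by(auto intro: order_trans)

text \<open>Norm continuity of \<open>ga \<mapsto> [F (ga, _)]\<close> along sequences. Sequences
  suffice in a second countable group and are the form in which dominated convergence and the
  Scheffe lemma apply.\<close>

definition scont :: "nat => ((nat => 'g) \<times> 'x => 'e \<Rightarrow>\<^sub>L real) => bool" where
	"scont n F <-> (ALL s ga. (ALL j::nat. s j : space (En n)) --> ga : space (En n) --> (ALL i<n. (%j. s j i) ----> ga i) -->
		(%j. Linf_norm mu (%x. F (ga,x) - F (s j,x))) ----> 0)"

lemma scontD:
	assumes "scont n F" "!!j::nat. s j : space (En n)" "ga : space (En n)" "!!i. i < n ==> (%j. s j i) ----> ga i"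
	shows "(%j. Linf_norm mu (%x. F (ga,x) - F (s j,x))) ----> 0"
	using assms unfolding scont_def by simp

lemma scontI:
	assumes "!!s ga. (!!j::nat. s j : space (En n)) ==> ga : space (En n) ==> (!!i. i < n ==> (%j. s j i) ----> ga i) ==>
		EX d. d ----> 0 & (ALL j. Linf_norm mu (%x. F (ga,x) - F (s j,x)) <= d j)" and F:"bd n C F"
	shows "scont n F"
	unfolding scont_def
proof(intro allI impI)
	fix s ga assume s:"ALL j::nat. s j : space (En n)" and ga:"ga : space (En n)" and lim:"ALL i<n. (%j. s j i) ----> ga i"
	obtain d where d:"d ----> 0" "ALL j. Linf_norm mu (%x. F (ga,x) - F (s j,x)) <= d j"
		using assms(1)[of s ga] s ga lim by blast
	show "(%j. Linf_norm mu (%x. F (ga,x) - F (s j,x))) ----> 0"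
	proof(rule tendsto_sandwich[OF _ _ tendsto_const d(1)])
		show "\<forall>\<^sub>F j in sequentially. 0 <= Linf_norm mu (%x. F (ga,x) - F (s j,x))"
			using s ga by(intro always_eventually allI Linf_norm_nonneg Linf.diff_mem section_mem[OF F]) simp_all
	qed (simp add: d(2))
qed

lemma scont_add:
	assumes F:"bd n C F" "scont n F" and G:"bd n C' G" "scont n G" shows "scont n (%z. F z + G z)"
proof(rule scontI[OF _ bd_add[OF F(1) G(1)]])
	fix s ga assume s:"!!j::nat. s j : space (En n)" and ga:"ga : space (En n)" and lim:"!!i. i < n ==> (%j. s j i) ----> ga i"
	let ?d = "%j. Linf_norm mu (%x. F (ga,x) - F (s j,x)) + Linf_norm mu (%x. G (ga,x) - G (s j,x))"
	have "?d ----> 0 + 0" by(intro tendsto_add scontD[OF F(2) s ga lim] scontD[OF G(2) s ga lim])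
	moreover have "Linf_norm mu (%x. F (ga,x) + G (ga,x) - (F (s j,x) + G (s j,x))) <= ?d j" for j
		using Linf.p_triangle[OF Linf.diff_mem[OF section_mem[OF F(1) ga] section_mem[OF F(1) s]]
			Linf.diff_mem[OF section_mem[OF G(1) ga] section_mem[OF G(1) s]],of j j] by(simp add: algebra_simps)
	ultimately show "EX d. d ----> 0 & (ALL j. Linf_norm mu (%x. F (ga,x) + G (ga,x) - (F (s j,x) + G (s j,x))) <= d j)"
		by(intro exI[of _ ?d]) simp
qed

lemma scont_scale:
	assumes F:"bd n C F" "scont n F" shows "scont n (%z. r *\<^sub>R F z)"
proof(rule scontI[OF _ bd_scale[OF F(1)]])
	fix s ga assume s:"!!j::nat. s j : space (En n)" and ga:"ga : space (En n)" and lim:"!!i. i < n ==> (%j. s j i) ----> ga i"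
	let ?d = "%j. \<bar>r\<bar> * Linf_norm mu (%x. F (ga,x) - F (s j,x))"
	have "?d ----> \<bar>r\<bar> * 0" by(intro tendsto_mult tendsto_const scontD[OF F(2) s ga lim])
	moreover have "Linf_norm mu (%x. r *\<^sub>R F (ga,x) - r *\<^sub>R F (s j,x)) <= ?d j" for j
		using Linf.p_scale[OF Linf.diff_mem[OF section_mem[OF F(1) ga] section_mem[OF F(1) s]],of r j] by(simp add: scaleR_diff_right)
	ultimately show "EX d. d ----> 0 & (ALL j. Linf_norm mu (%x. r *\<^sub>R F (ga,x) - r *\<^sub>R F (s j,x)) <= d j)"
		by(intro exI[of _ ?d]) simp
qed

lemma scont_sum:
	assumes "finite I" "!!i. i : I ==> bd n C (F i)" "!!i. i : I ==> scont n (F i)"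
	shows "scont n (%z. \<Sum>i\<in>I. (-1) ^ i *\<^sub>R F i z)"
	using assms
proof(induction I)
	case empty
	have "scont n (%z. 0)" by(simp add: scont_def Linf.p_zero)
	then show ?case by simp
next
	case (insert i I)
	have "scont n (%z. (-1) ^ i *\<^sub>R F i z + (\<Sum>i\<in>I. (-1) ^ i *\<^sub>R F i z))"
		using insert by(intro scont_add[OF bd_scale _ bd_sum] scont_scale) auto
	then show ?case using insert.hyps by simp
qed

lemma scont_cobF:
	assumes F:"bd n C F" "scont n F" shows "scont (Suc n) (cobF n F)"
	unfolding cobF_def[abs_def]
proof(rule scont_sum[where C=C])
	fix i
	show "scont (Suc n) (%z. F (omit n i (fst z),snd z))"
		unfolding scont_def
	proof(intro allI impI)
		fix s ga assume "ALL j::nat. s j : space (En (Suc n))" "ga : space (En (Suc n))" and l:"ALL i<Suc n. (%j. s j i) ----> ga i"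
		have "(%j. Linf_norm mu (%x. F (omit n i ga,x) - F (omit n i (s j),x))) ----> 0"
			by(rule scontD[OF F(2) omit_in omit_in]) (use l in \<open>simp add: omit_def\<close>)
		then show "(%j. Linf_norm mu (%x. F (omit n i (fst (ga,x)),snd (ga,x)) - F (omit n i (fst (s j,x)),snd (s j,x)))) ----> 0"
			by simp
	qed
qed (simp_all add: bd_omit[OF F(1)])

text \<open>For each \<open>h\<close> the selected tuple depends continuously on \<open>ga\<close>,
  so the norm of the difference of sections tends to zero; its integral over \<open>h\<close>
  dominates the norm of the difference of averages. This gives continuity of the homotopy for a
  continuous \<open>F\<close>.\<close>

lemma scont_Av:
	assumes t:"selects n m t" and F:"bd m C0 F" and c:"scont m F" shows "scont n (Av n m t F)"
proof(rule scontI[OF _ bd_Av[OF t F]])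
	define C where "C = \<bar>C0\<bar>"
	have FC:"bd m C F" unfolding C_def by(rule bd_mono[OF F abs_ge_self])
	have C0:"0 <= C" by(simp add: C_def)
	fix s ga assume s:"!!j::nat. s j : space (En n)" and ga:"ga : space (En n)" and lim:"!!i. i < n ==> (%j. s j i) ----> ga i"
	define A where "A ga p = F (sel m t ga (shift n ga (fst p)),snd p)" for ga and p :: "(nat => 'g) \<times> 'x"
	\<comment> \<open>Truncation by \<open>C + C\<close> only affects points outside the space and
	  provides the global bound that measurability of \<open>K j\<close> requires.\<close>
	define D where "D j p = (if norm (A ga p - A (s j) p) <= C + C then A ga p - A (s j) p else 0)" for j p
	define K where "K j h = Linf_norm mu (%x. D j (h,x))" for j h
	have A:"wmeas (Pn n\<otimes>mu) (A de)" if "de : space (En n)" for de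
		unfolding A_def[abs_def] by(rule wmeas_compose[OF bdD(1)[OF FC] path_joint_measurable[OF t that]])
	have AC:"norm (A de (h,x)) <= C" if "x : space mu" for de h x
		unfolding A_def by(rule bdD(2)[OF FC]) (simp add: space_TnI that)
	have DA:"D j (h,x) = A ga (h,x) - A (s j) (h,x)" if "x : space mu" for j h x
		using norm_triangle_le_diff[OF add_mono[OF AC[OF that] AC[OF that]]] by(simp add: D_def)
	have Dw:"wmeas (Pn n\<otimes>mu) (D j)" for j
	proof -
		have w:"wmeas (Pn n\<otimes>mu) (%p. A ga p - A (s j) p)" by(intro wmeas_diff A ga s)
		have [measurable]: "(%p. norm (A ga p - A (s j) p)) : borel_measurable (Pn n\<otimes>mu)" by(rule wmeas_norm[OF w])
		show ?thesis unfolding D_def[abs_def] by(intro wmeas_If w wmeas_zero) measurable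
	qed
	have DC:"norm (D j p) <= C + C" for j p using C0 by(simp add: D_def)
	have Dm:"(%x. D j (h,x)) : Linf_functions mu" if "h : space (Pn n)" for j h
		by(rule Linf_functionsI[OF wmeas_compose[OF Dw measurable_Pair1'[OF that]] AE_I2[OF DC]])
	have K:"K j : borel_measurable (Pn n)" for j
		unfolding K_def[abs_def] by(rule mu.Linf_norm_section_measurable[OF Dw DC])
	have K0:"0 <= K j h" and KC:"K j h <= C + C" if "h : space (Pn n)" for j h
	proof -
		show "0 <= K j h" unfolding K_def by(rule Linf_norm_nonneg[OF Dm[OF that]])
		show "K j h <= C + C" unfolding K_def by(rule Linf_norm_le[OF _ AE_I2[OF DC]]) (use C0 in simp)
	qed
	have Klim:"(%j. K j h) ----> 0" for h
	proof -
		have "K j h = Linf_norm mu (%x. F (sel m t ga (shift n ga h),x) - F (sel m t (s j) (shift n (s j) h),x))" for j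
			unfolding K_def by(rule Linf_norm_cong_AE,rule AE_I2) (simp add: DA A_def)
		moreover have "(%j. Linf_norm mu (%x. F (sel m t ga (shift n ga h),x) - F (sel m t (s j) (shift n (s j) h),x))) ----> 0"
		proof(rule scontD[OF c sel_in sel_in])
			fix i assume i:"i < m"
			show "(%j. sel m t (s j) (shift n (s j) h) i) ----> sel m t ga (shift n ga h) i"
				using t i by(cases rule: selectsE) (simp_all add: i sel_def shift_def lim tendsto_add)
		qed
		ultimately show ?thesis by simp
	qed
	have Ki:"integrable (Pn n) (K j)" for j
		by(rule pr.integrable_const_bound[of _ "C + C"]) (use K0 KC K in auto)
	have "(%j. LINT h|Pn n. K j h) ----> (LINT h|Pn n. 0)"
	proof(rule integral_dominated_convergence[where w="%_. C + C"])
		show "AE h in Pn n. norm (K j h) <= C + C" for j by(rule AE_I2) (use K0 KC in simp)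
	qed (use K Klim in simp_all)
	then have lim0:"(%j. LINT h|Pn n. K j h) ----> 0" by simp
	have "Linf_norm mu (%x. Av n m t F (ga,x) - Av n m t F (s j,x)) <= (LINT h|Pn n. K j h)" for j
	proof(rule Linf_norm_le)
		show "0 <= (LINT h|Pn n. K j h)" by(rule Bochner_Integration.integral_nonneg_AE) (use K0 in auto)
		let ?Q = "%h x. norm (D j (h,x)) <= K j h"
		have Q:"{p : space (Pn n\<otimes>mu). ?Q (fst p) (snd p)} : sets (Pn n\<otimes>mu)"
		proof -
			have [measurable]: "(%p. norm (D j p)) : borel_measurable (Pn n\<otimes>mu)" by(rule wmeas_norm[OF Dw])
			note [measurable] = K
			show ?thesis by simp
		qed
		have "AE h in Pn n. AE x in mu. ?Q h x"
			by(rule AE_I2) (use AE_le_Linf_norm[OF Dm] in \<open>simp add: K_def\<close>)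
		then have "AE x in mu. AE h in Pn n. ?Q h x" using pm.AE_commute[OF Q] by simp
		then show "AE x in mu. norm (Av n m t F (ga,x) - Av n m t F (s j,x)) <= (LINT h|Pn n. K j h)"
			using AE_space
		proof eventually_elim
			case (elim x)
			have z:"(de,x) : space (Tn n)" if "de : space (En n)" for de by(rule space_TnI[OF that elim(2)])
			have Aw:"wmeas (Pn n) (%h. A de (h,x))" if "de : space (En n)" for de
				using path_wmeas[OF t z[OF that] bdD(1)[OF FC]] by(simp add: A_def)
			have "Av n m t F (ga,x) - Av n m t F (s j,x) = winteg (Pn n) (%h. A ga (h,x) - A (s j) (h,x))"
				using pr.winteg_diff[OF Aw[OF ga] AC[OF elim(2)] Aw[OF s] AC[OF elim(2)],of j] by(simp add: Av_def A_def)
			also have "... = winteg (Pn n) (%h. D j (h,x))" by(simp add: DA[OF elim(2)])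
			also have "norm ... <= (LINT h|Pn n. K j h)"
			proof(rule winteg_norm_integral[OF prob_Pn _ DC Ki elim(1)])
				show "wmeas (Pn n) (%h. D j (h,x))"
					using wmeas_diff[OF Aw[OF ga] Aw[OF s]] by(simp add: DA[OF elim(2)])
			qed
			finally show ?case .
		qed
	qed
	then show "EX d. d ----> 0 & (ALL j. Linf_norm mu (%x. Av n m t F (ga,x) - Av n m t F (s j,x)) <= d j)"
		using lim0 by(intro exI[of _ "%j. LINT h|Pn n. K j h"]) simp
qed

lemma scont_Hm:"bd (Suc n) C F ==> scont (Suc n) F ==> scont n (Hm n F)"
	unfolding Hm_def[abs_def] by(rule scont_sum[where C=C]) (auto intro: bd_Av scont_Av selects_mixt)

section \<open>Smoothing by the averaging kernel\<close>

definition Psig :: "nat => (nat => 'g) => (nat => 'g) => real" where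
	"Psig n ga de = Psi n (shift n (%i. - ga i) de)"

lemma Psig_nonneg:"0 <= Psig n ga de" by(simp add: Psig_def Psi_nonneg)

lemma Psig_integrable:"integrable (En n) (Psig n ga)"
	unfolding Psig_def[abs_def]
	by(rule integrable_distr[OF shift_measurable1]) (simp only: distr_shift Psi_integrable)

lemma Psig_integral:"(LINT de|En n. Psig n ga de) = 1"
proof -
	have "Psi n : borel_measurable (En n)" using Psi_integrable by auto
	from integral_distr[OF shift_measurable1 this,of "%i. - ga i"] show ?thesis
		unfolding distr_shift Psig_def by(simp add: Psi_integral)
qed

text \<open>\<open>Psig n ga\<close> is the density of \<open>ga + h\<close>. Left invariance moves
  the dependence on \<open>ga\<close> into this density, so that \<open>F\<close> enters the
  continuity estimate only through its bound.\<close>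

lemma Rg_kernel:
	assumes F:"bd n C F" and ga:"ga : space (En n)" and x:"x : space mu"
	shows "blinfun_apply (Rg n F (ga,x)) v = (LINT de|En n. Psig n ga de * blinfun_apply (F (de,x)) v)"
proof -
	have z:"(ga,x) : space (Tn n)" by(rule space_TnI[OF ga x])
	have Fx [measurable]: "(%de. blinfun_apply (F (de,x)) v) : borel_measurable (En n)"
		by(intro wmeasD wmeas_compose[OF bdD(1)[OF F]] measurable_Pair measurable_const x) simp
	note [measurable] = shift_measurable1
	have [measurable]: "Psi n : borel_measurable (En n)" "Psig n ga : borel_measurable (En n)"
		using Psi_integrable Psig_integrable by auto
	have "blinfun_apply (Rg n F (ga,x)) v = (LINT h|Pn n. blinfun_apply (F (shift n ga h,x)) v)"
		unfolding Av_def using pr.winteg_apply[OF path_wmeas[OF selects_Inr z bdD(1)[OF F]] path_bound[OF z F]]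
		by(simp add: sel_Inr_shift)
	also have "... = (LINT h|En n. Psi n h * blinfun_apply (F (shift n ga h,x)) v)"
		unfolding Pn_density by(subst integral_density) (auto simp: Psi_nonneg)
	also have "... = (LINT h|En n. Psig n ga (shift n ga h) * blinfun_apply (F (shift n ga h,x)) v)"
		by(simp add: Psig_def Psi_def shift_def add.assoc[symmetric])
	also have "... = (LINT de|distr (En n) (En n) (shift n ga). Psig n ga de * blinfun_apply (F (de,x)) v)"
		by(rule integral_distr[symmetric]) measurable
	finally show ?thesis unfolding distr_shift .
qed

text \<open>All kernels are nonnegative of integral 1 and converge pointwise because
  \<open>psi\<close> is continuous.\<close>

lemma Psig_L1_continuous:
	assumes lim:"!!i. i < n ==> (%j. s j i) ----> ga i"
	shows "(%j. LINT de|En n. \<bar>Psig n (s j) de - Psig n ga de\<bar>) ----> 0"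
proof(rule tendsto_ennrealD)
	have "(%j. \<integral>\<^sup>+de. norm (Psig n (s j) de - Psig n ga de) \<partial>En n) ----> 0"
	proof(rule Scheffe_lemma2)
		show "Psig n (s j) : borel_measurable (En n)" for j using Psig_integrable by auto
		show "integrable (En n) (Psig n ga)" by(rule Psig_integrable)
		have nn:"(\<integral>\<^sup>+de. ennreal (norm (Psig n ga de)) \<partial>En n) = 1" for ga
			using nn_integral_eq_integral[OF Psig_integrable,of n ga] by(simp add: Psig_nonneg Psig_integral)
		show "(\<integral>\<^sup>+de. norm (Psig n (s j) de) \<partial>En n) <= (\<integral>\<^sup>+de. norm (Psig n ga de) \<partial>En n)" for j
			unfolding nn by simp
		show "AE de in En n. (%j. Psig n (s j) de) ----> Psig n ga de"
		proof(rule AE_I2)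
			fix de :: "nat => 'g"
			have c:"isCont psi y" for y using psi(1) by(simp add: continuous_on_eq_continuous_at)
			have "(%j. \<Prod>i<n. psi (- s j i + de i)) ----> (\<Prod>i<n. psi (- ga i + de i))"
				by(intro tendsto_prod isCont_tendsto_compose[OF c] tendsto_add tendsto_minus tendsto_const lim) simp
			then show "(%j. Psig n (s j) de) ----> Psig n ga de" by(simp add: Psig_def Psi_def shift_def)
		qed
	qed
	moreover have "(\<integral>\<^sup>+de. norm (Psig n (s j) de - Psig n ga de) \<partial>En n) = ennreal (LINT de|En n. \<bar>Psig n (s j) de - Psig n ga de\<bar>)" for j
		unfolding real_norm_def by(rule nn_integral_eq_integral) (simp_all add: Psig_integrable)
	ultimately show "(%j. ennreal (LINT de|En n. \<bar>Psig n (s j) de - Psig n ga de\<bar>)) ----> ennreal 0" by simp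
qed simp_all

lemma scont_Rg:
	assumes F:"bd n C0 F" shows "scont n (Rg n F)"
proof(rule scontI[OF _ bd_Av[OF selects_Inr F]])
	define C where "C = \<bar>C0\<bar>"
	have FC:"bd n C F" unfolding C_def by(rule bd_mono[OF F abs_ge_self])
	have C0:"0 <= C" by(simp add: C_def)
	fix s ga assume s:"!!j::nat. s j : space (En n)" and ga:"ga : space (En n)" and lim:"!!i. i < n ==> (%j. s j i) ----> ga i"
	let ?w = "%j de. \<bar>Psig n (s j) de - Psig n ga de\<bar>"
	let ?d = "%j. C * (LINT de|En n. ?w j de)"
	have "?d ----> C * 0" by(intro tendsto_mult tendsto_const Psig_L1_continuous lim)
	moreover have "Linf_norm mu (%x. Rg n F (ga,x) - Rg n F (s j,x)) <= ?d j" for j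
	proof(rule Linf_norm_le)
		show d0:"0 <= ?d j" using C0 by simp
		show "AE x in mu. norm (Rg n F (ga,x) - Rg n F (s j,x)) <= ?d j"
		proof(rule AE_I2,rule norm_blinfun_bound[OF d0])
			fix x v assume x:"x : space mu"
			let ?G = "%de. blinfun_apply (F (de,x)) v"
			have G:"?G : borel_measurable (En n)"
				by(intro wmeasD wmeas_compose[OF bdD(1)[OF F]] measurable_Pair measurable_const x) simp
			have Gb:"norm (?G de) <= C * norm v" if "de : space (En n)" for de
				using norm_blinfun[of "F (de,x)" v] mult_right_mono[OF bdD(2)[OF FC space_TnI[OF that x]],of "norm v"] by simp
			have bnd:"AE de in En n. norm (f de * ?G de) <= norm (\<bar>f de\<bar> * (C * norm v))" for f
			proof(rule AE_I2)
				fix de assume "de : space (En n)"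
				from mult_left_mono[OF Gb[OF this],of "\<bar>f de\<bar>"] C0
				show "norm (f de * ?G de) <= norm (\<bar>f de\<bar> * (C * norm v))" by(simp add: abs_mult)
			qed
			have i:"integrable (En n) (%de. f de * ?G de)" if f:"integrable (En n) f" for f
				by(rule Bochner_Integration.integrable_bound[OF _ _ bnd]) (use f G in auto)
			have iw:"integrable (En n) (%de. Psig n ga de - Psig n (s j) de)" by(simp add: Psig_integrable)
			have "blinfun_apply (Rg n F (ga,x) - Rg n F (s j,x)) v
					= (LINT de|En n. (Psig n ga de - Psig n (s j) de) * ?G de)"
				using i[OF Psig_integrable[of n ga]] i[OF Psig_integrable[of n "s j"]]
				by(simp add: minus_blinfun.rep_eq Rg_kernel[OF F ga x] Rg_kernel[OF F s x] left_diff_distrib)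
			also have "norm ... <= (LINT de|En n. norm ((Psig n ga de - Psig n (s j) de) * ?G de))" by(rule integral_norm_bound)
			also have "... <= (LINT de|En n. ?w j de * (C * norm v))"
			proof(rule integral_mono_AE)
				show "integrable (En n) (%de. norm ((Psig n ga de - Psig n (s j) de) * ?G de))" by(intro integrable_norm i iw)
				show "integrable (En n) (%de. ?w j de * (C * norm v))" by(simp add: Psig_integrable)
				show "AE de in En n. norm ((Psig n ga de - Psig n (s j) de) * ?G de) <= ?w j de * (C * norm v)"
					using bnd[of "%de. Psig n ga de - Psig n (s j) de"] by eventually_elim (use C0 in \<open>simp add: abs_mult abs_minus_commute\<close>)
			qed
			finally show "norm (blinfun_apply (Rg n F (ga,x) - Rg n F (s j,x)) v) <= ?d j * norm v" by(simp add: mult_ac)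
		qed
	qed
	ultimately show "EX d. d ----> 0 & (ALL j. Linf_norm mu (%x. Rg n F (ga,x) - Rg n F (s j,x)) <= d j)"
		by(intro exI[of _ ?d]) simp
qed

end

section \<open>Continuous cochains and their jointly measurable representatives\<close>

context semidirect_module
begin

abbreviation "Dn n \<equiv> topspace (tuple_topology n :: (nat => 'g) topology)"

lemma topspace_tuple:"Dn n = space (En n)"
	by(simp add: tuple_topology_def space_PiM)

lemma restrict_continuous:"continuous_map euclidean (tuple_topology n) (%y::nat => 'g. restrict y {..<n})"
	unfolding tuple_topology_def continuous_map_componentwise
proof(intro conjI ballI)
	fix i assume "i : {..<n}"
	then have "(%y::nat => 'g. restrict y {..<n} i) = (%y. y i)" by auto
	moreover have "continuous_map euclidean euclidean (%y::nat => 'g. y i)"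
		unfolding continuous_map_iff_continuous2 by(rule continuous_on_product_coordinates)
	ultimately show "continuous_map euclidean euclidean (%y::nat => 'g. restrict y {..<n} i)" by simp
qed auto

lemma tuple_open_restrict:"openin (tuple_topology n) S ==> open {y::nat => 'g. restrict y {..<n} : S}"
	using openin_continuous_map_preimage[OF restrict_continuous[of n],of S] by simp

lemma inclusion_continuous:"continuous_map (tuple_topology n) euclidean (%y::nat => 'g. y)"
	unfolding euclidean_product_topology[symmetric] continuous_map_componentwise_UNIV
proof
	fix k
	show "continuous_map (tuple_topology n) euclidean (%y::nat => 'g. y k)"
	proof(cases "k < n")
		case True
		then show ?thesis unfolding tuple_topology_def by(intro continuous_map_product_projection) simp
	next
		case False
		have "continuous_map (tuple_topology n) euclidean (%y::nat => 'g. undefined :: 'g)" by simp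
		then show ?thesis
			by(rule continuous_map_eq) (use False in \<open>simp add: topspace_tuple space_En extensional_def\<close>)
	qed
qed

text \<open>Tuples are extensional functions, hence a retract of the full type
  \<open>nat => 'g\<close> under \<open>restrict\<close>, and neighbourhoods in that type can be
  tested on sequences.\<close>

lemma continuous_tuple_iff:
	assumes f:"!!ga. ga : space (En n) ==> f ga : vcarrier V"
	shows "continuous_map (tuple_topology n) (norm_topology V) f \<longleftrightarrow>
		(ALL s ga. (ALL j::nat. s j : space (En n)) --> ga : space (En n) --> (ALL i<n. (%j. s j i) ----> ga i) -->
			(%j. vdist V (f ga) (f (s j))) ----> 0)" (is "?c <-> ?s")
proof -
	interpret MV: Metric_space "vcarrier V" "vdist V" by(rule V.Metric_space_vdist)
	have c:"?c <-> (ALL ga:space (En n). ALL e>0. EX S. openin (tuple_topology n) S & ga : S & (ALL y:S. vdist V (f ga) (f y) < e))"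
		unfolding V.continuous_map_norm_topology_iff topspace_tuple using f by simp
	show ?thesis
	proof
		assume ?c
		show ?s
		proof(intro allI impI)
			fix s ga assume s:"ALL j::nat. s j : space (En n)" and ga:"ga : space (En n)" and lim:"ALL i<n. (%j. s j i) ----> ga i"
			have l:"limitin (tuple_topology n) s ga sequentially"
				unfolding tuple_topology_def limitin_componentwise
				using s ga lim by(simp add: space_En PiE_def Pi_def)
			show "(%j. vdist V (f ga) (f (s j))) ----> 0"
			proof(rule order_tendstoI)
				fix a :: real assume a:"a < 0"
				show "\<forall>\<^sub>F j in sequentially. a < vdist V (f ga) (f (s j))"
					by(rule always_eventually) (use a MV.nonneg less_le_trans in blast)
			next
				fix e :: real assume e:"0 < e"
				obtain S where S:"openin (tuple_topology n) S" "ga : S" "ALL y:S. vdist V (f ga) (f y) < e"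
					using \<open>?c\<close>[unfolded c,rule_format,OF ga e] by(elim exE conjE)
				have "\<forall>\<^sub>F j in sequentially. s j : S" using l S(1,2) unfolding limitin_def by blast
				then show "\<forall>\<^sub>F j in sequentially. vdist V (f ga) (f (s j)) < e"
					by(rule eventually_mono) (use S(3) in blast)
			qed
		qed
	next
		assume s: ?s
		show ?c unfolding c
		proof(intro ballI allI impI)
			fix ga and e :: real assume ga:"ga : space (En n)" and e:"0 < e"
			have rga:"restrict ga {..<n} = ga" using ga by(simp add: space_En extensional_restrict)
			have "eventually (%y. vdist V (f ga) (f (restrict y {..<n})) < e) (nhds ga)"
				unfolding eventually_nhds_iff_sequentially
			proof(intro allI impI)
				fix y :: "nat => nat => 'g" assume y:"y ----> ga"
				have "(%j. vdist V (f ga) (f (restrict (y j) {..<n}))) ----> 0"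
				proof(rule s[rule_format])
					show "restrict (y j) {..<n} : space (En n)" for j by(simp add: space_En)
					fix i assume "i < n"
					then show "(%j. restrict (y j) {..<n} i) ----> ga i"
						using continuous_on_tendsto_compose[OF continuous_on_product_coordinates[of i] y] by simp
				qed (rule ga)
				then show "eventually (%j. vdist V (f ga) (f (restrict (y j) {..<n})) < e) sequentially"
					using e by(rule order_tendstoD(2))
			qed
			then obtain U where U:"open U" "ga : U" "ALL y:U. vdist V (f ga) (f (restrict y {..<n})) < e"
				unfolding eventually_nhds by(elim exE conjE)
			have "openin (tuple_topology n) {y : Dn n. y : U}"
				by(rule openin_continuous_map_preimage[OF inclusion_continuous]) (use U(1) in simp)
			moreover have "vdist V (f ga) (f y) < e" if "y : {y : Dn n. y : U}" for y
				using U(3)[rule_format,of y] that by(simp add: topspace_tuple space_En extensional_restrict)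
			ultimately show "EX S. openin (tuple_topology n) S & ga : S & (ALL y:S. vdist V (f ga) (f y) < e)"
				using U(2) ga by(intro exI[of _ "{y : Dn n. y : U}"]) (simp add: topspace_tuple)
		qed
	qed
qed

definition cc :: "nat => ((nat => 'g) \<times> 'x => 'e \<Rightarrow>\<^sub>L real) => (nat => 'g) => ('x => 'e \<Rightarrow>\<^sub>L real) set" where
	"cc n F = (\<lambda>ga\<in>Dn n. Lcls mu (%x. F (ga,x)))"

lemma cc_apply:"ga : space (En n) ==> cc n F ga = Lcls mu (%x. F (ga,x))"
	by(simp add: cc_def topspace_tuple)

lemma cc_mem:"bd n C F ==> ga : space (En n) ==> cc n F ga : vcarrier V"
	unfolding cc_apply by(intro V_mem section_mem)

lemma cc_continuous_iff:
	assumes F:"bd n C F" shows "continuous_map (tuple_topology n) (norm_topology V) (cc n F) <-> scont n F"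
proof -
	have "vdist V (cc n F ga) (cc n F de) = Linf_norm mu (%x. F (ga,x) - F (de,x))"
		if "ga : space (En n)" "de : space (En n)" for ga de
		unfolding cc_apply[OF that(1)] cc_apply[OF that(2)]
		by(rule vdist_Linf[OF section_mem[OF F that(1)] section_mem[OF F that(2)]])
	then show ?thesis
		unfolding scont_def by(subst continuous_tuple_iff[OF cc_mem[OF F]]) auto
qed

lemma inclusion_borel:"(%y::nat => 'g. y) : En n ->M borel"
proof -
	have "(%y i. y i) : En n ->M PiM UNIV (%_::nat. borel :: 'g measure)"
	proof(rule measurable_PiM_single')
		fix i :: nat
		show "(%y. y i) : En n ->M (borel :: 'g measure)"
		proof(cases "i < n")
			case True
			then show ?thesis using measurable_component_singleton[of i "{..<n}" "%_. eta"]
				by(simp add: measurable_cong_sets[OF refl sets_eta])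
		next
			case False
			have "(%y. y i) : En n ->M (borel :: 'g measure) <-> (%y. undefined) : En n ->M (borel :: 'g measure)"
				by(rule measurable_cong) (use False in \<open>simp add: space_En extensional_def\<close>)
			then show ?thesis by simp
		qed
	qed (simp add: space_PiM)
	then show ?thesis by(simp add: measurable_cong_sets[OF refl sets_PiM_equal_borel])
qed

text \<open>By Lindelof countably many open sets, on each of which \<open>f\<close> varies by less
  than \<open>e\<close> from its value at a centre, cover all tuples. Taking a representative at the
  centre of the first set that contains the tuple uses only countably many of them, and therefore
  gives a jointly measurable function.\<close>

lemma step_approximation:
	assumes f:"!!ga. ga : space (En n) ==> f ga : vcarrier V"
		and c:"continuous_map (tuple_topology n) (norm_topology V) f" and e:"0 < e"
	shows "EX G. wmeas (Tn n) G & (ALL ga:space (En n). (%x. G (ga,x)) : Linf_functions mu & vdist V (Lcls mu (%x. G (ga,x))) (f ga) < e)"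
proof -
	have "EX l. l : Linf_functions mu & f ga = Lcls mu l" if "ga : space (En n)" for ga
		using f[OF that] by(rule V_cases) (intro exI conjI)
	then obtain l where l:"!!ga. ga : space (En n) ==> l ga : Linf_functions mu" "!!ga. ga : space (En n) ==> f ga = Lcls mu (l ga)"
		by metis
	have "EX U. open U & ga : U & (ALL de:U. de : space (En n) --> vdist V (f ga) (f de) < e)" if ga:"ga : space (En n)" for ga
	proof -
		obtain S where S:"openin (tuple_topology n) S" "ga : S" "ALL y:S. vdist V (f ga) (f y) < e"
			using c ga e unfolding V.continuous_map_norm_topology_iff topspace_tuple by blast
		have r:"restrict de {..<n} = de" if "de : space (En n)" for de :: "nat => 'g"
			using that by(simp add: space_En extensional_restrict)
		show ?thesis
		proof(intro exI conjI ballI impI)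
			show "open {y. restrict y {..<n} : S}" by(rule tuple_open_restrict[OF S(1)])
			show "ga : {y. restrict y {..<n} : S}" using S(2) r[OF ga] by simp
			fix de assume "de : {y. restrict y {..<n} : S}" "de : space (En n)"
			then show "vdist V (f ga) (f de) < e" using S(3) r[of de] by simp
		qed
	qed
	then obtain U where U:"!!ga. ga : space (En n) ==> open (U ga)" "!!ga. ga : space (En n) ==> ga : U ga"
		"!!ga de. ga : space (En n) ==> de : U ga ==> de : space (En n) ==> vdist V (f ga) (f de) < e"
		by metis
	obtain \<F> where \<F>: "\<F> <= U ` space (En n)" "countable \<F>" "\<Union>\<F> = \<Union>(U ` space (En n))"
		using Lindelof[of "U ` space (En n)"] U(1) by blast
	then obtain K where K:"countable K" "K <= space (En n)" "\<F> = U ` K"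
		by(meson countable_subset_image)
	have "(%_. undefined) : space (En n)" by(simp add: space_En extensional_def)
	then have Kne:"K ~= {}" using \<F>(3) U(2) unfolding K(3) by blast
	define a where "a = from_nat_into K"
	have aK:"a i : space (En n)" for i using from_nat_into[OF Kne] K(2) unfolding a_def by blast
	have cover:"EX i. ga : U (a i)" if "ga : space (En n)" for ga
	proof -
		have "ga : \<Union>(U ` K)" using \<F>(3) U(2)[OF that] that unfolding K(3) by blast
		then obtain k where "k : K" "ga : U k" by blast
		then show ?thesis using from_nat_into_surj[OF K(1)] unfolding a_def by metis
	qed
	define idx where "idx ga = (LEAST i. ga : U (a i))" for ga
	have idx:"ga : U (a (idx ga))" if "ga : space (En n)" for ga
		unfolding idx_def using cover[OF that] by(rule LeastI_ex)
	have m:"(%z. idx (fst z)) : Tn n ->M count_space UNIV"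
		unfolding idx_def
	proof(rule measurable_Least)
		fix i
		have "U (a i) : sets borel" using U(1)[OF aK] by simp
		then have [measurable]: "Measurable.pred borel (%y. y : U (a i))" by simp
		have [measurable]: "(%z. fst z) : Tn n ->M borel"
			by(rule measurable_compose[OF measurable_fst inclusion_borel])
		show "Measurable.pred (Tn n) (%z. fst z : U (a i))" by measurable
	qed
	define G where "G z = l (a (idx (fst z))) (snd z)" for z
	have "wmeas (Tn n) G"
		unfolding wmeas_def G_def
	proof
		fix v
		show "(%z. blinfun_apply (l (a (idx (fst z))) (snd z)) v) : borel_measurable (Tn n)"
		proof(rule measurable_compose_countable[OF _ m])
			fix i
			have "wmeas mu (l (a i))" using l(1)[OF aK] by(simp add: Linf_functions_iff)
			from measurable_compose[OF measurable_snd wmeasD[OF this]]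
			show "(%z. blinfun_apply (l (a i) (snd z)) v) : borel_measurable (Tn n)" .
		qed
	qed
	moreover have "(%x. G (ga,x)) : Linf_functions mu & vdist V (Lcls mu (%x. G (ga,x))) (f ga) < e" if ga:"ga : space (En n)" for ga
	proof -
		have "(%x. G (ga,x)) = l (a (idx ga))" by(simp add: G_def)
		then show ?thesis using l[OF aK[of "idx ga"]] U(3)[OF aK idx[OF ga] ga] by simp
	qed
	ultimately show ?thesis by blast
qed

text \<open>Choosing a representative for each tuple separately gives no joint measurability. The
  step functions are jointly measurable, and geometrically small errors make them converge at almost
  every point of the section over each single tuple.\<close>

lemma joint_representative:
	assumes f:"!!ga. ga : space (En n) ==> f ga : vcarrier V"
		and c:"continuous_map (tuple_topology n) (norm_topology V) f"
		and C:"!!ga. ga : space (En n) ==> vnorm V (f ga) <= C"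
	obtains F where "bd n C F" "!!ga. ga : space (En n) ==> f ga = Lcls mu (%x. F (ga,x))"
proof -
	have "(%_. undefined) : space (En n)" by(simp add: space_En extensional_def)
	from C[OF this] V.norm_nonneg[OF f[OF this]] have C0:"0 <= C" by linarith
	have "EX G. wmeas (Tn n) G & (ALL ga:space (En n). (%x. G (ga,x)) : Linf_functions mu &
			vdist V (Lcls mu (%x. G (ga,x))) (f ga) < (1 / 2) ^ m)" for m :: nat
		by(rule step_approximation[OF f c]) simp_all
	then obtain G where G:"!!m. wmeas (Tn n) (G m)"
		"!!m ga. ga : space (En n) ==> (%x. G m (ga,x)) : Linf_functions mu"
		"!!m ga. ga : space (En n) ==> vdist V (Lcls mu (%x. G m (ga,x))) (f ga) < (1 / 2) ^ m"
		by metis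
	\<comment> \<open>\<open>2 * (1 / 2) ^ m\<close> dominates the sum of the errors of two consecutive
	  approximations, so over every tuple almost all points are good.\<close>
	define good where "good z <-> (ALL m. norm (G (Suc m) z - G m z) <= 2 * (1 / 2) ^ m)" for z
	define F0 where "F0 z = (if good z then lim (%m. G m z) else 0)" for z
	\<comment> \<open>The cut at \<open>C\<close> gives the exact bound at every point; over each tuple
	  it changes the function on a null set only, since \<open>f ga\<close> has norm at most
	  \<open>C\<close>.\<close>
	define F where "F z = (if norm (F0 z) <= C then F0 z else 0)" for z
	have conv:"(%m. G m z) ----> F0 z" if "good z" for z
	proof -
		have "summable (%m. G (Suc m) z - G m z)"
		proof(rule summable_comparison_test')
			show "summable (%m. 2 * (1 / 2 :: real) ^ m)" by(intro summable_mult summable_geometric) simp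
			show "norm (G (Suc m) z - G m z) <= 2 * (1 / 2) ^ m" for m using that by(simp add: good_def)
		qed
		from summable_LIMSEQ[OF this] have "(%m. G m z - G 0 z) ----> (\<Sum>m. G (Suc m) z - G m z)"
			by(simp add: sum_lessThan_telescope[of "%m. G m z"])
		from tendsto_add[OF this tendsto_const[of "G 0 z"]]
		have "convergent (%m. G m z)" by(simp add: convergentI)
		then show ?thesis unfolding F0_def using that by(simp add: convergent_LIMSEQ_iff)
	qed
	have gm:"{z : space (Tn n). good z} : sets (Tn n)"
	proof -
		have [measurable]: "(%z. norm (G (Suc m) z - G m z)) : borel_measurable (Tn n)" for m
			by(intro wmeas_norm wmeas_diff G(1))
		show ?thesis unfolding good_def by measurable
	qed
	have F0:"wmeas (Tn n) F0"
		unfolding wmeas_def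
	proof
		fix v
		show "(%z. blinfun_apply (F0 z) v) : borel_measurable (Tn n)"
		proof(rule borel_measurable_LIMSEQ_real)
			show "(%z. blinfun_apply (if good z then G m z else 0) v) : borel_measurable (Tn n)" for m
				by(intro wmeasD wmeas_If G(1) wmeas_zero gm)
			fix z
			show "(%m. blinfun_apply (if good z then G m z else 0) v) ----> blinfun_apply (F0 z) v"
			proof(cases "good z")
				case True
				then show ?thesis using bounded_linear.tendsto[OF blinfun.bounded_linear_left conv[OF True],of v] by simp
			qed (simp add: F0_def)
		qed
	qed
	have [measurable]: "(%z. norm (F0 z)) : borel_measurable (Tn n)" by(rule wmeas_norm[OF F0])
	have "wmeas (Tn n) F" unfolding F_def[abs_def] by(intro wmeas_If F0 wmeas_zero) measurable
	then have bF:"bd n C F" using C0 by(simp add: bd_def F_def)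
	have "f ga = Lcls mu (%x. F (ga,x))" if ga:"ga : space (En n)" for ga
	proof -
		obtain l where l:"l : Linf_functions mu" "f ga = Lcls mu l" using f[OF ga] by(rule V_cases)
		have "Linf_norm mu (%x. G m (ga,x) - l x) <= (1 / 2) ^ m" for m
			using G(3)[OF ga,of m] unfolding l(2) vdist_Linf[OF G(2)[OF ga] l(1)] by simp
		then have "AE x in mu. norm (G m (ga,x) - l x) <= (1 / 2) ^ m" for m
			using AE_le_Linf_norm[OF Linf.diff_mem[OF G(2)[OF ga,of m] l(1)]] by(auto elim: eventually_mono intro: order_trans)
		then have ae:"AE x in mu. ALL m. norm (G m (ga,x) - l x) <= (1 / 2) ^ m" by(simp add: AE_all_countable)
		have "Linf_norm mu l <= C" using C[OF ga] unfolding l(2) norm_Linf[OF l(1)] .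
		then have "AE x in mu. norm (l x) <= C"
			using AE_le_Linf_norm[OF l(1)] by(auto elim: eventually_mono intro: order_trans)
		then have "AE x in mu. l x = F (ga,x)"
			using ae
		proof eventually_elim
			case (elim x)
			have "norm (G (Suc m) (ga,x) - G m (ga,x)) <= 2 * (1 / 2) ^ m" for m
			proof -
				have "norm (G (Suc m) (ga,x) - G m (ga,x)) <= norm (G (Suc m) (ga,x) - l x) + norm (G m (ga,x) - l x)"
					using norm_triangle_ineq4[of "G (Suc m) (ga,x) - l x" "G m (ga,x) - l x"] by simp
				also have "... <= (1 / 2) ^ Suc m + (1 / 2) ^ m" using elim(2) by(intro add_mono) blast+
				also have "... <= 2 * (1 / 2) ^ m" by simp
				finally show ?thesis .
			qed
			then have "good (ga,x)" by(simp add: good_def)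
			from conv[OF this] have 1:"(%m. G m (ga,x)) ----> F0 (ga,x)" .
			have "(%m. G m (ga,x) - l x) ----> 0"
				by(rule Lim_null_comparison[OF _ LIMSEQ_power_zero[of "1 / 2 :: real"]]) (use elim(2) in simp_all)
			then have "(%m. G m (ga,x)) ----> l x" by(simp add: LIM_zero_iff)
			from LIMSEQ_unique[OF this 1] have "l x = F0 (ga,x)" .
			then show ?case using elim(1) by(simp add: F_def)
		qed
		then show ?thesis unfolding l(2) using Lcls_eq_iff[OF l(1) section_mem[OF bF ga]] by blast
	qed
	then show thesis by(rule that[OF bF])
qed

end

section \<open>Invariant cochains\<close>

lemma (in sigma_finite_measure) AE_section_sets:
	assumes P:"{z : space (N\<otimes>M). P z} : sets (N\<otimes>M)"
	shows "{y : space N. AE x in M. P (y,x)} : sets N"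
proof -
	let ?A = "{z : space (N\<otimes>M). ~ P z}"
	have A:"?A : sets (N\<otimes>M)" using P by(rule sets.sets_Collect_neg)
	have "(AE x in M. P (y,x)) <-> emeasure M (Pair y -` ?A) = 0" if "y : space N" for y
		by(rule AE_iff_measurable[OF sets_Pair1[OF A]]) (use that in \<open>auto simp: space_pair_measure\<close>)
	then have eq:"{y : space N. AE x in M. P (y,x)} = {y : space N. emeasure M (Pair y -` ?A) = 0}" by blast
	have [measurable]: "(%y. emeasure M (Pair y -` ?A)) : borel_measurable N" by(rule measurable_emeasure_Pair[OF A])
	show ?thesis unfolding eq by measurable
qed

context semidirect_module
begin

definition consn :: "nat => 'g \<times> (nat => 'g) => nat => 'g" where
	"consn n p = (\<lambda>i\<in>{..<Suc n}. case i of 0 => fst p | Suc j => snd p j)"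

definition tailn :: "nat => (nat => 'g) => nat => 'g" where
	"tailn n de = (\<lambda>i\<in>{..<n}. de (Suc i))"

lemma consn_measurable:"consn n : eta\<otimes>En n ->M En (Suc n)"
	unfolding consn_def[abs_def]
proof(rule measurable_restrict)
	fix i assume i:"i : {..<Suc n}"
	show "(%p. case i of 0 => fst p | Suc j => snd p j) : eta\<otimes>En n ->M eta"
	proof(cases i)
		case (Suc j)
		then have "j : {..<n}" using i by simp
		from measurable_compose[OF measurable_snd measurable_component_singleton[OF this]]
		show ?thesis by(simp add: Suc)
	qed simp
qed

lemma distr_consn:"distr (eta\<otimes>En n) (En (Suc n)) (consn n) = En (Suc n)"
proof(rule pf.PiM_eqI)
	fix A :: "nat => 'g set" assume A:"!!i. i : {..<Suc n} ==> A i : sets eta"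
	have A': "A (Suc j) : sets eta" if "j : {..<n}" for j using A[of "Suc j"] that by simp
	have "consn n -` Pi\<^sub>E {..<Suc n} A Int space (eta\<otimes>En n) = A 0 \<times> Pi\<^sub>E {..<n} (%j. A (Suc j))"
	proof(intro set_eqI)
		fix p :: "'g \<times> (nat => 'g)"
		have "consn n p : extensional {..<Suc n}" by(simp add: consn_def)
		then have "consn n p : Pi\<^sub>E {..<Suc n} A <-> (ALL i<Suc n. consn n p i : A i)" by(simp add: PiE_iff Ball_def)
		also have "... <-> fst p : A 0 & (ALL j<n. snd p j : A (Suc j))"
			unfolding All_less_Suc2 by(simp add: consn_def)
		finally show "p : consn n -` Pi\<^sub>E {..<Suc n} A Int space (eta\<otimes>En n) <-> p : A 0 \<times> Pi\<^sub>E {..<n} (%j. A (Suc j))"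
			by(simp add: space_pair_measure space_PiM PiE_iff mem_Times_iff Ball_def conj_ac)
	qed
	then have "emeasure (distr (eta\<otimes>En n) (En (Suc n)) (consn n)) (Pi\<^sub>E {..<Suc n} A)
			= emeasure (eta\<otimes>En n) (A 0 \<times> Pi\<^sub>E {..<n} (%j. A (Suc j)))"
		using A by(subst emeasure_distr[OF consn_measurable]) (auto intro!: sets_PiM_I_finite)
	also have "... = emeasure eta (A 0) * (\<Prod>j\<in>{..<n}. emeasure eta (A (Suc j)))"
	proof(subst sigma_finite_measure.emeasure_pair_measure_Times[OF sigma_finite_power])
		have "emeasure (En n) (Pi\<^sub>E {..<n} (%j. A (Suc j))) = (\<Prod>j\<in>{..<n}. emeasure eta (A (Suc j)))"
			by(rule pf.emeasure_PiM) (simp_all add: A')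
		then show "emeasure eta (A 0) * emeasure (En n) (Pi\<^sub>E {..<n} (%j. A (Suc j))) = emeasure eta (A 0) * (\<Prod>j\<in>{..<n}. emeasure eta (A (Suc j)))"
			by simp
	qed (use A A' in \<open>auto intro!: sets_PiM_I_finite\<close>)
	also have "... = (\<Prod>i\<in>{..<Suc n}. emeasure eta (A i))" by(simp only: prod.lessThan_Suc_shift)
	finally show "emeasure (distr (eta\<otimes>En n) (En (Suc n)) (consn n)) (Pi\<^sub>E {..<Suc n} A) = (\<Prod>i\<in>{..<Suc n}. emeasure eta (A i))" .
qed simp_all

text \<open>Entry 0 is the acting arrow in \<open>groupoid_invariant\<close>. Separating it by
  Fubini turns invariance into a condition on \<open>Tn n\<close> for almost every group
  element.\<close>

lemma AE_split_first:
	assumes Q:"{p : space (eta\<otimes>Tn n). Q (fst p) (snd p)} : sets (eta\<otimes>Tn n)"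
	shows "(AE z in Tn (Suc n). Q (fst z 0) (tailn n (fst z),snd z)) <-> (AE g in eta. AE w in Tn n. Q g w)"
proof -
	interpret en: pair_sigma_finite eta "En n"
		by(rule pair_sigma_finite.intro[OF sigma_finite_measure_axioms sigma_finite_power])
	have pred:"Measurable.pred (eta\<otimes>Tn n) (%p. Q (fst p) (snd p))" using Q by(simp add: pred_def)
	have c0:"(%z. fst z 0) : Tn (Suc n) ->M eta"
		by(rule measurable_compose[OF measurable_fst measurable_component_singleton]) simp
	have c1:"(%z. tailn n (fst z)) : Tn (Suc n) ->M En n"
		unfolding tailn_def
		by(rule measurable_restrict,rule measurable_compose[OF measurable_fst measurable_component_singleton]) simp
	have "(%z. (fst z 0,(tailn n (fst z),snd z))) : Tn (Suc n) ->M eta\<otimes>Tn n"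
		by(intro measurable_Pair c0 c1 measurable_snd)
	from measurable_compose[OF this pred]
	have m1:"{z : space (Tn (Suc n)). Q (fst z 0) (tailn n (fst z),snd z)} : sets (Tn (Suc n))" by(simp add: pred_def)
	have "(%p. (fst (fst p),(snd (fst p),snd p))) : (eta\<otimes>En n)\<otimes>mu ->M eta\<otimes>Tn n" by measurable
	from measurable_compose[OF this pred]
	have m2:"{p : space ((eta\<otimes>En n)\<otimes>mu). Q (fst (fst p)) (snd (fst p),snd p)} : sets ((eta\<otimes>En n)\<otimes>mu)"
		by(simp add: pred_def)
	have m3:"{w : space (Tn n). Q g w} : sets (Tn n)" for g
		using measurable_compose[OF measurable_Pair1'[of g eta "Tn n"] pred] by(simp add: pred_def)
	have tc:"tailn n (consn n p) = snd p" "consn n p 0 = fst p" if "p : space (eta\<otimes>En n)" for p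
	proof -
		have "snd p : extensional {..<n}" using that by(auto simp: space_pair_measure space_En)
		then show "tailn n (consn n p) = snd p"
			by(auto simp: tailn_def consn_def fun_eq_iff restrict_def extensional_def)
	qed (simp add: consn_def)
	let ?R = "%de. AE x in mu. Q (de 0) (tailn n de,x)"
	have "(AE z in Tn (Suc n). Q (fst z 0) (tailn n (fst z),snd z)) <-> (AE de in En (Suc n). ?R de)"
		using pn.AE_pair_iff[of "Suc n" "%de x. Q (de 0) (tailn n de,x)"] m1 by simp
	also have "... <-> (AE de in distr (eta\<otimes>En n) (En (Suc n)) (consn n). ?R de)" unfolding distr_consn ..
	also have "... <-> (AE p in eta\<otimes>En n. ?R (consn n p))"
		using mu.AE_section_sets[OF m1] by(intro AE_distr_iff consn_measurable) simp
	also have "... <-> (AE p in eta\<otimes>En n. AE x in mu. Q (fst p) (snd p,x))"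
		by(rule AE_cong) (simp add: tc)
	also have "... <-> (AE g in eta. AE ga in En n. AE x in mu. Q g (ga,x))"
		using en.AE_pair_iff[of "%g ga. AE x in mu. Q g (ga,x)"] mu.AE_section_sets[OF m2] by simp
	also have "... <-> (AE g in eta. AE w in Tn n. Q g w)"
		using pn.AE_pair_iff[of n "%ga x. Q _ (ga,x)"] m3 by simp
	finally show ?thesis .
qed

definition INV :: "nat => ((nat => 'g) \<times> 'x => 'e \<Rightarrow>\<^sub>L real) => bool" where
	"INV n F <-> (AE g in eta. AE z in Tn n. F z = Tw n g F z)"

text \<open>The counterpart of \<open>INV\<close> for continuous cochains: the identity is required
  at every tuple, with an exceptional set of points \<open>x\<close> only. It remains a condition
  for almost every \<open>g\<close>, as \<open>Lb\<close> allows no more.\<close>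

definition CINV :: "nat => ((nat => 'g) \<times> 'x => 'e \<Rightarrow>\<^sub>L real) => bool" where
	"CINV n F <-> (AE g in eta. ALL ga:space (En n). AE x in mu. F (ga,x) = Tw n g F (ga,x))"

lemma AE_TnI:
	assumes "bd n C F" "bd n C' F'" "!!ga. ga : space (En n) ==> AE x in mu. F (ga,x) = F' (ga,x)"
	shows "AE z in Tn n. F z = F' z"
	by(rule pn.AE_pair_measure) (use assms in \<open>auto intro!: wmeas_eq_set bdD(1)\<close>)

lemma INV_CINV:"bd n C F ==> CINV n F ==> INV n F"
proof -
	assume F:"bd n C F" and C:"CINV n F"
	show "INV n F" using C unfolding INV_def CINV_def
		by(rule eventually_mono) (rule AE_TnI[OF F bd_Tw[OF F]],blast)
qed

lemma Tw_cong_AE: assumes "AE z in Tn n. F z = F' z" shows "AE z in Tn n. Tw n g F z = Tw n g F' z"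
	using nonsingularD[OF Tz_nonsingular assms,of g] by(rule eventually_mono) (simp add: Tw_def)

lemma INV_cong:
	assumes eq:"AE z in Tn n. F z = F' z" shows "INV n F <-> INV n F'"
proof -
	have *: "INV n F'" if i:"INV n F" and eq:"AE z in Tn n. F z = F' z" for F F'
		using i unfolding INV_def
	proof(rule eventually_mono)
		fix g assume "AE z in Tn n. F z = Tw n g F z"
		then show "AE z in Tn n. F' z = Tw n g F' z"
			using eq Tw_cong_AE[OF eq,of g] by eventually_elim simp
	qed
	have "AE z in Tn n. F' z = F z" using eq by(rule eventually_mono) simp
	then show ?thesis using * eq by blast
qed

lemma Tw_add:"Tw n g (%z. F z + G z) z = Tw n g F z + Tw n g G z"
	unfolding Tw_def by(rule blinfun_eqI) (simp add: blinfun.add_left)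

lemma Tw_scale:"Tw n g (%z. r *\<^sub>R F z) z = r *\<^sub>R Tw n g F z"
	unfolding Tw_def by(rule blinfun_eqI) (simp add: blinfun.scaleR_left)

lemma INV_add:
	assumes "INV n F" "INV n G" shows "INV n (%z. F z + G z)"
	using assms unfolding INV_def
proof eventually_elim
	case (elim g)
	then show ?case by eventually_elim (simp add: Tw_add)
qed

lemma INV_scale:
	assumes "INV n F" shows "INV n (%z. r *\<^sub>R F z)"
	using assms unfolding INV_def
proof eventually_elim
	case (elim g)
	then show ?case by eventually_elim (simp add: Tw_scale)
qed

lemma CINV_add:
	assumes "CINV n F" "CINV n G" shows "CINV n (%z. F z + G z)"
	using assms unfolding CINV_def
proof eventually_elim
	case (elim g)
	show ?case
	proof
		fix ga assume ga:"ga : space (En n)"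
		from elim(1)[rule_format,OF ga] elim(2)[rule_format,OF ga]
		show "AE x in mu. F (ga,x) + G (ga,x) = Tw n g (%z. F z + G z) (ga,x)" by eventually_elim (simp add: Tw_add)
	qed
qed

lemma CINV_scale:
	assumes "CINV n F" shows "CINV n (%z. r *\<^sub>R F z)"
	using assms unfolding CINV_def
proof eventually_elim
	case (elim g)
	show ?case
	proof
		fix ga assume ga:"ga : space (En n)"
		from elim[rule_format,OF ga]
		show "AE x in mu. r *\<^sub>R F (ga,x) = Tw n g (%z. r *\<^sub>R F z) (ga,x)" by eventually_elim (simp add: Tw_scale)
	qed
qed

lemma INV_cobF: assumes "INV n F" shows "INV (Suc n) (cobF n F)"
	using assms unfolding INV_def
proof(rule eventually_mono)
	fix g assume "AE z in Tn n. F z = Tw n g F z"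
	then show "AE z in Tn (Suc n). cobF n F z = Tw (Suc n) g (cobF n F) z"
		unfolding cobF_Tw[symmetric] by(rule cobF_cong_AE)
qed

lemma cobF_cong_all:
	assumes "!!ga. ga : space (En n) ==> AE x in mu. F (ga,x) = F' (ga,x)"
	shows "AE x in mu. cobF n F (ga,x) = cobF n F' (ga,x)"
proof -
	have "AE x in mu. ALL i:{..<Suc n}. F (omit n i ga,x) = F' (omit n i ga,x)"
		using assms[OF omit_in] by(simp add: AE_ball_countable)
	then show ?thesis by(rule eventually_mono) (simp add: cobF_def del: sum.lessThan_Suc)
qed

lemma CINV_cobF: assumes "CINV n F" shows "CINV (Suc n) (cobF n F)"
	using assms unfolding CINV_def
proof(rule eventually_mono)
	fix g assume a:"ALL ga:space (En n). AE x in mu. F (ga,x) = Tw n g F (ga,x)"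
	show "ALL ga:space (En (Suc n)). AE x in mu. cobF n F (ga,x) = Tw (Suc n) g (cobF n F) (ga,x)"
		unfolding cobF_Tw[symmetric] by(intro ballI cobF_cong_all) (rule a[rule_format])
qed

lemma INV_Hm: assumes F:"bd (Suc n) C F" and i:"INV (Suc n) F" shows "INV n (Hm n F)"
	unfolding INV_def
proof(rule eventually_mono[OF i[unfolded INV_def]])
	fix g assume a:"AE z in Tn (Suc n). F z = Tw (Suc n) g F z"
	show "AE z in Tn n. Hm n F z = Tw n g (Hm n F) z"
		using Hm_cong_AE[OF F bd_Tw[OF F] a] AE_space by eventually_elim (simp add: Hm_Tw[OF F])
qed

lemma CINV_Hm: assumes F:"bd (Suc n) C F" and i:"CINV (Suc n) F" shows "CINV n (Hm n F)"
	unfolding CINV_def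
proof(rule eventually_mono[OF i[unfolded CINV_def]],intro ballI)
	fix g ga assume a:"ALL ga:space (En (Suc n)). AE x in mu. F (ga,x) = Tw (Suc n) g F (ga,x)" and ga:"ga : space (En n)"
	have "AE x in mu. Hm n F (ga,x) = Hm n (Tw (Suc n) g F) (ga,x)"
		by(rule Hm_cong_all[OF F bd_Tw[OF F] _ ga]) (rule a[rule_format])
	then show "AE x in mu. Hm n F (ga,x) = Tw n g (Hm n F) (ga,x)"
		using AE_space by eventually_elim (simp add: Hm_Tw[OF F space_TnI[OF ga]])
qed

text \<open>Smoothing upgrades invariance at almost every tuple to invariance at every tuple, by
  \<open>Rg_cong\<close> applied to \<open>F\<close> and its translate.\<close>

lemma CINV_Rg: assumes F:"bd n C F" and i:"INV n F" shows "CINV n (Rg n F)"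
	unfolding CINV_def
proof(rule eventually_mono[OF i[unfolded INV_def]],intro ballI)
	fix g ga assume a:"AE z in Tn n. F z = Tw n g F z" and ga:"ga : space (En n)"
	show "AE x in mu. Rg n F (ga,x) = Tw n g (Rg n F) (ga,x)"
		using Rg_cong[OF F bd_Tw[OF F] a ga] AE_space
		by eventually_elim (simp add: Av_Tw[OF selects_Inr F space_TnI[OF ga]])
qed

section \<open>Measurable cochains\<close>

definition MC :: "nat => ((nat => 'g) \<times> 'x => 'e \<Rightarrow>\<^sub>L real) => ((nat => 'g \<times> 'x) => 'e \<Rightarrow>\<^sub>L real) set" where
	"MC n F = Lcls (FP n) (%a. F (J' n a))"

abbreviation "LF n \<equiv> Linf (FP n) :: ((nat => 'g \<times> 'x) => 'e \<Rightarrow>\<^sub>L real) set seminormed_space"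

context
	fixes n :: nat assumes n:"0 < n"
begin

lemma MC_mem:"bd n C F ==> (%a. F (J' n a)) : Linf_functions (FP n)"
proof -
	assume F:"bd n C F"
	note m = J'_measurable[OF n]
	show ?thesis
		by(rule Linf_functionsI[OF wmeas_compose[OF bdD(1)[OF F] m] AE_I2[OF bdD(2)[OF F measurable_space[OF m]]]])
qed

lemma MC_carrier:"bd n C F ==> MC n F : vcarrier (LF n)"
	unfolding MC_def carrier_Linf by(rule imageI[OF MC_mem])

lemma mem_MC_iff:
	assumes F:"bd n C F"
	shows "f : MC n F <-> f : Linf_functions (FP n) & (AE z in Tn n. f (J n z) = F z)"
proof -
	have "(AE a in FP n. f a = F (J' n a)) <-> (AE z in Tn n. f (J n z) = F z)"
		unfolding AE_FP_iff[OF n] by(rule AE_cong) (simp add: J'_J[OF n])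
	then show ?thesis unfolding MC_def mem_Lcls_iff[OF MC_mem[OF F]] by simp
qed

lemma MC_eq_iff:
	assumes F:"bd n C F" and F': "bd n C' F'" shows "MC n F = MC n F' <-> (AE z in Tn n. F z = F' z)"
proof -
	have "(AE a in FP n. F (J' n a) = F' (J' n a)) <-> (AE z in Tn n. F z = F' z)"
		unfolding AE_FP_iff[OF n] by(rule AE_cong) (simp add: J'_J[OF n])
	then show ?thesis unfolding MC_def Lcls_eq_iff[OF MC_mem[OF F] MC_mem[OF F']] .
qed

text \<open>The representative is bounded at every point by the norm of the class itself; any larger
  constant would spoil the isometry on cohomology.\<close>

lemma MC_cases:
	assumes A:"A : vcarrier (LF n)" obtains F where "bd n (vnorm (LF n) A) F" "A = MC n F"
proof -
	obtain f where f:"f : Linf_functions (FP n)" "A = Lcls (FP n) f" using A unfolding carrier_Linf by(elim imageE)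
	define N where "N = Linf_norm (FP n) f"
	have N0:"0 <= N" unfolding N_def by(rule Linf_norm_nonneg[OF f(1)])
	define F where "F z = (if norm (f (J n z)) <= N then f (J n z) else 0)" for z
	have w:"wmeas (Tn n) (%z. f (J n z))"
		using f(1) by(intro wmeas_compose[OF _ J_measurable]) (simp add: Linf_functions_iff)
	have [measurable]: "(%z. norm (f (J n z))) : borel_measurable (Tn n)" by(rule wmeas_norm[OF w])
	have "wmeas (Tn n) F" unfolding F_def[abs_def] by(intro wmeas_If w wmeas_zero) measurable
	then have F:"bd n N F" using N0 by(simp add: bd_def F_def)
	have "AE z in Tn n. norm (f (J n z)) <= N"
		using AE_le_Linf_norm[OF f(1)] unfolding AE_FP_iff[OF n] N_def .
	then have "AE z in Tn n. f (J n z) = F z" by(rule eventually_mono) (simp add: F_def)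
	then have "f : MC n F" using mem_MC_iff[OF F] f(1) by blast
	then have "A = MC n F" using Linf.mem_cls_iff[OF MC_mem[OF F]] f(2) unfolding MC_def by blast
	moreover have "vnorm (LF n) A = N" unfolding f(2) norm_Linf[OF f(1)] N_def ..
	ultimately show thesis using that F by simp
qed

lemma MC_add:"bd n C F ==> bd n C' F' ==> vadd (LF n) (MC n F) (MC n F') = MC n (%z. F z + F' z)"
	unfolding MC_def by(rule add_Linf[OF MC_mem MC_mem])

lemma MC_scale:"bd n C F ==> vscale (LF n) r (MC n F) = MC n (%z. r *\<^sub>R F z)"
	unfolding MC_def by(rule scale_Linf[OF MC_mem])

lemma MC_zero:"vzero (LF n) = MC n (%z. 0)"
	unfolding MC_def by(rule zero_Linf)

lemma MC_norm:"bd n C F ==> 0 <= C ==> vnorm (LF n) (MC n F) <= C"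
	unfolding MC_def norm_Linf[OF MC_mem]
	by(rule Linf_norm_le) (auto intro!: bdD(2) measurable_space[OF J'_measurable[OF n]])

lemma groupoid_invariant_iff:
	assumes w:"wmeas (Tn n) (%z. f (J n z))"
	shows "groupoid_invariant \<G> nu kap Lb n f <-> INV n (%z. f (J n z))"
proof -
	let ?F = "%z. f (J n z)"
	let ?Q = "%g w. ?F w = Tw n g ?F w"
	have e1:"(\<lambda>i\<in>{..<n}. J (Suc n) z (Suc i)) = J n (tailn n (fst z),snd z)" for z
		by(auto simp: J_def tailn_def restrict_def fun_eq_iff)
	\<comment> \<open>Left multiplication by the inverse of the arrow \<open>(g, act (- g) x)\<close>
	  translates all group parts by \<open>- g\<close> and moves the common target from
	  \<open>x\<close> to \<open>act (- g) x\<close>.\<close>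
	have e2:"(\<lambda>i\<in>{..<n}. gcomp \<G> (ginv \<G> (J (Suc n) z 0)) (J (Suc n) z (Suc i)))
			= J n (Tz n (fst z 0) (tailn n (fst z),snd z))" if z:"z : space (Tn (Suc n))" for z
	proof -
		have x:"snd z : space mu" using z by(auto simp: space_pair_measure)
		have "act (- (- fst z 0 + fst z (Suc i))) (act (- fst z 0) (snd z)) = act (- fst z (Suc i)) (snd z)" for i
			using act_add[OF x,of "- fst z (Suc i) + fst z 0" "- fst z 0"] by(simp add: minus_add add.assoc)
		then show ?thesis
			using x by(auto simp: J_def Tz_def ltr_def tailn_def restrict_def fun_eq_iff)
	qed
	have e3:"contragredient \<G> Lb (J (Suc n) z 0) l = l o\<^sub>L Lb (- fst z 0,snd z)" if z:"z : space (Tn (Suc n))" for z l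
		using z by(auto simp: contragredient_def J_def space_pair_measure)
	have "groupoid_invariant \<G> nu kap Lb n f <-> (AE z in Tn (Suc n). ?Q (fst z 0) (tailn n (fst z),snd z))"
		unfolding groupoid_invariant_def AE_FP_iff[OF zero_less_Suc]
		by(rule AE_cong) (simp only: e1 e2 e3 Tw_def fst_conv snd_conv eq_commute)
	also have "... <-> (AE g in eta. AE w in Tn n. ?Q g w)"
	proof(rule AE_split_first)
		have s:"sets (eta\<otimes>Tn n) = sets (borel\<otimes>Tn n)" by(intro sets_pair_measure_cong sets_eta refl)
		have "{p : space (borel\<otimes>Tn n). ?Q (fst p) (snd p)} : sets (borel\<otimes>Tn n)"
			by(intro wmeas_eq_set Tw_wmeas[OF w] wmeas_compose[OF w]) simp
		then show "{p : space (eta\<otimes>Tn n). ?Q (fst p) (snd p)} : sets (eta\<otimes>Tn n)"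
			unfolding s sets_eq_imp_space_eq[OF s] .
	qed
	finally show ?thesis unfolding INV_def .
qed

lemma MC_invariant_iff:
	assumes F:"bd n C F" shows "(ALL f:MC n F. groupoid_invariant \<G> nu kap Lb n f) <-> INV n F"
proof -
	have *: "groupoid_invariant \<G> nu kap Lb n f <-> INV n F" if f:"f : MC n F" for f
	proof -
		have f': "f : Linf_functions (FP n)" "AE z in Tn n. f (J n z) = F z" using f mem_MC_iff[OF F] by blast+
		have "wmeas (Tn n) (%z. f (J n z))"
			using f'(1) by(intro wmeas_compose[OF _ J_measurable]) (simp add: Linf_functions_iff)
		from groupoid_invariant_iff[OF this] INV_cong[OF f'(2)] show ?thesis by simp
	qed
	have "(%a. F (J' n a)) : MC n F" unfolding MC_def by(rule Linf.cls_self[OF MC_mem[OF F]])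
	then show ?thesis using * by blast
qed

end

lemma omit_J:"omit n i (J (Suc n) z) = J n (omit n i (fst z),snd z)"
	by(auto simp: omit_def J_def restrict_def fun_eq_iff)

text \<open>The existential in \<open>mb_coboundary\<close> does not depend on the representative,
  because omitting an entry is a nonsingular map.\<close>

lemma mb_coboundary_MC:
	assumes F:"bd (Suc k) C F"
	shows "mb_coboundary \<G> nu kap k (MC (Suc k) F) = MC (Suc (Suc k)) (cobF (Suc k) F)"
proof(intro set_eqI)
	fix h
	have k:"k + 2 = Suc (Suc k)" "k + 1 = Suc k" by simp_all
	have cF:"bd (Suc (Suc k)) (real (Suc (Suc k)) * C) (cobF (Suc k) F)" by(rule bd_cobF[OF F])
	have eq:"(AE a in FP (Suc (Suc k)). h a = (\<Sum>i<Suc (Suc k). (-1) ^ i *\<^sub>R f (omit (Suc k) i a))) \<longleftrightarrow>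
			(AE z in Tn (Suc (Suc k)). h (J (Suc (Suc k)) z) = cobF (Suc k) F z)" if f:"f : MC (Suc k) F" for f
	proof -
		have "AE z in Tn (Suc k). f (J (Suc k) z) = F z" using f mem_MC_iff[OF zero_less_Suc F] by blast
		from cobF_cong_AE[OF this]
		have c:"AE z in Tn (Suc (Suc k)). cobF (Suc k) (%z. f (J (Suc k) z)) z = cobF (Suc k) F z" .
		have "(AE a in FP (Suc (Suc k)). h a = (\<Sum>i<Suc (Suc k). (-1) ^ i *\<^sub>R f (omit (Suc k) i a))) \<longleftrightarrow>
				(AE z in Tn (Suc (Suc k)). h (J (Suc (Suc k)) z) = cobF (Suc k) (%z. f (J (Suc k) z)) z)"
			using AE_FP_iff[of "Suc (Suc k)" "%a. h a = (\<Sum>i<Suc (Suc k). (-1) ^ i *\<^sub>R f (omit (Suc k) i a))"]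
			by(simp add: omit_J cobF_def del: sum.lessThan_Suc)
		also have "... <-> (AE z in Tn (Suc (Suc k)). h (J (Suc (Suc k)) z) = cobF (Suc k) F z)"
			by(rule eventually_subst) (rule eventually_mono[OF c],simp)
		finally show ?thesis .
	qed
	have f0:"(%a. F (J' (Suc k) a)) : MC (Suc k) F" unfolding MC_def by(rule Linf.cls_self[OF MC_mem[OF zero_less_Suc F]])
	have bex:"(EX f:S. P f) <-> Q" if "f : S" "!!f. f : S ==> P f <-> Q" for f S P and Q :: bool
		using that by blast
	have b:"(EX f:MC (Suc k) F. AE a in FP (Suc (Suc k)). h a = (\<Sum>i<Suc (Suc k). (-1) ^ i *\<^sub>R f (omit (Suc k) i a))) \<longleftrightarrow>
			(AE z in Tn (Suc (Suc k)). h (J (Suc (Suc k)) z) = cobF (Suc k) F z)"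
		by(rule bex[OF f0]) (rule eq)
	show "h : mb_coboundary \<G> nu kap k (MC (Suc k) F) <-> h : MC (Suc (Suc k)) (cobF (Suc k) F)"
		unfolding mb_coboundary_def k mem_MC_iff[OF zero_less_Suc cF] mem_Collect_eq b ..
qed

end

section \<open>Isometries between quotients\<close>

context vspace
begin

definition subspace :: "'v set => bool" where
	"subspace N <-> N <= vcarrier V & vzero V : N & (ALL u:N. ALL v:N. vadd V u v : N) &
		(ALL r. ALL v:N. vscale V r v : N)"

lemma subspaceD:
	assumes "subspace N"
	shows "N <= vcarrier V" "vzero V : N" "u : N ==> v : N ==> vadd V u v : N" "v : N ==> vscale V r v : N"
	using assms unfolding subspace_def by simp_all

definition vdiff :: "'v => 'v => 'v" where
	"vdiff u v = vadd V u (vscale V (-1) v)"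

lemma vdiff_closed:"u : vcarrier V ==> v : vcarrier V ==> vdiff u v : vcarrier V"
	by(simp add: vdiff_def add_closed scale_closed)

lemma add_vdiff:"v : vcarrier V ==> w : vcarrier V ==> vadd V v (vdiff w v) = w"
	unfolding vdiff_def
	using add_left_commute[of v w "vscale V (-1) v"] by(simp add: scale_closed add_uminus add_zero_right)

lemma vdiff_unique:
	assumes "v : vcarrier V" "n : vcarrier V" shows "vdiff (vadd V v n) v = n"
	by(rule add_cancel_left[of v]) (use assms in \<open>simp_all add: add_vdiff add_closed vdiff_closed\<close>)

lemma vdiff_eqI:"vadd V v n = w ==> v : vcarrier V ==> n : vcarrier V ==> vdiff w v = n"
	using vdiff_unique by blast

lemma add_add_swap:
	assumes "a : vcarrier V" "b : vcarrier V" "c : vcarrier V" "e : vcarrier V"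
	shows "vadd V (vadd V a b) (vadd V c e) = vadd V (vadd V a c) (vadd V b e)"
proof -
	have "vadd V (vadd V a b) (vadd V c e) = vadd V a (vadd V b (vadd V c e))"
		using assms by(simp add: add_assoc add_closed)
	also have "vadd V b (vadd V c e) = vadd V c (vadd V b e)" using assms by(simp add: add_left_commute)
	finally show ?thesis using assms by(simp add: add_assoc add_closed)
qed

context
	fixes N assumes N:"subspace N"
begin

lemma N_mem:"n : N ==> n : vcarrier V" using subspaceD(1)[OF N] by blast

lemma vcoset_iff:
	assumes v:"v : vcarrier V" shows "w : vcoset V N v <-> w : vcarrier V & vdiff w v : N"
proof
	assume "w : vcoset V N v"
	then obtain n where n:"n : N" "w = vadd V v n" unfolding vcoset_def by(elim imageE)
	then show "w : vcarrier V & vdiff w v : N" using v N_mem[OF n(1)] by(simp add: add_closed vdiff_unique)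
next
	assume "w : vcarrier V & vdiff w v : N"
	then show "w : vcoset V N v" unfolding vcoset_def
		using v by(intro image_eqI[of _ _ "vdiff w v"]) (simp_all add: add_vdiff)
qed

lemma vcoset_self:"v : vcarrier V ==> v : vcoset V N v"
	using subspaceD(2)[OF N] by(simp add: vcoset_iff vdiff_def add_uminus)

lemma vdiff_trans:
	assumes c:"u : vcarrier V" "v : vcarrier V" "w : vcarrier V" and N': "vdiff u v : N" "vdiff v w : N"
	shows "vdiff u w : N"
proof -
	have "vdiff u w = vadd V (vdiff v w) (vdiff u v)"
		using c by(intro vdiff_eqI) (simp_all add: add_assoc[symmetric] add_vdiff vdiff_closed add_closed)
	then show ?thesis using subspaceD(3)[OF N N'(2,1)] by simp
qed

lemma vdiff_sym:
	assumes c:"u : vcarrier V" "v : vcarrier V" and N': "vdiff u v : N" shows "vdiff v u : N"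
proof -
	have "vdiff v u = vscale V (-1) (vdiff u v)"
		using c unfolding vdiff_def by(simp add: scale_add_right scale_closed scale_scale scale_one add_commute)
	then show ?thesis using subspaceD(4)[OF N N'] by simp
qed

lemma vcoset_eq_iff:
	assumes c:"u : vcarrier V" "v : vcarrier V" shows "vcoset V N u = vcoset V N v <-> vdiff u v : N"
proof
	assume "vcoset V N u = vcoset V N v"
	then have "u : vcoset V N v" using vcoset_self[OF c(1)] by simp
	then show "vdiff u v : N" using vcoset_iff[OF c(2)] by simp
next
	assume uv:"vdiff u v : N"
	show "vcoset V N u = vcoset V N v"
	proof(intro set_eqI)
		fix w show "w : vcoset V N u <-> w : vcoset V N v"
			unfolding vcoset_iff[OF c(1)] vcoset_iff[OF c(2)]
			using vdiff_trans[of w u v] vdiff_trans[of w v u] vdiff_sym[OF c uv] c uv by blast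
	qed
qed

lemma vcoset_eqI:"u : vcoset V N v ==> v : vcarrier V ==> vcoset V N u = vcoset V N v"
	using vcoset_iff vcoset_eq_iff by blast

lemma vcoset_add:
	assumes c:"u : vcarrier V" "v : vcarrier V"
	shows "{vadd V a b | a b. a : vcoset V N u & b : vcoset V N v} = vcoset V N (vadd V u v)"
proof(intro set_eqI iffI)
	fix w assume "w : {vadd V a b | a b. a : vcoset V N u & b : vcoset V N v}"
	then obtain m n where mn:"m : N" "n : N" "w = vadd V (vadd V u m) (vadd V v n)"
		unfolding vcoset_def by blast
	then have "w = vadd V (vadd V u v) (vadd V m n)" using c N_mem add_add_swap by simp
	then show "w : vcoset V N (vadd V u v)" unfolding vcoset_def using subspaceD(3)[OF N mn(1,2)] by blast
next
	fix w assume "w : vcoset V N (vadd V u v)"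
	then obtain n where n:"n : N" "w = vadd V (vadd V u v) n" unfolding vcoset_def by blast
	then have "w = vadd V u (vadd V v n)" using c N_mem add_assoc by simp
	then show "w : {vadd V a b | a b. a : vcoset V N u & b : vcoset V N v}"
		using vcoset_self[OF c(1)] n(1) unfolding vcoset_def[of V N v] by blast
qed

lemma vcoset_scale:
	assumes c:"u : vcarrier V"
	shows "{vadd V (vscale V r a) n | a n. a : vcoset V N u & n : N} = vcoset V N (vscale V r u)"
proof(intro set_eqI iffI)
	fix w assume "w : {vadd V (vscale V r a) n | a n. a : vcoset V N u & n : N}"
	then obtain m n where mn:"m : N" "n : N" "w = vadd V (vscale V r (vadd V u m)) n"
		unfolding vcoset_def by blast
	then have "w = vadd V (vscale V r u) (vadd V (vscale V r m) n)"
		using c N_mem by(simp add: scale_add_right add_assoc scale_closed)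
	then show "w : vcoset V N (vscale V r u)"
		unfolding vcoset_def using subspaceD(3)[OF N subspaceD(4)[OF N mn(1)] mn(2)] by blast
next
	fix w assume "w : vcoset V N (vscale V r u)"
	then show "w : {vadd V (vscale V r a) n | a n. a : vcoset V N u & n : N}"
		using vcoset_self[OF c] unfolding vcoset_def[of V N "vscale V r u"] by blast
qed

end

end

text \<open>
	\<open>Z/B\<close> and \<open>Z'/B'\<close> are isometric as soon as \<open>io\<close> does not increase norms, reflects \<open>B\<close>, and every
	coset of \<open>B\<close> meets the image of \<open>io\<close> without loss of norm.
\<close>

lemma quotient_isometry:
	fixes V :: "'v seminormed_space" and V' :: "'w seminormed_space"
	assumes V:"vspace V" and V': "vspace V'"
		and Z:"vspace.subspace V Z" and B:"vspace.subspace V B" "B <= Z"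
		and Z': "vspace.subspace V' Z'" and B': "vspace.subspace V' B'" "B' <= Z'"
		and nn:"!!A. A : Z ==> 0 <= vnorm V A" "!!c. c : Z' ==> 0 <= vnorm V' c"
		and ioZ:"!!c. c : Z' ==> io c : Z"
		and io_add:"!!c e. c : Z' ==> e : Z' ==> io (vadd V' c e) = vadd V (io c) (io e)"
		and io_scale:"!!r c. c : Z' ==> io (vscale V' r c) = vscale V r (io c)"
		and io_norm:"!!c. c : Z' ==> vnorm V (io c) <= vnorm V' c"
		and ioB:"!!c. c : Z' ==> io c : B <-> c : B'"
		and onto:"!!A. A : Z ==> EX c:Z'. vadd V (io c) (vscale V (-1) A) : B & vnorm V' c <= vnorm V A"
	shows "EX Phi. isometric_iso (quotient_vspace (V\<lparr>vcarrier := Z\<rparr>) B) (quotient_vspace (V'\<lparr>vcarrier := Z'\<rparr>) B') Phi &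
		(ALL c:Z'. Phi (vcoset V B (io c)) = vcoset V' B' c)"
proof -
	interpret V: vspace V by fact
	interpret V': vspace V' by fact
	have ZV:"A : vcarrier V" if "A : Z" for A using V.subspaceD(1)[OF Z] that by blast
	have ZV': "c : vcarrier V'" if "c : Z'" for c using V'.subspaceD(1)[OF Z'] that by blast
	have ioV:"io c : vcarrier V" if "c : Z'" for c using ZV[OF ioZ[OF that]] .
	have diff:"V.vdiff (io c) (io e) : B <-> V'.vdiff c e : B'" if c:"c : Z'" and e:"e : Z'" for c e
	proof -
		have e': "vscale V' (-1) e : Z'" by(rule V'.subspaceD(4)[OF Z' e])
		have "V.vdiff (io c) (io e) = io (V'.vdiff c e)"
			unfolding V.vdiff_def V'.vdiff_def using io_add[OF c e'] io_scale[OF e] by simp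
		moreover have "V'.vdiff c e : Z'" unfolding V'.vdiff_def by(rule V'.subspaceD(3)[OF Z' c e'])
		ultimately show ?thesis using ioB by simp
	qed
	have eq:"vcoset V B (io c) = vcoset V B (io e) <-> vcoset V' B' c = vcoset V' B' e" if "c : Z'" "e : Z'" for c e
		using that by(simp add: V.vcoset_eq_iff[OF B(1)] V'.vcoset_eq_iff[OF B'(1)] ioV ZV' diff)
	have lift:"EX c:Z'. vcoset V B A = vcoset V B (io c) & vnorm V' c <= vnorm V A" if A:"A : Z" for A
	proof -
		obtain c where c:"c : Z'" "vadd V (io c) (vscale V (-1) A) : B" "vnorm V' c <= vnorm V A"
			using onto[OF A] by(elim bexE conjE)
		have "vcoset V B (io c) = vcoset V B A"
			using c(2) by(simp add: V.vcoset_eq_iff[OF B(1) ioV[OF c(1)] ZV[OF A]] V.vdiff_def)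
		then show ?thesis using c by(intro bexI[of _ c]) simp_all
	qed
	\<comment> \<open>The choice does not matter: by \<open>eq\<close>, preimages with the same class
	  under \<open>io\<close> have the same class modulo \<open>B'\<close>.\<close>
	define Phi where "Phi S = vcoset V' B' (SOME c. c : Z' & vcoset V B (io c) = S)" for S
	have Phi:"Phi (vcoset V B (io c)) = vcoset V' B' c" if c:"c : Z'" for c
	proof -
		let ?e = "SOME e. e : Z' & vcoset V B (io e) = vcoset V B (io c)"
		have "?e : Z' & vcoset V B (io ?e) = vcoset V B (io c)" by(rule someI[of _ c]) (simp add: c)
		then show ?thesis unfolding Phi_def using eq[of ?e c] c by simp
	qed
	let ?Q = "quotient_vspace (V\<lparr>vcarrier := Z\<rparr>) B" and ?Q' = "quotient_vspace (V'\<lparr>vcarrier := Z'\<rparr>) B'"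
	have coset [simp]: "vcoset (V\<lparr>vcarrier := Z\<rparr>) B = vcoset V B" "vcoset (V'\<lparr>vcarrier := Z'\<rparr>) B' = vcoset V' B'"
		by(simp_all add: vcoset_def fun_eq_iff)
	have carr:"vcarrier ?Q = (%c. vcoset V B (io c)) ` Z'"
		unfolding quotient_vspace_def
	proof(simp,intro equalityI subsetI)
		fix S assume "S : vcoset V B ` Z"
		then show "S : (%c. vcoset V B (io c)) ` Z'" using lift by blast
	next
		fix S assume "S : (%c. vcoset V B (io c)) ` Z'"
		then show "S : vcoset V B ` Z" using ioZ by blast
	qed
	have carr': "vcarrier ?Q' = vcoset V' B' ` Z'" by(simp add: quotient_vspace_def)
	have add:"vadd ?Q (vcoset V B u) (vcoset V B v) = vcoset V B (vadd V u v)"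
		if "u : vcarrier V" "v : vcarrier V" for u v
		using V.vcoset_add[OF B(1) that] by(simp add: quotient_vspace_def)
	have add': "vadd ?Q' (vcoset V' B' u) (vcoset V' B' v) = vcoset V' B' (vadd V' u v)"
		if "u : vcarrier V'" "v : vcarrier V'" for u v
		using V'.vcoset_add[OF B'(1) that] by(simp add: quotient_vspace_def)
	have scale:"vscale ?Q r (vcoset V B u) = vcoset V B (vscale V r u)" if "u : vcarrier V" for r u
		using V.vcoset_scale[OF B(1) that] by(simp add: quotient_vspace_def)
	have scale': "vscale ?Q' r (vcoset V' B' u) = vcoset V' B' (vscale V' r u)" if "u : vcarrier V'" for r u
		using V'.vcoset_scale[OF B'(1) that] by(simp add: quotient_vspace_def)
	have norm:"vnorm ?Q' (vcoset V' B' c) = vnorm ?Q (vcoset V B (io c))" if c:"c : Z'" for c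
	proof(rule antisym)
		have Zc:"A : Z" if A:"A : vcoset V B (io c)" for A
		proof -
			obtain b where "b : B" "A = vadd V (io c) b" using A unfolding vcoset_def by(elim imageE)
			then show ?thesis using V.subspaceD(3)[OF Z ioZ[OF c]] B(2) by blast
		qed
		have Zc': "e : Z'" if e:"e : vcoset V' B' c" for e
		proof -
			obtain b where "b : B'" "e = vadd V' c b" using e unfolding vcoset_def by(elim imageE)
			then show ?thesis using V'.subspaceD(3)[OF Z' c] B'(2) by blast
		qed
		have ne:"vcoset V B (io c) ~= {}" "vcoset V' B' c ~= {}"
			using V.vcoset_self[OF B(1) ioV[OF c]] V'.vcoset_self[OF B'(1) ZV'[OF c]] by blast+
		have bdd:"bdd_below (vnorm V ` vcoset V B (io c))" "bdd_below (vnorm V' ` vcoset V' B' c)"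
			using nn Zc Zc' by(auto intro!: bdd_belowI[of _ 0])
		\<comment> \<open>By \<open>lift\<close> any member of the coset can be replaced by some
		  \<open>io e\<close> of the same class with \<open>e\<close> of no larger norm, and
		  \<open>eq\<close> puts \<open>e\<close> into the coset of \<open>c\<close>.\<close>
		have "(INF e\<in>vcoset V' B' c. vnorm V' e) <= vnorm V A" if A:"A : vcoset V B (io c)" for A
		proof -
			obtain e where e:"e : Z'" "vcoset V B A = vcoset V B (io e)" "vnorm V' e <= vnorm V A"
				using lift[OF Zc[OF A]] by(elim bexE conjE)
			have "vcoset V B (io e) = vcoset V B (io c)" using V.vcoset_eqI[OF B(1) A ioV[OF c]] e(2) by simp
			then have "vcoset V' B' e = vcoset V' B' c" using eq[OF e(1) c] by simp
			then have "e : vcoset V' B' c" using V'.vcoset_self[OF B'(1) ZV'[OF e(1)]] by simp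
			from cINF_lower[OF bdd(2) this] e(3) show ?thesis by linarith
		qed
		from cINF_greatest[OF ne(1),of _ "vnorm V",OF this]
		show "vnorm ?Q' (vcoset V' B' c) <= vnorm ?Q (vcoset V B (io c))" by(simp add: quotient_vspace_def)
		have "(INF A\<in>vcoset V B (io c). vnorm V A) <= vnorm V' e" if e:"e : vcoset V' B' c" for e
		proof -
			have "vcoset V' B' e = vcoset V' B' c" by(rule V'.vcoset_eqI[OF B'(1) e ZV'[OF c]])
			then have "vcoset V B (io e) = vcoset V B (io c)" using eq[OF Zc'[OF e] c] by simp
			then have "io e : vcoset V B (io c)" using V.vcoset_self[OF B(1) ioV[OF Zc'[OF e]]] by simp
			from cINF_lower[OF bdd(1) this] io_norm[OF Zc'[OF e]] show ?thesis by linarith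
		qed
		from cINF_greatest[OF ne(2),of _ "vnorm V'",OF this]
		show "vnorm ?Q (vcoset V B (io c)) <= vnorm ?Q' (vcoset V' B' c)" by(simp add: quotient_vspace_def)
	qed
	have "isometric_iso ?Q ?Q' Phi"
		unfolding isometric_iso_def
	proof(intro conjI ballI allI)
		show "bij_betw Phi (vcarrier ?Q) (vcarrier ?Q')"
			unfolding bij_betw_def
		proof
			show "inj_on Phi (vcarrier ?Q)" unfolding carr by(rule inj_onI) (elim imageE,simp add: Phi eq)
			show "Phi ` vcarrier ?Q = vcarrier ?Q'" unfolding carr carr' image_image by(rule image_cong) (simp_all add: Phi)
		qed
		fix S assume "S : vcarrier ?Q"
		then obtain c where c:"c : Z'" "S = vcoset V B (io c)" unfolding carr by(elim imageE)
		show "vnorm ?Q' (Phi S) = vnorm ?Q S" unfolding c(2) using Phi[OF c(1)] norm[OF c(1)] by simp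
		show "Phi (vscale ?Q r S) = vscale ?Q' r (Phi S)" for r
		proof -
			have "Phi (vscale ?Q r S) = Phi (vcoset V B (io (vscale V' r c)))"
				unfolding c(2) scale[OF ioV[OF c(1)]] io_scale[OF c(1)] ..
			also have "... = vscale ?Q' r (Phi S)"
				unfolding c(2) Phi[OF c(1)] scale'[OF ZV'[OF c(1)]] by(rule Phi[OF V'.subspaceD(4)[OF Z' c(1)]])
			finally show ?thesis .
		qed
		fix T assume "T : vcarrier ?Q"
		then obtain e where e:"e : Z'" "T = vcoset V B (io e)" unfolding carr by(elim imageE)
		have "Phi (vadd ?Q S T) = Phi (vcoset V B (io (vadd V' c e)))"
			unfolding c(2) e(2) add[OF ioV[OF c(1)] ioV[OF e(1)]] io_add[OF c(1) e(1)] ..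
		also have "... = vadd ?Q' (Phi S) (Phi T)"
			unfolding c(2) e(2) Phi[OF c(1)] Phi[OF e(1)] add'[OF ZV'[OF c(1)] ZV'[OF e(1)]]
			by(rule Phi[OF V'.subspaceD(3)[OF Z' c(1) e(1)]])
		finally show "Phi (vadd ?Q S T) = vadd ?Q' (Phi S) (Phi T)" .
	qed
	then show ?thesis using Phi by(intro exI[of _ Phi]) simp
qed

definition pointwise_vspace :: "'v seminormed_space => 'a set => (('a => 'v) => real) => ('a => 'v) seminormed_space" where
	"pointwise_vspace V D p =
		\<lparr>vcarrier = {f : extensional D. ALL a:D. f a : vcarrier V},vzero = (\<lambda>a\<in>D. vzero V),
		 vadd = (%f f'. \<lambda>a\<in>D. vadd V (f a) (f' a)),vscale = (%r f. \<lambda>a\<in>D. vscale V r (f a)),vnorm = p\<rparr>"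

lemma (in vspace) vspace_pointwise:"vspace (pointwise_vspace V D p)"
proof -
	have eqI:"f = f'" if "f : extensional D" "f' : extensional D" "!!a. a : D ==> f a = f' a" for f f' :: "'a => 'v"
		using that by(rule extensionalityI)
	show ?thesis
		by unfold_locales
			(auto simp: pointwise_vspace_def zero_closed add_closed scale_closed add_assoc add_zero add_uminus
				scale_add_right scale_add_left scale_scale scale_one intro!: eqI add_commute)
qed

section \<open>Both cochain complexes in terms of bounded functions of a tuple and a point\<close>

context semidirect_module
begin

text \<open>Omitting one of independent identically distributed increments leaves the law of the
  shorter tuple, so smoothing is a chain map.\<close>

lemma Rg_cobF:
	assumes F:"bd k C F" and z:"z : space (Tn (Suc k))"
	shows "Rg (Suc k) (cobF k F) z = cobF k (Rg k F) z"
proof -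
	obtain ga x where zz:"z = (ga,x)" by(cases z)
	have x:"x : space mu" using z unfolding zz by(auto simp: space_pair_measure)
	have om:"omit k i : Pn (Suc k) ->M Pn k" for i
		using omit_nonsingular[of k i] by(simp add: nonsingular_def measurable_cong_sets[OF sets_Pn sets_Pn])
	have zi:"(omit k i ga,x) : space (Tn k)" for i by(rule space_TnI[OF omit_in x])
	have w:"wmeas (Pn k) (%h. F (shift k (omit k i ga) h,x))" for i
		using path_wmeas[OF selects_Inr zi bdD(1)[OF F]] by(simp add: sel_Inr_shift)
	have w': "wmeas (Pn (Suc k)) (%h. F (omit k i (shift (Suc k) ga h),x))" for i
		unfolding omit_shift by(rule wmeas_compose[OF w om])
	have b:"norm (F (omit k i de,x)) <= C" for i de by(rule bdD(2)[OF F space_TnI[OF omit_in x]])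
	have "Rg (Suc k) (cobF k F) z = winteg (Pn (Suc k)) (%h. \<Sum>i<Suc k. (-1) ^ i *\<^sub>R F (omit k i (shift (Suc k) ga h),x))"
		by(simp add: Av_def zz sel_Inr_shift cobF_def del: sum.lessThan_Suc)
	also have "... = (\<Sum>i<Suc k. (-1) ^ i *\<^sub>R winteg (Pn (Suc k)) (%h. F (omit k i (shift (Suc k) ga h),x)))"
		by(rule pr.winteg_sum[OF w' b])
	also have "... = (\<Sum>i<Suc k. (-1) ^ i *\<^sub>R winteg (Pn k) (%h. F (shift k (omit k i ga) h,x)))"
		unfolding omit_shift winteg_distr[OF om w distr_omit_Pn] ..
	finally show ?thesis by(simp add: cobF_def Av_def zz sel_Inr_shift del: sum.lessThan_Suc)
qed

lemma bd_zero:"bd n 0 (%z. 0)" by(simp add: bd_def wmeas_zero)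

lemma cobF_zero:"cobF n (%z. 0) z = 0" by(simp add: cobF_def)
lemma Av_zero:"Av n m t (%z. 0) z = 0" by(simp add: Av_def pr.winteg_const)
lemma Hm_zero:"Hm n (%z. 0) z = 0" by(simp add: Hm_def Av_zero)
lemma cobF_add:"cobF n (%z. F z + G z) z = cobF n F z + cobF n G z"
	unfolding cobF_def by(simp only: scaleR_add_right sum.distrib)
lemma cobF_scale:"cobF n (%z. r *\<^sub>R F z) z = r *\<^sub>R cobF n F z"
	unfolding cobF_def by(simp only: scaleR_sum_right scaleR_scaleR mult.commute)

lemma Tw_zero:"Tw n g (%z. 0) z = 0" unfolding Tw_def by(rule blinfun_eqI) simp
lemma INV_zero:"INV n (%z. 0)" by(simp add: INV_def Tw_zero)
lemma CINV_zero:"CINV n (%z. 0)" by(simp add: CINV_def Tw_zero)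
lemma scont_zero:"scont n (%z. 0)" by(simp add: scont_def Linf.p_zero)

definition bounded_fn where "bounded_fn n F <-> (EX C. bd n C F)"

lemma bounded_fnE: assumes "bounded_fn n F" obtains C where "bd n C F" using assms unfolding bounded_fn_def by blast
lemma bounded_fnI:"bd n C F ==> bounded_fn n F" unfolding bounded_fn_def by blast

text \<open>Requiring \<open>F = 0\<close> on empty tuples makes the coboundaries in degree \<open>0\<close> trivial.\<close>

definition gmb :: "nat => ((nat => 'g) \<times> 'x => 'e \<Rightarrow>\<^sub>L real) => bool" where
	"gmb k F <-> bounded_fn k F & INV k F & (k = 0 --> F = (%z. 0))"

definition gcb :: "nat => ((nat => 'g) \<times> 'x => 'e \<Rightarrow>\<^sub>L real) => bool" where
	"gcb k F <-> bounded_fn k F & scont k F & CINV k F & (k = 0 --> F = (%z. 0))"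

lemma gcb_gmb:"gcb k F ==> gmb k F"
	unfolding gcb_def gmb_def by(blast intro: INV_CINV elim: bounded_fnE)

definition linear_class where
	"linear_class n P <-> (ALL F. P F --> bounded_fn n F) & P (%z. 0) & (ALL F G. P F --> P G --> P (%z. F z + G z)) & (ALL r F. P F --> P (%z. r *\<^sub>R F z))"

lemma linear_classD:
	assumes "linear_class n P"
	shows "P F ==> bounded_fn n F" "P (%z. 0)" "P F ==> P G ==> P (%z. F z + G z)" "P F ==> P (%z. r *\<^sub>R F z)"
	using assms unfolding linear_class_def by simp_all

lemma bounded_fn_simps:
	"bounded_fn n (%z. 0)" "bounded_fn n F ==> bounded_fn n G ==> bounded_fn n (%z. F z + G z)"
	"bounded_fn n F ==> bounded_fn n (%z. r *\<^sub>R F z)" "bounded_fn n F ==> bounded_fn (Suc n) (cobF n F)"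
	by(blast intro: bounded_fnI bd_zero bd_add bd_scale bd_cobF elim: bounded_fnE)+

lemma linear_gmb:"linear_class k (gmb k)"
	unfolding linear_class_def gmb_def by(auto simp: bounded_fn_simps INV_zero INV_add INV_scale)

lemma scont_add': "bounded_fn n F ==> bounded_fn n G ==> scont n F ==> scont n G ==> scont n (%z. F z + G z)"
	by(elim bounded_fnE) (rule scont_add)

lemma scont_scale': "bounded_fn n F ==> scont n F ==> scont n (%z. r *\<^sub>R F z)"
	by(elim bounded_fnE) (rule scont_scale)

lemma linear_gcb:"linear_class k (gcb k)"
	unfolding linear_class_def gcb_def
	by(auto simp: bounded_fn_simps CINV_zero CINV_add CINV_scale scont_zero scont_add' scont_scale')

lemma linear_cob:"linear_class k P ==> linear_class (Suc k) (%F. EX F'. P F' & F = cobF k F')"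
	unfolding linear_class_def
proof(intro conjI allI impI; elim conjE exE)
	assume P:"ALL F. P F --> bounded_fn k F" "P (%z. 0)" "ALL F G. P F --> P G --> P (%z. F z + G z)" "ALL r F. P F --> P (%z. r *\<^sub>R F z)"
	show "EX F'. P F' & (%z. 0) = cobF k F'" by(intro exI[of _ "%z. 0"]) (simp add: P(2) cobF_zero fun_eq_iff)
	fix F F' assume F:"P F'" "F = cobF k F'"
	show "bounded_fn (Suc k) F" using P(1) F bounded_fn_simps(4) by blast
	show "EX F'. P F' & (%z. r *\<^sub>R F z) = cobF k F'" for r
		using P(4) F by(intro exI[of _ "%z. r *\<^sub>R F' z"]) (simp add: cobF_scale fun_eq_iff)
	fix G G' assume G:"P G'" "G = cobF k G'"
	show "EX F'. P F' & (%z. F z + G z) = cobF k F'"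
		using P(3) F G by(intro exI[of _ "%z. F' z + G' z"]) (simp add: cobF_add fun_eq_iff)
qed

lemma linear_conj:
	assumes P:"linear_class n P" and Q:"Q (%z. 0)" "!!F G. Q F ==> Q G ==> Q (%z. F z + G z)" "!!r F. Q F ==> Q (%z. r *\<^sub>R F z)"
	shows "linear_class n (%F. P F & Q F)"
	using linear_classD[OF P] Q unfolding linear_class_def by simp

sublocale LFn: normed_vspace "LF n" for n by(rule normed_vspace_Linf)

lemma subspace_MC:
	assumes n:"0 < n" and P:"linear_class n P" shows "LFn.subspace n {A. EX F. P F & A = MC n F}"
proof -
	note PD = linear_classD[OF P]
	show ?thesis
		unfolding LFn.subspace_def
	proof(intro conjI subsetI ballI allI)
		show "vzero (LF n) : {A. EX F. P F & A = MC n F}" using PD(2) MC_zero[OF n] by blast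
		fix A assume "A : {A. EX F. P F & A = MC n F}"
		then obtain F where F:"P F" "A = MC n F" by blast
		obtain C where C:"bd n C F" using PD(1)[OF F(1)] by(rule bounded_fnE)
		show "A : vcarrier (LF n)" unfolding F(2) by(rule MC_carrier[OF n C])
		show "vscale (LF n) r A : {A. EX F. P F & A = MC n F}" for r
			unfolding F(2) MC_scale[OF n C] using PD(4)[OF F(1)] by blast
		fix B assume "B : {A. EX F. P F & A = MC n F}"
		then obtain G where G:"P G" "B = MC n G" by blast
		obtain C' where C': "bd n C' G" using PD(1)[OF G(1)] by(rule bounded_fnE)
		show "vadd (LF n) A B : {A. EX F. P F & A = MC n F}"
			unfolding F(2) G(2) MC_add[OF n C C'] using PD(3)[OF F(1) G(1)] by blast
	qed
qed

abbreviation "PV n \<equiv> pointwise_vspace V (Dn n) (%f. SUP ga\<in>Dn n. vnorm V (f ga))"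

sublocale PVn: vspace "PV n" for n by(rule V.vspace_pointwise)

lemma cc_carrier:"bd n C F ==> cc n F : vcarrier (PV n)"
	using cc_mem by(auto simp: pointwise_vspace_def cc_def topspace_tuple)

lemma cc_add:"bd n C F ==> bd n C' G ==> vadd (PV n) (cc n F) (cc n G) = cc n (%z. F z + G z)"
	by(simp add: pointwise_vspace_def cc_def topspace_tuple add_Linf[OF section_mem section_mem] cong: restrict_cong)

lemma cc_scale:"bd n C F ==> vscale (PV n) r (cc n F) = cc n (%z. r *\<^sub>R F z)"
	by(simp add: pointwise_vspace_def cc_def topspace_tuple scale_Linf[OF section_mem] cong: restrict_cong)

lemma cc_zero:"vzero (PV n) = cc n (%z. 0)"
	by(simp add: pointwise_vspace_def cc_def zero_Linf)

lemma cc_eq_iff: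
	assumes "bd n C F" "bd n C' G"
	shows "cc n F = cc n G <-> (ALL ga:space (En n). AE x in mu. F (ga,x) = G (ga,x))"
proof -
	have "cc n F = cc n G <-> (ALL ga:space (En n). cc n F ga = cc n G ga)"
	proof
		assume "ALL ga:space (En n). cc n F ga = cc n G ga"
		then show "cc n F = cc n G"
			by(intro extensionalityI[of _ "Dn n"]) (auto simp: cc_def topspace_tuple)
	qed simp
	also have "... <-> (ALL ga:space (En n). AE x in mu. F (ga,x) = G (ga,x))"
		by(intro ball_cong refl) (simp add: cc_apply Lcls_eq_iff[OF section_mem[OF assms(1)] section_mem[OF assms(2)]])
	finally show ?thesis .
qed

lemma subspace_cc:
	assumes P:"linear_class n P" shows "PVn.subspace n {c. EX F. P F & c = cc n F}"
proof -
	note PD = linear_classD[OF P]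
	show ?thesis
		unfolding PVn.subspace_def
	proof(intro conjI subsetI ballI allI)
		show "vzero (PV n) : {c. EX F. P F & c = cc n F}" using PD(2) cc_zero by blast
		fix A assume "A : {c. EX F. P F & c = cc n F}"
		then obtain F where F:"P F" "A = cc n F" by blast
		obtain C where C:"bd n C F" using PD(1)[OF F(1)] by(rule bounded_fnE)
		show "A : vcarrier (PV n)" unfolding F(2) by(rule cc_carrier[OF C])
		show "vscale (PV n) r A : {c. EX F. P F & c = cc n F}" for r
			unfolding F(2) cc_scale[OF C] using PD(4)[OF F(1)] by blast
		fix B assume "B : {c. EX F. P F & c = cc n F}"
		then obtain G where G:"P G" "B = cc n G" by blast
		obtain C' where C': "bd n C' G" using PD(1)[OF G(1)] by(rule bounded_fnE)
		show "vadd (PV n) A B : {c. EX F. P F & c = cc n F}"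
			unfolding F(2) G(2) cc_add[OF C C'] using PD(3)[OF F(1) G(1)] by blast
	qed
qed

lemma cb_coboundary_cc:
	assumes F:"bd (Suc k) C F" shows "cb_coboundary V k (cc (Suc k) F) = cc (Suc (Suc k)) (cobF (Suc k) F)"
proof -
	have s:"vsum V (%i. vscale V ((-1) ^ i) (Lcls mu (l i))) m = Lcls mu (%x. \<Sum>i<m. (-1) ^ i *\<^sub>R l i x) &
			(%x. \<Sum>i<m. (-1) ^ i *\<^sub>R l i x) : Linf_functions mu" if l:"!!i. l i : Linf_functions mu" for l :: "nat => 'x => 'e \<Rightarrow>\<^sub>L real" and m
	proof(induction m)
		case 0
		then show ?case by(simp add: zero_Linf Linf.zero_mem)
	next
		case (Suc m)
		have m:"(%x. (-1) ^ m *\<^sub>R l m x) : Linf_functions mu" by(rule Linf.scale_mem[OF l])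
		show ?case
			using Suc add_Linf[OF _ m] Linf.add_mem[OF _ m] by(simp add: scale_Linf[OF l])
	qed
	have k:"k + 2 = Suc (Suc k)" "k + 1 = Suc k" by simp_all
	have "vsum V (%i. vscale V ((-1) ^ i) (cc (Suc k) F (omit (Suc k) i ga))) (Suc (Suc k)) = Lcls mu (%x. cobF (Suc k) F (ga,x))" for ga
		using s[of "%i x. F (omit (Suc k) i ga,x)" "Suc (Suc k)"] section_mem[OF F omit_in]
		by(simp add: cc_apply cobF_def del: sum.lessThan_Suc vsum.simps)
	then show ?thesis unfolding cb_coboundary_def k cc_def[of "Suc (Suc k)"] by simp
qed

lemma cc_norm:
	assumes F:"bd n C F" shows "ga : space (En n) ==> vnorm V (cc n F ga) <= (SUP ga\<in>Dn n. vnorm V (cc n F ga))"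
		and "0 <= (SUP ga\<in>Dn n. vnorm V (cc n F ga))" "0 <= C' ==> bd n C' F ==> (SUP ga\<in>Dn n. vnorm V (cc n F ga)) <= C'"
proof -
	have le:"vnorm V (cc n F ga) <= C'" if "bd n C' F" "0 <= C'" "ga : Dn n" for ga C'
		using section_norm[OF that(1) _ that(2)] that(3) by(simp add: topspace_tuple cc_apply norm_Linf[OF section_mem[OF F]])
	have bdd:"bdd_above ((%ga. vnorm V (cc n F ga)) ` Dn n)"
		using le[OF bd_mono[OF F abs_ge_self]] by(auto intro!: bdd_aboveI[of _ "\<bar>C\<bar>"])
	have d:"(%_. undefined) : space (En n)" by(simp add: space_En extensional_def)
	show up:"vnorm V (cc n F ga) <= (SUP ga\<in>Dn n. vnorm V (cc n F ga))" if "ga : space (En n)" for ga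
		by(rule cSUP_upper[OF _ bdd]) (use that in \<open>simp add: topspace_tuple\<close>)
	show "0 <= (SUP ga\<in>Dn n. vnorm V (cc n F ga))" using up[OF d] V.norm_nonneg[OF cc_mem[OF F d]] by linarith
	show "(SUP ga\<in>Dn n. vnorm V (cc n F ga)) <= C'" if "0 <= C'" "bd n C' F"
		by(rule cSUP_least) (use d topspace_tuple le[OF that(2,1)] in auto)
qed

lemma mb_carrier_iff:"A : vcarrier (mb_cochains \<G> nu kap Lb k) <-> A : vcarrier (LF (Suc k)) & (ALL f:A. groupoid_invariant \<G> nu kap Lb (Suc k) f)"
	by(simp add: mb_cochains_def Let_def)

lemma MC_mb:"bd (Suc k) C F ==> MC (Suc k) F : vcarrier (mb_cochains \<G> nu kap Lb k) <-> INV (Suc k) F"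
	unfolding mb_carrier_iff using MC_invariant_iff[OF zero_less_Suc] MC_carrier[OF zero_less_Suc] by blast

lemma mb_cocycles:
	"cocycles (mb_cochains \<G> nu kap Lb) (mb_coboundary \<G> nu kap) k
		= {A. EX F. (gmb (Suc k) F & (AE z in Tn (Suc (Suc k)). cobF (Suc k) F z = 0)) & A = MC (Suc k) F}"
proof -
	have z:"vzero (mb_cochains \<G> nu kap Lb (Suc k)) = MC (Suc (Suc k)) (%z. 0)"
		by(simp add: mb_cochains_def Let_def MC_zero)
	have d:"mb_coboundary \<G> nu kap k (MC (Suc k) F) = vzero (mb_cochains \<G> nu kap Lb (Suc k)) <-> (AE z in Tn (Suc (Suc k)). cobF (Suc k) F z = 0)"
		if "bd (Suc k) C F" for C F
		unfolding z mb_coboundary_MC[OF that] by(rule MC_eq_iff[OF zero_less_Suc bd_cobF[OF that] bd_zero])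
	show ?thesis
	proof(intro set_eqI iffI)
		fix A assume "A : cocycles (mb_cochains \<G> nu kap Lb) (mb_coboundary \<G> nu kap) k"
		then have A:"A : vcarrier (mb_cochains \<G> nu kap Lb k)" "mb_coboundary \<G> nu kap k A = vzero (mb_cochains \<G> nu kap Lb (Suc k))"
			by(simp_all add: cocycles_def)
		then have "A : vcarrier (LF (Suc k))" by(simp add: mb_carrier_iff)
		then obtain F where F:"bd (Suc k) (vnorm (LF (Suc k)) A) F" "A = MC (Suc k) F" by(rule MC_cases[OF zero_less_Suc])
		then show "A : {A. EX F. (gmb (Suc k) F & (AE z in Tn (Suc (Suc k)). cobF (Suc k) F z = 0)) & A = MC (Suc k) F}"
			using A d[OF F(1)] MC_mb[OF F(1)] bounded_fnI[OF F(1)] unfolding gmb_def by auto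
	next
		fix A assume "A : {A. EX F. (gmb (Suc k) F & (AE z in Tn (Suc (Suc k)). cobF (Suc k) F z = 0)) & A = MC (Suc k) F}"
		then obtain F where F:"gmb (Suc k) F" "AE z in Tn (Suc (Suc k)). cobF (Suc k) F z = 0" "A = MC (Suc k) F" by blast
		then obtain C where C:"bd (Suc k) C F" unfolding gmb_def by(blast elim: bounded_fnE)
		show "A : cocycles (mb_cochains \<G> nu kap Lb) (mb_coboundary \<G> nu kap) k"
			unfolding cocycles_def F(3) using d[OF C] F(1,2) MC_mb[OF C] unfolding gmb_def by simp
	qed
qed

lemma mb_coboundaries:
	"coboundaries (mb_cochains \<G> nu kap Lb) (mb_coboundary \<G> nu kap) k
		= {A. EX F. (EX F'. gmb k F' & F = cobF k F') & A = MC (Suc k) F}"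
proof(cases k)
	case 0
	have "cobF 0 (%z. 0) = (%z. 0)" by(simp add: cobF_zero fun_eq_iff)
	moreover have "gmb 0 F' <-> F' = (%z. 0)" for F' using linear_classD(2)[OF linear_gmb[of 0]] by(auto simp: gmb_def)
	ultimately show ?thesis by(simp add: 0 coboundaries_def mb_cochains_def Let_def MC_zero)
next
	case (Suc j)
	show ?thesis
	proof(intro set_eqI iffI)
		fix A assume "A : coboundaries (mb_cochains \<G> nu kap Lb) (mb_coboundary \<G> nu kap) k"
		then obtain B where B:"B : vcarrier (mb_cochains \<G> nu kap Lb j)" "A = mb_coboundary \<G> nu kap j B"
			by(auto simp: Suc coboundaries_def)
		then have "B : vcarrier (LF (Suc j))" by(simp add: mb_carrier_iff)
		then obtain F where F:"bd (Suc j) (vnorm (LF (Suc j)) B) F" "B = MC (Suc j) F" by(rule MC_cases[OF zero_less_Suc])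
		then have "gmb k F" using B(1) MC_mb[OF F(1)] bounded_fnI[OF F(1)] by(simp add: gmb_def Suc)
		then show "A : {A. EX F. (EX F'. gmb k F' & F = cobF k F') & A = MC (Suc k) F}"
			using B(2) F(2) mb_coboundary_MC[OF F(1)] Suc by blast
	next
		fix A assume "A : {A. EX F. (EX F'. gmb k F' & F = cobF k F') & A = MC (Suc k) F}"
		then obtain F where F:"gmb k F" "A = MC (Suc k) (cobF k F)" by blast
		then obtain C where C:"bd (Suc j) C F" unfolding gmb_def Suc by(blast elim: bounded_fnE)
		have "MC (Suc j) F : vcarrier (mb_cochains \<G> nu kap Lb j)" using MC_mb[OF C] F(1) by(simp add: gmb_def Suc)
		then show "A : coboundaries (mb_cochains \<G> nu kap Lb) (mb_coboundary \<G> nu kap) k"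
			unfolding F(2) Suc coboundaries_def using mb_coboundary_MC[OF C] by(auto simp: image_iff)
	qed
qed

end

section \<open>The comparison map\<close>

context semidirect_module
begin

lemma ltr_add:"ltr n (a + b) ga = ltr n b (ltr n a ga)"
	by(auto simp: ltr_def restrict_def fun_eq_iff minus_add add.assoc diff_conv_add_uminus simp del: add_uminus_conv_diff)

text \<open>For almost every \<open>g\<close> the action \<open>rho g\<close> is given by
  \<open>Tf g\<close>, so the equivariance at \<open>g\<close> is the condition in
  \<open>CINV\<close>. The group elements with exact equivariance are closed under addition because
  \<open>rho\<close> is multiplicative, so a conull set of them is everything.\<close>

lemma CINV_exact:
	assumes rep:"isometric_rep V rho" and acts:"acts_by_cocycle eta act mu Lb rho" and G:"bd n C G"
	shows "(ALL g. ALL ga:space (En n). rho g (cc n G (ltr n g ga)) = cc n G ga) <-> CINV n G"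
proof -
	let ?P = "%g. ALL ga:space (En n). rho g (cc n G (ltr n g ga)) = cc n G ga"
	have iff:"?P g <-> (ALL ga:space (En n). AE x in mu. G (ga,x) = Tw n g G (ga,x))"
		if g:"ALL l:Linf_functions mu. rho g (Lcls mu l) = Lcls mu (Tf g l)" for g
	proof(intro ball_cong refl)
		fix ga assume ga:"ga : space (En n)"
		have m:"(%x. G (ltr n g ga,x)) : Linf_functions mu" by(rule section_mem[OF G ltr_in])
		have e:"Tf g (%x. G (ltr n g ga,x)) = (%x. Tw n g G (ga,x))" by(simp add: Tf_def Tw_def Tz_def fun_eq_iff)
		have A:"rho g (cc n G (ltr n g ga)) = Lcls mu (%x. Tw n g G (ga,x))"
			using g[rule_format,OF m] unfolding cc_apply[OF ltr_in] e .
		have B:"Lcls mu (%x. G (ga,x)) = Lcls mu (%x. Tw n g G (ga,x)) <-> (AE x in mu. G (ga,x) = Tw n g G (ga,x))"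
			by(rule Lcls_eq_iff[OF section_mem[OF G ga] section_mem[OF bd_Tw[OF G] ga]])
		show "rho g (cc n G (ltr n g ga)) = cc n G ga <-> (AE x in mu. G (ga,x) = Tw n g G (ga,x))"
			unfolding A cc_apply[OF ga] B[symmetric] by(rule eq_commute)
	qed
	have ae:"AE g in eta. ALL l:Linf_functions mu. rho g (Lcls mu l) = Lcls mu (Tf g l)" using acts unfolding acts_iff[OF rep] .
	have add:"rho (a + b) A = rho a (rho b A)" if "A : vcarrier V" for a b A
		using rep that unfolding isometric_rep_def by simp
	have "(ALL g. ?P g) <-> (AE g in eta. ?P g)"
	proof
		assume P:"AE g in eta. ?P g"
		have "?P g" for g
		proof(rule AE_subgroup[where P="?P",OF P])
			fix a b assume a:"?P a" and b:"?P b"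
			show "?P (a + b)"
			proof
				fix ga assume ga:"ga : space (En n)"
				have "rho (a + b) (cc n G (ltr n (a + b) ga)) = rho a (rho b (cc n G (ltr n b (ltr n a ga))))"
					unfolding ltr_add by(rule add[OF cc_mem[OF G ltr_in]])
				then show "rho (a + b) (cc n G (ltr n (a + b) ga)) = cc n G ga"
					using a[rule_format,OF ga] b[rule_format,OF ltr_in] by simp
			qed
		qed
		then show "ALL g. ?P g" ..
	qed simp
	also have "... <-> CINV n G"
		unfolding CINV_def by(rule eventually_subst) (rule eventually_mono[OF ae iff])
	finally show ?thesis .
qed

context
	fixes rho :: "'g => ('x => 'e \<Rightarrow>\<^sub>L real) set => ('x => 'e \<Rightarrow>\<^sub>L real) set"
	assumes rep:"isometric_rep V rho" and acts:"acts_by_cocycle eta act mu Lb rho"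
begin

abbreviation "CB \<equiv> cb_cochains V rho"

lemma CB_carrier:"vcarrier (CB k) = {f : extensional (Dn (Suc k)).
		continuous_map (tuple_topology (Suc k)) (norm_topology V) f & (EX C. ALL ga:Dn (Suc k). vnorm V (f ga) <= C) &
		(ALL g. ALL ga:space (En (Suc k)). rho g (f (ltr (Suc k) g ga)) = f ga)}"
	by(simp add: cb_cochains_def Let_def ltr_def topspace_tuple)

lemma CB_norm:"vnorm (CB k) c = (SUP ga\<in>Dn (Suc k). vnorm V (c ga))"
	by(simp add: cb_cochains_def Let_def)

lemma CB_zero:"vzero (CB k) = cc (Suc k) (%z. 0)"
	using cc_zero[of "Suc k"] by(simp add: cb_cochains_def Let_def pointwise_vspace_def)

lemma cc_CB:
	assumes F:"bd (Suc k) C F" shows "cc (Suc k) F : vcarrier (CB k) <-> scont (Suc k) F & CINV (Suc k) F"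
proof -
	have "cc (Suc k) F : extensional (Dn (Suc k))" by(simp add: cc_def)
	moreover have "EX C. ALL ga:Dn (Suc k). vnorm V (cc (Suc k) F ga) <= C"
		using cc_norm(1)[OF F] unfolding topspace_tuple by blast
	ultimately show ?thesis
		unfolding CB_carrier mem_Collect_eq cc_continuous_iff[OF F] CINV_exact[OF rep acts F] by blast
qed

text \<open>As in \<open>MC_cases\<close>, the bound of the representative is the norm of the
  cochain itself.\<close>

lemma CB_cases:
	assumes c:"c : vcarrier (CB k)"
	obtains F where "bd (Suc k) (vnorm (CB k) c) F" "c = cc (Suc k) F"
proof -
	from c have ext:"c : extensional (Dn (Suc k))" and cont:"continuous_map (tuple_topology (Suc k)) (norm_topology V) c"
		and bd:"EX C. ALL ga:Dn (Suc k). vnorm V (c ga) <= C" unfolding CB_carrier by simp_all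
	have V:"c ga : vcarrier V" if "ga : space (En (Suc k))" for ga
		using continuous_map_image_subset_topspace[OF cont] that unfolding V.topspace_norm_topology topspace_tuple by blast
	have "bdd_above ((%ga. vnorm V (c ga)) ` Dn (Suc k))" using bd by(auto simp: bdd_above_def)
	then have le:"vnorm V (c ga) <= vnorm (CB k) c" if "ga : space (En (Suc k))" for ga
		unfolding CB_norm using that by(intro cSUP_upper) (simp_all add: topspace_tuple)
	obtain F where F:"bd (Suc k) (vnorm (CB k) c) F" "!!ga. ga : space (En (Suc k)) ==> c ga = Lcls mu (%x. F (ga,x))"
	proof(rule joint_representative[OF V cont le])
		fix F assume a:"bd (Suc k) (vnorm (CB k) c) F" "!!ga. ga : space (En (Suc k)) ==> c ga = Lcls mu (%x. F (ga,x))"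
		show thesis by(rule that[OF a])
	qed
	have "c = cc (Suc k) F"
		by(rule extensionalityI[OF ext]) (use F(2) in \<open>auto simp: cc_def topspace_tuple\<close>)
	then show thesis by(rule that[OF F(1)])
qed

lemma cb_cocycles:"cocycles CB (cb_coboundary V) k = {c. EX F. (gcb (Suc k) F &
		(ALL ga:space (En (Suc (Suc k))). AE x in mu. cobF (Suc k) F (ga,x) = 0)) & c = cc (Suc k) F}"
proof -
	have d:"cb_coboundary V k (cc (Suc k) F) = vzero (CB (Suc k)) <-> (ALL ga:space (En (Suc (Suc k))). AE x in mu. cobF (Suc k) F (ga,x) = 0)"
		if "bd (Suc k) C F" for C F
		unfolding CB_zero cb_coboundary_cc[OF that] by(rule cc_eq_iff[OF bd_cobF[OF that] bd_zero])
	show ?thesis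
	proof(intro set_eqI iffI)
		fix c assume "c : cocycles CB (cb_coboundary V) k"
		then have c:"c : vcarrier (CB k)" "cb_coboundary V k c = vzero (CB (Suc k))" by(simp_all add: cocycles_def)
		obtain F where F:"bd (Suc k) (vnorm (CB k) c) F" "c = cc (Suc k) F" using c(1) by(rule CB_cases)
		then show "c : {c. EX F. (gcb (Suc k) F & (ALL ga:space (En (Suc (Suc k))). AE x in mu. cobF (Suc k) F (ga,x) = 0)) & c = cc (Suc k) F}"
			using c d[OF F(1)] cc_CB[OF F(1)] bounded_fnI[OF F(1)] unfolding gcb_def by auto
	next
		fix c assume "c : {c. EX F. (gcb (Suc k) F & (ALL ga:space (En (Suc (Suc k))). AE x in mu. cobF (Suc k) F (ga,x) = 0)) & c = cc (Suc k) F}"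
		then obtain F where F:"gcb (Suc k) F" "ALL ga:space (En (Suc (Suc k))). AE x in mu. cobF (Suc k) F (ga,x) = 0" "c = cc (Suc k) F" by blast
		then obtain C where C:"bd (Suc k) C F" unfolding gcb_def by(blast elim: bounded_fnE)
		show "c : cocycles CB (cb_coboundary V) k"
			unfolding cocycles_def F(3) using d[OF C] F(1,2) cc_CB[OF C] unfolding gcb_def by simp
	qed
qed

lemma cb_coboundaries:
	"coboundaries CB (cb_coboundary V) k = {c. EX F. (EX F'. gcb k F' & F = cobF k F') & c = cc (Suc k) F}"
proof(cases k)
	case 0
	have c:"cobF 0 (%z. 0) = (%z. 0)" by(rule ext) (rule cobF_zero)
	have g:"gcb 0 F' <-> F' = (%z. 0)" for F'
	proof
		show "gcb 0 F' ==> F' = (%z. 0)" unfolding gcb_def by blast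
		show "F' = (%z. 0) ==> gcb 0 F'" using linear_classD(2)[OF linear_gcb[of 0]] by(simp only:)
	qed
	have "{c. EX F. (EX F'. F' = (%z. 0) & F = cobF 0 F') & c = cc (Suc 0) F} = {cc (Suc 0) (cobF 0 (%z. 0))}"
		by blast
	then show ?thesis unfolding 0 coboundaries_def nat.case CB_zero g c ..
next
	case (Suc j)
	show ?thesis
	proof(intro set_eqI iffI)
		fix c assume "c : coboundaries CB (cb_coboundary V) k"
		then obtain e where e:"e : vcarrier (CB j)" "c = cb_coboundary V j e"
			by(auto simp: Suc coboundaries_def)
		obtain F where F:"bd (Suc j) (vnorm (CB j) e) F" "e = cc (Suc j) F" using e(1) by(rule CB_cases)
		then have "gcb k F" using e(1) cc_CB[OF F(1)] bounded_fnI[OF F(1)] by(simp add: gcb_def Suc)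
		then show "c : {c. EX F. (EX F'. gcb k F' & F = cobF k F') & c = cc (Suc k) F}"
			using e(2) F(2) cb_coboundary_cc[OF F(1)] Suc by blast
	next
		fix c assume "c : {c. EX F. (EX F'. gcb k F' & F = cobF k F') & c = cc (Suc k) F}"
		then obtain F where F:"gcb k F" "c = cc (Suc k) (cobF k F)" by blast
		then obtain C where C:"bd (Suc j) C F" unfolding gcb_def Suc by(blast elim: bounded_fnE)
		have "cc (Suc j) F : vcarrier (CB j)" using cc_CB[OF C] F(1) by(simp add: gcb_def Suc)
		from imageI[OF this,of "cb_coboundary V j"]
		show "c : coboundaries CB (cb_coboundary V) k"
			unfolding F(2) Suc coboundaries_def cb_coboundary_cc[OF C] by simp
	qed
qed

text \<open>On a cocycle the homotopy formula loses the term that contains the coboundary, so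
  smoothing changes it by the coboundary of \<open>Hm k F\<close>. For \<open>k = 0\<close> this
  correction is an empty sum, in accordance with the convention on empty tuples.\<close>

lemma smoothing_cocycle:
	assumes F:"bd (Suc k) C F" and i:"INV (Suc k) F" and z:"AE z in Tn (Suc (Suc k)). cobF (Suc k) F z = 0"
	shows "gcb (Suc k) (Rg (Suc k) F)"
		and "ALL ga:space (En (Suc (Suc k))). AE x in mu. cobF (Suc k) (Rg (Suc k) F) (ga,x) = 0"
		and "gmb k (Hm k F)"
		and "AE z in Tn (Suc k). Rg (Suc k) F z - F z = cobF k (Hm k F) z"
proof -
	show "gcb (Suc k) (Rg (Suc k) F)"
		using bounded_fnI[OF bd_Av[OF selects_Inr F]] scont_Rg[OF F] CINV_Rg[OF F i] by(simp add: gcb_def)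
	show "ALL ga:space (En (Suc (Suc k))). AE x in mu. cobF (Suc k) (Rg (Suc k) F) (ga,x) = 0"
	proof
		fix ga assume ga:"ga : space (En (Suc (Suc k)))"
		show "AE x in mu. cobF (Suc k) (Rg (Suc k) F) (ga,x) = 0"
			using Rg_cong[OF bd_cobF[OF F] bd_zero z ga] AE_space
			by eventually_elim (simp add: Rg_cobF[OF F space_TnI[OF ga],symmetric] Av_zero)
	qed
	show "gmb k (Hm k F)"
		using bounded_fnI[OF bd_Hm[OF F]] INV_Hm[OF F i] by(auto simp: gmb_def Hm_def)
	show "AE z in Tn (Suc k). Rg (Suc k) F z - F z = cobF k (Hm k F) z"
		using Hm_cong_AE[OF bd_cobF[OF F] bd_zero z] AE_space
	proof eventually_elim
		case (elim z)
		show ?case using prism_average[OF F elim(2)] elim(1) by(simp add: Hm_zero)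
	qed
qed

text \<open>The homotopy formula gives \<open>F = Rg (Suc k) F - cobF k (Hm k F)\<close> at every
  tuple. Replacing \<open>F\<close> by \<open>cobF k F'\<close> under the smoothing is allowed
  although they agree only almost everywhere, and smoothing is a chain map, so
  \<open>Rg k F' - Hm k F\<close> is a primitive. The first term is continuous for any bounded
  \<open>F'\<close>, the second because \<open>F\<close> is continuous.\<close>

lemma continuous_primitive:
	assumes F:"bd (Suc k) C F" and c:"scont (Suc k) F" and i:"CINV (Suc k) F"
		and z:"!!ga. ga : space (En (Suc (Suc k))) ==> AE x in mu. cobF (Suc k) F (ga,x) = 0"
		and F': "gmb k F'" and eq:"AE z in Tn (Suc k). F z = cobF k F' z"
	shows "EX F''. gcb k F'' & (ALL ga:space (En (Suc k)). AE x in mu. F (ga,x) = cobF k F'' (ga,x))"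
proof -
	obtain C' where C': "bd k C' F'" using F' unfolding gmb_def by(blast elim: bounded_fnE)
	let ?R = "Rg k F'" and ?H = "%z. (-1) *\<^sub>R Hm k F z"
	let ?G = "%z. ?R z + ?H z"
	have R:"gcb k ?R"
	proof -
		have "?R = (%z. 0)" if "k = 0"
		proof -
			have e:"F' = (%z. 0)" using F' that by(simp add: gmb_def)
			show ?thesis unfolding e by(rule ext) (rule Av_zero)
		qed
		then show ?thesis
			using bounded_fnI[OF bd_Av[OF selects_Inr C']] scont_Rg[OF C'] CINV_Rg[OF C'] F' unfolding gcb_def gmb_def by blast
	qed
	have "gcb k (Hm k F)"
		using bounded_fnI[OF bd_Hm[OF F]] scont_Hm[OF F c] CINV_Hm[OF F i] by(auto simp: gcb_def Hm_def)
	then have "gcb k ?H" by(rule linear_classD(4)[OF linear_gcb])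
	with R have G:"gcb k ?G" by(rule linear_classD(3)[OF linear_gcb])
	have "AE x in mu. F (ga,x) = cobF k ?G (ga,x)" if ga:"ga : space (En (Suc k))" for ga
	proof -
		have "AE x in mu. Hm (Suc k) (cobF (Suc k) F) (ga,x) = Hm (Suc k) (%z. 0) (ga,x)"
			by(rule Hm_cong_all[OF bd_cobF[OF F] bd_zero _ ga]) (rule z)
		with Rg_cong[OF F bd_cobF[OF C'] eq ga] AE_space show ?thesis
		proof eventually_elim
		case (elim x)
		have s:"(ga,x) : space (Tn (Suc k))" by(rule space_TnI[OF ga elim(2)])
		have "F (ga,x) = Rg (Suc k) F (ga,x) - cobF k (Hm k F) (ga,x)"
			using prism_average[OF F s] elim(3) by(simp add: Hm_zero)
		also have "Rg (Suc k) F (ga,x) = cobF k ?R (ga,x)" using elim(1) Rg_cobF[OF C' s] by simp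
		finally show ?case unfolding cobF_add cobF_scale by simp
		qed
	qed
	then show ?thesis using G by blast
qed

lemma comparison:
	"EX Phi. isometric_iso (H_mb \<G> nu kap Lb k) (H_cb V rho k) Phi & inverts_inclusion eta act mu nu kap Lb rho k Phi"
proof -
	let ?n = "Suc k"
	let ?Z = "cocycles (mb_cochains \<G> nu kap Lb) (mb_coboundary \<G> nu kap) k"
		and ?B = "coboundaries (mb_cochains \<G> nu kap Lb) (mb_coboundary \<G> nu kap) k"
		and ?Z' = "cocycles CB (cb_coboundary V) k" and ?B' = "coboundaries CB (cb_coboundary V) k"
	let ?Q = "%F. gmb ?n F & (AE z in Tn (Suc ?n). cobF ?n F z = 0)"
	let ?Q' = "%F. gcb ?n F & (ALL ga:space (En (Suc ?n)). AE x in mu. cobF ?n F (ga,x) = 0)"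
	have Q:"linear_class ?n ?Q"
	proof(rule linear_conj[OF linear_gmb])
		show "AE z in Tn (Suc ?n). cobF ?n (%z. 0) z = 0" by(simp add: cobF_zero)
		show "AE z in Tn (Suc ?n). cobF ?n (%z. F z + G z) z = 0"
			if "AE z in Tn (Suc ?n). cobF ?n F z = 0" "AE z in Tn (Suc ?n). cobF ?n G z = 0" for F G
			using that by eventually_elim (simp add: cobF_add)
		show "AE z in Tn (Suc ?n). cobF ?n (%z. r *\<^sub>R F z) z = 0" if "AE z in Tn (Suc ?n). cobF ?n F z = 0" for r F
			using that by eventually_elim (simp add: cobF_scale)
	qed
	have Q': "linear_class ?n ?Q'"
	proof(rule linear_conj[OF linear_gcb])
		show "ALL ga:space (En (Suc ?n)). AE x in mu. cobF ?n (%z. 0) (ga,x) = 0" by(simp add: cobF_zero)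
		show "ALL ga:space (En (Suc ?n)). AE x in mu. cobF ?n (%z. F z + G z) (ga,x) = 0"
			if F:"ALL ga:space (En (Suc ?n)). AE x in mu. cobF ?n F (ga,x) = 0"
				and G:"ALL ga:space (En (Suc ?n)). AE x in mu. cobF ?n G (ga,x) = 0" for F G
		proof
			fix ga assume ga:"ga : space (En (Suc ?n))"
			show "AE x in mu. cobF ?n (%z. F z + G z) (ga,x) = 0"
				using F[rule_format,OF ga] G[rule_format,OF ga] by eventually_elim (simp add: cobF_add)
		qed
		show "ALL ga:space (En (Suc ?n)). AE x in mu. cobF ?n (%z. r *\<^sub>R F z) (ga,x) = 0"
			if F:"ALL ga:space (En (Suc ?n)). AE x in mu. cobF ?n F (ga,x) = 0" for r F
		proof
			fix ga assume ga:"ga : space (En (Suc ?n))"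
			show "AE x in mu. cobF ?n (%z. r *\<^sub>R F z) (ga,x) = 0"
				using F[rule_format,OF ga] by eventually_elim (simp add: cobF_scale)
		qed
	qed
	have Zs:"LFn.subspace ?n ?Z" unfolding mb_cocycles by(rule subspace_MC[OF zero_less_Suc Q])
	have Bs:"LFn.subspace ?n ?B" unfolding mb_coboundaries by(rule subspace_MC[OF zero_less_Suc linear_cob[OF linear_gmb]])
	have Zs': "PVn.subspace ?n ?Z'" unfolding cb_cocycles by(rule subspace_cc[OF Q'])
	have Bs': "PVn.subspace ?n ?B'" unfolding cb_coboundaries by(rule subspace_cc[OF linear_cob[OF linear_gcb]])
	have BZ:"?B <= ?Z"
	proof
		fix A assume "A : ?B"
		then obtain F' where F': "gmb k F'" "A = MC ?n (cobF k F')" unfolding mb_coboundaries by blast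
		have "gmb ?n (cobF k F')" using F'(1) bounded_fn_simps(4) INV_cobF by(simp add: gmb_def)
		then show "A : ?Z" unfolding mb_cocycles using F'(2) by(auto simp: cobF_cobF)
	qed
	have BZ': "?B' <= ?Z'"
	proof
		fix c assume "c : ?B'"
		then obtain F' where F': "gcb k F'" "c = cc ?n (cobF k F')" unfolding cb_coboundaries by blast
		then obtain C where C:"bd k C F'" unfolding gcb_def by(blast elim: bounded_fnE)
		have "gcb ?n (cobF k F')" using F'(1) bounded_fn_simps(4) CINV_cobF scont_cobF[OF C] by(simp add: gcb_def)
		then show "c : ?Z'" unfolding cb_cocycles using F'(2) by(auto simp: cobF_cobF)
	qed
	\<comment> \<open>The inclusion of continuous cochains on the level of classes. Two representatives
	  of \<open>c\<close> agree at every tuple for almost every point, hence almost everywhere on the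
	  product, so the choice does not affect the class.\<close>
	define io where "io c = MC ?n (SOME F. bounded_fn ?n F & cc ?n F = c)" for c
	have io:"io (cc ?n F) = MC ?n F" if F:"bd ?n C F" for C F
	proof -
		let ?F = "SOME G. bounded_fn ?n G & cc ?n G = cc ?n F"
		have "bounded_fn ?n ?F & cc ?n ?F = cc ?n F" by(rule someI[of _ F]) (use bounded_fnI[OF F] in simp)
		then obtain C' where C': "bd ?n C' ?F" and e:"cc ?n ?F = cc ?n F" by(blast elim: bounded_fnE)
		have "AE z in Tn ?n. ?F z = F z"
			by(rule AE_TnI[OF C' F]) (use e[unfolded cc_eq_iff[OF C' F]] in blast)
		then show ?thesis unfolding io_def MC_eq_iff[OF zero_less_Suc C' F] .
	qed
	\<comment> \<open>The function supplied by \<open>cb_cocycles\<close> may have a bound larger than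
	  the norm of \<open>c\<close>. The one from \<open>CB_cases\<close> has the exact bound and agrees
	  with it at every tuple for almost every point, so the cocycle property carries over.\<close>
	have Zc:"EX F. bd ?n (vnorm (CB k) c) F & ?Q' F & c = cc ?n F" if "c : ?Z'" for c
	proof -
		have c:"c : vcarrier (CB k)" using that by(simp add: cocycles_def)
		obtain F where F:"bd ?n (vnorm (CB k) c) F" "c = cc ?n F" using c by(rule CB_cases)
		obtain G where G:"?Q' G" "c = cc ?n G" using \<open>c : ?Z'\<close> unfolding cb_cocycles by blast
		obtain C where C:"bd ?n C G" using G(1) unfolding gcb_def by(blast elim: bounded_fnE)
		have FG:"AE x in mu. F (ga,x) = G (ga,x)" if "ga : space (En ?n)" for ga
			using cc_eq_iff[OF F(1) C] F(2) G(2) that by blast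
		have "gcb ?n F" using c cc_CB[OF F(1)] F(2) bounded_fnI[OF F(1)] by(simp add: gcb_def)
		moreover have "AE x in mu. cobF ?n F (ga,x) = 0" if ga:"ga : space (En (Suc ?n))" for ga
		proof -
			have "AE x in mu. cobF ?n F (ga,x) = cobF ?n G (ga,x)" by(rule cobF_cong_all) (rule FG)
			then show ?thesis using G(1)[THEN conjunct2,rule_format,OF ga] by eventually_elim simp
		qed
		ultimately show ?thesis using F by blast
	qed
	have nio:"0 <= vnorm (CB k) c" if "c : ?Z'" for c
		using Zc[OF that] cc_norm(2) unfolding CB_norm by blast
	\<comment> \<open>The groupoid side plays the role of \<open>V\<close> and the continuous side that
	  of \<open>V'\<close>, so the resulting \<open>Phi\<close> inverts the map induced by
	  \<open>io\<close>.\<close>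
	have main:"EX Phi. isometric_iso (quotient_vspace ((LF ?n)\<lparr>vcarrier := ?Z\<rparr>) ?B) (quotient_vspace ((PV ?n)\<lparr>vcarrier := ?Z'\<rparr>) ?B') Phi &
			(ALL c:?Z'. Phi (vcoset (LF ?n) ?B (io c)) = vcoset (PV ?n) ?B' c)"
	proof(rule quotient_isometry[OF LFn.vspace_axioms PVn.vspace_axioms Zs Bs BZ Zs' Bs' BZ'])
		have N:"vnorm (PV ?n) = vnorm (CB k)" by(simp add: pointwise_vspace_def CB_norm fun_eq_iff)
		show "0 <= vnorm (LF ?n) A" if "A : ?Z" for A
			using LFn.norm_nonneg LFn.subspaceD(1)[OF Zs] that by blast
		fix c assume c:"c : ?Z'"
		show "0 <= vnorm (PV ?n) c" unfolding N by(rule nio[OF c])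
		obtain F where F:"bd ?n (vnorm (CB k) c) F" "?Q' F" "c = cc ?n F" using Zc[OF c] by blast
		have gm:"gmb ?n F" using F(2) by(simp add: gcb_gmb)
		have "AE z in Tn (Suc ?n). cobF ?n F z = 0" by(rule AE_TnI[OF bd_cobF[OF F(1)] bd_zero]) (use F(2) in blast)
		then show "io c : ?Z" unfolding mb_cocycles F(3) io[OF F(1)] using gm by blast
		show "vnorm (LF ?n) (io c) <= vnorm (PV ?n) c"
			unfolding N F(3) io[OF F(1)] using MC_norm[OF zero_less_Suc F(1) nio[OF c]] F(3) by simp
		show "io (vscale (PV ?n) r c) = vscale (LF ?n) r (io c)" for r
			unfolding F(3) cc_scale[OF F(1)] io[OF F(1)] io[OF bd_scale[OF F(1)]] MC_scale[OF zero_less_Suc F(1)] ..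
		show "io (vadd (PV ?n) c e) = vadd (LF ?n) (io c) (io e)" if e:"e : ?Z'" for e
		proof -
			obtain G where G:"bd ?n (vnorm (CB k) e) G" "e = cc ?n G" using Zc[OF e] by blast
			show ?thesis
				unfolding F(3) G(2) cc_add[OF F(1) G(1)] io[OF F(1)] io[OF G(1)] io[OF bd_add[OF F(1) G(1)]]
					MC_add[OF zero_less_Suc F(1) G(1)] ..
		qed
		show "io c : ?B <-> c : ?B'"
		proof
			assume "io c : ?B"
			then obtain F' where F': "gmb k F'" "MC ?n F = MC ?n (cobF k F')"
				unfolding mb_coboundaries F(3) io[OF F(1)] by blast
			obtain C' where C': "bd k C' F'" using F'(1) unfolding gmb_def by(blast elim: bounded_fnE)
			have eq:"AE z in Tn ?n. F z = cobF k F' z" using F'(2) unfolding MC_eq_iff[OF zero_less_Suc F(1) bd_cobF[OF C']] .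
			have "EX F''. gcb k F'' & (ALL ga:space (En ?n). AE x in mu. F (ga,x) = cobF k F'' (ga,x))"
				by(rule continuous_primitive[OF F(1) _ _ _ F'(1) eq]) (use F(2) in \<open>simp_all add: gcb_def\<close>)
			then obtain F'' where F'': "gcb k F''" "ALL ga:space (En ?n). AE x in mu. F (ga,x) = cobF k F'' (ga,x)" by blast
			obtain C'' where C'': "bd k C'' F''" using F''(1) unfolding gcb_def by(blast elim: bounded_fnE)
			have "c = cc ?n (cobF k F'')" unfolding F(3) cc_eq_iff[OF F(1) bd_cobF[OF C'']] by(rule F''(2))
			then show "c : ?B'" unfolding cb_coboundaries using F''(1) by blast
		next
			assume "c : ?B'"
			then obtain F' where F': "gcb k F'" "c = cc ?n (cobF k F')" unfolding cb_coboundaries by blast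
			obtain C' where C': "bd k C' F'" using F'(1) unfolding gcb_def by(blast elim: bounded_fnE)
			show "io c : ?B" unfolding mb_coboundaries F'(2) io[OF bd_cobF[OF C']] using gcb_gmb[OF F'(1)] by blast
		qed
	next
		fix A assume A:"A : ?Z"
		then have "A : vcarrier (LF ?n)" using LFn.subspaceD(1)[OF Zs] by blast
		then obtain F where F:"bd ?n (vnorm (LF ?n) A) F" "A = MC ?n F" by(rule MC_cases[OF zero_less_Suc])
		obtain G where G:"?Q G" "A = MC ?n G" using A unfolding mb_cocycles by blast
		obtain C where C:"bd ?n C G" using G(1) unfolding gmb_def by(blast elim: bounded_fnE)
		have FG:"AE z in Tn ?n. F z = G z" using F(2) G(2) MC_eq_iff[OF zero_less_Suc F(1) C] by simp
		have i:"INV ?n F" using INV_cong[OF FG] G(1) by(simp add: gmb_def)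
		have z:"AE z in Tn (Suc ?n). cobF ?n F z = 0"
			using cobF_cong_AE[OF FG] G(1)[THEN conjunct2] by eventually_elim simp
		note s = smoothing_cocycle[OF F(1) i z]
		have A0:"0 <= vnorm (LF ?n) A" by(rule LFn.norm_nonneg) fact
		have R:"bd ?n (vnorm (LF ?n) A) (Rg ?n F)" by(rule bd_Av[OF selects_Inr F(1)])
		obtain C' where C': "bd k C' (Hm k F)" using s(3) unfolding gmb_def by(blast elim: bounded_fnE)
		\<comment> \<open>The witness is the smoothed cocycle: it keeps the bound
		  \<open>vnorm (LF ?n) A\<close> of \<open>F\<close> and differs from \<open>A\<close> by the
		  coboundary of \<open>Hm k F\<close>.\<close>
		show "EX c:?Z'. vadd (LF ?n) (io c) (vscale (LF ?n) (-1) A) : ?B & vnorm (PV ?n) c <= vnorm (LF ?n) A"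
		proof(intro bexI conjI)
			show "cc ?n (Rg ?n F) : ?Z'" unfolding cb_cocycles using s(1,2) by blast
			show "vnorm (PV ?n) (cc ?n (Rg ?n F)) <= vnorm (LF ?n) A"
				using cc_norm(3)[OF R A0 R] by(simp add: pointwise_vspace_def)
			have "vadd (LF ?n) (io (cc ?n (Rg ?n F))) (vscale (LF ?n) (-1) A) = MC ?n (%z. Rg ?n F z + (-1) *\<^sub>R F z)"
				unfolding io[OF R] F(2) MC_scale[OF zero_less_Suc F(1)]
				by(rule MC_add[OF zero_less_Suc R bd_scale[OF F(1)]])
			also have "... = MC ?n (cobF k (Hm k F))"
				unfolding MC_eq_iff[OF zero_less_Suc bd_add[OF R bd_scale[OF F(1)]] bd_cobF[OF C']]
				using s(4) by(rule eventually_mono) simp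
			finally show "vadd (LF ?n) (io (cc ?n (Rg ?n F))) (vscale (LF ?n) (-1) A) : ?B"
				unfolding mb_coboundaries using s(3) by blast
		qed
	qed
	then obtain Phi where Phi:"isometric_iso (quotient_vspace ((LF ?n)\<lparr>vcarrier := ?Z\<rparr>) ?B) (quotient_vspace ((PV ?n)\<lparr>vcarrier := ?Z'\<rparr>) ?B') Phi"
		and Phic:"!!c. c : ?Z' ==> Phi (vcoset (LF ?n) ?B (io c)) = vcoset (PV ?n) ?B' c" by blast
	\<comment> \<open>Forming cohomology replaces the carrier by the cocycles, so the cochain spaces
	  may be exchanged for ambient spaces with the same operations and norm.\<close>
	have mb:"(mb_cochains \<G> nu kap Lb k)\<lparr>vcarrier := ?Z\<rparr> = (LF ?n)\<lparr>vcarrier := ?Z\<rparr>" by(simp add: mb_cochains_def Let_def)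
	have cb:"(CB k)\<lparr>vcarrier := ?Z'\<rparr> = (PV ?n)\<lparr>vcarrier := ?Z'\<rparr>" by(simp add: cb_cochains_def Let_def pointwise_vspace_def)
	have iso:"isometric_iso (H_mb \<G> nu kap Lb k) (H_cb V rho k) Phi"
		unfolding H_mb_def H_cb_def cohomology_def mb cb by(rule Phi)
	have "inverts_inclusion eta act mu nu kap Lb rho k Phi"
		unfolding inverts_inclusion_def Let_def
	proof
		fix c assume c:"c : ?Z'"
		obtain F where F:"bd ?n (vnorm (CB k) c) F" "?Q' F" "c = cc ?n F" using Zc[OF c] by blast
		have "AE z in Tn (Suc ?n). cobF ?n F z = 0" by(rule AE_TnI[OF bd_cobF[OF F(1)] bd_zero]) (use F(2) in blast)
		then have Z:"io c : ?Z" unfolding mb_cocycles F(3) io[OF F(1)] using gcb_gmb F(2) by blast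
		have cl:"cohomology_class (mb_cochains \<G> nu kap Lb) (mb_coboundary \<G> nu kap) k (io c) = vcoset (LF ?n) ?B (io c)"
			"cohomology_class CB (cb_coboundary V) k c = vcoset (PV ?n) ?B' c"
			by(simp_all add: cohomology_class_def vcoset_def mb_cochains_def cb_cochains_def Let_def pointwise_vspace_def)
		have "represents eta act k (io c) c"
			unfolding represents_def
		proof(rule bexI,rule AE_I2)
			show "(%a. F (J' ?n a)) : io c"
				unfolding F(3) io[OF F(1)] MC_def by(rule Linf.cls_self[OF MC_mem[OF zero_less_Suc F(1)]])
			fix ga assume ga:"ga : space (En ?n)"
			let ?f = "%x. F (J' ?n (\<lambda>i\<in>{..<?n}. (ga i,act (- ga i) x)))"
			have e:"?f x = F (ga,x)" if "x : space mu" for x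
				using J'_J[OF zero_less_Suc space_TnI[OF ga that]] by(simp add: J_def)
			have m:"(%x. F (ga,x)) : Linf_functions mu" by(rule section_mem[OF F(1) ga])
			have ae:"AE x in mu. ?f x = F (ga,x)" by(rule AE_I2) (rule e)
			have "wmeas mu ?f <-> wmeas mu (%x. F (ga,x))" by(rule wmeas_cong) (rule e)
			then have "?f : Linf_functions mu"
				using m by(intro Linf_functionsI[of _ _ "vnorm (CB k) c"] AE_I2)
					(simp_all add: Linf_functions_iff e bdD(2)[OF F(1) space_TnI[OF ga]])
			then show "?f : c ga" unfolding F(3) cc_apply[OF ga] mem_Lcls_iff[OF m] using ae by blast
		qed
		then show "EX A:?Z. represents eta act k A c & Phi (cohomology_class (mb_cochains \<G> nu kap Lb) (mb_coboundary \<G> nu kap) k A)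
				= cohomology_class CB (cb_coboundary V) k c"
			using Z Phic[OF c] unfolding cl(2) by(intro bexI[of _ "io c"]) (simp_all add: cl(1))
	qed
	then show ?thesis using iso by blast
qed

end

end

theorem theorem1:
  fixes \<eta> :: "'g::{topological_group_add, t2_space, second_countable_topology} measure"
    and act :: "'g \<Rightarrow> 'x \<Rightarrow> 'x"
    and \<mu> :: "'x measure"
    and \<nu> :: "('g \<times> 'x) measure"
    and \<kappa> :: "'x \<Rightarrow> ('g \<times> 'x) measure"
    and Lb :: "'g \<times> 'x \<Rightarrow> 'e::{banach, second_countable_topology} \<Rightarrow>\<^sub>L 'e"
  assumes "locally_compact_space (euclidean :: 'g topology)"
    and "left_haar_measure \<eta>"
    and "lebesgue_G_space act \<mu>"
    and "equiv_measures \<nu> (\<eta> \<Otimes>\<^sub>M \<mu>)"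
    and "measured_groupoid (semidirect_groupoid act \<mu>) \<nu> \<kappa>"
    and "measurable_coefficient_module (semidirect_groupoid act \<mu>) \<nu> \<kappa> Lb"
  shows "(\<exists>!\<rho>. coefficient_module (Linf \<mu>) \<rho> (L1 \<mu>) (Linf_L1_pairing \<mu>) \<and>
             acts_by_cocycle \<eta> act \<mu> Lb \<rho>) \<and>
    (\<forall>\<rho>. coefficient_module (Linf \<mu>) \<rho> (L1 \<mu>) (Linf_L1_pairing \<mu>) \<and>
         acts_by_cocycle \<eta> act \<mu> Lb \<rho> \<longrightarrow>
       (\<forall>k. \<exists>\<Phi>. isometric_iso (H_mb (semidirect_groupoid act \<mu>) \<nu> \<kappa> Lb k) (H_cb (Linf \<mu>) \<rho> k) \<Phi> \<and>
              inverts_inclusion \<eta> act \<mu> \<nu> \<kappa> Lb \<rho> k \<Phi>))"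
proof -
  interpret semidirect_module \<eta> act \<mu> \<nu> \<kappa> Lb
    using assms by (rule semidirect_module.intro)
  have rep: "isometric_rep V \<rho>" if "coefficient_module V \<rho> W (Linf_L1_pairing \<mu>)" for \<rho> :: "'g \<Rightarrow> ('x \<Rightarrow> 'e \<Rightarrow>\<^sub>L real) set \<Rightarrow> ('x \<Rightarrow> 'e \<Rightarrow>\<^sub>L real) set"
    using that by (simp add: coefficient_module_def)
  obtain \<rho>0 where \<rho>0: "coefficient_module V \<rho>0 W (Linf_L1_pairing \<mu>)" "acts_by_cocycle \<eta> act \<mu> Lb \<rho>0"
    by (rule representation_exists)
  have "\<exists>!\<rho>. coefficient_module V \<rho> W (Linf_L1_pairing \<mu>) \<and> acts_by_cocycle \<eta> act \<mu> Lb \<rho>"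
  proof (rule ex1I)
    show "coefficient_module V \<rho>0 W (Linf_L1_pairing \<mu>) \<and> acts_by_cocycle \<eta> act \<mu> Lb \<rho>0" using \<rho>0 ..
    fix \<rho> assume "coefficient_module V \<rho> W (Linf_L1_pairing \<mu>) \<and> acts_by_cocycle \<eta> act \<mu> Lb \<rho>"
    then show "\<rho> = \<rho>0" using representation_unique[of \<rho> \<rho>0] rep \<rho>0 by blast
  qed
  moreover have "\<forall>\<rho>. coefficient_module V \<rho> W (Linf_L1_pairing \<mu>) \<and> acts_by_cocycle \<eta> act \<mu> Lb \<rho> \<longrightarrow>
      (\<forall>k. \<exists>\<Phi>. isometric_iso (H_mb \<G> \<nu> \<kappa> Lb k) (H_cb V \<rho> k) \<Phi> \<and> inverts_inclusion \<eta> act \<mu> \<nu> \<kappa> Lb \<rho> k \<Phi>)"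
    using comparison rep by blast
  ultimately show ?thesis by (rule conjI)
qed

end
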